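(* Let $\hat{\mathbf h}(\beta,\mathbf k)$ be a multi-particle wavepacket with $nk$-spectrum $S=\{(n_l,\mathbf k_{*l})\}_{l=1}^N$, regularity degree $s$ and positions $\mathbf r_{*l}$, $l=1,\dots,N$, let $\vec{\mathbf h}_\Psi$ be the corresponding initial data of the averaged wavepacket interaction system $$\vec{\mathbf v}=\mathcal F_{\mathrm{av},\Psi_2}(\vec{\mathbf v})+\vec{\mathbf h}_\Psi ,\qquad( * )$$ and let $\|\vec{\mathbf h}_\Psi\|_{(E^1)^{2N}(\vec{\mathbf r}_* )}\le R$. Assume that $S$ is universally resonance invariant, and that $0<\beta\le1$, $0<\varrho\le 1$, $\beta^2/\varrho\le C_1$. Then there exists $\tau_{**}>0$, which does not depend on $\vec{\mathbf r}_*,\beta,\varrho$, such that if $\tau_*\le\tau_{**}$ then $( * )$ has a unique solution $\vec{\mathbf v}$ in $(E^1)^{2N}(\vec{\mathbf r}_* )$ such that $$\|\vec{\mathbf v}\|_{(E^1)^{2N}(\vec{\mathbf r}_* )}\le2R,$$ where $R$ does not depend on $\varrho,\beta$ and $\vec{\mathbf r}_*$. This solution is a multi-particle wavepacket with positions $\mathbf r_{*l}$.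
   Context: **Linear part.** Fix $d,J\ge1$. $\mathbf L(\mathbf k)$, $\mathbf k\in\mathbb R^d$, is a Hermitian $2J\times2J$ matrix with eigenvalues $\omega_{n,\zeta}(\mathbf k)$ and unit eigenvectors $\mathbf g_{n,\zeta}(\mathbf k)$, $n=1,\dots,J$, $\zeta=\pm$, ordered $\omega_{J,+}\ge\dots\ge\omega_{1,+}\ge0\ge\omega_{1,-}\ge\dots\ge\omega_{J,-}$, with $\omega_{n,-\zeta}(-\mathbf k)=-\omega_{n,\zeta}(\mathbf k)$. Write $\omega_n=\omega_{n,+}$, and $\Pi_{n,\zeta}(\mathbf k)$ for the orthogonal projection onto $\mathbb C\mathbf g_{n,\zeta}(\mathbf k)$. $\sigma_{bc}$ is the set of $\mathbf k_0$ with $\omega_{n+1,\zeta}(\mathbf k_0)=\omega_{n,\zeta}(\mathbf k_0)$ for some $n,\zeta$, or $\mathbf L$ not continuous at $\mathbf k_0$, or $\omega_{1,\pm}(\mathbf k_0)=0$. Assumed: $\sigma_{bc}$ is closed, nowhere dense, Lebesgue null; $\mathbf L$ is $C^\infty$ off $\sigma_{bc}$, polynomially bounded. **Nonlinearity.** $\mathfrak M_F\subset\{2,3,\dots\}$ is finite; for $m\in\mathfrak M_F$, $\chi^{(m)}(\mathbf k,\mathbf k',\dots,\mathbf k^{(m)})$ takes values in $m$-linear maps $(\mathbb C^{2J})^m\to\mathbb C^{2J}$, is $C^\infty$ when all arguments are off $\sigma_{bc}$, and bounded. $E=C([0,\tau_*],L^1(\mathbb R^d;\mathbb C^{2J}))$.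 For $\vec\xi=((n_1,\zeta'),\dots,(n_m,\zeta^{(m)}))$ and $0<\varrho\le1$, $$\mathcal F^{(m)}_{n,\zeta,\vec\xi}(\hat{\mathbf u}_1,\dots,\hat{\mathbf u}_m)(\mathbf k,\tau)=\int_0^\tau\!\int_{\mathbb R^{(m-1)d}}e^{i\phi\tau_1/\varrho}\,\Pi_{n,\zeta}(\mathbf k)\chi^{(m)}\big[\Pi_{n_1,\zeta'}(\mathbf k')\hat{\mathbf u}_1(\mathbf k',\tau_1),\dots,\Pi_{n_m,\zeta^{(m)}}(\mathbf k^{(m)})\hat{\mathbf u}_m(\mathbf k^{(m)},\tau_1)\big]\frac{d\mathbf k'\cdots d\mathbf k^{(m-1)}}{(2\pi)^{(m-1)d}}d\tau_1,$$ where $\mathbf k^{(m)}=\mathbf k-\mathbf k'-\dots-\mathbf k^{(m-1)}$ and $\phi=\omega_{n,\zeta}(\mathbf k)-\sum_{j=1}^m\omega_{n_j,\zeta^{(j)}}(\mathbf k^{(j)})$. **Wavepackets.** Fix $0<\epsilon<1$ and a $C^\infty$ cutoff $\Psi\ge0$ on $\mathbb R^d$, $\Psi(\eta)=1$ for $|\eta|\le1/2$, $\Psi(\eta)=0$ for $|\eta|\ge1$. $\hat{\mathbf h}(\beta;\mathbf k)$ is a wavepacket with $nk$-pair $(n,\mathbf k_* )$ and regularity degree $s>0$ if for small $\beta$: $\|\hat{\mathbf h}\|_{L^1}\le C$; $\hat{\mathbf h}=\hat{\mathbf h}_-+\hat{\mathbf h}_++D_h$ with $\hat{\mathbf h}_\zeta=\Psi(\tfrac12\beta^{-(1-\epsilon)}(\mathbf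 k-\zeta\mathbf k_* ))\Pi_{n,\zeta}(\mathbf k)\hat{\mathbf h}_\zeta$, $\|D_h\|_{L^1}\le C'\beta^s$. A family $\hat{\mathbf h}(\beta,\mathbf r_*;\mathbf k)$, $\mathbf r_*\in\mathbb R^d$, is a particle-like wavepacket with position $\mathbf r_*$ if it is a wavepacket with $C,C'$ independent of $\mathbf r_*$ and $\int|\nabla_{\mathbf k}(e^{i\mathbf r_*\cdot\mathbf k}\hat{\mathbf h}_\zeta)|d\mathbf k\le C_1\beta^{-1-\epsilon}$ with $C_1$ independent of $\beta,\mathbf r_*$. A multi-particle wavepacket with $nk$-spectrum $S=\{(n_l,\mathbf k_{*l})\}_{l=1}^N$ (distinct pairs) and positions $\mathbf r_{*l}$ is a sum $\sum_l\hat{\mathbf h}_l$ of such particle-like wavepackets; a vector $\vec{\mathbf v}=(\hat{\mathbf v}_{l,\vartheta})$ is called a multi-particle wavepacket if its components $\hat{\mathbf v}_{l,\pm}$ are the $\pm$ parts of particle-like wavepackets with $nk$-pairs $(n_l,\mathbf k_{*l})$ and positions $\mathbf r_{*l}$ (for every $\tau$). **Resonance.** For $\vec\lambda=((\zeta',l_1),\dots,(\zeta^{(m)},l_m))\in(\{\pm1\}\times\{1,\dots,N\})^m$ put $\varkappa_m(\vec\lambda)=\sum_j\zeta^{(j)}\mathbf k_{*l_j}$. The resonance equation for $(m,\zeta,n,\vec\lambda)$ is $-\zeta\omega_n(\zeta\varkappa_m(\vec\lambda))+\sum_j\zeta^{(j)}\omega_{n_{l_j}}(\mathbf k_{*l_j})=0$,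 $m\in\mathfrak M_F$. A solution is internal if $(n,\zeta\varkappa_m(\vec\lambda))\in S$; universal if, with $\delta_l=\sum_{j:l_j=l}\zeta^{(j)}$, there is $I_0$ with $\delta_{I_0}=\pm1$, $\delta_l=0$ for $l\ne I_0$, $n=n_{I_0}$, $\zeta=\delta_{I_0}$. $S$ is universally resonance invariant if all solutions are internal and universal. Standing assumptions: $\mathbf k_{*l}\notin\sigma_{bc}$, all $\varkappa_m(\vec\lambda)\notin\sigma_{bc}$. **Averaged system.** $\Lambda^m_{l,\vartheta}$ is the set of $\vec\lambda$ such that $(m,\vartheta,n_l,\vec\lambda)$ solves the resonance equation and $\vartheta\varkappa_m(\vec\lambda)=\mathbf k_{*l}$; $\vec\xi(\vec\lambda)=((n_{l_1},\zeta'),\dots,(n_{l_m},\zeta^{(m)}))$. For $\vec{\mathbf v}=(\hat{\mathbf v}_{l,\vartheta})_{l=1..N,\vartheta=\pm}\in E^{2N}$, $\mathcal F_{\mathrm{av},\Psi_2}(\vec{\mathbf v})$ has components $$\sum_{m\in\mathfrak M_F}\sum_{\vec\lambda\in\Lambda^m_{l,\vartheta}}\Psi\big(\beta^{-(1-\epsilon)}(\cdot-\vartheta\mathbf k_{*l})\big)\mathcal F^{(m)}_{n_l,\vartheta,\vec\xi(\vec\lambda)}\big(\tilde{\mathbf v}_{l_1,\zeta'},\dots,\tilde{\mathbf v}_{l_m,\zeta^{(m)}}\big),\quad \tilde{\mathbf v}_{l,\zeta}=\Psi\big(\tfrac12\beta^{-(1-\epsilon)}(\cdot-\zeta\mathbf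 k_{*l})\big)\hat{\mathbf v}_{l,\zeta},$$ and $\vec{\mathbf h}_\Psi$ has components $\Psi(\beta^{-(1-\epsilon)}(\cdot-\vartheta\mathbf k_{*l}))\Pi_{n_l,\vartheta}\hat{\mathbf h}$. **Norms.** $\|\mathbf w\|_{E^1(\mathbf r_* )}=\beta^{1+\epsilon}\|\nabla_{\mathbf k}(e^{i\mathbf r_*\cdot\mathbf k}\mathbf w)\|_E+\|\mathbf w\|_E$; $\vec{\mathbf r}_*=(\mathbf r_{*1},\dots,\mathbf r_{*N})$; $\|\vec{\mathbf w}\|_{(E^1)^{2N}(\vec{\mathbf r}_* )}=\sum_{l,\vartheta}\|\hat{\mathbf w}_{l,\vartheta}\|_{E^1(\mathbf r_{*l})}$.
   Formalization: The range 0<β≤1 is replaced by 0<β≤β_0≤1, where β_0 is such that the balls of radius 2β_0^{1-ε} about those ±k_{*l} not in σ_bc avoid σ_bc; for larger β the cutoffs may reach σ_bc, where the projections can jump and no E^1 solution need exist. *)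

theory Defs
  imports "HOL-Analysis.Analysis"
begin

section \<open>Smoothness, test functions, weak gradients\<close>

text \<open>
  \<open>D\<close> is a set of coordinate lines \<open>p\<close>, where \<open>p x t\<close> is the point \<open>x\<close> moved by \<open>t\<close> along one
  coordinate.  On an open \<open>U\<close>, \<open>smooth_along D U f\<close> says that all iterated partial derivatives
  along \<open>D\<close> exist and are continuous.  The abstract \<open>D\<close> allows the same notion to be used on
  \<open>\<real>\<^sup>d\<close> and on \<open>(\<real>\<^sup>d)\<^sup>m\<^sup>+\<^sup>1\<close> with \<open>m\<close> ranging over numbers, the latter being represented by the
  coordinates \<open>0, \<dots>, m\<close> of functions on \<open>nat\<close> (with the product topology).
\<close>

primrec Ck_along ::
  "('a \<Rightarrow> real \<Rightarrow> 'a) set \<Rightarrow> nat \<Rightarrow> 'a::topological_space set \<Rightarrow> ('a \<Rightarrow> 'b::real_normed_vector) \<Rightarrow> bool"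
where
  "Ck_along D 0 U f \<longleftrightarrow> continuous_on U f"
| "Ck_along D (Suc n) U f \<longleftrightarrow> continuous_on U f \<and>
     (\<forall>p\<in>D. \<exists>g. (\<forall>x\<in>U. ((\<lambda>t. f (p x t)) has_vector_derivative g x) (at 0)) \<and> Ck_along D n U g)"

definition smooth_along ::
  "('a \<Rightarrow> real \<Rightarrow> 'a) set \<Rightarrow> 'a::topological_space set \<Rightarrow> ('a \<Rightarrow> 'b::real_normed_vector) \<Rightarrow> bool"
where "smooth_along D U f \<longleftrightarrow> (\<forall>n. Ck_along D n U f)"

definition coord_lines :: "(real^'d \<Rightarrow> real \<Rightarrow> real^'d) set"
where "coord_lines = {(\<lambda>x t. x + t *\<^sub>R b) | b. b \<in> Basis}"

definition multi_coord_lines :: "nat \<Rightarrow> ((nat \<Rightarrow> real^'d) \<Rightarrow> real \<Rightarrow> (nat \<Rightarrow> real^'d)) set"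
where "multi_coord_lines m = {(\<lambda>x t. x(i := x i + t *\<^sub>R b)) | i b. i \<le> m \<and> b \<in> Basis}"

definition test_function :: "(real^'d \<Rightarrow> real) \<Rightarrow> bool"
where "test_function \<phi> \<longleftrightarrow> smooth_along coord_lines UNIV \<phi> \<and> (\<exists>K. compact K \<and> (\<forall>k. k \<notin> K \<longrightarrow> \<phi> k = 0))"

type_synonym ('d, 'c) wavefield = "real^'d \<Rightarrow> complex^'c"

text \<open>
  Gradients are distributional, as the spaces \<open>E\<^sup>1\<close> below have to be complete; component \<open>i\<close> of the
  gradient is the partial derivative in the \<open>i\<close>-th coordinate of \<open>k\<close>.  Integrals are taken with
  respect to the (complete) Lebesgue measure, since fields are only controlled off the null set
  of band crossings.
\<close>

definition has_weak_gradient ::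
  "('d::finite, 'c::finite) wavefield \<Rightarrow> (real^'d \<Rightarrow> complex^'c^'d) \<Rightarrow> bool"
where "has_weak_gradient w G \<longleftrightarrow> integrable lebesgue w \<and> integrable lebesgue G \<and>
  (\<forall>\<phi> i. test_function \<phi> \<longrightarrow>
     (LINT k|lebesgue. vector_derivative (\<lambda>t. \<phi> (k + t *\<^sub>R axis i 1)) (at 0) *\<^sub>R w k)
       = - (LINT k|lebesgue. \<phi> k *\<^sub>R (G k $ i)))"

text \<open>Well defined up to null sets whenever some weak gradient exists.\<close>

definition weak_gradient ::
  "('d::finite, 'c::finite) wavefield \<Rightarrow> real^'d \<Rightarrow> complex^'c^'d"
where "weak_gradient w = (SOME G. has_weak_gradient w G)"


section \<open>The spaces \<open>E\<close> and \<open>E\<^sup>1\<close>\<close>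

text \<open>
  An element of \<open>E = C([0,T], L\<^sup>1)\<close> is represented by a function \<open>u \<tau> k\<close>; equality in \<open>E\<close> is equality
  for every \<open>\<tau> \<in> [0,T]\<close> and almost every \<open>k\<close>.
\<close>

definition L1_norm :: "(real^'d \<Rightarrow> 'v::{banach, second_countable_topology}) \<Rightarrow> real"
where "L1_norm f = (LINT k|lebesgue. norm (f k))"

definition in_E ::
  "real \<Rightarrow> (real \<Rightarrow> real^'d \<Rightarrow> 'v::{banach, second_countable_topology}) \<Rightarrow> bool"
where "in_E T u \<longleftrightarrow> (\<forall>\<tau>\<in>{0..T}. integrable lebesgue (u \<tau>)) \<and>
  (\<forall>\<tau>0\<in>{0..T}. ((\<lambda>\<tau>. L1_norm (\<lambda>k. u \<tau> k - u \<tau>0 k)) \<longlongrightarrow> 0) (at \<tau>0 within {0..T}))"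

definition E_norm ::
  "real \<Rightarrow> (real \<Rightarrow> real^'d \<Rightarrow> 'v::{banach, second_countable_topology}) \<Rightarrow> real"
where "E_norm T u = (SUP \<tau>\<in>{0..T}. L1_norm (u \<tau>))"

definition modulate :: "real^'d \<Rightarrow> ('d, 'c::finite) wavefield \<Rightarrow> ('d, 'c) wavefield"
where "modulate r w = (\<lambda>k. cis (r \<bullet> k) *s w k)"

definition in_E1 ::
  "real \<Rightarrow> real^'d \<Rightarrow> (real \<Rightarrow> ('d::finite, 'c::finite) wavefield) \<Rightarrow> bool"
where "in_E1 T r w \<longleftrightarrow> in_E T w \<and>
  (\<forall>\<tau>\<in>{0..T}. \<exists>G. has_weak_gradient (modulate r (w \<tau>)) G) \<and>
  in_E T (\<lambda>\<tau>. weak_gradient (modulate r (w \<tau>)))"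

definition E1_norm ::
  "real \<Rightarrow> real \<Rightarrow> real \<Rightarrow> real^'d \<Rightarrow> (real \<Rightarrow> ('d::finite, 'c::finite) wavefield) \<Rightarrow> real"
where "E1_norm \<epsilon> T \<beta> r w =
  \<beta> powr (1 + \<epsilon>) * E_norm T (\<lambda>\<tau>. weak_gradient (modulate r (w \<tau>))) + E_norm T w"


section \<open>Linear part and nonlinearity\<close>

definition signs :: "int set" where "signs = {1, -1}"

text \<open>
  \<open>freq n \<zeta> k\<close> and \<open>evec n \<zeta> k\<close> are \<open>\<omega>\<^sub>n\<^sub>,\<^sub>\<zeta>(k)\<close> and \<open>g\<^sub>n\<^sub>,\<^sub>\<zeta>(k)\<close> for \<open>n \<in> {1..nbands}\<close>, \<open>\<zeta> \<in> signs\<close>, with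
  \<open>nbands = J\<close>.  \<open>chi m [k, k', \<dots>, k\<^sup>(\<^sup>m\<^sup>)] [u\<^sub>1, \<dots>, u\<^sub>m]\<close> is \<open>\<chi>\<^sup>(\<^sup>m\<^sup>)\<close> applied to its \<open>m + 1\<close> wavevectors
  and its \<open>m\<close> vector arguments; \<open>degs\<close> is the set of orders \<open>m\<close>.  \<open>cut\<close> is the cutoff \<open>\<Psi>\<close>.
\<close>

record ('d, 'c) wave_model =
  Lop :: "real^'d \<Rightarrow> complex^'c^'c"
  nbands :: nat
  freq :: "nat \<Rightarrow> int \<Rightarrow> real^'d \<Rightarrow> real"
  evec :: "nat \<Rightarrow> int \<Rightarrow> real^'d \<Rightarrow> complex^'c"
  degs :: "nat set"
  chi :: "nat \<Rightarrow> (real^'d) list \<Rightarrow> (complex^'c) list \<Rightarrow> complex^'c"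
  cut :: "real^'d \<Rightarrow> real"
  eps :: real

definition cinner :: "complex^'c \<Rightarrow> complex^'c \<Rightarrow> complex"
where "cinner x y = (\<Sum>i\<in>UNIV. cnj (x $ i) * y $ i)"

definition hermitian :: "complex^'c^'c \<Rightarrow> bool"
where "hermitian A \<longleftrightarrow> (\<forall>i j. A $ i $ j = cnj (A $ j $ i))"

text \<open>Orthogonal projection onto the line spanned by the unit vector \<open>g\<^sub>n\<^sub>,\<^sub>\<zeta>(k)\<close>.\<close>

definition band_proj ::
  "('d::finite, 'c::finite) wave_model \<Rightarrow> nat \<Rightarrow> int \<Rightarrow> real^'d \<Rightarrow> complex^'c \<Rightarrow> complex^'c"
where "band_proj M n \<zeta> k u = cinner (evec M n \<zeta> k) u *s evec M n \<zeta> k"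

definition sigma_bc :: "('d::finite, 'c::finite) wave_model \<Rightarrow> (real^'d) set"
where "sigma_bc M = {k.
    (\<exists>\<zeta>\<in>signs. \<exists>n. 1 \<le> n \<and> n < nbands M \<and> freq M (n + 1) \<zeta> k = freq M n \<zeta> k)
  \<or> \<not> isCont (Lop M) k
  \<or> (\<exists>\<zeta>\<in>signs. freq M 1 \<zeta> k = 0)}"

text \<open>
  Orthonormality of the \<open>2J\<close> eigenvectors makes the \<open>freq\<close> the full list of eigenvalues,
  with multiplicities.
\<close>

definition linear_part :: "('d::finite, 'c::finite) wave_model \<Rightarrow> bool"
where "linear_part M \<longleftrightarrow>
    1 \<le> nbands M \<and> CARD('c) = 2 * nbands M
  \<and> (\<forall>k. hermitian (Lop M k))
  \<and> (\<forall>k. \<forall>n\<in>{1..nbands M}. \<forall>\<zeta>\<in>signs.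
       Lop M k *v evec M n \<zeta> k = complex_of_real (freq M n \<zeta> k) *s evec M n \<zeta> k)
  \<and> (\<forall>k. \<forall>n\<in>{1..nbands M}. \<forall>\<zeta>\<in>signs. \<forall>n'\<in>{1..nbands M}. \<forall>\<zeta>'\<in>signs.
       cinner (evec M n \<zeta> k) (evec M n' \<zeta>' k) = (if n = n' \<and> \<zeta> = \<zeta>' then 1 else 0))
  \<and> (\<forall>k n. 1 \<le> n \<and> n < nbands M \<longrightarrow>
       freq M n 1 k \<le> freq M (n + 1) 1 k \<and> freq M (n + 1) (-1) k \<le> freq M n (-1) k)
  \<and> (\<forall>k. freq M 1 1 k \<ge> 0 \<and> 0 \<ge> freq M 1 (-1) k)
  \<and> (\<forall>k. \<forall>n\<in>{1..nbands M}. \<forall>\<zeta>\<in>signs. freq M n (-\<zeta>) (-k) = - freq M n \<zeta> k)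
  \<and> closed (sigma_bc M) \<and> interior (closure (sigma_bc M)) = {} \<and> sigma_bc M \<in> null_sets lebesgue
  \<and> smooth_along coord_lines (- sigma_bc M) (Lop M)
  \<and> (\<exists>C p. \<forall>k. norm (Lop M k) \<le> C * (1 + norm k ^ p))"

definition nonlinear_part :: "('d::finite, 'c::finite) wave_model \<Rightarrow> bool"
where "nonlinear_part M \<longleftrightarrow> finite (degs M) \<and> degs M \<subseteq> {2..} \<and> (\<forall>m\<in>degs M.
    (\<forall>ks us i. length ks = Suc m \<and> length us = m \<and> i < m \<longrightarrow>
       Vector_Spaces.linear (*s) (*s) (\<lambda>u. chi M m ks (us[i := u])))
  \<and> (\<forall>us. length us = m \<longrightarrow>
       smooth_along (multi_coord_lines m) {x. \<forall>i\<le>m. x i \<notin> sigma_bc M}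
         (\<lambda>x. chi M m (map x [0..<Suc m]) us))
  \<and> (\<exists>C. \<forall>ks us. length ks = Suc m \<and> length us = m \<longrightarrow>
       norm (chi M m ks us) \<le> C * (\<Prod>j<m. norm (us ! j))))"

definition cutoff :: "('d::finite, 'c::finite) wave_model \<Rightarrow> bool"
where "cutoff M \<longleftrightarrow> 0 < eps M \<and> eps M < 1 \<and>
  smooth_along coord_lines UNIV (cut M) \<and> (\<forall>\<eta>. 0 \<le> cut M \<eta>) \<and>
  (\<forall>\<eta>. norm \<eta> \<le> 1/2 \<longrightarrow> cut M \<eta> = 1) \<and> (\<forall>\<eta>. norm \<eta> \<ge> 1 \<longrightarrow> cut M \<eta> = 0)"

text \<open>\<open>\<Psi>(c \<beta>\<^sup>-\<^sup>(\<^sup>1\<^sup>-\<^sup>\<epsilon>\<^sup>)(k - k\<^sub>0))\<close>, used with \<open>c = 1\<close> and \<open>c = 1/2\<close>\<close>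

definition localizer ::
  "('d::finite, 'c::finite) wave_model \<Rightarrow> real \<Rightarrow> real \<Rightarrow> real^'d \<Rightarrow> real^'d \<Rightarrow> real"
where "localizer M c \<beta> k0 k = cut M ((c * \<beta> powr (- (1 - eps M))) *\<^sub>R (k - k0))"

text \<open>The list \<open>[k, k', \<dots>, k\<^sup>(\<^sup>m\<^sup>)]\<close> with \<open>k\<^sup>(\<^sup>j\<^sup>) = q j\<close> for \<open>1 \<le> j < m\<close> and \<open>k\<^sup>(\<^sup>m\<^sup>) = k - k' - \<dots> - k\<^sup>(\<^sup>m\<^sup>-\<^sup>1\<^sup>)\<close>\<close>

definition wavevectors :: "nat \<Rightarrow> real^'d \<Rightarrow> (nat \<Rightarrow> real^'d) \<Rightarrow> (real^'d) list"
where "wavevectors m k q = k # map q [1..<m] @ [k - (\<Sum>j\<in>{1..<m}. q j)]"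

text \<open>Here and below a field argument \<open>us ! j\<close> is evaluated at the wavevector \<open>ks ! Suc j\<close>.\<close>

definition phase ::
  "('d::finite, 'c::finite) wave_model \<Rightarrow> nat \<Rightarrow> nat \<Rightarrow> int \<Rightarrow> (nat \<times> int) list \<Rightarrow> (real^'d) list \<Rightarrow> real"
where "phase M m n \<zeta> \<xi> ks =
  freq M n \<zeta> (ks ! 0) - (\<Sum>j<m. freq M (fst (\<xi> ! j)) (snd (\<xi> ! j)) (ks ! Suc j))"

text \<open>
  The integral over \<open>\<real>\<^sup>(\<^sup>m\<^sup>-\<^sup>1\<^sup>)\<^sup>d\<close> is with respect to Lebesgue measure, i.e. the completed product
  measure.  For \<open>m \<ge> 2\<close> the inner integral does not depend on the representatives chosen for the
  elements \<open>us\<close> of \<open>E\<close>, for any \<open>k\<close> and \<open>\<tau>\<^sub>1\<close>.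
\<close>

definition interaction ::
  "('d::finite, 'c::finite) wave_model \<Rightarrow> real \<Rightarrow> nat \<Rightarrow> nat \<Rightarrow> int \<Rightarrow> (nat \<times> int) list \<Rightarrow>
   (real \<Rightarrow> ('d, 'c) wavefield) list \<Rightarrow> real \<Rightarrow> ('d, 'c) wavefield"
where "interaction M \<rho> m n \<zeta> \<xi> us \<tau> k =
  (LINT \<tau>1:{0..\<tau>}|lebesgue.
    (LINT q|completion (Pi\<^sub>M {1..<m} (\<lambda>_. lborel)).
      (let ks = wavevectors m k q in
       (1 / (2 * pi) ^ ((m - 1) * CARD('d))) *\<^sub>R
       (cis (phase M m n \<zeta> \<xi> ks * \<tau>1 / \<rho>) *s
        band_proj M n \<zeta> k
          (chi M m ks
            (map (\<lambda>j. band_proj M (fst (\<xi> ! j)) (snd (\<xi> ! j)) (ks ! Suc j)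
                        ((us ! j) \<tau>1 (ks ! Suc j))) [0..<m]))))))"


section \<open>The \<open>nk\<close>-spectrum and resonances\<close>

text \<open>The pairs \<open>(band l, ctr l)\<close>, \<open>l = 1, \<dots>, size\<close>, are the \<open>nk\<close>-pairs \<open>(n\<^sub>l, k\<^sub>*\<^sub>l)\<close>.\<close>

record 'd nk_spectrum =
  nparts :: nat
  band :: "nat \<Rightarrow> nat"
  ctr :: "nat \<Rightarrow> real^'d"

definition nk_pairs :: "'d::finite nk_spectrum \<Rightarrow> (nat \<times> (real^'d)) set"
where "nk_pairs S = (\<lambda>l. (band S l, ctr S l)) ` {1..nparts S}"

text \<open>The vectors \<open>\<lambda> = ((\<zeta>', l\<^sub>1), \<dots>, (\<zeta>\<^sup>(\<^sup>m\<^sup>), l\<^sub>m))\<close>\<close>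

definition index_vectors :: "'d::finite nk_spectrum \<Rightarrow> nat \<Rightarrow> (int \<times> nat) list set"
where "index_vectors S m = {lam. length lam = m \<and> set lam \<subseteq> signs \<times> {1..nparts S}}"

definition kappa :: "'d::finite nk_spectrum \<Rightarrow> (int \<times> nat) list \<Rightarrow> real^'d"
where "kappa S lam = (\<Sum>(\<zeta>, l)\<leftarrow>lam. real_of_int \<zeta> *\<^sub>R ctr S l)"

definition nk_spectrum_ok :: "('d::finite, 'c::finite) wave_model \<Rightarrow> 'd nk_spectrum \<Rightarrow> bool"
where "nk_spectrum_ok M S \<longleftrightarrow>
    (\<forall>l\<in>{1..nparts S}. band S l \<in> {1..nbands M})
  \<and> inj_on (\<lambda>l. (band S l, ctr S l)) {1..nparts S}
  \<and> (\<forall>l\<in>{1..nparts S}. ctr S l \<notin> sigma_bc M)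
  \<and> (\<forall>m\<in>degs M. \<forall>lam\<in>index_vectors S m. kappa S lam \<notin> sigma_bc M)"

definition resonant ::
  "('d::finite, 'c::finite) wave_model \<Rightarrow> 'd nk_spectrum \<Rightarrow> int \<Rightarrow> nat \<Rightarrow> (int \<times> nat) list \<Rightarrow> bool"
where "resonant M S \<zeta> n lam \<longleftrightarrow>
  - real_of_int \<zeta> * freq M n 1 (real_of_int \<zeta> *\<^sub>R kappa S lam)
  + (\<Sum>(\<zeta>', l)\<leftarrow>lam. real_of_int \<zeta>' * freq M (band S l) 1 (ctr S l)) = 0"

definition internal ::
  "'d::finite nk_spectrum \<Rightarrow> int \<Rightarrow> nat \<Rightarrow> (int \<times> nat) list \<Rightarrow> bool"
where "internal S \<zeta> n lam \<longleftrightarrow> (n, real_of_int \<zeta> *\<^sub>R kappa S lam) \<in> nk_pairs S"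

definition delta :: "(int \<times> nat) list \<Rightarrow> nat \<Rightarrow> int"
where "delta lam l = (\<Sum>(\<zeta>, l')\<leftarrow>lam. if l' = l then \<zeta> else 0)"

definition universal ::
  "'d::finite nk_spectrum \<Rightarrow> int \<Rightarrow> nat \<Rightarrow> (int \<times> nat) list \<Rightarrow> bool"
where "universal S \<zeta> n lam \<longleftrightarrow> (\<exists>I0\<in>{1..nparts S}. delta lam I0 \<in> signs \<and>
  (\<forall>l\<in>{1..nparts S}. l \<noteq> I0 \<longrightarrow> delta lam l = 0) \<and> n = band S I0 \<and> \<zeta> = delta lam I0)"

definition universally_resonance_invariant ::
  "('d::finite, 'c::finite) wave_model \<Rightarrow> 'd nk_spectrum \<Rightarrow> bool"
where "universally_resonance_invariant M S \<longleftrightarrow>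
  (\<forall>m\<in>degs M. \<forall>\<zeta>\<in>signs. \<forall>n\<in>{1..nbands M}. \<forall>lam\<in>index_vectors S m.
     resonant M S \<zeta> n lam \<longrightarrow> internal S \<zeta> n lam \<and> universal S \<zeta> n lam)"

definition resonant_vectors ::
  "('d::finite, 'c::finite) wave_model \<Rightarrow> 'd nk_spectrum \<Rightarrow> nat \<Rightarrow> nat \<Rightarrow> int \<Rightarrow> (int \<times> nat) list set"
where "resonant_vectors M S m l \<theta> = {lam \<in> index_vectors S m.
  resonant M S \<theta> (band S l) lam \<and> real_of_int \<theta> *\<^sub>R kappa S lam = ctr S l}"


section \<open>Wavepackets\<close>

text \<open>
  The wavepacket conditions at a single \<open>\<beta>\<close>, with explicit constants and with explicit
  \<open>\<plusminus>\<close> parts \<open>fz (\<plusminus>1)\<close>.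
\<close>

definition wavepacket_at ::
  "('d::finite, 'c::finite) wave_model \<Rightarrow> nat \<times> (real^'d) \<Rightarrow> real \<Rightarrow> real \<Rightarrow> real \<Rightarrow> real \<Rightarrow>
   ('d, 'c) wavefield \<Rightarrow> (int \<Rightarrow> ('d, 'c) wavefield) \<Rightarrow> bool"
where "wavepacket_at M nk s C C' \<beta> f fz \<longleftrightarrow>
    integrable lebesgue f \<and> L1_norm f \<le> C
  \<and> (\<forall>\<zeta>\<in>signs. integrable lebesgue (fz \<zeta>) \<and>
       (AE k in lebesgue. fz \<zeta> k =
          localizer M (1/2) \<beta> (real_of_int \<zeta> *\<^sub>R snd nk) k *\<^sub>R band_proj M (fst nk) \<zeta> k (fz \<zeta> k)))
  \<and> L1_norm (\<lambda>k. f k - fz (-1) k - fz 1 k) \<le> C' * \<beta> powr s"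

text \<open>
  A family \<open>f \<beta> p\<close> with \<open>\<plusminus>\<close> parts \<open>fz \<zeta> \<beta> p\<close>, where \<open>p \<in> P\<close> collects all parameters other than
  \<open>\<beta>\<close> and \<open>P \<beta>\<close> is the set of their admissible values; \<open>pos p\<close> is the position.  The constants
  are uniform in \<open>\<beta>\<close> and \<open>p\<close>.
\<close>

definition particle_like_wavepacket ::
  "('d::finite, 'c::finite) wave_model \<Rightarrow> nat \<times> (real^'d) \<Rightarrow> real \<Rightarrow>
   (real \<Rightarrow> 'p set) \<Rightarrow> ('p \<Rightarrow> real^'d) \<Rightarrow>
   (real \<Rightarrow> 'p \<Rightarrow> ('d, 'c) wavefield) \<Rightarrow> (int \<Rightarrow> real \<Rightarrow> 'p \<Rightarrow> ('d, 'c) wavefield) \<Rightarrow> bool"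
where "particle_like_wavepacket M nk s P pos f fz \<longleftrightarrow>
  (\<exists>C C' C1. \<forall>\<^sub>F \<beta> in at_right 0. \<forall>p\<in>P \<beta>.
     wavepacket_at M nk s C C' \<beta> (f \<beta> p) (\<lambda>\<zeta>. fz \<zeta> \<beta> p) \<and>
     (\<forall>\<zeta>\<in>signs. (\<exists>G. has_weak_gradient (modulate (pos p) (fz \<zeta> \<beta> p)) G) \<and>
        L1_norm (weak_gradient (modulate (pos p) (fz \<zeta> \<beta> p))) \<le> C1 * \<beta> powr (- 1 - eps M)))"

text \<open>
  Scalar version: \<open>h \<beta> r\<close> depends on the positions \<open>r 1, \<dots>, r N\<close>; the \<open>l\<close>-th summand only
  depends on \<open>r l\<close>, which ranges over all of \<open>\<real>\<^sup>d\<close>.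
\<close>

definition multi_particle_wavepacket ::
  "('d::finite, 'c::finite) wave_model \<Rightarrow> 'd nk_spectrum \<Rightarrow> real \<Rightarrow>
   (real \<Rightarrow> (nat \<Rightarrow> real^'d) \<Rightarrow> ('d, 'c) wavefield) \<Rightarrow> bool"
where "multi_particle_wavepacket M S s h \<longleftrightarrow>
  (\<exists>hl. (\<forall>l\<in>{1..nparts S}. \<exists>hz.
      particle_like_wavepacket M (band S l, ctr S l) s (\<lambda>_. UNIV) (\<lambda>r. r) (hl l) hz) \<and>
    (\<forall>\<^sub>F \<beta> in at_right 0. \<forall>r. AE k in lebesgue. h \<beta> r k = (\<Sum>l\<in>{1..nparts S}. hl l \<beta> (r l) k)))"

text \<open>Vector version: the components \<open>v \<beta> p l \<theta>\<close> are the \<open>\<plusminus>\<close> parts of particle-like wavepackets.\<close>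

definition multi_particle_wavepacket_vector ::
  "('d::finite, 'c::finite) wave_model \<Rightarrow> 'd nk_spectrum \<Rightarrow> real \<Rightarrow>
   (real \<Rightarrow> 'p set) \<Rightarrow> ('p \<Rightarrow> nat \<Rightarrow> real^'d) \<Rightarrow>
   (real \<Rightarrow> 'p \<Rightarrow> nat \<Rightarrow> int \<Rightarrow> ('d, 'c) wavefield) \<Rightarrow> bool"
where "multi_particle_wavepacket_vector M S s P pos v \<longleftrightarrow>
  (\<forall>l\<in>{1..nparts S}. \<exists>f.
     particle_like_wavepacket M (band S l, ctr S l) s P (\<lambda>p. pos p l) f (\<lambda>\<theta> \<beta> p. v \<beta> p l \<theta>))"


section \<open>The averaged system\<close>

text \<open>Elements \<open>v l \<theta> \<tau> k\<close> of \<open>E\<^sup>2\<^sup>N\<close>, relevant for \<open>l \<in> {1..N}\<close> and \<open>\<theta> \<in> signs\<close> only\<close>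

type_synonym ('d, 'c) wavevec = "nat \<Rightarrow> int \<Rightarrow> real \<Rightarrow> ('d, 'c) wavefield"

definition F_av ::
  "('d::finite, 'c::finite) wave_model \<Rightarrow> 'd nk_spectrum \<Rightarrow> real \<Rightarrow> real \<Rightarrow>
   ('d, 'c) wavevec \<Rightarrow> ('d, 'c) wavevec"
where "F_av M S \<beta> \<rho> v l \<theta> \<tau> k =
  (\<Sum>m\<in>degs M. \<Sum>lam\<in>resonant_vectors M S m l \<theta>.
     localizer M 1 \<beta> (real_of_int \<theta> *\<^sub>R ctr S l) k *\<^sub>R
     interaction M \<rho> m (band S l) \<theta> (map (\<lambda>(\<zeta>, l'). (band S l', \<zeta>)) lam)
       (map (\<lambda>(\<zeta>, l') \<tau>1 k1.
          localizer M (1/2) \<beta> (real_of_int \<zeta> *\<^sub>R ctr S l') k1 *\<^sub>R v l' \<zeta> \<tau>1 k1) lam) \<tau> k)"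

definition h_Psi ::
  "('d::finite, 'c::finite) wave_model \<Rightarrow> 'd nk_spectrum \<Rightarrow> real \<Rightarrow> ('d, 'c) wavefield \<Rightarrow>
   ('d, 'c) wavevec"
where "h_Psi M S \<beta> f l \<theta> \<tau> k =
  localizer M 1 \<beta> (real_of_int \<theta> *\<^sub>R ctr S l) k *\<^sub>R band_proj M (band S l) \<theta> k (f k)"

definition averaged_system ::
  "('d::finite, 'c::finite) wave_model \<Rightarrow> 'd nk_spectrum \<Rightarrow> real \<Rightarrow> real \<Rightarrow> real \<Rightarrow>
   ('d, 'c) wavevec \<Rightarrow> ('d, 'c) wavevec \<Rightarrow> bool"
where "averaged_system M S T \<beta> \<rho> H v \<longleftrightarrow>
  (\<forall>l\<in>{1..nparts S}. \<forall>\<theta>\<in>signs. \<forall>\<tau>\<in>{0..T}. AE k in lebesgue.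
     v l \<theta> \<tau> k = F_av M S \<beta> \<rho> v l \<theta> \<tau> k + H l \<theta> \<tau> k)"

definition in_E1_vec ::
  "'d::finite nk_spectrum \<Rightarrow> real \<Rightarrow> (nat \<Rightarrow> real^'d) \<Rightarrow> ('d, 'c::finite) wavevec \<Rightarrow> bool"
where "in_E1_vec S T r v \<longleftrightarrow> (\<forall>l\<in>{1..nparts S}. \<forall>\<theta>\<in>signs. in_E1 T (r l) (v l \<theta>))"

definition E1_vec_norm ::
  "('d::finite, 'c::finite) wave_model \<Rightarrow> 'd nk_spectrum \<Rightarrow> real \<Rightarrow> real \<Rightarrow> (nat \<Rightarrow> real^'d) \<Rightarrow>
   ('d, 'c) wavevec \<Rightarrow> real"
where "E1_vec_norm M S T \<beta> r v =
  (\<Sum>l\<in>{1..nparts S}. \<Sum>\<theta>\<in>signs. E1_norm (eps M) T \<beta> (r l) (v l \<theta>))"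

definition E_vec_eq ::
  "'d::finite nk_spectrum \<Rightarrow> real \<Rightarrow> ('d, 'c::finite) wavevec \<Rightarrow> ('d, 'c) wavevec \<Rightarrow> bool"
where "E_vec_eq S T v w \<longleftrightarrow>
  (\<forall>l\<in>{1..nparts S}. \<forall>\<theta>\<in>signs. \<forall>\<tau>\<in>{0..T}. AE k in lebesgue. v l \<theta> \<tau> k = w l \<theta> \<tau> k)"

text \<open>
  Wavepackets are considered for small \<open>\<beta>\<close>; \<open>small_beta\<close> fixes a range \<open>0 < \<beta> \<le> \<beta>0 \<le> 1\<close> for which the
  cutoffs (supported in balls of radius \<open>2 \<beta>\<^sup>1\<^sup>-\<^sup>\<epsilon>\<close>) stay away from the band crossings, where projections
  and frequencies need not be differentiable.  As \<open>sigma_bc\<close> is closed, every sufficiently small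
  \<open>\<beta>0\<close> qualifies.
\<close>

definition small_beta ::
  "('d::finite, 'c::finite) wave_model \<Rightarrow> 'd nk_spectrum \<Rightarrow> real \<Rightarrow> bool"
where "small_beta M S \<beta>0 \<longleftrightarrow> 0 < \<beta>0 \<and> \<beta>0 \<le> 1 \<and>
  (\<forall>l\<in>{1..nparts S}. \<forall>\<zeta>\<in>signs. real_of_int \<zeta> *\<^sub>R ctr S l \<notin> sigma_bc M \<longrightarrow>
     cball (real_of_int \<zeta> *\<^sub>R ctr S l) (2 * \<beta>0 powr (1 - eps M)) \<inter> sigma_bc M = {})"

end

theory Submission
 imports Defs
begin

text \<open>
 The averaged system is solved by a fixed point argument in \<open>E\<^sup>1\<close>, for which each summand of the
 averaged nonlinearity must be bounded uniformly in the positions, \<open>\<beta>\<close> and \<open>\<rho>\<close>.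
 Since \<open>k = k' + \<dots> + k\<^sup>(\<^sup>m\<^sup>)\<close>, modulation by \<open>cis (r \<bullet> k)\<close> can be moved onto all fields at once, and a
 derivative in \<open>k\<close> can be put on a single field. Universality provides a slot with the same index
 \<open>(l, \<theta>)\<close> as the equation, hence with the same position. There, the phase has derivative
 \<open>\<nabla>\<omega>(k) - \<nabla>\<omega>(k\<^sup>(\<^sup>j\<^sup>)) = O(\<beta>\<^sup>1\<^sup>-\<^sup>\<epsilon>)\<close> on the supports of the cutoffs, and
 \<open>\<beta>\<^sup>1\<^sup>+\<^sup>\<epsilon> \<beta>\<^sup>1\<^sup>-\<^sup>\<epsilon> / \<rho> \<le> C1\<close> compensates the fast oscillation.
\<close>

text \<open>The positions are unbounded, so no constant may contain a difference of two positions.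
  The modulus of a modulated field does not see its position; only the field that is differentiated
  has to be modulated by its own one. The slot supplied by universality shares more than the
  position with the output: band, sign and centre agree too. The two frequencies that vary are thus
  one function at two points near one centre, and a Lipschitz bound for the gradient of \<omega>
  suffices. It has to come from the smoothness of \<open>Lop\<close> alone: eigenvectors are an
  arbitrary choice at each wavevector, so all regularity passes through the rank-one projections. A
  second obstacle is that gradients are weak and fields are representatives. Weak derivatives are
  replaced by L1 limits of difference quotients; these pass through the interaction integral,
  because a translation of k is absorbed exactly by a translation of one integration variable.
  Derivatives of the cutoffs cost \<beta>^(-(1-\<epsilon>)), which the weight \<beta>^(1+\<epsilon>)
  pays for. A factor T in front of all bounds yields the contraction.\<close>

notation (input) scaleR (infixr "*R" 75)

notation (input) has_vector_derivative (infix "has'_vd" 50)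

abbreviation (input) "borel_fun == borel_measurable borel"

abbreviation (input) "joint_borel == borel_measurable (borel \<Otimes>\<^sub>M borel)"


section \<open>Lebesgue measure: Borel representatives, translations and the L1 norm\<close>

lemma AE_translate:
 fixes a :: "'a::euclidean_space"
 assumes "AE k in lebesgue. P k"
 shows "AE k in lebesgue. P (k + a)"
proof -
 have "AE k in lborel. P k" using assms by (simp add: AE_completion_iff)
 then obtain N where N: "N : null_sets lborel" "{k. ~ P k} \<subseteq> N"
  unfolding eventually_ae_filter by auto
 have "AE k in distr lborel borel ((+) a). k ~: N"
  using N(1) by (simp add: lborel_distr_plus AE_not_in)
 then have "AE k in lborel. a + k ~: N"
  using N(1) by (subst (asm) AE_distr_iff) auto
 then have "AE k in lborel. P (k + a)"
  by eventually_elim (use N(2) in \<open>auto simp: add.commute\<close>)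
 then show ?thesis by (simp add: AE_completion_iff)
qed

text \<open>Fubini is applied to products of uncompleted Borel measures, while fields are only
  Lebesgue measurable. The replacement is made in each coordinate separately.\<close>

lemma ex_borel_representative:
 fixes f :: "'a::euclidean_space => 'v::euclidean_space"
 assumes "f : borel_measurable lebesgue"
 shows "EX f'. f' : borel_fun & (AE x in lebesgue. f x = f' x)"
proof -
 have "ALL b:Basis. EX g:borel_measurable (lborel::'a measure). AE x in lborel. f x \<bullet> b = g x"
  using assms by (intro ballI completion_ex_borel_measurable_real) auto
 then obtain g where g: "!!b. b : Basis ==> g b : borel_measurable (lborel::'a measure)"
   "!!b. b : Basis ==> AE x in lborel. f x \<bullet> b = g b x"
  by metis
 have "AE x in lborel. ALL b:Basis. f x \<bullet> b = g b x"
  using g(2) by (subst AE_ball_countable) (auto intro: countable_finite)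
 then have "AE x in lborel. f x = (SUM b:Basis. g b x *R b)"
 proof eventually_elim
  case (elim x)
  have "f x = (SUM b:Basis. (f x \<bullet> b) *R b)" by (simp add: euclidean_representation)
  also have "... = (SUM b:Basis. g b x *R b)" using elim by (intro sum.cong) auto
  finally show ?case .
 qed
 moreover have "(%x. SUM b:Basis. g b x *R b) : borel_fun"
  using g(1) by (auto intro!: borel_measurable_sum borel_measurable_scaleR)
 ultimately show ?thesis by (auto simp: AE_completion_iff)
qed

lemma borel_measurable_lebesgue_AE:
 fixes f g :: "'a::euclidean_space => 'v::euclidean_space"
 assumes "f : borel_measurable lebesgue" "AE x in lebesgue. f x = g x"
 shows "g : borel_measurable lebesgue"
proof -
 have "g -` A : sets lebesgue" if "A : sets borel" for A
 proof (rule completion.in_sets_AE)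
  show "AE x in lebesgue. (x : f -` A) = (x : g -` A)"
   using assms(2) by eventually_elim auto
  show "f -` A : sets lebesgue"
   using measurable_sets[OF assms(1) that] by simp
 qed auto
 then show ?thesis by (auto simp: measurable_def)
qed

lemma integrable_lebesgue_AE:
 fixes f g :: "'a::euclidean_space => 'v::euclidean_space"
 assumes "integrable lebesgue f" "AE x in lebesgue. f x = g x"
 shows "integrable lebesgue g"
 using assms borel_measurable_lebesgue_AE[of f g]
 by (auto intro!: integrable_cong_AE_imp[OF assms(1)] elim: eventually_mono)

lemma integrable_borel_representative:
 fixes f :: "'a::euclidean_space => 'v::euclidean_space"
 assumes "integrable lebesgue f"
 obtains f' where "f' : borel_fun" "AE x in lebesgue. f x = f' x"
  "integrable lborel f'" "integrable lebesgue f'"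
proof -
 obtain f' where f': "f' : borel_fun" "AE x in lebesgue. f x = f' x"
  using ex_borel_representative[of f] assms by auto
 have "integrable lebesgue f'" using integrable_lebesgue_AE[OF assms f'(2)] .
 moreover have "integrable lborel f'"
  using calculation f'(1) by (subst (asm) integrable_completion) auto
 ultimately show ?thesis using that f' by blast
qed

lemma lebesgue_distr_plus: "distr lebesgue lebesgue (%x. x + a) = (lebesgue :: 'a::euclidean_space measure)"
proof -
 have T: "(%x. a + (SUM j:Basis. (1 * (x \<bullet> j)) *R j)) = (%x::'a. x + a)"
  by (auto simp: euclidean_representation add.commute)
 show ?thesis
  using lebesgue_affine_euclidean[of "%_. 1" "a"] T by (simp add: density_1)
qed

lemma measurable_plus_lebesgue: "(%x. x + a) : lebesgue \<rightarrow>\<^sub>M (lebesgue :: 'a::euclidean_space measure)"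
proof -
 have T: "(%x. a + (SUM j:Basis. (1 * (x \<bullet> j)) *R j)) = (%x::'a. x + a)"
  by (auto simp: euclidean_representation add.commute)
 show ?thesis using lebesgue_affine_measurable[of "%_. 1" a] T by simp
qed

lemma integrable_translate:
 fixes f :: "'a::euclidean_space => 'v::euclidean_space"
 assumes "integrable lebesgue f"
 shows "integrable lebesgue (%k. f (k + a))"
 using integrable_distr[OF measurable_plus_lebesgue[of a], where f=f] assms by (simp add: lebesgue_distr_plus)

lemma integral_translate:
 fixes f :: "'a::euclidean_space => 'v::euclidean_space"
 assumes "f : borel_measurable lebesgue"
 shows "(LINT k|lebesgue. f (k + a)) = (LINT k|lebesgue. f k)"
 using integral_distr[OF measurable_plus_lebesgue assms, of a] by (simp add: lebesgue_distr_plus)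

lemma L1_norm_translate:
 fixes f :: "real^'d => 'v::euclidean_space"
 assumes "f : borel_measurable lebesgue"
 shows "L1_norm (%k. f (k + a)) = L1_norm f"
 unfolding L1_norm_def using assms by (intro integral_translate) auto

lemma L1_norm_nonneg [simp]: "0 <= L1_norm f"
 unfolding L1_norm_def by (intro integral_nonneg_AE) auto

lemma L1_norm_cong_AE:
 fixes f g :: "real^'d => 'v::euclidean_space"
 assumes "AE k in lebesgue. f k = g k" "f : borel_measurable lebesgue"
 shows "L1_norm f = L1_norm g"
 unfolding L1_norm_def using assms borel_measurable_lebesgue_AE[of f g]
 by (intro integral_cong_AE) (auto elim: eventually_mono)

lemma L1_norm_add:
 fixes f g :: "real^'d => 'v::euclidean_space"
 assumes "integrable lebesgue f" "integrable lebesgue g"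
 shows "L1_norm (%k. f k + g k) <= L1_norm f + L1_norm g"
proof -
 have "L1_norm (%k. f k + g k) <= (LINT k|lebesgue. norm (f k) + norm (g k))"
  unfolding L1_norm_def using assms by (intro integral_mono) (auto intro: norm_triangle_ineq)
 then show ?thesis using assms by (simp add: L1_norm_def)
qed

lemma L1_norm_minus_commute: "L1_norm (%k. f k - g k) = L1_norm (%k. g k - f k)"
 unfolding L1_norm_def by (simp add: norm_minus_commute)

lemma L1_norm_diff_triangle:
 fixes f g h :: "real^'d => 'v::euclidean_space"
 assumes "integrable lebesgue f" "integrable lebesgue g" "integrable lebesgue h"
 shows "L1_norm (%k. f k - h k) <= L1_norm (%k. f k - g k) + L1_norm (%k. g k - h k)"
 using L1_norm_add[of "%k. f k - g k" "%k. g k - h k"] assms by auto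

lemma L1_norm_le_diff:
 fixes f g :: "real^'d => 'v::euclidean_space"
 assumes "integrable lebesgue f" "integrable lebesgue g"
 shows "L1_norm f <= L1_norm g + L1_norm (%k. f k - g k)"
 using L1_norm_add[of g "%k. f k - g k"] assms by auto

lemma L1_norm_scaleR: "L1_norm (%k. c *R f k) = \<bar>c\<bar> * L1_norm f"
 unfolding L1_norm_def by simp

lemma L1_norm_mono:
 fixes f :: "real^'d => 'v::euclidean_space" and g :: "real^'d => 'w::euclidean_space"
 assumes "f : borel_measurable lebesgue" "integrable lebesgue g" "AE k in lebesgue. norm (f k) <= C * norm (g k)"
 shows "integrable lebesgue f & L1_norm f <= C * L1_norm g"
proof -
 have i: "integrable lebesgue f"
  by (rule Bochner_Integration.integrable_bound[of lebesgue "%k. C * norm (g k)"]) (use assms in auto)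
 have "L1_norm f <= (LINT k|lebesgue. C * norm (g k))"
  unfolding L1_norm_def using assms i by (intro integral_mono_AE) auto
 then show ?thesis using i by (simp add: L1_norm_def)
qed

lemma L1_norm_eq_0:
 fixes f :: "real^'d => 'v::euclidean_space"
 assumes "integrable lebesgue f" "L1_norm f <= 0"
 shows "AE k in lebesgue. f k = 0"
proof -
 have "L1_norm f = 0" using assms(2) L1_norm_nonneg[of f] by linarith
 then show ?thesis
  using integral_nonneg_eq_0_iff_AE[of lebesgue "%k. norm (f k)"] assms(1) by (simp add: L1_norm_def)
qed

lemma norm_integral_le_L1_norm: "norm (LINT k|lebesgue. f k) <= L1_norm f"
 unfolding L1_norm_def by simp

lemma L1_norm_sum_le:
 fixes f :: "'i => real^'d => 'v::euclidean_space"
 assumes "finite A" "!!i. i : A ==> integrable lebesgue (f i)"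
 shows "L1_norm (%k. SUM i:A. f i k) <= (SUM i:A. L1_norm (f i))"
 using assms
proof (induction A rule: finite_induct)
 case empty then show ?case by (simp add: L1_norm_def)
next
 case (insert i A)
 have "L1_norm (%k. f i k + (SUM i:A. f i k)) <= L1_norm (f i) + L1_norm (%k. SUM i:A. f i k)"
  using insert by (intro L1_norm_add Bochner_Integration.integrable_sum) auto
 then show ?case using insert by force
qed

section \<open>Continuity of translations in L1\<close>

text \<open>Approximate \<open>A\<close> from inside by a compact \<open>K\<close>, and
  \<open>K\<close> from outside by an open \<open>U\<close>. A sufficiently short shift keeps
  \<open>K\<close> inside \<open>U\<close>, so the change of the indicator is paid for by
  \<open>A - K\<close> and \<open>U - K\<close>, each of measure below \<open>e\<close> and each
  counted twice.\<close>

lemma L1_norm_indicator_translate: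
 fixes A :: "(real^'d) set" and c :: "'v::euclidean_space"
 assumes A: "A : sets lebesgue" "emeasure lebesgue A < \<infinity>" and "0 < e"
 shows "\<forall>\<^sub>F a in at 0. L1_norm (%k. indicator A (k + a) *R c - indicator A k *R c) <= 4 * e * norm c"
proof -
 have lm: "A : lmeasurable" using A by (simp add: fmeasurable_def)
 obtain K where K: "compact K" "K \<subseteq> A" "A - K : lmeasurable" "measure lebesgue (A - K) < e"
 proof -
  obtain T where T: "closed T" "T \<subseteq> A" "A - T : lmeasurable" "emeasure lebesgue (A - T) < ennreal (e/2)"
   by (rule sets_lebesgue_inner_closed[OF A(1) half_gt_zero[OF \<open>0 < e\<close>]])
  have mT: "T : lmeasurable" using T(1,2) lm
   by (intro fmeasurableI2[of A lebesgue T]) auto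
  \<comment> \<open>The inner approximation is only closed; cutting it by a large ball makes it
    compact at the cost of another \<open>e/2\<close>.\<close>
  have "(%n. measure lebesgue (T \<inter> cball 0 (real n))) \<longlonglongrightarrow> measure lebesgue (UN n. T \<inter> cball 0 (real n))"
  proof (rule Lim_measure_incseq)
   show "incseq (%n. T \<inter> cball 0 (real n))" by (auto simp: incseq_def)
   show "emeasure lebesgue (UN i. T \<inter> cball 0 (real i)) ~= \<infinity>"
   proof -
    have "emeasure lebesgue (UN i. T \<inter> cball 0 (real i)) <= emeasure lebesgue T"
     using mT by (intro emeasure_mono) auto
    then show ?thesis using mT by (auto simp: fmeasurable_def top_unique)
   qed
  qed (use T(1) in auto)
  moreover have "(UN n. T \<inter> cball 0 (real n)) = T"
  proof -
   have "EX n. norm x <= real n" for x :: "real^'d" by (rule real_arch_simple)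
   then show ?thesis by auto
  qed
  ultimately have "(%n. measure lebesgue (T \<inter> cball 0 (real n))) \<longlonglongrightarrow> measure lebesgue T" by simp
  then have "\<forall>\<^sub>F n in sequentially. measure lebesgue (T \<inter> cball 0 (real n)) > measure lebesgue T - e/2"
   using \<open>0 < e\<close> by (intro order_tendstoD(1)) auto
  from eventually_happens'[OF sequentially_bot this]
  obtain n where n: "measure lebesgue (T \<inter> cball 0 (real n)) > measure lebesgue T - e/2" ..
  let ?K = "T \<inter> cball 0 (real n)"
  have cK: "compact ?K" using T(1) by (simp add: closed_Int_compact)
  have mK: "?K : lmeasurable" using cK by (simp add: lmeasurable_compact)
  have "measure lebesgue (A - ?K) = measure lebesgue A - measure lebesgue ?K"
   using lm mK T(2) by (intro measurable_measure_Diff) auto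
  moreover have "measure lebesgue (A - T) = measure lebesgue A - measure lebesgue T"
   using lm mT T(2) by (intro measurable_measure_Diff) auto
  moreover have "measure lebesgue (A - T) < e/2"
   using T(3,4) \<open>0 < e\<close> by (simp add: emeasure_eq_measure2 ennreal_less_iff)
  ultimately have "measure lebesgue (A - ?K) < e" using n by simp
  then show ?thesis using that[of ?K] cK T(2) lm mK by auto
 qed
 have mK: "K : lmeasurable" using K by (simp add: lmeasurable_compact)
 obtain U where U: "open U" "K \<subseteq> U" "U - K : lmeasurable" "emeasure lebesgue (U - K) < ennreal e"
  by (rule sets_lebesgue_outer_open[OF fmeasurableD[OF mK] \<open>0 < e\<close>])
 have mU: "U : lmeasurable"
  using fmeasurable.Un[OF mK U(3)] U(2) by (simp add: Un_absorb1)
 have mUK: "measure lebesgue U - measure lebesgue K < e"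
 proof -
  have "measure lebesgue (U - K) < e"
   using U(3,4) \<open>0 < e\<close> by (simp add: emeasure_eq_measure2 ennreal_less_iff)
  then show ?thesis using mU mK U(2) measurable_measure_Diff[of U lebesgue K] by simp
 qed
 obtain d where d: "0 < d" "(UN x:K. ball x d) \<subseteq> U"
  by (rule compact_subset_open_imp_ball_epsilon_subset[OF K(1) U(1,2)])
 note int = integrable_real_indicator
 have iA: "integrable lebesgue (indicator A :: _ => real)" "integrable lebesgue (indicator K :: _ => real)"
   "integrable lebesgue (indicator U :: _ => real)"
  using lm mK mU by (auto simp: fmeasurable_def intro!: integrable_real_indicator)
 have "L1_norm (%k. indicator A (k + a) *R c - indicator A k *R c) <= 4 * e * norm c"
  if a: "dist a 0 < d" "a ~= 0" for a
 proof -
  have KU: "indicator K (k + a) <= (indicator U k :: real)" for k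
  proof (cases "k + a : K")
   case True
   then have "k : ball (k + a) d" using a by (simp add: dist_norm)
   then have "k : U" using True d(2) by blast
   then show ?thesis by (simp add: indicator_def)
  qed (auto simp: indicator_def)
  \<comment> \<open>Four nonnegative terms; each integrates to at most \<open>e\<close>, because
    translations preserve the integral.\<close>
  define F where "F = (%k. (indicator A (k + a) - indicator K (k + a)) + (indicator A k - indicator K k)
    + (indicator U k - indicator K (k + a)) + (indicator U k - indicator K k) :: real)"
  have le: "norm (indicator A (k + a) *R c - indicator A k *R c) <= F k * norm c" for k
  proof -
   have "\<bar>indicator A (k + a) - indicator A k\<bar> <= F k"
   proof -
    have "indicator K (k + a) <= (indicator A (k + a) :: real)" "indicator K k <= (indicator A k :: real)"
      "indicator K k <= (indicator U k :: real)"
     using K(2) U(2) by (auto simp: indicator_def)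
    then show ?thesis using KU[of k] unfolding F_def by linarith
   qed
   then show ?thesis by (simp add: scaleR_diff_left[symmetric] mult_right_mono)
  qed
  note it = iA iA[THEN integrable_translate, of a]
  have iF: "integrable lebesgue F" unfolding F_def using it by auto
  have "L1_norm (%k. indicator A (k + a) *R c - indicator A k *R c) <= (LINT k|lebesgue. F k * norm c)"
   unfolding L1_norm_def using it iF le by (intro integral_mono) auto
  also have "... = (LINT k|lebesgue. F k) * norm c" by simp
  also have "(LINT k|lebesgue. F k) = 2 * (measure lebesgue A - measure lebesgue K) + 2 * (measure lebesgue U - measure lebesgue K)"
   unfolding F_def using it integral_translate[of "indicat_real A" a] integral_translate[of "indicat_real K" a]
   by simp
  also have "... <= 4 * e"
   using mUK K(4) measurable_measure_Diff[of A lebesgue K] lm mK K(2) by auto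
  finally show ?thesis by (simp add: mult_right_mono)
 qed
 then show ?thesis unfolding eventually_at using d(1) by blast
qed

text \<open>Indicators of sets of finite measure suffice: the claim survives sums, and it survives
  L1 limits because translations are isometries of L1.\<close>

lemma L1_translation_continuous:
 fixes f :: "real^'d => 'v::euclidean_space"
 assumes "integrable lebesgue f"
 shows "((%a. L1_norm (%k. f (k + a) - f k)) \<longlongrightarrow> 0) (at 0)"
 using assms
proof (induction rule: integrable_induct)
 case (base A c)
 show ?case
 proof (rule tendstoI)
  fix e :: real assume "0 < e"
  define e' where "e' = e / (8 * (norm c + 1))"
  have nc: "norm c + 1 > 0" by (simp add: add_nonneg_pos)
  have e': "0 < e'" unfolding e'_def using \<open>0 < e\<close> nc by auto
  have "4 * e' * norm c < e"
   unfolding e'_def using \<open>0 < e\<close> nc by (simp add: field_simps add_pos_nonneg)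
  then show "\<forall>\<^sub>F a in at 0. dist (L1_norm (%k. indicator A (k + a) *R c - indicator A k *R c)) 0 < e"
   using L1_norm_indicator_translate[OF base e', of c] by (auto elim: eventually_mono)
 qed
next
 case (add f g)
 show ?case
 proof (rule tendsto_sandwich[OF _ _ tendsto_const])
  show "\<forall>\<^sub>F a in at 0. L1_norm (%k. f (k + a) + g (k + a) - (f k + g k)) <=
    L1_norm (%k. f (k + a) - f k) + L1_norm (%k. g (k + a) - g k)"
  proof (intro always_eventually allI)
   fix a
   show "L1_norm (%k. f (k + a) + g (k + a) - (f k + g k)) <=
     L1_norm (%k. f (k + a) - f k) + L1_norm (%k. g (k + a) - g k)"
    using L1_norm_add[of "%k. f (k + a) - f k" "%k. g (k + a) - g k"] add.hyps
    by (simp add: integrable_translate add_diff_add)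
  qed
  show "((%a. L1_norm (%k. f (k + a) - f k) + L1_norm (%k. g (k + a) - g k)) \<longlongrightarrow> 0) (at 0)"
   using tendsto_add[OF add.IH] by simp
 qed auto
next
 case (lim f s)
 \<comment> \<open>The approximations converge pointwise and stay below twice the modulus of
   \<open>f\<close>, so they converge in L1 by domination.\<close>
 have "(%i. LINT k|lebesgue. norm (s i k - f k)) \<longlonglongrightarrow> (LINT k|(lebesgue :: (real^'d) measure). (0::real))"
 proof (rule integral_dominated_convergence[where w="%k. 3 * norm (f k)"])
  show "AE x in lebesgue. (%i. norm (s i x - f x)) \<longlonglongrightarrow> 0"
   using lim.hyps(2) by (intro AE_I2) (auto intro!: tendsto_norm_zero simp: LIM_zero_iff)
  show "AE x in lebesgue. norm (norm (s i x - f x)) <= 3 * norm (f x)" for i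
  proof (rule AE_I2)
   fix x :: "real^'d" assume "x : space lebesgue"
   then show "norm (norm (s i x - f x)) <= 3 * norm (f x)"
    using lim.hyps(3)[of x i] norm_triangle_ineq4[of "s i x" "f x"] by simp
  qed
 qed (use lim in auto)
 then have conv: "(%i. L1_norm (%k. s i k - f k)) \<longlonglongrightarrow> 0" by (simp add: L1_norm_def)
 show ?case
 proof (rule tendstoI)
  fix e :: real assume e: "0 < e"
  have "\<forall>\<^sub>F i in sequentially. L1_norm (%k. s i k - f k) < e/4"
   using order_tendstoD(2)[OF conv, of "e/4"] e by simp
  from eventually_happens'[OF sequentially_bot this]
  obtain i where i: "L1_norm (%k. s i k - f k) < e/4" ..
  have "\<forall>\<^sub>F a in at 0. L1_norm (%k. s i (k + a) - s i k) < e/4"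
   using order_tendstoD(2)[OF lim.IH[of i], of "e/4"] e by auto
  then show "\<forall>\<^sub>F a in at 0. dist (L1_norm (%k. f (k + a) - f k)) 0 < e"
  proof eventually_elim
   case (elim a)
   note it = lim.hyps(1)[of i] lim.hyps(4) lim.hyps(1)[of i, THEN integrable_translate, of a] lim.hyps(4)[THEN integrable_translate, of a]
   have "L1_norm (%k. f (k + a) - f k) <= L1_norm (%k. f (k + a) - s i (k + a)) + L1_norm (%k. s i (k + a) - f k)"
    using it by (intro L1_norm_diff_triangle)
   moreover have "L1_norm (%k. s i (k + a) - f k) <= L1_norm (%k. s i (k + a) - s i k) + L1_norm (%k. s i k - f k)"
    using it by (intro L1_norm_diff_triangle)
   moreover have "L1_norm (%k. f (k + a) - s i (k + a)) = L1_norm (%k. f k - s i k)"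
    using it L1_norm_translate[of "%k. f k - s i k" a] by auto
   moreover have "L1_norm (%k. f k - s i k) = L1_norm (%k. s i k - f k)" by (rule L1_norm_minus_commute)
   ultimately show ?case using elim i e by simp
  qed
 qed
qed

section \<open>Test functions and the fundamental lemma of the calculus of variations\<close>

lemma has_vector_derivative_along_line:
 fixes f :: "'a::real_vector => 'v::real_normed_vector"
 assumes "!!x. ((%t. f (x + t *R b)) has_vd g x) (at 0)"
 shows "((%t. f (x + t *R b)) has_vd g (x + t *R b)) (at t)"
proof -
 have 1: "((%s. s - t) has_vd 1) (at t)"
  by (auto intro!: derivative_eq_intros simp: has_vector_derivative_def)
 have 2: "((%s. f ((x + t *R b) + s *R b)) has_vd g (x + t *R b)) (at ((%s. s - t) t))"
  using assms[of "x + t *R b"] by simp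
 have "(%s. f ((x + t *R b) + s *R b)) \<circ> (%s. s - t) = (%s. f (x + s *R b))"
  by (auto simp: fun_eq_iff algebra_simps)
 then show ?thesis using vector_diff_chain_at[OF 1 2] by simp
qed

lemma test_function_derivative:
 assumes fi: "test_function fi" and b: "b : Basis"
 shows "EX fi' B. continuous_on UNIV fi & continuous_on UNIV fi' & (ALL x. \<bar>fi x\<bar> <= B & \<bar>fi' x\<bar> <= B) &
  (ALL x t. ((%t. fi (x + t *R b)) has_vd fi' (x + t *R b)) (at t))"
proof -
 have "Ck_along coord_lines (Suc 0) UNIV fi"
  using fi by (simp only: test_function_def smooth_along_def)
 then have c: "continuous_on UNIV fi" and ex: "ALL p:coord_lines. EX g.
   (ALL x:UNIV. ((%t. fi (p x t)) has_vd g x) (at 0)) & continuous_on UNIV g"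
  by auto
 have "(%x t. x + t *R b) : coord_lines" using b by (auto simp: coord_lines_def)
 from bspec[OF ex this] obtain g where g: "!!x. ((%t. fi (x + t *R b)) has_vd g x) (at 0)" "continuous_on UNIV g"
  by auto
 obtain K where K: "compact K" "!!k. k ~: K ==> fi k = 0"
  using fi unfolding test_function_def by auto
 \<comment> \<open>Off the support a short piece of the coordinate line stays off it too, so the
   derivative vanishes there. Function and derivative are then bounded by their bounds on the
   compact \<open>K\<close>.\<close>
 have g0: "g x = 0" if "x ~: K" for x
 proof -
  have "open ((%t. x + t *R b) -` (- K))"
   using K(1) by (intro open_vimage continuous_intros) (auto intro: compact_imp_closed)
  then have "open {t. x + t *R b : - K}" by (simp add: vimage_def)
  moreover have "0 : {t. x + t *R b : - K}" using that by simp
  ultimately have "((%t. 0) has_vd g x) (at 0)"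
   by (rule has_vector_derivative_transform_within_open[OF g(1)]) (use K(2) in auto)
  then show ?thesis by (rule vector_derivative_unique_at[OF _ has_vector_derivative_const])
 qed
 have "bounded (fi ` K)" "bounded (g ` K)"
  by (intro compact_imp_bounded compact_continuous_image K(1) continuous_on_subset[OF c] continuous_on_subset[OF g(2)] subset_UNIV)+
 then obtain B1 B2 where B: "!!x. x : K ==> \<bar>fi x\<bar> <= B1" "!!x. x : K ==> \<bar>g x\<bar> <= B2"
  by (auto simp: bounded_iff)
 have "\<bar>fi x\<bar> <= max 0 (max B1 B2) & \<bar>g x\<bar> <= max 0 (max B1 B2)" for x
  using B[of x] K(2)[of x] g0[of x] by (cases "x : K") (auto simp: le_max_iff_disj)
 then show ?thesis using c g has_vector_derivative_along_line[of fi b g, OF g(1)] by blast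
qed

lemma test_function_continuous: "test_function fi ==> continuous_on UNIV fi"
 using test_function_derivative SOME_Basis by blast

lemma test_function_measurable: "test_function fi ==> fi : borel_fun"
 by (intro borel_measurable_continuous_onI test_function_continuous)

lemma test_function_bounded: "test_function fi ==> EX B. ALL x. \<bar>fi x\<bar> <= B"
 using test_function_derivative[of fi, OF _ SOME_Basis] by blast

lemma Ck_along_scaleR:
 "Ck_along D n U f ==> Ck_along D n U (%x. c *R f x)"
proof (induction n arbitrary: f)
 case 0 then show ?case by (auto intro!: continuous_intros)
next
 case (Suc n)
 have "EX g. (ALL x:U. ((%t. c *R f (p x t)) has_vd g x) (at 0)) & Ck_along D n U g"
  if "p : D" for p
 proof -
  have "ALL p:D. EX g. (ALL x:U. ((%t. f (p x t)) has_vd g x) (at 0)) & Ck_along D n U g"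
   using Suc.prems by simp
  from bspec[OF this that]
  obtain g where g: "ALL x:U. ((%t. f (p x t)) has_vd g x) (at 0)" "Ck_along D n U g"
   by (elim exE conjE)
  then show ?thesis using Suc.IH[OF g(2)]
   by (intro exI[of _ "%x. c *R g x"])
    (auto intro: bounded_linear.has_vector_derivative[OF bounded_linear_scaleR_right])
 qed
 then show ?case using Suc.prems by (auto intro!: continuous_intros)
qed

text \<open>The chain rule puts a factor \<open>c\<close> in front of the derivative, which the
  induction absorbs through closure under scalar multiples.\<close>

lemma Ck_along_affine:
 fixes f :: "real^'d => 'v::real_normed_vector"
 shows "Ck_along coord_lines n UNIV f ==> Ck_along coord_lines n UNIV (%x. f (c *R (x - y)))"
proof (induction n arbitrary: f)
 case 0 then show ?case by (auto intro!: continuous_intros elim!: continuous_on_compose2)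
next
 case (Suc n)
 have "EX g'. (ALL x:UNIV. ((%t. f (c *R (p x t - y))) has_vd g' x) (at 0)) & Ck_along coord_lines n UNIV g'"
  if p: "p : coord_lines" for p
 proof -
  obtain b where b: "p = (%x t. x + t *R b)" using p by (auto simp: coord_lines_def)
  have "ALL p:coord_lines. EX g. (ALL x:UNIV. ((%t. f (p x t)) has_vd g x) (at 0)) & Ck_along coord_lines n UNIV g"
   using Suc.prems by simp
  from bspec[OF this p]
  obtain g where g: "ALL x:UNIV. ((%t. f (p x t)) has_vd g x) (at 0)" "Ck_along coord_lines n UNIV g"
   by (elim exE conjE)
  have "((%t. f (c *R (p x t - y))) has_vd c *R g (c *R (x - y))) (at 0)" for x
  proof -
   have 1: "((%s. c * s) has_vd c) (at 0)"
    by (auto intro!: derivative_eq_intros simp: has_vector_derivative_def)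
   have 2: "((%s. f (c *R (x - y) + s *R b)) has_vd g (c *R (x - y))) (at ((%s. c * s) 0))"
    using g(1) b by simp
   have "(%s. f (c *R (x - y) + s *R b)) \<circ> (%s. c * s) = (%t. f (c *R (p x t - y)))"
    by (auto simp: fun_eq_iff b algebra_simps)
   then show ?thesis using vector_diff_chain_at[OF 1 2] by simp
  qed
  moreover have "Ck_along coord_lines n UNIV (%x. c *R g (c *R (x - y)))"
   by (rule Ck_along_scaleR[OF Suc.IH[OF g(2)]])
  ultimately show ?thesis by (intro exI[of _ "%x. c *R g (c *R (x - y))"]) simp
 qed
 moreover have "continuous_on UNIV (%x. f (c *R (x - y)))"
  using Suc.prems by (auto intro!: continuous_intros elim!: continuous_on_compose2)
 ultimately show ?case by simp
qed

lemma test_function_affine: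
 assumes "test_function fi" "c ~= 0"
 shows "test_function (%x. fi (c *R (x - y)))"
proof -
 obtain K where K: "compact K" "!!k. k ~: K ==> fi k = 0"
  using assms unfolding test_function_def by auto
 have "compact ((%z. y + (1/c) *R z) ` K)"
  using K(1) by (intro compact_continuous_image continuous_intros)
 moreover have "fi (c *R (x - y)) = 0" if "x ~: (%z. y + (1/c) *R z) ` K" for x
 proof (rule K(2), rule notI)
  assume "c *R (x - y) : K"
  moreover have "x = y + (1/c) *R (c *R (x - y))" using assms(2) by simp
  ultimately show False using that by blast
 qed
 ultimately show ?thesis
  using assms unfolding test_function_def smooth_along_def by (blast intro: Ck_along_affine)
qed

text \<open>The cutoff of the model is itself the bump used for averaging; this is how
  \<open>cutoff M\<close> enters statements about L1 functions and their weak gradients.\<close>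

lemma test_function_cut: "cutoff M ==> test_function (cut M)"
 unfolding test_function_def cutoff_def
 by (auto intro!: exI[of _ "cball 0 1"])

lemma integrable_bounded_scaleR:
 fixes w :: "'a::euclidean_space => 'v::euclidean_space" and ps :: "'a => real"
 assumes "integrable lebesgue w" "ps : borel_measurable lebesgue" "!!x. \<bar>ps x\<bar> <= B"
 shows "integrable lebesgue (%x. ps x *R w x)"
proof (rule Bochner_Integration.integrable_bound[of lebesgue "%x. B * norm (w x)"])
 show "AE x in lebesgue. norm (ps x *R w x) <= norm (B * norm (w x))"
  using assms(3) by (intro AE_I2) (simp add: abs_mult mult_right_mono order_trans[OF _ abs_ge_self])
qed (use assms in auto)

text \<open>Testing against translates of a bump of width \<open>1/c\<close> shows that \<open>w\<close> is controlled by its own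
 modulus of continuity in \<open>L\<^sup>1\<close>.\<close>

lemma fundamental_lemma:
 fixes w :: "real^'d => 'v::euclidean_space" and M :: "('d::finite, 'c::finite) wave_model"
 assumes M: "cutoff M" and w: "integrable lebesgue w"
  and test: "!!fi. test_function fi ==> (LINT k|lebesgue. fi k *R w k) = 0"
 shows "AE k in lebesgue. w k = 0"
proof (rule L1_norm_eq_0[OF w], rule field_le_epsilon)
 fix e :: real assume e: "0 < e"
 obtain w' where w': "w' : borel_fun" "AE x in lebesgue. w x = w' x"
   "integrable lborel w'" "integrable lebesgue w'"
  by (rule integrable_borel_representative[OF w])
 note [measurable] = w'(1)
 have "\<forall>\<^sub>F a in at 0. L1_norm (%k. w' (k + a) - w' k) < e"
  using order_tendstoD(2)[OF L1_translation_continuous[OF w'(4)]] e by simp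
 then obtain d where d: "0 < d" "!!a. a ~= 0 ==> norm a < d ==> L1_norm (%k. w' (k + a) - w' k) < e"
  unfolding eventually_at dist_norm by auto
 have d': "L1_norm (%k. w' (k + a) - w' k) <= e" if "norm a < d" for a
  using d(2)[of a] that e by (cases "a = 0") (auto simp: L1_norm_def)
 \<comment> \<open>The dilated cutoff \<open>p\<close> lives where \<open>norm z < d\<close>, the
   range of shifts that move \<open>w'\<close> by at most \<open>e\<close> in L1. It equals 1 on the
   ball of half that radius, so its integral \<open>I\<close> is positive.\<close>
 define c where "c = 1 / d"
 have c: "c > 0" using d(1) by (simp add: c_def)
 define p where "p = (%z. cut M (c *R z))"
 have tp: "test_function p"
  using test_function_affine[OF test_function_cut[OF M], of c 0] c by (simp add: p_def)
 have pm[measurable]: "p : borel_fun" by (rule test_function_measurable[OF tp])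
 obtain B where B: "!!x. \<bar>p x\<bar> <= B" using test_function_bounded[OF tp] by auto
 have p0: "p z >= 0" for z using M by (simp add: p_def cutoff_def)
 have supp: "p z = 0" if "norm z >= d" for z
 proof -
  have "norm (c *R z) >= 1" using that d(1) c by (simp add: c_def)
  then show ?thesis using M by (simp add: p_def cutoff_def)
 qed
 have p1: "p z = 1" if "norm z <= d/2" for z
 proof -
  have "norm (c *R z) <= 1/2" using that d(1) c by (simp add: c_def field_simps)
  then show ?thesis using M by (simp add: p_def cutoff_def)
 qed
 have pi: "integrable lborel p"
 proof (rule Bochner_Integration.integrable_bound[of lborel "%z. B * indicat_real (cball (0::real^'d) d) z"])
  show "AE x in lborel. norm (p x) <= norm (B * indicat_real (cball (0::real^'d) d) x)"
   using B supp by (auto simp: indicator_def intro!: AE_I2 order_trans[OF B])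
  show "integrable lborel (%z. B * indicat_real (cball (0::real^'d) d) z)"
   using emeasure_bounded_finite[of "cball (0::real^'d) d"]
   by (intro integrable_mult_right integrable_real_indicator) auto
 qed simp
 define I where "I = (LINT z|lborel. p z)"
 have I0: "I > 0"
 proof -
  have "0 < measure lborel (ball (0::real^'d) (d/2))"
   using d(1) by (simp add: content_ball_pos)
  also have "... = (LINT z|lborel. indicator (ball (0::real^'d) (d/2)) z)" by simp
  also have "... <= I" unfolding I_def
   using pi p0 p1 by (intro integral_mono integrable_real_indicator)
    (use emeasure_bounded_finite[of "ball (0::real^'d) (d/2)"] in \<open>auto simp: indicator_def\<close>)
  finally show ?thesis .
 qed
 \<comment> \<open>Testing with \<open>p\<close> centred at \<open>y\<close> kills the average of
   \<open>w'\<close> around \<open>y\<close>, so \<open>I\<close> times \<open>w' y\<close> is minus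
   the average of the increments \<open>w' (y + z) - w' y\<close>.\<close>
 have key: "I * norm (w' y) <= (LINT z|lborel. p z * norm (w' (y + z) - w' y))" 
  and key2: "integrable lborel (%z. p z * norm (w' (y + z) - w' y))" for y
 proof -
  have "test_function (%x. p (x - y))" using test_function_affine[OF tp, of 1 y] by simp
  then have "(LINT x|lebesgue. p (x - y) *R w x) = 0" by (rule test)
  also have "(LINT x|lebesgue. p (x - y) *R w x) = (LINT x|lebesgue. p (x - y) *R w' x)"
  proof (intro integral_cong_AE borel_measurable_scaleR)
   show "(%x. p (x - y)) : borel_measurable lebesgue"
    by (rule measurable_completion) measurable
   then show "(%x. p (x - y)) : borel_measurable lebesgue" .
  qed (use w' w in \<open>auto elim: eventually_mono\<close>)
  also have "... = (LINT z|lebesgue. p z *R w' (z + y))"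
  proof -
   have "(%x. p (x - y) *R w' x) : borel_measurable lebesgue"
    using w'(1) by (intro measurable_completion) measurable
   from integral_translate[OF this, of y] show ?thesis by simp
  qed
  also have "... = (LINT z|lborel. p z *R w' (z + y))"
   using w'(1) by (intro integral_completion) measurable
  finally have z0: "(LINT z|lborel. p z *R w' (z + y)) = 0" .
  have i1: "integrable lebesgue (%z. p z *R w' (z + y))"
   using integrable_translate[OF w'(4), of y] B pm
   by (intro integrable_bounded_scaleR) (auto intro: measurable_completion)
  have i1': "integrable lborel (%z. p z *R w' (z + y))"
   using i1 w'(1) by (subst (asm) integrable_completion) measurable
  have i2: "integrable lborel (%z. p z *R w' y)" using pi by simp
  have i3: "integrable lborel (%z. p z *R w' (z + y) - p z *R w' y)" using i1' i2 by simp
  have n3: "norm (p z *R w' (z + y) - p z *R w' y) = p z * norm (w' (y + z) - w' y)" for z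
   using p0[of z] by (simp add: scaleR_diff_right[symmetric] add.commute)
  show "integrable lborel (%z. p z * norm (w' (y + z) - w' y))"
   using integrable_norm[OF i3] n3 by simp
  have "I *R w' y = - (LINT z|lborel. p z *R w' (z + y) - p z *R w' y)"
   using z0 i1' i2 pi by (simp add: I_def integral_scaleR_left)
  then have "norm (I *R w' y) = norm (LINT z|lborel. p z *R w' (z + y) - p z *R w' y)"
   by (simp only: norm_minus_cancel)
  then have "I * norm (w' y) = norm (LINT z|lborel. p z *R w' (z + y) - p z *R w' y)"
   using I0 by simp
  also have "... <= (LINT z|lborel. norm (p z *R w' (z + y) - p z *R w' y))"
   by (rule integral_norm_bound)
  finally show "I * norm (w' y) <= (LINT z|lborel. p z * norm (w' (y + z) - w' y))" using n3 by simp
 qed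
 have "ennreal I * (\<integral>\<^sup>+y. ennreal (norm (w' y)) \<partial>lborel) = (\<integral>\<^sup>+y. ennreal (I * norm (w' y)) \<partial>lborel)"
  using I0 by (subst nn_integral_cmult[symmetric]) (auto simp: ennreal_mult)
 also have "... <= (\<integral>\<^sup>+y. (\<integral>\<^sup>+z. ennreal (p z * norm (w' (y + z) - w' y)) \<partial>lborel) \<partial>lborel)"
 proof (rule nn_integral_mono)
  fix y
  have "(\<integral>\<^sup>+z. ennreal (p z * norm (w' (y + z) - w' y)) \<partial>lborel) = ennreal (LINT z|lborel. p z * norm (w' (y + z) - w' y))"
   using key2[of y] p0 by (intro nn_integral_eq_integral) auto
  then show "ennreal (I * norm (w' y)) <= (\<integral>\<^sup>+z. ennreal (p z * norm (w' (y + z) - w' y)) \<partial>lborel)"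
   using key[of y] by (simp add: ennreal_leI)
 qed
 \<comment> \<open>Integrating first in \<open>y\<close> turns the increments into L1 translation
   moduli, at most \<open>e\<close> wherever \<open>p\<close> does not vanish.\<close>
 also have "... = (\<integral>\<^sup>+z. (\<integral>\<^sup>+y. ennreal (p z * norm (w' (y + z) - w' y)) \<partial>lborel) \<partial>lborel)"
  by (rule lborel_pair.Fubini') measurable
 also have "... <= (\<integral>\<^sup>+z. ennreal (e * p z) \<partial>lborel)"
 proof (rule nn_integral_mono)
  fix z
  show "(\<integral>\<^sup>+y. ennreal (p z * norm (w' (y + z) - w' y)) \<partial>lborel) <= ennreal (e * p z)"
  proof (cases "norm z < d")
   case True
   have it: "integrable lebesgue (%y. norm (w' (y + z) - w' y))"
    using w'(4) by (intro integrable_norm Bochner_Integration.integrable_diff integrable_translate)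
   then have it': "integrable lborel (%y. norm (w' (y + z) - w' y))"
    by (subst (asm) integrable_completion) measurable
   have "(LINT y|lborel. norm (w' (y + z) - w' y)) = L1_norm (%y. w' (y + z) - w' y)"
    unfolding L1_norm_def by (rule integral_completion[symmetric]) measurable
   then have "(LINT y|lborel. p z * norm (w' (y + z) - w' y)) <= e * p z"
    using d'[OF True] p0[of z] by (simp add: mult.commute[of e] mult_left_mono)
   moreover have "(\<integral>\<^sup>+y. ennreal (p z * norm (w' (y + z) - w' y)) \<partial>lborel) = ennreal (LINT y|lborel. p z * norm (w' (y + z) - w' y))"
    using it' p0[of z] by (intro nn_integral_eq_integral) auto
   ultimately show ?thesis by (simp add: ennreal_leI)
  qed (use supp[of z] in auto)
 qed
 also have "... = ennreal (e * I)"
  unfolding I_def using pi p0 e by (subst nn_integral_eq_integral) auto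
 finally have "ennreal I * (\<integral>\<^sup>+y. ennreal (norm (w' y)) \<partial>lborel) <= ennreal (e * I)" .
 moreover have "(\<integral>\<^sup>+y. ennreal (norm (w' y)) \<partial>lborel) = ennreal (L1_norm w')"
  unfolding L1_norm_def using w'(1,3)
  by (subst nn_integral_eq_integral) (auto simp: integral_completion)
 ultimately have "I * L1_norm w' <= e * I"
  using I0 e by (simp add: ennreal_mult[symmetric] less_imp_le)
 then have "L1_norm w' <= e" using I0 by simp
 moreover have "L1_norm w = L1_norm w'" using w w'(2) by (intro L1_norm_cong_AE) auto
 ultimately show "L1_norm w <= 0 + e" by simp
qed

section \<open>Time integrals and Fubini's theorem\<close>

lemma time_integral_product:
 fixes F :: "real => 'a::euclidean_space => 'v::euclidean_space"
 assumes F[measurable]: "case_prod F : joint_borel"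
  and bnd: "!!s. s : {0..t} ==> integrable lebesgue (F s) & (LINT k|lebesgue. norm (F s k)) <= C"
 shows "integrable (lborel \<Otimes>\<^sub>M lborel) (%(s, x). indicator {0..t} s *R F s x)"
proof -
 have Fs[measurable]: "F s : borel_fun" for s by measurable
 have il: "integrable lborel (F s) & (LINT k|lborel. norm (F s k)) <= C" if "s : {0..t}" for s
  using bnd[OF that] integrable_completion[of "F s" lborel] integral_completion[of "%k. norm (F s k)" lborel] by simp
 show ?thesis
 proof (rule lborel_pair.Fubini_integrable)
  show "AE s in lborel. integrable lborel (%y. case (s, y) of (s, x) => indicat_real {0..t} s *R F s x)"
   using il by (intro AE_I2) (auto simp: indicator_def)
  show "integrable lborel (%s. LINT y|lborel. norm (case (s, y) of (s, x) => indicat_real {0..t} s *R F s x))"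
  proof (rule Bochner_Integration.integrable_bound[of lborel "%s. C * indicator {0..t} s"])
   show "integrable lborel (%s. C * indicat_real {0..t} s)"
    by (intro integrable_mult_right integrable_real_indicator) (auto simp: emeasure_lborel_Icc_eq)
   show "AE s in lborel. norm (LINT y|lborel. norm (case (s, y) of (s, x) => indicat_real {0..t} s *R F s x)) <= norm (C * indicat_real {0..t} s)"
   proof (rule AE_I2)
    fix s
    have "(LINT y|lborel. norm (F s y)) >= 0" by simp
    then show "norm (LINT y|lborel. norm (case (s, y) of (s, x) => indicat_real {0..t} s *R F s x)) <= norm (C * indicat_real {0..t} s)"
     using il[of s] by (auto simp: indicator_def)
   qed
  qed measurable
 qed measurable
qed

lemma set_integral_lebesgue_lborel:
 fixes f :: "real => 'v::euclidean_space"
 assumes [measurable]: "f : borel_fun"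
 shows "(LINT s:{0..t}|lebesgue. f s) = (LINT s|lborel. indicator {0..t} s *R f s)"
 unfolding set_lebesgue_integral_def by (rule integral_completion) measurable

text \<open>The factor \<open>t\<close> in the norm bound is the source of the contraction for short
  times. The exchange of integrals will let weak derivatives pass under the time integral.\<close>

lemma time_integral:
 fixes F :: "real => real^'d => 'v::euclidean_space" and ps :: "real^'d => real"
 assumes F[measurable]: "case_prod F : joint_borel"
  and bnd: "!!s. s : {0..t} ==> integrable lebesgue (F s) & L1_norm (F s) <= C"
  and t: "0 <= t"
 shows time_integral_integrable: "integrable lebesgue (%k. LINT s:{0..t}|lebesgue. F s k)"
  and time_integral_norm: "L1_norm (%k. LINT s:{0..t}|lebesgue. F s k) <= t * C"
  and time_integral_measurable: "(%k. LINT s:{0..t}|lebesgue. F s k) : borel_fun"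
  and time_integral_swap: "(LINT k|lebesgue. (LINT s:{0..t}|lebesgue. F s k)) = (LINT s:{0..t}|lebesgue. (LINT k|lebesgue. F s k))"
proof -
 let ?G = "%s x. indicator {0..t} s *R F s x"
 have Fs[measurable]: "F s : borel_fun" for s by measurable
 have eq: "(LINT s:{0..t}|lebesgue. F s k) = (LINT s|lborel. ?G s k)" for k
  by (rule set_integral_lebesgue_lborel) measurable
 have int: "integrable (lborel \<Otimes>\<^sub>M lborel) (%(s, x). ?G s x)"
  using time_integral_product[OF F, of t C] bnd by (simp add: L1_norm_def)
 have m: "(%k. LINT s|lborel. ?G s k) : borel_fun" by measurable
 show "(%k. LINT s:{0..t}|lebesgue. F s k) : borel_fun" unfolding eq by (rule m)
 have i2: "integrable lborel (%k. LINT s|lborel. ?G s k)"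
  using lborel_pair.integrable_snd[OF int] by simp
 then show "integrable lebesgue (%k. LINT s:{0..t}|lebesgue. F s k)"
  unfolding eq using m by (subst integrable_completion) auto
 have intn: "integrable (lborel \<Otimes>\<^sub>M lborel) (%(s, x). norm (?G s x))"
  using integrable_norm[OF int] by (simp add: case_prod_beta')
 have "L1_norm (%k. LINT s:{0..t}|lebesgue. F s k) = (LINT k|lborel. norm (LINT s|lborel. ?G s k))"
  unfolding eq L1_norm_def using m by (intro integral_completion) simp
 also have "... <= (LINT k|lborel. (LINT s|lborel. norm (?G s k)))"
  using i2 lborel_pair.integrable_snd[OF intn] by (intro integral_mono integral_norm_bound) auto
 also have "... = (LINT s|lborel. (LINT k|lborel. norm (?G s k)))"
  using lborel_pair.Fubini_integral[OF intn] by simp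
 also have "... <= (LINT s|lborel. C * indicator {0..t} s)"
 proof (rule integral_mono)
  show "integrable lborel (%s. LINT k|lborel. norm (?G s k))"
   using lborel_pair.integrable_fst[OF intn] by simp
  show "integrable lborel (%s. C * indicat_real {0..t} s)"
   by (intro integrable_mult_right integrable_real_indicator) (auto simp: emeasure_lborel_Icc_eq)
  fix s
  have "(LINT y|lborel. norm (F s y)) = L1_norm (F s)"
   unfolding L1_norm_def by (rule integral_completion[symmetric]) measurable
  then show "(LINT k|lborel. norm (?G s k)) <= C * indicator {0..t} s"
   using bnd[of s] by (auto simp: indicator_def)
 qed
 also have "... = t * C" using t by simp
 finally show "L1_norm (%k. LINT s:{0..t}|lebesgue. F s k) <= t * C" .
 have "(LINT k|lebesgue. (LINT s:{0..t}|lebesgue. F s k)) = (LINT k|lborel. (LINT s|lborel. ?G s k))"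
  unfolding eq using m by (intro integral_completion) auto
 also have "... = (LINT s|lborel. (LINT k|lborel. ?G s k))"
  using lborel_pair.Fubini_integral[OF int] by simp
 also have "... = (LINT s|lborel. indicator {0..t} s *R (LINT k|lebesgue. F s k))"
  by (intro Bochner_Integration.integral_cong refl) (simp add: integral_completion)
 also have "... = (LINT s:{0..t}|lebesgue. (LINT k|lebesgue. F s k))"
 proof (rule set_integral_lebesgue_lborel[symmetric])
  have "(%s. LINT k|lborel. F s k) : borel_fun" by measurable
  then show "(%s. LINT k|lebesgue. F s k) : borel_fun" by (simp add: integral_completion)
 qed
 finally show "(LINT k|lebesgue. (LINT s:{0..t}|lebesgue. F s k)) = (LINT s:{0..t}|lebesgue. (LINT k|lebesgue. F s k))" .
qed

text \<open>Sums, differences and components of time integrals behave as expected only at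
  wavevectors where the integrand is integrable in time; by Fubini these are almost all.\<close>

lemma time_integral_AE_integrable:
 fixes F :: "real => real^'d => 'v::euclidean_space"
 assumes F[measurable]: "case_prod F : joint_borel"
  and bnd: "!!s. s : {0..t} ==> integrable lebesgue (F s) & L1_norm (F s) <= C"
 shows "AE k in lebesgue. set_integrable lebesgue {0..t} (%s. F s k)"
proof -
 have int: "integrable (lborel \<Otimes>\<^sub>M lborel) (%(s, x). indicator {0..t} s *R F s x)"
  using time_integral_product[OF F, of t C] bnd by (simp add: L1_norm_def)
 have "AE k in lborel. integrable lborel (%s. indicator {0..t} s *R F s k)"
  using lborel_pair.AE_integrable_fst'[OF lborel_pair.integrable_product_swap[OF int]] by simp
 then have "AE k in lborel. integrable lebesgue (%s. indicator {0..t} s *R F s k)"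
 proof eventually_elim
  case (elim k)
  have "(%s. indicator {0..t} s *R F s k) : borel_measurable lborel" by measurable
  then show ?case using elim by (subst integrable_completion) auto
 qed
 then show ?thesis by (simp add: AE_completion_iff set_integrable_def)
qed

lemma norm_diff_le_derivative_bound:
 fixes h :: "real => 'v::real_normed_vector"
 assumes "!!t. (h has_vector_derivative h' t) (at t)" "!!t. norm (h' t) <= B"
 shows "norm (h s - h u) <= B * \<bar>s - u\<bar>"
proof -
 have "norm (h s - h u) <= B * norm (s - u)"
 proof (rule differentiable_bound[of UNIV h "%t r. r *R h' t"])
  show "onorm (%r. r *R h' t) <= B" for t
  proof (rule onorm_bound)
   show "0 <= B" using assms(2)[of t] norm_ge_zero order_trans by blast
   show "norm (r *R h' t) <= B * norm r" for r
    using assms(2)[of t] by (simp add: mult.commute[of B] mult_left_mono)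
  qed
 qed (use assms(1) in \<open>auto simp: has_vector_derivative_def\<close>)
 then show ?thesis by simp
qed

lemma inverse_Suc_at_right: "filterlim (%n. 1 / real (Suc n)) (at_right 0) sequentially"
 using LIMSEQ_inverse_real_of_nat by (auto simp: filterlim_at inverse_eq_divide)

section \<open>Weak derivatives as L1 limits of difference quotients\<close>

text \<open>For coordinate directions this strong derivative agrees with the distributional one, by
  the next two lemmas. Unlike the latter it can be carried through convolution integrals by direct
  estimates, without test functions.\<close>

definition has_L1_derivative ::
 "(real^'d => 'v::euclidean_space) => real^'d => (real^'d => 'v) => bool"
where "has_L1_derivative w b g \<longleftrightarrow> integrable lebesgue w & integrable lebesgue g &
 ((%t. L1_norm (%k. (1 / t) *R (w (k + t *R b) - w k) - g k)) \<longlongrightarrow> 0) (at_right 0)"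

text \<open>Translation invariance moves the difference quotient from \<open>w\<close> to the test
  function, where it converges boundedly to minus the derivative. On the other side the quotient of
  \<open>w\<close> converges to \<open>g\<close> in L1.\<close>

lemma has_L1_derivative_weak:
 fixes w :: "real^'d => 'v::euclidean_space"
 assumes w: "has_L1_derivative w b g" and fi: "test_function fi" and b: "b : Basis"
 shows "(LINT k|lebesgue. vector_derivative (%t. fi (k + t *R b)) (at 0) *R w k) = - (LINT k|lebesgue. fi k *R g k)"
proof -
 obtain fi' B where c: "continuous_on UNIV fi" "continuous_on UNIV fi'"
  and B: "!!x. \<bar>fi x\<bar> <= B" "!!x. \<bar>fi' x\<bar> <= B"
  and d: "!!x t. ((%t. fi (x + t *R b)) has_vd fi' (x + t *R b)) (at t)"
  using test_function_derivative[OF fi b] by (elim exE conjE) blast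
 have wi: "integrable lebesgue w" and gi: "integrable lebesgue g" using w by (auto simp: has_L1_derivative_def)
 have m: "fi : borel_fun" "fi' : borel_fun"
  using c by (auto intro: borel_measurable_continuous_onI)
 note [measurable] = m
 have ml: "(%k. fi (k + a)) : borel_measurable lebesgue" "fi' : borel_measurable lebesgue" "fi : borel_measurable lebesgue" for a
  by (intro measurable_completion; measurable)+
 define q where "q t k = (1/t) * (fi (k - t *R b) - fi k)" for t k
 have qB: "\<bar>q t k\<bar> <= B" if "t > 0" for t k
 proof -
  have "norm (fi (k + (- t) *R b) - fi (k + 0 *R b)) <= B * \<bar>(-t) - 0\<bar>"
   by (rule norm_diff_le_derivative_bound[OF d]) (use B in auto)
  then show ?thesis using that by (simp add: q_def abs_mult field_simps)
 qed
 have ptw: "(%n. q (1 / real (Suc n)) k) \<longlonglongrightarrow> - fi' k" for k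
 proof -
  have "((%t. fi (k + t *R b)) has_vd fi' k) (at 0)" using d[of k 0] by simp
  then have "((%h. (fi (k + h *R b) - fi k) / h) \<longlongrightarrow> fi' k) (at 0)"
   by (simp add: has_real_derivative_iff_has_vector_derivative[symmetric] DERIV_def)
  moreover have "filterlim (%n. - (1 / real (Suc n))) (at 0) sequentially"
   using LIMSEQ_inverse_real_of_nat[THEN tendsto_minus] by (auto simp: filterlim_at inverse_eq_divide)
  ultimately have "(%n. (fi (k + (- (1 / real (Suc n))) *R b) - fi k) / (- (1 / real (Suc n)))) \<longlonglongrightarrow> fi' k"
   by (rule filterlim_compose)
  from tendsto_minus[OF this] show ?thesis by (simp add: q_def mult.commute)
 qed
 have eq: "(LINT k|lebesgue. fi k *R ((1 / t) *R (w (k + t *R b) - w k))) = (LINT k|lebesgue. q t k *R w k)" if "t > 0" for t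
 proof -
  have i1: "integrable lebesgue (%k. fi k *R w (k + t *R b))"
   using ml B by (intro integrable_bounded_scaleR integrable_translate wi)
  have i2: "integrable lebesgue (%k. fi k *R w k)" using ml B by (intro integrable_bounded_scaleR wi)
  have i3: "integrable lebesgue (%k. fi (k - t *R b) *R w k)"
   using ml(1)[of "- (t *R b)"] B by (intro integrable_bounded_scaleR wi) auto
  have "(LINT k|lebesgue. fi k *R w (k + t *R b)) = (LINT k|lebesgue. fi (k - t *R b) *R w k)"
   using integral_translate[OF borel_measurable_integrable[OF i3], of "t *R b"] by simp
  then have "(LINT k|lebesgue. fi k *R w (k + t *R b) - fi k *R w k) = (LINT k|lebesgue. fi (k - t *R b) *R w k - fi k *R w k)"
   using i1 i2 i3 by simp
  then have "(1/t) *R (LINT k|lebesgue. fi k *R w (k + t *R b) - fi k *R w k) = (1/t) *R (LINT k|lebesgue. fi (k - t *R b) *R w k - fi k *R w k)"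
   by simp
  then show ?thesis
   by (subst (asm) (1 2) integral_scaleR_right[symmetric])
    (simp add: q_def scaleR_diff_right scaleR_diff_left right_diff_distrib diff_divide_distrib mult.commute)
 qed
 have "(%n. LINT k|lebesgue. q (1 / real (Suc n)) k *R w k) \<longlonglongrightarrow> (LINT k|lebesgue. - fi' k *R w k)"
 proof (rule integral_dominated_convergence[where w="%k. B * norm (w k)"])
  show "(%k. q (1 / real (Suc n)) k *R w k) : borel_measurable lebesgue" for n
   using ml(3) ml(1)[of "- ((1 / real (Suc n)) *R b)"] wi unfolding q_def by simp
  show "AE x in lebesgue. norm (q (1 / real (Suc n)) x *R w x) <= B * norm (w x)" for n
   using qB[of "1 / real (Suc n)"] by (intro AE_I2) (auto intro: mult_right_mono)
  show "AE x in lebesgue. (%n. q (1 / real (Suc n)) x *R w x) \<longlonglongrightarrow> - fi' x *R w x"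
   by (intro AE_I2 tendsto_scaleR ptw tendsto_const)
 qed (use wi ml in auto)
 then have lim1: "(%n. LINT k|lebesgue. fi k *R ((1 / (1 / real (Suc n))) *R (w (k + (1 / real (Suc n)) *R b) - w k)))
   \<longlonglongrightarrow> (LINT k|lebesgue. - fi' k *R w k)"
  by (subst eq) auto
 have "((%t. LINT k|lebesgue. fi k *R ((1 / t) *R (w (k + t *R b) - w k))) \<longlongrightarrow> (LINT k|lebesgue. fi k *R g k)) (at_right 0)"
 proof (rule tendsto_norm_zero_cancel[THEN Lim_null[THEN iffD2]])
  show "((%t. norm ((LINT k|lebesgue. fi k *R ((1 / t) *R (w (k + t *R b) - w k))) - (LINT k|lebesgue. fi k *R g k))) \<longlongrightarrow> 0) (at_right 0)"
  proof (rule tendsto_sandwich[OF _ _ tendsto_const])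
   show "((%t. B * L1_norm (%k. (1 / t) *R (w (k + t *R b) - w k) - g k)) \<longlongrightarrow> 0) (at_right 0)"
    using w unfolding has_L1_derivative_def by (auto intro: tendsto_mult_right_zero)
   show "\<forall>\<^sub>F t in at_right 0. norm ((LINT k|lebesgue. fi k *R ((1 / t) *R (w (k + t *R b) - w k))) - (LINT k|lebesgue. fi k *R g k))
     <= B * L1_norm (%k. (1 / t) *R (w (k + t *R b) - w k) - g k)"
   proof (intro always_eventually allI)
    fix t
    have j: "integrable lebesgue (%k. (1 / t) *R (w (k + t *R b) - w k))"
     using wi by (intro integrable_scaleR_right Bochner_Integration.integrable_diff integrable_translate)
    have "(LINT k|lebesgue. fi k *R ((1 / t) *R (w (k + t *R b) - w k))) - (LINT k|lebesgue. fi k *R g k)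
      = (LINT k|lebesgue. fi k *R ((1 / t) *R (w (k + t *R b) - w k) - g k))"
     using integrable_bounded_scaleR[OF j ml(3) B(1)] integrable_bounded_scaleR[OF gi ml(3) B(1)]
     by (subst Bochner_Integration.integral_diff[symmetric]) (auto simp: scaleR_diff_right)
    also have "norm ... <= L1_norm (%k. fi k *R ((1 / t) *R (w (k + t *R b) - w k) - g k))"
     by (rule norm_integral_le_L1_norm)
    also have "... <= B * L1_norm (%k. (1 / t) *R (w (k + t *R b) - w k) - g k)"
     using j gi ml(3) B(1) by (intro conjunct2[OF L1_norm_mono]) (auto intro!: AE_I2 mult_right_mono)
    finally show "norm ((LINT k|lebesgue. fi k *R ((1 / t) *R (w (k + t *R b) - w k))) - (LINT k|lebesgue. fi k *R g k))
     <= B * L1_norm (%k. (1 / t) *R (w (k + t *R b) - w k) - g k)" .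
   qed
  qed auto
 qed
 from filterlim_compose[OF this inverse_Suc_at_right] lim1
 have "(LINT k|lebesgue. - fi' k *R w k) = (LINT k|lebesgue. fi k *R g k)"
  using LIMSEQ_unique by blast
 moreover have "vector_derivative (%t. fi (k + t *R b)) (at 0) = fi' k" for k
  using d[of k 0] by (intro vector_derivative_at) simp
 ultimately show ?thesis by (simp add: minus_equation_iff eq_commute)
qed

text \<open>Weak differentiability forces the increment of \<open>w\<close> along \<open>b\<close>
  to be the integral of \<open>g\<close> over the segment, for almost every \<open>k\<close>. The
  difference quotient is thus an average of translates of \<open>g\<close>, and these return to
  \<open>g\<close> in L1.\<close>

lemma has_L1_derivative_weakI:
 fixes w g :: "real^'d => 'v::euclidean_space" and M :: "('d::finite, 'c::finite) wave_model"
 assumes M: "cutoff M" and w: "integrable lebesgue w" and g: "integrable lebesgue g" and b: "b : Basis"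
  and weak: "!!fi. test_function fi ==>
   (LINT k|lebesgue. vector_derivative (%t. fi (k + t *R b)) (at 0) *R w k) = - (LINT k|lebesgue. fi k *R g k)"
 shows "has_L1_derivative w b g"
proof -
 obtain w' where w': "w' : borel_fun" "AE x in lebesgue. w x = w' x"
   "integrable lborel w'" "integrable lebesgue w'"
  by (rule integrable_borel_representative[OF w])
 obtain g' where g': "g' : borel_fun" "AE x in lebesgue. g x = g' x"
   "integrable lborel g'" "integrable lebesgue g'"
  by (rule integrable_borel_representative[OF g])
 note [measurable] = w'(1) g'(1)
 define Q where "Q t k = (LINT s:{0..t}|lebesgue. g' (k + s *R b))" for t k
 have m1: "case_prod (%s k. g' (k + s *R b)) : joint_borel" by measurable
 have bnd1: "integrable lebesgue (%k. g' (k + s *R b)) & L1_norm (%k. g' (k + s *R b)) <= L1_norm g'" for s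
  using g'(4) by (simp add: integrable_translate L1_norm_translate)
 have Qi: "integrable lebesgue (Q t)" if "0 <= t" for t
  unfolding Q_def using bnd1 by (intro time_integral_integrable[OF m1 _ that]) auto
 have repr: "AE k in lebesgue. w (k + t *R b) - w k = Q t k" if t: "0 <= t" for t
 proof -
  let ?D = "%k. w (k + t *R b) - w k - Q t k"
  have Di: "integrable lebesgue ?D" using w Qi[OF t] by (simp add: integrable_translate)
  \<comment> \<open>All shifts are moved onto \<open>ps\<close>. Its increment is the integral of
    its derivative over \<open>{0..t}\<close>, and at each \<open>s\<close> the weak derivative is
    applied with the test function translated by \<open>s *R b\<close>.\<close>
  have "(LINT k|lebesgue. ps k *R ?D k) = 0" if ps: "test_function ps" for ps
  proof -
   obtain ps' B where c: "continuous_on UNIV ps" "continuous_on UNIV ps'"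
    and B: "!!x. \<bar>ps x\<bar> <= B" "!!x. \<bar>ps' x\<bar> <= B"
    and d: "!!x t. ((%t. ps (x + t *R b)) has_vd ps' (x + t *R b)) (at t)"
    using test_function_derivative[OF ps b] by (elim exE conjE) blast
   have m[measurable]: "ps : borel_fun" "ps' : borel_fun"
    using c by (auto intro: borel_measurable_continuous_onI)
   have ml: "(%k. ps (k + a)) : borel_measurable lebesgue" "(%k. ps' (k + a)) : borel_measurable lebesgue"
    "ps : borel_measurable lebesgue" for a
    by (intro measurable_completion; measurable)+
   have i1: "integrable lebesgue (%k. ps k *R w (k + t *R b))"
    using ml B by (intro integrable_bounded_scaleR integrable_translate w)
   have i2: "integrable lebesgue (%k. ps k *R w k)" using ml B by (intro integrable_bounded_scaleR w)
   have i3: "integrable lebesgue (%k. ps (k - t *R b) *R w k)"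
    using ml(1)[of "- (t *R b)"] B by (intro integrable_bounded_scaleR w) auto
   have i4: "integrable lebesgue (%k. ps k *R Q t k)"
    using ml B by (intro integrable_bounded_scaleR Qi t)
   have ftc: "(ps (k - t *R b) - ps k) *R w' k = (LINT s:{0..t}|lebesgue. (- ps' (k - s *R b)) *R w' k)" for k
   proof -
    have "has_bochner_integral lborel (%s. indicator {0..t} s *R (- ps' (k - s *R b))) (ps (k - t *R b) - ps (k - 0 *R b))"
    proof (rule has_bochner_integral_FTC_Icc[OF t])
     fix x
     have 1: "((%s. - s) has_vd -1) (at x)"
      by (auto intro!: derivative_eq_intros simp: has_vector_derivative_def)
     have "((%s. ps (k + s *R b)) has_vd ps' (k + (- x) *R b)) (at ((%s. - s) x))"
      using d[of k "- x"] by simp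
     from vector_diff_chain_at[OF 1 this]
     show "((%s. ps (k - s *R b)) has_vd - ps' (k - x *R b)) (at x within {0..t})"
      by (simp add: o_def has_vector_derivative_at_within)
    next
     show "continuous_on {0..t} (%s. - ps' (k - s *R b))"
      by (intro continuous_intros continuous_on_compose2[OF c(2)]) auto
    qed
    then have "ps (k - t *R b) - ps k = (LINT s|lborel. indicator {0..t} s *R (- ps' (k - s *R b)))"
     and "integrable lborel (%s. indicator {0..t} s *R (- ps' (k - s *R b)))"
     by (simp_all add: has_bochner_integral_iff)
    then have "(ps (k - t *R b) - ps k) *R w' k = (LINT s|lborel. (indicator {0..t} s *R (- ps' (k - s *R b))) *R w' k)"
     by (subst integral_scaleR_left) auto
    also have "... = (LINT s:{0..t}|lebesgue. (- ps' (k - s *R b)) *R w' k)"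
     by (subst set_integral_lebesgue_lborel) auto
    finally show ?thesis .
   qed
   have m2: "case_prod (%s k. (- ps' (k - s *R b)) *R w' k) : joint_borel" by measurable
   have bnd2: "integrable lebesgue (%k. (- ps' (k - s *R b)) *R w' k) & L1_norm (%k. (- ps' (k - s *R b)) *R w' k) <= B * L1_norm w'" for s
    using B ml(2)[of "- (s *R b)"] w'(4) by (intro L1_norm_mono) (auto intro!: AE_I2 mult_right_mono)
   have m3: "case_prod (%s k. ps k *R g' (k + s *R b)) : joint_borel" by measurable
   have bnd3: "integrable lebesgue (%k. ps k *R g' (k + s *R b)) & L1_norm (%k. ps k *R g' (k + s *R b)) <= B * L1_norm g'" for s
   proof -
    have "integrable lebesgue (%k. ps k *R g' (k + s *R b)) & L1_norm (%k. ps k *R g' (k + s *R b)) <= B * L1_norm (%k. g' (k + s *R b))"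
     using B ml bnd1[of s] by (intro L1_norm_mono) (auto intro!: AE_I2 mult_right_mono)
    then show ?thesis using g'(4) by (simp add: L1_norm_translate)
   qed
   have inner: "(LINT k|lebesgue. (- ps' (k - s *R b)) *R w' k) = (LINT k|lebesgue. ps k *R g' (k + s *R b))" for s
   proof -
    have tf: "test_function (%k. ps (k - s *R b))" using test_function_affine[OF ps, of 1 "s *R b"] by simp
    have vd: "vector_derivative (%t. ps (k + t *R b - s *R b)) (at 0) = ps' (k - s *R b)" for k
    proof (rule vector_derivative_at)
     show "((%t. ps (k + t *R b - s *R b)) has_vd ps' (k - s *R b)) (at 0)"
      using d[of "k - s *R b" 0] by (simp add: algebra_simps)
    qed
    have "(LINT k|lebesgue. (- ps' (k - s *R b)) *R w' k) = (LINT k|lebesgue. (- ps' (k - s *R b)) *R w k)"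
     using w'(2) ml(2)[of "- (s *R b)"] w w'(4) by (intro integral_cong_AE) (auto elim: eventually_mono)
    also have "... = - (LINT k|lebesgue. ps' (k - s *R b) *R w k)" by simp
    also have "... = (LINT k|lebesgue. ps (k - s *R b) *R g k)"
     using weak[OF tf] by (simp add: vd)
    also have "... = (LINT k|lebesgue. ps (k - s *R b) *R g' k)"
     using g'(2) ml(1)[of "- (s *R b)"] g g'(4) by (intro integral_cong_AE) (auto elim: eventually_mono)
    also have "... = (LINT k|lebesgue. ps k *R g' (k + s *R b))"
    proof -
     have "(%k. ps (k - s *R b) *R g' k) : borel_measurable lebesgue"
      by (intro measurable_completion) measurable
     from integral_translate[OF this, of "s *R b"] show ?thesis by simp
    qed
    finally show ?thesis .
   qed
   have "(LINT k|lebesgue. ps k *R w (k + t *R b)) = (LINT k|lebesgue. ps (k - t *R b) *R w k)"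
    using integral_translate[OF borel_measurable_integrable[OF i3], of "t *R b"] by simp
   then have "(LINT k|lebesgue. ps k *R w (k + t *R b)) - (LINT k|lebesgue. ps k *R w k)
     = (LINT k|lebesgue. (ps (k - t *R b) - ps k) *R w k)"
    using i3 i2 by (simp add: scaleR_diff_left)
   also have "... = (LINT k|lebesgue. (ps (k - t *R b) - ps k) *R w' k)"
    using w'(2) ml(1)[of "- (t *R b)"] ml(3) w w'(4) by (intro integral_cong_AE) (auto elim: eventually_mono)
   also have "... = (LINT s:{0..t}|lebesgue. (LINT k|lebesgue. (- ps' (k - s *R b)) *R w' k))"
    unfolding ftc using bnd2 by (intro time_integral_swap[OF m2 _ t]) auto
   also have "... = (LINT s:{0..t}|lebesgue. (LINT k|lebesgue. ps k *R g' (k + s *R b)))"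
    unfolding inner ..
   also have "... = (LINT k|lebesgue. (LINT s:{0..t}|lebesgue. ps k *R g' (k + s *R b)))"
    using bnd3 by (intro time_integral_swap[OF m3 _ t, symmetric]) auto
   also have "... = (LINT k|lebesgue. ps k *R Q t k)"
   proof -
    have "(LINT s:{0..t}|lebesgue. ps k *R g' (k + s *R b)) = ps k *R Q t k" for k
     unfolding Q_def set_lebesgue_integral_def
     by (subst integral_scaleR_right[symmetric]) (simp add: mult.commute)
    then show ?thesis by (simp only:)
   qed
   finally show ?thesis using i1 i2 i4 by (simp add: scaleR_diff_right)
  qed
  then have "AE k in lebesgue. ?D k = 0" by (rule fundamental_lemma[OF M Di])
  then show ?thesis by eventually_elim simp
 qed
 have "((%t. L1_norm (%k. (1 / t) *R (w (k + t *R b) - w k) - g k)) \<longlongrightarrow> 0) (at_right 0)"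
 proof (rule tendstoI)
  fix e :: real assume "0 < e"
  then have e2: "0 < e/2" by simp
  have "\<forall>\<^sub>F a in at 0. L1_norm (%k. g' (k + a) - g' k) < e/2"
   by (rule order_tendstoD(2)[OF L1_translation_continuous[OF g'(4)] e2])
  then obtain r where r: "0 < r" "!!a. a ~= 0 ==> norm a < r ==> L1_norm (%k. g' (k + a) - g' k) < e/2"
   unfolding eventually_at dist_norm by auto
  have r': "L1_norm (%k. g' (k + a) - g' k) <= e/2" if "norm a < r" for a
   using r(2)[of a] that e2 by (cases "a = 0") (auto simp: L1_norm_def)
  have "dist (L1_norm (%k. (1 / t) *R (w (k + t *R b) - w k) - g k)) 0 < e" if t: "0 < t" "t < r" for t
  proof -
   have m4: "case_prod (%s k. g' (k + s *R b) - g' k) : joint_borel" by measurable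
   have bnd4: "integrable lebesgue (%k. g' (k + s *R b) - g' k) & L1_norm (%k. g' (k + s *R b) - g' k) <= e/2"
    if "s : {0..t}" for s
    using r'[of "s *R b"] that t b g'(4) by (auto simp: integrable_translate)
   have ae: "AE k in lebesgue. set_integrable lebesgue {0..t} (%s. g' (k + s *R b))"
    by (rule time_integral_AE_integrable[OF m1]) (rule bnd1)
   \<comment> \<open>Subtracting \<open>g' k\<close> inside the average leaves the mean of the
     translation increments of \<open>g'\<close>, each at most \<open>e/2\<close> in L1.\<close>
   have "AE k in lebesgue. (1/t) *R (w (k + t *R b) - w k) - g k = (1/t) *R (LINT s:{0..t}|lebesgue. g' (k + s *R b) - g' k)"
    using repr[of t, OF less_imp_le[OF t(1)]] g'(2) ae
   proof eventually_elim
    case (elim k)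
    have c: "set_integrable lebesgue {0..t} (%s. g' k)"
     unfolding set_integrable_def by (intro integrable_scaleR_left integrable_real_indicator) (auto simp: emeasure_lborel_Icc_eq)
    have "(LINT s:{0..t}|lebesgue. g' k) = t *R g' k"
     using t(1) unfolding set_lebesgue_integral_def
     by (subst integral_scaleR_left) (auto intro!: integrable_real_indicator simp: emeasure_lborel_Icc_eq)
    then have "(LINT s:{0..t}|lebesgue. g' (k + s *R b) - g' k) = Q t k - t *R g' k"
     using set_integral_diff(2)[OF _ c, of "%s. g' (k + s *R b)"] elim(3) by (simp add: Q_def)
    then show ?case using elim(1,2) t(1) by (simp add: scaleR_diff_right)
   qed
   then have "L1_norm (%k. (1 / t) *R (w (k + t *R b) - w k) - g k) = L1_norm (%k. (1/t) *R (LINT s:{0..t}|lebesgue. g' (k + s *R b) - g' k))"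
    using w g by (intro L1_norm_cong_AE) (auto simp: integrable_translate intro!: borel_measurable_integrable)
   also have "... = (1/t) * L1_norm (%k. (LINT s:{0..t}|lebesgue. g' (k + s *R b) - g' k))"
    using t(1) by (simp add: L1_norm_scaleR)
   also have "... <= (1/t) * (t * (e/2))"
    using t(1) bnd4 by (intro mult_left_mono time_integral_norm[OF m4]) auto
   finally show ?thesis using t(1) \<open>0 < e\<close> by simp
  qed
  then show "\<forall>\<^sub>F t in at_right 0. dist (L1_norm (%k. (1 / t) *R (w (k + t *R b) - w k) - g k)) 0 < e"
   unfolding eventually_at_right_field using r(1) by blast
 qed
 then show ?thesis using w g by (simp add: has_L1_derivative_def)
qed

lemma has_L1_derivative_unique:
 fixes w g h :: "real^'d => 'v::euclidean_space"
 assumes "has_L1_derivative w b g" "has_L1_derivative w b h"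
 shows "AE k in lebesgue. g k = h k"
proof -
 have i: "integrable lebesgue w" "integrable lebesgue g" "integrable lebesgue h"
  using assms by (auto simp: has_L1_derivative_def)
 let ?q = "%t k. (1 / t) *R (w (k + t *R b) - w k)"
 have qi: "integrable lebesgue (?q t)" for t using i by (simp add: integrable_translate)
 have "((%t. L1_norm (%k. ?q t k - g k) + L1_norm (%k. ?q t k - h k)) \<longlongrightarrow> 0) (at_right 0)"
  using assms unfolding has_L1_derivative_def by (auto intro: tendsto_add_zero)
 moreover have "\<forall>\<^sub>F t in at_right 0. L1_norm (%k. g k - h k) <= L1_norm (%k. ?q t k - g k) + L1_norm (%k. ?q t k - h k)"
  using L1_norm_diff_triangle[OF i(2) qi i(3)] by (simp add: L1_norm_minus_commute[of g])
 ultimately have "L1_norm (%k. g k - h k) <= 0"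
  by (intro tendsto_lowerbound[of _ 0 "at_right 0"]) auto
 then have "AE k in lebesgue. g k - h k = 0" using i by (intro L1_norm_eq_0) auto
 then show ?thesis by eventually_elim simp
qed

lemma integrable_vec_nth:
 "integrable lebesgue (G :: real^'d => complex^'c^'d) ==> integrable lebesgue (%k. G k $ i)"
 by (rule integrable_bounded_linear[OF bounded_linear_vec_nth])

lemma axis_one_Basis: "axis i 1 : (Basis :: (real^'d) set)"
 by simp

lemma has_weak_gradient_iff:
 fixes M :: "('d::finite, 'c::finite) wave_model" and w :: "real^'d => complex^'e::finite"
 assumes "cutoff M"
 shows "has_weak_gradient w G \<longleftrightarrow> integrable lebesgue w & integrable lebesgue G &
  (ALL i. has_L1_derivative w (axis i 1) (%k. G k $ i))"
proof
 assume w: "has_weak_gradient w G"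
 have "has_L1_derivative w (axis i 1) (%k. G k $ i)" for i
  using w unfolding has_weak_gradient_def
  by (intro has_L1_derivative_weakI[OF assms] integrable_vec_nth axis_one_Basis) auto
 then show "integrable lebesgue w & integrable lebesgue G & (ALL i. has_L1_derivative w (axis i 1) (%k. G k $ i))"
  using w by (auto simp: has_weak_gradient_def)
next
 assume "integrable lebesgue w & integrable lebesgue G & (ALL i. has_L1_derivative w (axis i 1) (%k. G k $ i))"
 then show "has_weak_gradient w G"
  unfolding has_weak_gradient_def by (intro conjI allI impI has_L1_derivative_weak axis_one_Basis) auto
qed

text \<open>\<open>weak_gradient\<close> is a choice among all weak gradients; uniqueness makes its
  L1 norm that of any gradient exhibited by hand.\<close>

lemma has_weak_gradient_unique:
 fixes M :: "('d::finite, 'c::finite) wave_model" and w :: "real^'d => complex^'e::finite"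
 assumes "cutoff M" "has_weak_gradient w G" "has_weak_gradient w H"
 shows "AE k in lebesgue. G k = H k"
proof -
 have "AE k in lebesgue. ALL i. G k $ i = H k $ i"
  using assms(2,3) unfolding has_weak_gradient_iff[OF assms(1)]
  by (subst AE_all_countable) (auto intro: has_L1_derivative_unique)
 then show ?thesis by (simp add: vec_eq_iff)
qed

lemma has_weak_gradient_weak_gradient: "has_weak_gradient w G ==> has_weak_gradient w (weak_gradient w)"
 unfolding weak_gradient_def by (rule someI[of "has_weak_gradient w"])

lemma weak_gradient_AE:
 fixes M :: "('d::finite, 'c::finite) wave_model" and w :: "real^'d => complex^'e::finite"
 assumes "cutoff M" "has_weak_gradient w G"
 shows "AE k in lebesgue. weak_gradient w k = G k"
 using has_weak_gradient_unique[OF assms(1) has_weak_gradient_weak_gradient[OF assms(2)] assms(2)] .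

lemma has_weak_gradient_cong:
 assumes w: "has_weak_gradient w G" and "AE k in lebesgue. w k = w' k" "AE k in lebesgue. G k = G' k"
 shows "has_weak_gradient w' G'"
proof -
 have i: "integrable lebesgue w" "integrable lebesgue G" "integrable lebesgue w'" "integrable lebesgue G'"
  using assms integrable_lebesgue_AE by (auto simp: has_weak_gradient_def)
 show ?thesis unfolding has_weak_gradient_def
 proof (intro conjI allI impI)
  fix fi :: "real^'a => real" and i
  assume fi: "test_function fi"
  obtain fi' B where c: "continuous_on UNIV fi'"
   and d: "!!x t. ((%t. fi (x + t *R axis i 1)) has_vd fi' (x + t *R axis i 1)) (at t)"
   using test_function_derivative[OF fi axis_one_Basis[of i]] by (elim exE conjE) blast
  have vd: "vector_derivative (%t. fi (k + t *R axis i 1)) (at 0) = fi' k" for k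
   using d[of k 0] by (intro vector_derivative_at) simp
  have ml: "fi : borel_measurable lebesgue" "fi' : borel_measurable lebesgue"
   using test_function_measurable[OF fi] c by (auto intro!: measurable_completion borel_measurable_continuous_onI)
  have "(LINT k|lebesgue. fi' k *R w k) = (LINT k|lebesgue. fi' k *R w' k)"
   using assms(2) ml i by (intro integral_cong_AE) (auto elim: eventually_mono)
  moreover have "(LINT k|lebesgue. fi k *R (G k $ i)) = (LINT k|lebesgue. fi k *R (G' k $ i))"
   using assms(3) ml i(2,4)[THEN integrable_vec_nth, of i]
   by (intro integral_cong_AE borel_measurable_scaleR) (auto elim: eventually_mono)
  moreover have "(LINT k|lebesgue. fi' k *R w k) = - (LINT k|lebesgue. fi k *R (G k $ i))"
   using w fi unfolding has_weak_gradient_def vd[symmetric] by blast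
  ultimately show "(LINT k|lebesgue. vector_derivative (%t. fi (k + t *R axis i 1)) (at 0) *R w' k) = - (LINT k|lebesgue. fi k *R (G' k $ i))"
   by (simp add: vd)
 qed (use i in auto)
qed

lemma has_weak_gradient_lincomb:
 assumes v: "has_weak_gradient v G" and w: "has_weak_gradient w H"
 shows "has_weak_gradient (%k. a *R v k + b *R w k) (%k. a *R G k + b *R H k)"
proof -
 have i: "integrable lebesgue v" "integrable lebesgue G" "integrable lebesgue w" "integrable lebesgue H"
  using assms by (auto simp: has_weak_gradient_def)
 show ?thesis unfolding has_weak_gradient_def
 proof (intro conjI allI impI)
  fix fi :: "real^'a => real" and i
  assume fi: "test_function fi"
  obtain fi' B where c: "continuous_on UNIV fi'" and B: "!!x. \<bar>fi x\<bar> <= B" "!!x. \<bar>fi' x\<bar> <= B"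
   and d: "!!x t. ((%t. fi (x + t *R axis i 1)) has_vd fi' (x + t *R axis i 1)) (at t)"
   using test_function_derivative[OF fi axis_one_Basis[of i]] by (elim exE conjE) blast
  have vd: "vector_derivative (%t. fi (k + t *R axis i 1)) (at 0) = fi' k" for k
   using d[of k 0] by (intro vector_derivative_at) simp
  have ml: "fi : borel_measurable lebesgue" "fi' : borel_measurable lebesgue"
   using test_function_measurable[OF fi] c by (auto intro!: measurable_completion borel_measurable_continuous_onI)
  have j: "integrable lebesgue (%k. fi' k *R v k)" "integrable lebesgue (%k. fi' k *R w k)"
   "integrable lebesgue (%k. fi k *R (G k $ i))" "integrable lebesgue (%k. fi k *R (H k $ i))"
   using B ml i by (auto intro!: integrable_bounded_scaleR integrable_vec_nth)
  have "(LINT k|lebesgue. fi' k *R v k) = - (LINT k|lebesgue. fi k *R (G k $ i))"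
   "(LINT k|lebesgue. fi' k *R w k) = - (LINT k|lebesgue. fi k *R (H k $ i))"
   using v w fi unfolding has_weak_gradient_def vd[symmetric] by blast+
  then show "(LINT k|lebesgue. vector_derivative (%t. fi (k + t *R axis i 1)) (at 0) *R (a *R v k + b *R w k))
    = - (LINT k|lebesgue. fi k *R ((a *R G k + b *R H k) $ i))"
  proof -
   have e: "fi' k *R (a *R v k + b *R w k) = a *R (fi' k *R v k) + b *R (fi' k *R w k)"
    "fi k *R ((a *R G k + b *R H k) $ i) = a *R (fi k *R (G k $ i)) + b *R (fi k *R (H k $ i))" for k
    by (simp_all add: scaleR_add_right mult.commute)
   have i1: "(LINT k|lebesgue. a *R (fi' k *R v k) + b *R (fi' k *R w k))
     = a *R (LINT k|lebesgue. fi' k *R v k) + b *R (LINT k|lebesgue. fi' k *R w k)"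
    by (subst Bochner_Integration.integral_add) (use j in \<open>auto simp only: integral_scaleR_right integrable_scaleR_right\<close>)
   have i2: "(LINT k|lebesgue. a *R (fi k *R (G k $ i)) + b *R (fi k *R (H k $ i)))
     = a *R (LINT k|lebesgue. fi k *R (G k $ i)) + b *R (LINT k|lebesgue. fi k *R (H k $ i))"
    by (subst Bochner_Integration.integral_add) (use j in \<open>auto simp only: integral_scaleR_right integrable_scaleR_right\<close>)
   show ?thesis unfolding e vd i1 i2 \<open>(LINT k|lebesgue. fi' k *R v k) = _\<close> \<open>(LINT k|lebesgue. fi' k *R w k) = _\<close> by simp
  qed
 qed (use i in auto)
qed

lemma tendsto_integral_bounded_scaleR:
 fixes w :: "nat => real^'d => 'v::euclidean_space"
 assumes "!!n. integrable lebesgue (w n)" "integrable lebesgue u" "(%n. L1_norm (%k. w n k - u k)) \<longlonglongrightarrow> 0"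
  and "ps : borel_measurable lebesgue" "!!x. \<bar>ps x\<bar> <= B"
 shows "(%n. LINT k|lebesgue. ps k *R w n k) \<longlonglongrightarrow> (LINT k|lebesgue. ps k *R u k)"
proof (rule LIM_zero_cancel, rule tendsto_norm_zero_cancel, rule tendsto_sandwich[OF _ _ tendsto_const])
 show "(%n. B * L1_norm (%k. w n k - u k)) \<longlonglongrightarrow> 0" using assms(3) by (rule tendsto_mult_right_zero)
 show "\<forall>\<^sub>F n in sequentially. norm ((LINT k|lebesgue. ps k *R w n k) - (LINT k|lebesgue. ps k *R u k)) <= B * L1_norm (%k. w n k - u k)"
 proof (intro always_eventually allI)
  fix n
  have "(LINT k|lebesgue. ps k *R w n k) - (LINT k|lebesgue. ps k *R u k) = (LINT k|lebesgue. ps k *R (w n k - u k))"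
   using integrable_bounded_scaleR[OF assms(1) assms(4,5)] integrable_bounded_scaleR[OF assms(2) assms(4,5)]
   by (simp add: scaleR_diff_right)
  also have "norm ... <= L1_norm (%k. ps k *R (w n k - u k))" by (rule norm_integral_le_L1_norm)
  also have "... <= B * L1_norm (%k. w n k - u k)"
   using assms by (intro conjunct2[OF L1_norm_mono]) (auto intro!: AE_I2 mult_right_mono)
  finally show "norm ((LINT k|lebesgue. ps k *R w n k) - (LINT k|lebesgue. ps k *R u k)) <= B * L1_norm (%k. w n k - u k)" .
 qed
qed auto

text \<open>Both sides of the defining identity are continuous in L1. This closedness is what makes
  the E1 spaces complete.\<close>

lemma has_weak_gradient_limit:
 assumes w: "!!n. has_weak_gradient (w n) (G n)" and i: "integrable lebesgue u" "integrable lebesgue H"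
  and l: "(%n. L1_norm (%k. w n k - u k)) \<longlonglongrightarrow> 0" "(%n. L1_norm (%k. G n k - H k)) \<longlonglongrightarrow> 0"
 shows "has_weak_gradient u H"
 unfolding has_weak_gradient_def
proof (intro conjI allI impI)
 fix fi :: "real^'a => real" and i
 assume fi: "test_function fi"
 obtain fi' B where c: "continuous_on UNIV fi'" and B: "!!x. \<bar>fi x\<bar> <= B" "!!x. \<bar>fi' x\<bar> <= B"
  and d: "!!x t. ((%t. fi (x + t *R axis i 1)) has_vd fi' (x + t *R axis i 1)) (at t)"
  using test_function_derivative[OF fi axis_one_Basis[of i]] by (elim exE conjE) blast
 have vd: "vector_derivative (%t. fi (k + t *R axis i 1)) (at 0) = fi' k" for k
  using d[of k 0] by (intro vector_derivative_at) simp
 have ml: "fi : borel_measurable lebesgue" "fi' : borel_measurable lebesgue"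
  using test_function_measurable[OF fi] c by (auto intro!: measurable_completion borel_measurable_continuous_onI)
 have wi: "integrable lebesgue (w n)" "integrable lebesgue (G n)" for n using w by (auto simp: has_weak_gradient_def)
 have "(%n. L1_norm (%k. G n k $ i - H k $ i)) \<longlonglongrightarrow> 0"
 proof (rule tendsto_sandwich[OF _ _ tendsto_const l(2)])
  show "\<forall>\<^sub>F n in sequentially. L1_norm (%k. G n k $ i - H k $ i) <= L1_norm (%k. G n k - H k)"
  proof (intro always_eventually allI)
   fix n
   have "L1_norm (%k. G n k $ i - H k $ i) <= 1 * L1_norm (%k. G n k - H k)"
    using wi i Finite_Cartesian_Product.norm_nth_le[of "G n k - H k" i for k]
    by (intro conjunct2[OF L1_norm_mono]) (auto intro!: integrable_vec_nth borel_measurable_diff borel_measurable_integrable)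
   then show "L1_norm (%k. G n k $ i - H k $ i) <= L1_norm (%k. G n k - H k)" by simp
  qed
 qed auto
 then have "(%n. LINT k|lebesgue. fi k *R (G n k $ i)) \<longlonglongrightarrow> (LINT k|lebesgue. fi k *R (H k $ i))"
  using wi i ml B by (intro tendsto_integral_bounded_scaleR integrable_vec_nth) auto
 then have "(%n. - (LINT k|lebesgue. fi k *R (G n k $ i))) \<longlonglongrightarrow> - (LINT k|lebesgue. fi k *R (H k $ i))"
  by (rule tendsto_minus)
 moreover have "- (LINT k|lebesgue. fi k *R (G n k $ i)) = (LINT k|lebesgue. fi' k *R w n k)" for n
 proof -
  have "(LINT k|lebesgue. fi' k *R w n k) = - (LINT k|lebesgue. fi k *R (G n k $ i))"
   using w[of n] fi unfolding has_weak_gradient_def vd[symmetric] by blast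
  then show ?thesis by simp
 qed
 moreover have "(%n. LINT k|lebesgue. fi' k *R w n k) \<longlonglongrightarrow> (LINT k|lebesgue. fi' k *R u k)"
  using wi i l(1) ml B by (intro tendsto_integral_bounded_scaleR) auto
 ultimately show "(LINT k|lebesgue. vector_derivative (%t. fi (k + t *R axis i 1)) (at 0) *R u k) = - (LINT k|lebesgue. fi k *R (H k $ i))"
  unfolding vd using LIMSEQ_unique by simp
qed (use i in auto)

section \<open>The space E of L1-continuous fields\<close>

lemma in_E_integrable: "in_E T u ==> ta : {0..T} ==> integrable lebesgue (u ta)"
 by (simp add: in_E_def)

text \<open>The L1 distance as a function of two times stands in for a Banach-space valued curve:
  its continuity on a compact square gives both uniform continuity and boundedness of
  \<open>u\<close>.\<close>

lemma in_E_continuous_on_L1_diff: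
 fixes u :: "real => real^'d => 'v::euclidean_space"
 assumes u: "in_E T u"
 shows "continuous_on ({0..T} \<times> {0..T}) (%(ta, sg). L1_norm (%k. u ta k - u sg k))"
 unfolding continuous_on_def
proof
 fix x assume x: "x : {0..T} \<times> {0..T}"
 obtain a b where ab: "x = (a, b)" "a : {0..T}" "b : {0..T}" using x by auto
 let ?D = "%ta sg. L1_norm (%k. u ta k - u sg k)"
 note i = in_E_integrable[OF u]
 have f: "((%y. ?D (fst y) a) \<longlongrightarrow> 0) (at x within {0..T} \<times> {0..T})"
 proof -
  have "((%ta. ?D ta a) \<longlongrightarrow> 0) (at a within {0..T})" using u ab by (simp add: in_E_def)
  then have "continuous (at a within {0..T}) (%ta. ?D ta a)"
   by (simp add: continuous_within L1_norm_def)
  then have "continuous (at x within {0..T} \<times> {0..T}) ((%ta. ?D ta a) \<circ> fst)"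
   by (intro continuous_within_compose continuous_intros) (auto simp: ab intro: continuous_within_subset)
  then show ?thesis by (simp add: continuous_within ab o_def L1_norm_def)
 qed
 have g: "((%y. ?D (snd y) b) \<longlongrightarrow> 0) (at x within {0..T} \<times> {0..T})"
 proof -
  have "((%ta. ?D ta b) \<longlongrightarrow> 0) (at b within {0..T})" using u ab by (simp add: in_E_def)
  then have "continuous (at b within {0..T}) (%ta. ?D ta b)"
   by (simp add: continuous_within L1_norm_def)
  then have "continuous (at x within {0..T} \<times> {0..T}) ((%ta. ?D ta b) \<circ> snd)"
   by (intro continuous_within_compose continuous_intros) (auto simp: ab intro: continuous_within_subset)
  then show ?thesis by (simp add: continuous_within ab o_def L1_norm_def)
 qed
 have "((%y. ?D (fst y) (snd y) - ?D a b) \<longlongrightarrow> 0) (at x within {0..T} \<times> {0..T})"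
 proof (rule tendsto_rabs_zero_cancel, rule tendsto_sandwich[OF _ _ tendsto_const])
  show "((%y. ?D (fst y) a + ?D (snd y) b) \<longlongrightarrow> 0) (at x within {0..T} \<times> {0..T})"
   using tendsto_add[OF f g] by simp
  show "\<forall>\<^sub>F y in at x within {0..T} \<times> {0..T}. \<bar>?D (fst y) (snd y) - ?D a b\<bar> <= ?D (fst y) a + ?D (snd y) b"
   unfolding eventually_at_filter
  proof (intro always_eventually allI impI)
   fix y assume "y ~= x" "y : {0..T} \<times> {0..T}"
   then have y: "fst y : {0..T}" "snd y : {0..T}" by auto
   have "?D (fst y) (snd y) <= ?D (fst y) a + ?D a (snd y)" "?D a (snd y) <= ?D a b + ?D b (snd y)"
    "?D a b <= ?D a (fst y) + ?D (fst y) b" "?D (fst y) b <= ?D (fst y) (snd y) + ?D (snd y) b"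
    using i y ab by (auto intro!: L1_norm_diff_triangle)
   moreover have "?D b (snd y) = ?D (snd y) b" "?D a (fst y) = ?D (fst y) a" by (rule L1_norm_minus_commute)+
   ultimately show "\<bar>?D (fst y) (snd y) - ?D a b\<bar> <= ?D (fst y) a + ?D (snd y) b" by linarith
  qed
 qed auto
 then show "((%(ta, sg). ?D ta sg) \<longlongrightarrow> (case x of (ta, sg) => ?D ta sg)) (at x within {0..T} \<times> {0..T})"
  by (simp add: ab LIM_zero_iff case_prod_beta')
qed

lemma in_E_uniformly_continuous:
 fixes u :: "real => real^'d => 'v::euclidean_space"
 assumes u: "in_E T u" and "0 < e"
 shows "EX d>0. ALL ta:{0..T}. ALL sg:{0..T}. \<bar>ta - sg\<bar> < d --> L1_norm (%k. u ta k - u sg k) < e"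
proof -
 have "uniformly_continuous_on ({0..T} \<times> {0..T}) (%(ta, sg). L1_norm (%k. u ta k - u sg k))"
  by (intro compact_uniformly_continuous in_E_continuous_on_L1_diff u compact_Times compact_Icc)
 then obtain d where d: "d > 0" "!!x y. x : {0..T} \<times> {0..T} ==> y : {0..T} \<times> {0..T} ==> dist y x < d ==>
   dist (case y of (ta, sg) => L1_norm (%k. u ta k - u sg k)) (case x of (ta, sg) => L1_norm (%k. u ta k - u sg k)) < e"
  using \<open>0 < e\<close> unfolding uniformly_continuous_on_def by blast
 have "L1_norm (%k. u ta k - u sg k) < e" if "ta : {0..T}" "sg : {0..T}" "\<bar>ta - sg\<bar> < d" for ta sg
  using d(2)[of "(sg, sg)" "(ta, sg)"] that by (simp add: dist_Pair_Pair dist_real_def L1_norm_def)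
 then show ?thesis using d(1) by blast
qed

lemma in_E_bdd_above:
 fixes u :: "real => real^'d => 'v::euclidean_space"
 assumes u: "in_E T u"
 shows "bdd_above ((%ta. L1_norm (u ta)) ` {0..T})"
proof (cases "0 <= T")
 case True
 have "bounded ((%(ta, sg). L1_norm (%k. u ta k - u sg k)) ` ({0..T} \<times> {0..T}))"
  by (intro compact_imp_bounded compact_continuous_image in_E_continuous_on_L1_diff u compact_Times compact_Icc)
 then obtain B where B: "!!ta. ta : {0..T} ==> L1_norm (%k. u ta k - u 0 k) <= B"
  unfolding bounded_iff using True by fastforce
 have "L1_norm (u ta) <= L1_norm (u 0) + B" if "ta : {0..T}" for ta
  using L1_norm_le_diff[OF in_E_integrable[OF u that] in_E_integrable[OF u], of 0] B[OF that] True by simp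
 then show ?thesis by (intro bdd_aboveI2)
qed simp

lemma L1_norm_le_E_norm:
 fixes u :: "real => real^'d => 'v::euclidean_space"
 shows "in_E T u ==> ta : {0..T} ==> L1_norm (u ta) <= E_norm T u"
 unfolding E_norm_def by (rule cSUP_upper[OF _ in_E_bdd_above])

lemma E_norm_le:
 assumes "0 <= T" "!!ta. ta : {0..T} ==> L1_norm (u ta) <= C"
 shows "E_norm T u <= C"
 unfolding E_norm_def using assms by (intro cSUP_least) auto

lemma E_norm_nonneg:
 fixes u :: "real => real^'d => 'v::euclidean_space"
 shows "in_E T u ==> 0 <= T ==> 0 <= E_norm T u"
 by (rule order_trans[OF L1_norm_nonneg L1_norm_le_E_norm[of T u 0]]) auto

lemma in_E_cong:
 fixes u v :: "real => real^'d => 'v::euclidean_space"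
 assumes u: "in_E T u" and eq: "!!ta. ta : {0..T} ==> AE k in lebesgue. u ta k = v ta k"
 shows "in_E T v" and "E_norm T v = E_norm T u"
proof -
 have v: "integrable lebesgue (v ta)" if "ta : {0..T}" for ta
  using integrable_lebesgue_AE[OF in_E_integrable[OF u that] eq[OF that]] .
 have d: "L1_norm (%k. v ta k - v sg k) = L1_norm (%k. u ta k - u sg k)" if "ta : {0..T}" "sg : {0..T}" for ta sg
 proof (rule L1_norm_cong_AE[symmetric])
  show "AE k in lebesgue. u ta k - u sg k = v ta k - v sg k"
   using eq[OF that(1)] eq[OF that(2)] by eventually_elim simp
 qed (use in_E_integrable[OF u] that in auto)
 show "in_E T v" unfolding in_E_def
 proof (intro conjI ballI)
  fix sg assume sg: "sg : {0..T}"
  have "((%ta. L1_norm (%k. u ta k - u sg k)) \<longlongrightarrow> 0) (at sg within {0..T})"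
   using u sg by (simp add: in_E_def)
  then show "((%ta. L1_norm (%k. v ta k - v sg k)) \<longlongrightarrow> 0) (at sg within {0..T})"
   by (rule Lim_transform_eventually) (use d sg in \<open>auto simp: eventually_at_filter\<close>)
 qed (use v in auto)
 show "E_norm T v = E_norm T u" unfolding E_norm_def
  by (intro SUP_cong refl L1_norm_cong_AE[symmetric] eq borel_measurable_integrable in_E_integrable[OF u])
qed

lemma in_E_lincomb:
 fixes u v :: "real => real^'d => 'v::euclidean_space"
 assumes u: "in_E T u" and v: "in_E T v"
 shows "in_E T (%ta k. a *R u ta k + b *R v ta k)"
 unfolding in_E_def
proof (intro conjI ballI)
 fix sg assume sg: "sg : {0..T}"
 show "((%ta. L1_norm (%k. a *R u ta k + b *R v ta k - (a *R u sg k + b *R v sg k))) \<longlongrightarrow> 0) (at sg within {0..T})"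
 proof (rule tendsto_sandwich[OF _ _ tendsto_const])
  have "((%ta. \<bar>a\<bar> * L1_norm (%k. u ta k - u sg k) + \<bar>b\<bar> * L1_norm (%k. v ta k - v sg k)) \<longlongrightarrow> \<bar>a\<bar> * 0 + \<bar>b\<bar> * 0) (at sg within {0..T})"
   using u v sg by (intro tendsto_intros) (auto simp: in_E_def)
  then show "((%ta. \<bar>a\<bar> * L1_norm (%k. u ta k - u sg k) + \<bar>b\<bar> * L1_norm (%k. v ta k - v sg k)) \<longlongrightarrow> 0) (at sg within {0..T})"
   by simp
  have "L1_norm (%k. a *R u ta k + b *R v ta k - (a *R u sg k + b *R v sg k))
    <= \<bar>a\<bar> * L1_norm (%k. u ta k - u sg k) + \<bar>b\<bar> * L1_norm (%k. v ta k - v sg k)" if "ta : {0..T}" for ta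
  proof -
   have "(%k. a *R u ta k + b *R v ta k - (a *R u sg k + b *R v sg k)) = (%k. a *R (u ta k - u sg k) + b *R (v ta k - v sg k))"
    by (simp add: algebra_simps)
   moreover have "L1_norm (%k. a *R (u ta k - u sg k) + b *R (v ta k - v sg k)) <=
    L1_norm (%k. a *R (u ta k - u sg k)) + L1_norm (%k. b *R (v ta k - v sg k))"
    using in_E_integrable[OF u] in_E_integrable[OF v] that sg by (intro L1_norm_add) auto
   ultimately show ?thesis by (simp add: L1_norm_scaleR)
  qed
  then show "\<forall>\<^sub>F ta in at sg within {0..T}. L1_norm (%k. a *R u ta k + b *R v ta k - (a *R u sg k + b *R v sg k))
    <= \<bar>a\<bar> * L1_norm (%k. u ta k - u sg k) + \<bar>b\<bar> * L1_norm (%k. v ta k - v sg k)"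
   by (auto simp: eventually_at_filter)
 qed auto
qed (use in_E_integrable[OF u] in_E_integrable[OF v] in auto)

lemma E_norm_lincomb:
 fixes u v :: "real => real^'d => 'v::euclidean_space"
 assumes u: "in_E T u" and v: "in_E T v" and T: "0 <= T"
 shows "E_norm T (%ta k. a *R u ta k + b *R v ta k) <= \<bar>a\<bar> * E_norm T u + \<bar>b\<bar> * E_norm T v"
proof (rule E_norm_le[OF T])
 fix ta assume ta: "ta : {0..T}"
 have "L1_norm (%k. a *R u ta k + b *R v ta k) <= L1_norm (%k. a *R u ta k) + L1_norm (%k. b *R v ta k)"
  using in_E_integrable[OF u ta] in_E_integrable[OF v ta] by (intro L1_norm_add) auto
 also have "... <= \<bar>a\<bar> * E_norm T u + \<bar>b\<bar> * E_norm T v"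
  unfolding L1_norm_scaleR using L1_norm_le_E_norm[OF u ta] L1_norm_le_E_norm[OF v ta]
  by (intro add_mono mult_left_mono) auto
 finally show "L1_norm (%k. a *R u ta k + b *R v ta k) <= \<bar>a\<bar> * E_norm T u + \<bar>b\<bar> * E_norm T v" .
qed

lemma in_E_LipschitzI:
 fixes u :: "real => real^'d => 'v::euclidean_space"
 assumes "!!ta. ta : {0..T} ==> integrable lebesgue (u ta)"
  and "!!ta sg. ta : {0..T} ==> sg : {0..T} ==> L1_norm (%k. u ta k - u sg k) <= C * \<bar>ta - sg\<bar>"
 shows "in_E T u"
 unfolding in_E_def
proof (intro conjI ballI)
 fix sg assume sg: "sg : {0..T}"
 show "((%ta. L1_norm (%k. u ta k - u sg k)) \<longlongrightarrow> 0) (at sg within {0..T})"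
 proof (rule tendsto_sandwich[OF _ _ tendsto_const])
  have "((%ta. C * \<bar>ta - sg\<bar>) \<longlongrightarrow> C * \<bar>sg - sg\<bar>) (at sg within {0..T})" by (intro tendsto_intros)
  then show "((%ta. C * \<bar>ta - sg\<bar>) \<longlongrightarrow> 0) (at sg within {0..T})" by simp
  show "\<forall>\<^sub>F ta in at sg within {0..T}. L1_norm (%k. u ta k - u sg k) <= C * \<bar>ta - sg\<bar>"
   using assms(2) sg by (auto simp: eventually_at_filter)
 qed auto
qed (use assms(1) in auto)

lemma in_E_uniform_limit:
 fixes u :: "nat => real => real^'d => 'v::euclidean_space"
 assumes u: "!!n. in_E T (u n)" and v: "!!ta. ta : {0..T} ==> integrable lebesgue (v ta)"
  and le: "!!n ta. ta : {0..T} ==> L1_norm (%k. u n ta k - v ta k) <= e n" and e: "e \<longlonglongrightarrow> 0"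
 shows "in_E T v"
 unfolding in_E_def
proof (intro conjI ballI)
 fix sg assume sg: "sg : {0..T}"
 show "((%ta. L1_norm (%k. v ta k - v sg k)) \<longlongrightarrow> 0) (at sg within {0..T})"
 proof (rule tendstoI)
  fix r :: real assume r: "0 < r"
  have r3: "0 < r / 3" using r by simp
  have "\<forall>\<^sub>F n in sequentially. e n < r / 3" by (rule order_tendstoD(2)[OF e r3])
  from eventually_happens'[OF sequentially_bot this] obtain n where n: "e n < r / 3" ..
  have "((%ta. L1_norm (%k. u n ta k - u n sg k)) \<longlongrightarrow> 0) (at sg within {0..T})"
   using u sg by (simp add: in_E_def)
  from order_tendstoD(2)[OF this r3]
  have "\<forall>\<^sub>F ta in at sg within {0..T}. L1_norm (%k. u n ta k - u n sg k) < r / 3" .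
  then show "\<forall>\<^sub>F ta in at sg within {0..T}. dist (L1_norm (%k. v ta k - v sg k)) 0 < r"
   unfolding eventually_at_filter
  proof eventually_elim
   case (elim ta)
   show ?case
   proof (intro impI)
    assume t: "ta ~= sg" "ta : {0..T}"
    have "L1_norm (%k. v ta k - v sg k) <= L1_norm (%k. v ta k - u n ta k) + L1_norm (%k. u n ta k - v sg k)"
     "L1_norm (%k. u n ta k - v sg k) <= L1_norm (%k. u n ta k - u n sg k) + L1_norm (%k. u n sg k - v sg k)"
     using in_E_integrable[OF u] v t sg by (auto intro!: L1_norm_diff_triangle)
    then show "dist (L1_norm (%k. v ta k - v sg k)) 0 < r"
     using elim t le[of ta n] le[of sg n] sg n L1_norm_minus_commute[of "v ta" "u n ta"] by simp
   qed
  qed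
 qed
qed (use v in auto)

text \<open>With geometrically small increments the sequence converges almost everywhere, so
  completeness of L1 comes with an explicit limit. The pointwise \<open>lim\<close> depends
  measurably on further parameters, in particular on time.\<close>

lemma L1_fast_Cauchy:
 fixes f :: "nat => real^'d => 'v::euclidean_space"
 assumes f: "!!n. integrable lebesgue (f n)" and q: "0 <= q" "q < 1"
  and le: "!!n. L1_norm (%k. f (Suc n) k - f n k) <= c * q ^ n"
 shows "integrable lebesgue (%k. lim (%n. f n k))"
  and "L1_norm (%k. f n k - lim (%n. f n k)) <= c * q ^ n / (1 - q)"
proof -
 define d where "d i k = f (Suc i) k - f i k" for i k
 have di: "integrable lebesgue (d i)" for i unfolding d_def using f by auto
 have c: "0 <= c" using order_trans[OF L1_norm_nonneg le[of 0]] by simp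
 have geo: "summable (%i. c * q ^ i)" using q by (intro summable_mult summable_geometric) auto
 have dn: "(LINT k|lebesgue. norm (d i k)) <= c * q ^ i" for i
  using le[of i] by (simp add: L1_norm_def d_def)
 have sumd: "summable (%i. LINT k|lebesgue. norm (d i k))"
  by (rule summable_comparison_test'[OF geo]) (use dn in auto)
 have "(\<integral>\<^sup>+k. (\<Sum>i. ennreal (norm (d i k))) \<partial>lebesgue) = (\<Sum>i. \<integral>\<^sup>+k. ennreal (norm (d i k)) \<partial>lebesgue)"
  using di by (intro nn_integral_suminf) auto
 also have "... = (\<Sum>i. ennreal (LINT k|lebesgue. norm (d i k)))"
  using di by (subst nn_integral_eq_integral) auto
 also have "... = ennreal (\<Sum>i. LINT k|lebesgue. norm (d i k))"
  using sumd by (intro suminf_ennreal2) auto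
 finally have "(\<integral>\<^sup>+k. (\<Sum>i. ennreal (norm (d i k))) \<partial>lebesgue) ~= \<infinity>" by simp
 then have "AE k in lebesgue. (\<Sum>i. ennreal (norm (d i k))) ~= \<infinity>"
  using di by (intro nn_integral_noteq_infinite) auto
 \<comment> \<open>A finite integral of the summed increments makes the sequence converge at almost
   every point. The same sum dominates all later differences.\<close>
 then have ae: "AE k in lebesgue. summable (%i. norm (d i k))"
  by eventually_elim (auto intro: summable_suminf_not_top)
 have isum: "integrable lebesgue (%k. \<Sum>i. norm (d i k))"
  using di ae sumd by (intro integrable_suminf) auto
 have tele: "f m k = f 0 k + (SUM i<m. d i k)" for m k
  by (induction m) (auto simp: d_def)
 have lim: "AE k in lebesgue. (%n. f n k) \<longlonglongrightarrow> lim (%n. f n k)"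
  using ae
 proof eventually_elim
  case (elim k)
  have "(%m. f 0 k + (SUM i<m. d i k)) \<longlonglongrightarrow> f 0 k + (\<Sum>i. d i k)"
   using summable_LIMSEQ[OF summable_norm_cancel[OF elim]] by (intro tendsto_intros)
  then have "convergent (%n. f n k)" unfolding convergent_def tele[symmetric] by blast
  then show ?case by (simp add: convergent_LIMSEQ_iff)
 qed
 have nb: "AE k in lebesgue. norm (f m k - f n k) <= (\<Sum>i. norm (d i k))" if "n <= m" for n m
  using ae
 proof eventually_elim
  case (elim k)
  have "f m k - f n k = (SUM i:{n..<m}. d i k)"
   unfolding d_def using sum_Suc_diff'[OF that, of "%i. f i k"] by simp
  also have "norm ... <= (SUM i:{n..<m}. norm (d i k))" by (rule norm_sum)
  also have "... <= (\<Sum>i. norm (d i k))" using elim by (intro sum_le_suminf) auto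
  finally show ?case .
 qed
 have mlim: "(%k. lim (%n. f n k)) : borel_measurable lebesgue"
  using f by (intro borel_measurable_lim_metric) auto
 have dom: "integrable lebesgue (%k. lim (%n. f n k) - f n k)"
  "(%m. LINT k|lebesgue. norm (f (m + n) k - f n k)) \<longlonglongrightarrow> (LINT k|lebesgue. norm (lim (%n. f n k) - f n k))" for n
 proof -
  have ae1: "AE k in lebesgue. (%m. f (m + n) k - f n k) \<longlonglongrightarrow> lim (%n. f n k) - f n k"
   using lim by eventually_elim (intro tendsto_intros LIMSEQ_ignore_initial_segment)
  show "integrable lebesgue (%k. lim (%n. f n k) - f n k)"
   using ae1 isum mlim f nb[of n "m + n" for m]
   by (intro integrable_dominated_convergence[where s="%m k. f (m + n) k - f n k" and w="%k. \<Sum>i. norm (d i k)"]) auto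
  have ae2: "AE k in lebesgue. (%m. norm (f (m + n) k - f n k)) \<longlonglongrightarrow> norm (lim (%n. f n k) - f n k)"
   using ae1 by eventually_elim (intro tendsto_norm)
  show "(%m. LINT k|lebesgue. norm (f (m + n) k - f n k)) \<longlonglongrightarrow> (LINT k|lebesgue. norm (lim (%n. f n k) - f n k))"
   using ae2 isum mlim f nb[of n "m + n" for m]
   by (intro integral_dominated_convergence[where w="%k. \<Sum>i. norm (d i k)"]) auto
 qed
 show "integrable lebesgue (%k. lim (%n. f n k))"
  using Bochner_Integration.integrable_add[OF dom(1)[of 0] f[of 0]] by simp
 have fin: "L1_norm (%k. f (m + n) k - f n k) <= c * q ^ n / (1 - q)" for m
 proof -
  have "L1_norm (%k. f (m + n) k - f n k) = L1_norm (%k. SUM i:{n..<m+n}. d i k)"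
   unfolding d_def using sum_Suc_diff'[of n "m + n" "%i. f i k" for k] by simp
  also have "... <= (SUM i:{n..<m+n}. L1_norm (d i))" by (intro L1_norm_sum_le di) auto
  also have "... <= (SUM i:{n..<m+n}. c * q ^ i)" using le by (intro sum_mono) (simp add: d_def[abs_def])
  also have "... = (SUM i<m. c * q ^ n * q ^ i)"
   by (rule sum.reindex_bij_witness[of _ "%i. i + n" "%i. i - n"]) (auto simp flip: power_add)
  also have "... <= (\<Sum>i. c * q ^ n * q ^ i)"
   using q c by (intro sum_le_suminf summable_mult summable_geometric) auto
  also have "... = c * q ^ n / (1 - q)"
   using q by (subst suminf_mult) (auto simp: suminf_geometric summable_geometric)
  finally show ?thesis .
 qed
 have "(LINT k|lebesgue. norm (lim (%n. f n k) - f n k)) <= c * q ^ n / (1 - q)"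
  by (rule tendsto_upperbound[OF dom(2)]) (use fin in \<open>auto simp: L1_norm_def\<close>)
 then show "L1_norm (%k. f n k - lim (%n. f n k)) <= c * q ^ n / (1 - q)"
  by (simp add: L1_norm_def norm_minus_commute)
qed

text \<open>Approximation by step functions in time: elements of \<open>E\<close> need not be jointly measurable.\<close>

lemma in_E_joint_representative:
 fixes u :: "real => real^'d => 'v::euclidean_space"
 assumes u: "in_E T u"
 shows "EX U. case_prod U : joint_borel & (ALL ta:{0..T}. AE k in lebesgue. u ta k = U ta k)"
proof -
 have "ALL sg. EX g. g : borel_fun & (sg : {0..T} --> (AE k in lebesgue. u sg k = g k))"
 proof
  fix sg
  show "EX g. g : borel_fun & (sg : {0..T} --> (AE k in lebesgue. u sg k = g k))"
  proof (cases "sg : {0..T}")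
   case True
   then show ?thesis using ex_borel_representative[OF borel_measurable_integrable[OF in_E_integrable[OF u True]]] by auto
  next
   case False then show ?thesis by (intro exI[of _ "%_. 0"]) auto
  qed
 qed
 then obtain u' where u': "!!sg. u' sg : borel_fun" "!!sg. sg : {0..T} ==> AE k in lebesgue. u sg k = u' sg k"
  by metis
 have "ALL n. EX d>0. ALL ta:{0..T}. ALL sg:{0..T}. \<bar>ta - sg\<bar> < d --> L1_norm (%k. u ta k - u sg k) < (1/2)^n"
  using in_E_uniformly_continuous[OF u] by simp
 then obtain d where d: "!!n. d n > 0"
  "!!n ta sg. ta : {0..T} ==> sg : {0..T} ==> \<bar>ta - sg\<bar> < d n ==> L1_norm (%k. u ta k - u sg k) < (1/2)^n"
  by metis
 \<comment> \<open>The mesh \<open>1 / m n\<close> is finer than the modulus of continuity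
   \<open>d n\<close>.\<close>
 define m where "m n = real (nat \<lceil>2 / d n\<rceil>) + 1" for n
 have m: "m n > 0" "1 / m n < d n" for n
 proof -
  show mp: "m n > 0" by (simp add: m_def add_nonneg_pos)
  have "2 / d n < m n" unfolding m_def using d(1)[of n] by linarith
  then have "2 < m n * d n" using d(1)[of n] by (simp add: field_simps)
  then show "1 / m n < d n" using mp by (simp add: field_simps)
 qed
 \<comment> \<open>Rounding down keeps the sampled time in \<open>{0..T}\<close>. Only countably
   many times are sampled, which makes the step function jointly measurable.\<close>
 define p where "p n ta = real_of_int \<lfloor>ta * m n\<rfloor> / m n" for n ta
 have p: "p n ta : {0..T}" "\<bar>p n ta - ta\<bar> < d n" if "ta : {0..T}" for n ta
 proof -
  have "p n ta <= ta" using m(1)[of n] by (simp add: p_def divide_le_eq)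
  moreover have "0 <= p n ta" using m(1)[of n] that by (simp add: p_def)
  moreover have "ta - 1 / m n < p n ta"
  proof -
   have "ta * m n - 1 < real_of_int \<lfloor>ta * m n\<rfloor>" by linarith
   then have "(ta * m n - 1) / m n < real_of_int \<lfloor>ta * m n\<rfloor> / m n" using m(1)[of n] by (intro divide_strict_right_mono)
   then show ?thesis using m(1)[of n] by (simp add: p_def diff_divide_distrib)
  qed
  ultimately show "p n ta : {0..T}" "\<bar>p n ta - ta\<bar> < d n" using that m(2)[of n] by auto
 qed
 define U where "U n ta k = u' (p n ta) k" for n ta k
 have Um: "case_prod (U n) : joint_borel" for n
 proof -
  have "(%x. (%i x. u' (real_of_int i / m n) (snd x)) ((%x. \<lfloor>fst x * m n\<rfloor>) x) x) : borel_measurable (borel \<Otimes>\<^sub>M (borel :: (real^'d) measure))"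
  proof (rule measurable_compose_countable[where f="%(i::int) x. u' (real_of_int i / m n) (snd x)" and g="%x. \<lfloor>fst x * m n\<rfloor>"])
   show "(%x. u' (real_of_int i / m n) (snd x)) : borel_measurable (borel \<Otimes>\<^sub>M (borel :: (real^'d) measure))" for i
    by (rule measurable_compose[OF measurable_snd u'(1)])
   have "(%x. fst x * m n) : borel_measurable (borel \<Otimes>\<^sub>M (borel :: (real^'d) measure))" by measurable
   then show "(%x. \<lfloor>fst x * m n\<rfloor>) : borel \<Otimes>\<^sub>M (borel :: (real^'d) measure) \<rightarrow>\<^sub>M count_space UNIV"
    by (rule measurable_compose[OF _ measurable_real_floor])
  qed
  then show ?thesis by (simp add: U_def p_def case_prod_beta')
 qed
 have Ui: "integrable lebesgue (U n ta)" if "ta : {0..T}" for n ta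
  unfolding U_def using integrable_lebesgue_AE[OF in_E_integrable[OF u] u'(2)] p(1)[OF that] by blast
 have Ud: "L1_norm (%k. U n ta k - u ta k) <= (1/2)^n" if "ta : {0..T}" for n ta
 proof -
  have "L1_norm (%k. u (p n ta) k - u ta k) = L1_norm (%k. U n ta k - u ta k)"
  proof (rule L1_norm_cong_AE)
   show "AE k in lebesgue. u (p n ta) k - u ta k = U n ta k - u ta k"
    using u'(2)[OF p(1)[OF that]] by eventually_elim (simp add: U_def)
  qed (use in_E_integrable[OF u] p(1) that in auto)
  then show ?thesis using d(2)[OF p(1)[OF that, of n] that p(2)[OF that, of n]] by (simp add: less_imp_le)
 qed
 define V where "V ta k = lim (%n. U n ta k)" for ta k
 have "(%x. lim (%n. case_prod (U n) x)) : joint_borel"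
  by (intro borel_measurable_lim_metric Um)
 then have "case_prod V : joint_borel" by (simp add: V_def case_prod_beta')
 moreover have "AE k in lebesgue. u ta k = V ta k" if ta: "ta : {0..T}" for ta
 proof -
  have le: "L1_norm (%k. U (Suc n) ta k - U n ta k) <= 2 * (1/2)^n" for n
  proof -
   have "L1_norm (%k. U (Suc n) ta k - U n ta k) <= L1_norm (%k. U (Suc n) ta k - u ta k) + L1_norm (%k. u ta k - U n ta k)"
    using Ui[OF ta] in_E_integrable[OF u ta] by (intro L1_norm_diff_triangle)
   also have "... <= (1/2)^(Suc n) + (1/2)^n"
    using Ud[OF ta, of "Suc n"] Ud[OF ta, of n] L1_norm_minus_commute[of "u ta" "U n ta"] by simp
   also have "... <= 2 * (1/2)^n" by simp
   finally show ?thesis .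
  qed
  note fc = L1_fast_Cauchy[of "%n. U n ta" "1/2" 2, OF Ui[OF ta] _ _ le]
  have Vi: "integrable lebesgue (V ta)" using fc(1) by (simp add: V_def[abs_def])
  have le5: "L1_norm (%k. u ta k - V ta k) <= 5 * (1/2)^n" for n
  proof -
   have "L1_norm (%k. u ta k - V ta k) <= L1_norm (%k. u ta k - U n ta k) + L1_norm (%k. U n ta k - V ta k)"
    using Ui[OF ta] in_E_integrable[OF u ta] Vi by (intro L1_norm_diff_triangle)
   moreover have "L1_norm (%k. U n ta k - V ta k) <= 4 * (1/2)^n" using fc(2)[of n] by (simp add: V_def)
   ultimately show ?thesis using Ud[OF ta, of n] L1_norm_minus_commute[of "u ta" "U n ta"] by simp
  qed
  have lim5: "(%n. 5 * (1/2)^n :: real) \<longlonglongrightarrow> 0" by (intro tendsto_mult_right_zero LIMSEQ_power_zero) simp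
  have "L1_norm (%k. u ta k - V ta k) <= 0"
   by (rule LIMSEQ_le_const[OF lim5]) (intro exI allI impI le5)
  then have "AE k in lebesgue. u ta k - V ta k = 0"
   using in_E_integrable[OF u ta] Vi by (intro L1_norm_eq_0) auto
  then show ?thesis by eventually_elim simp
 qed
 ultimately show ?thesis by blast
qed

section \<open>Modulation and the completeness of E1\<close>

lemma norm_smult: "norm (c *s v) = cmod c * norm (v :: complex^'c)"
 by (simp add: norm_vec_def norm_mult L2_set_right_distrib)

lemma bounded_bilinear_smult: "bounded_bilinear (%(c::complex) (v::complex^'c). c *s v)"
proof
 show "EX K. ALL a b. norm (a *s b :: complex^'c) <= norm a * norm b * K"
  by (intro exI[of _ 1]) (simp add: norm_smult)
qed (auto simp: vec_eq_iff algebra_simps)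

lemma borel_measurable_smult [measurable (raw)]:
 fixes f :: "'a => complex" and g :: "'a => complex^'c"
 assumes "f : borel_measurable M" "g : borel_measurable M"
 shows "(%x. f x *s g x) : borel_measurable M"
 using assms
 by (rule borel_measurable_continuous_Pair)
  (intro bounded_bilinear.continuous_on[OF bounded_bilinear_smult] continuous_intros)

lemma borel_measurable_cis [measurable (raw)]:
 "f : borel_measurable M ==> (%x. cis (f x)) : borel_measurable M"
 by (rule borel_measurable_continuous_on) (auto intro: continuous_intros)

lemma norm_modulate: "norm (modulate r w k) = norm (w k)"
 by (simp add: modulate_def norm_smult)

text \<open>This is why the positions of the fields that are not differentiated never enter an
  estimate.\<close>

lemma L1_norm_modulate: "L1_norm (modulate r w) = L1_norm w"
 by (simp add: L1_norm_def norm_modulate)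

lemma measurable_modulate:
 assumes "w : borel_measurable lebesgue" shows "modulate r w : borel_measurable lebesgue"
proof -
 have "(%k. cis (r \<bullet> k)) : borel_measurable lebesgue"
  by (intro measurable_completion) measurable
 then show ?thesis unfolding modulate_def using assms by measurable
qed

lemma integrable_modulate:
 assumes "integrable lebesgue w" shows "integrable lebesgue (modulate r w)"
 by (rule Bochner_Integration.integrable_bound[OF assms])
  (use measurable_modulate[OF borel_measurable_integrable[OF assms]] in \<open>auto simp: norm_modulate\<close>)

lemma modulate_lincomb:
 "modulate r (%k. a *R v k + b *R w k) = (%k. a *R modulate r v k + b *R modulate r w k)"
 by (simp add: fun_eq_iff modulate_def vec_eq_iff algebra_simps)

lemma modulate_diff: "modulate r (%k. v k - w k) = (%k. modulate r v k - modulate r w k)"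
 by (simp add: fun_eq_iff modulate_def vec_eq_iff algebra_simps)

lemma in_E_modulate:
 assumes "in_E T w" shows "in_E T (%ta. modulate r (w ta))"
 using assms unfolding in_E_def
 by (auto simp: integrable_modulate modulate_diff[symmetric] L1_norm_modulate)

text \<open>The norm may be computed from any family of weak gradients that lies in E, which frees
  later estimates from the choice inside \<open>weak_gradient\<close>.\<close>

lemma in_E1I:
 fixes M :: "('d::finite, 'c::finite) wave_model" and w :: "real => real^'d => complex^'e::finite"
 assumes M: "cutoff M" and w: "in_E T w" and G: "in_E T G"
  and d: "!!ta. ta : {0..T} ==> has_weak_gradient (modulate r (w ta)) (G ta)"
 shows "in_E1 T r w"
  and "E1_norm ee T bt r w = bt powr (1 + ee) * E_norm T G + E_norm T w"
proof -
 have eq: "AE k in lebesgue. G ta k = weak_gradient (modulate r (w ta)) k" if "ta : {0..T}" for ta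
  using weak_gradient_AE[OF M d[OF that]] by eventually_elim simp
 show "in_E1 T r w"
  using in_E_cong(1)[OF G eq] w d unfolding in_E1_def by blast
 show "E1_norm ee T bt r w = bt powr (1 + ee) * E_norm T G + E_norm T w"
  using in_E_cong(2)[OF G eq] by (simp add: E1_norm_def)
qed

lemma in_E1D:
 assumes "in_E1 T r w"
 shows "in_E T w" "in_E T (%ta. weak_gradient (modulate r (w ta)))"
  and "!!ta. ta : {0..T} ==> has_weak_gradient (modulate r (w ta)) (weak_gradient (modulate r (w ta)))"
proof -
 show "in_E T w" "in_E T (%ta. weak_gradient (modulate r (w ta)))" using assms by (simp_all add: in_E1_def)
 fix ta assume "ta : {0..T}"
 then obtain G where "has_weak_gradient (modulate r (w ta)) G" using assms unfolding in_E1_def by blast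
 then show "has_weak_gradient (modulate r (w ta)) (weak_gradient (modulate r (w ta)))"
  by (rule has_weak_gradient_weak_gradient)
qed

lemma modulate_cong_AE:
 "AE k in lebesgue. v k = w k ==> AE k in lebesgue. modulate r v k = modulate r w k"
 by (auto elim: eventually_mono simp: modulate_def)

lemma in_E1_cong:
 fixes M :: "('d::finite, 'c::finite) wave_model" and v w :: "real => real^'d => complex^'e::finite"
 assumes M: "cutoff M" and w: "in_E1 T r w" and eq: "!!ta. ta : {0..T} ==> AE k in lebesgue. w ta k = v ta k"
 shows "in_E1 T r v" and "E1_norm ee T bt r v = E1_norm ee T bt r w"
proof -
 have g: "has_weak_gradient (modulate r (v ta)) (weak_gradient (modulate r (w ta)))" if "ta : {0..T}" for ta
  by (rule has_weak_gradient_cong[OF in_E1D(3)[OF w that] modulate_cong_AE[OF eq[OF that]]]) simp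
 note I = in_E1I[OF M in_E_cong(1)[OF in_E1D(1)[OF w] eq] in_E1D(2)[OF w] g]
 show "in_E1 T r v" by (rule I(1))
 show "E1_norm ee T bt r v = E1_norm ee T bt r w"
 proof -
  have "E1_norm ee T bt r v = bt powr (1 + ee) * E_norm T (%ta. weak_gradient (modulate r (w ta))) + E_norm T v"
   by (rule I(2))
  moreover have "E_norm T v = E_norm T w" by (rule in_E_cong(2)[OF in_E1D(1)[OF w] eq])
  ultimately show ?thesis by (simp add: E1_norm_def)
 qed
qed

lemma in_E1_lincomb:
 fixes M :: "('d::finite, 'c::finite) wave_model" and v w :: "real => real^'d => complex^'e::finite"
 assumes M: "cutoff M" and v: "in_E1 T r v" and w: "in_E1 T r w" and T: "0 <= T"
 shows "in_E1 T r (%ta k. a *R v ta k + b *R w ta k)"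
  and "E1_norm ee T bt r (%ta k. a *R v ta k + b *R w ta k) <= \<bar>a\<bar> * E1_norm ee T bt r v + \<bar>b\<bar> * E1_norm ee T bt r w"
proof -
 let ?G = "%v ta. weak_gradient (modulate r (v ta))"
 have g: "has_weak_gradient (modulate r (%k. a *R v ta k + b *R w ta k)) (%k. a *R ?G v ta k + b *R ?G w ta k)"
  if "ta : {0..T}" for ta
  unfolding modulate_lincomb by (intro has_weak_gradient_lincomb in_E1D(3)[OF v that] in_E1D(3)[OF w that])
 note I = in_E1I[OF M in_E_lincomb[OF in_E1D(1)[OF v] in_E1D(1)[OF w]] in_E_lincomb[OF in_E1D(2)[OF v] in_E1D(2)[OF w]] g]
 show "in_E1 T r (%ta k. a *R v ta k + b *R w ta k)" by (rule I(1))
 have "bt powr (1 + ee) * E_norm T (%ta k. a *R ?G v ta k + b *R ?G w ta k)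
   <= bt powr (1 + ee) * (\<bar>a\<bar> * E_norm T (?G v) + \<bar>b\<bar> * E_norm T (?G w))"
  by (intro mult_left_mono E_norm_lincomb in_E1D(2) v w T) simp
 moreover have "E_norm T (%ta k. a *R v ta k + b *R w ta k) <= \<bar>a\<bar> * E_norm T v + \<bar>b\<bar> * E_norm T w"
  by (intro E_norm_lincomb in_E1D(1)[OF v] in_E1D(1)[OF w] T)
 moreover have "E1_norm ee T bt r (%ta k. a *R v ta k + b *R w ta k)
   = bt powr (1 + ee) * E_norm T (%ta k. a *R ?G v ta k + b *R ?G w ta k) + E_norm T (%ta k. a *R v ta k + b *R w ta k)"
  by (rule I(2))
 moreover have "\<bar>a\<bar> * E1_norm ee T bt r v + \<bar>b\<bar> * E1_norm ee T bt r w
   = bt powr (1 + ee) * (\<bar>a\<bar> * E_norm T (?G v) + \<bar>b\<bar> * E_norm T (?G w)) + (\<bar>a\<bar> * E_norm T v + \<bar>b\<bar> * E_norm T w)"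
  by (simp add: E1_norm_def algebra_simps)
 ultimately show "E1_norm ee T bt r (%ta k. a *R v ta k + b *R w ta k) <= \<bar>a\<bar> * E1_norm ee T bt r v + \<bar>b\<bar> * E1_norm ee T bt r w"
  by linarith
qed

lemma in_E1_add:
 fixes M :: "('d::finite, 'c::finite) wave_model" and v w :: "real => real^'d => complex^'e::finite"
 assumes M: "cutoff M" and v: "in_E1 T r v" and w: "in_E1 T r w" and T: "0 <= T"
 shows "in_E1 T r (%ta k. v ta k + w ta k)"
  and "E1_norm ee T bt r (%ta k. v ta k + w ta k) <= E1_norm ee T bt r v + E1_norm ee T bt r w"
 using in_E1_lincomb[OF M v w T, where a=1 and b=1] by simp_all

lemma in_E1_diff:
 fixes M :: "('d::finite, 'c::finite) wave_model" and v w :: "real => real^'d => complex^'e::finite"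
 assumes M: "cutoff M" and v: "in_E1 T r v" and w: "in_E1 T r w" and T: "0 <= T"
 shows "in_E1 T r (%ta k. v ta k - w ta k)"
  and "E1_norm ee T bt r (%ta k. v ta k - w ta k) <= E1_norm ee T bt r v + E1_norm ee T bt r w"
 using in_E1_lincomb[OF M v w T, where a=1 and b="-1"] by simp_all

lemma E_norm_le_E1_norm:
 assumes "in_E1 T r w" "0 <= T"
 shows "E_norm T w <= E1_norm ee T bt r w"
 using E_norm_nonneg[OF in_E1D(2)[OF assms(1)] assms(2)] by (simp add: E1_norm_def)

lemma E1_norm_nonneg:
 assumes "in_E1 T r w" "0 <= T"
 shows "0 <= E1_norm ee T bt r w"
 using E_norm_nonneg[OF in_E1D(1)[OF assms(1)] assms(2)] E_norm_le_E1_norm[OF assms] by (rule order_trans)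

text \<open>Dividing out the weight gives exactly the gradient bound demanded of particle-like
  wavepackets.\<close>

lemma L1_norm_weak_gradient_le_E1_norm:
 assumes w: "in_E1 T r w" and "ta : {0..T}" "0 < bt"
 shows "L1_norm (weak_gradient (modulate r (w ta))) <= bt powr (- 1 - ee) * E1_norm ee T bt r w"
proof -
 have T: "0 <= T" using assms(2) by simp
 have "L1_norm (weak_gradient (modulate r (w ta))) <= E_norm T (%ta. weak_gradient (modulate r (w ta)))" (is "_ <= ?N")
  by (rule L1_norm_le_E_norm[OF in_E1D(2)[OF w] assms(2)])
 also have "?N = bt powr (- 1 - ee) * (bt powr (1 + ee) * ?N)"
  using assms(3) by (simp add: powr_add[symmetric] mult.assoc[symmetric])
 also have "... <= bt powr (- 1 - ee) * E1_norm ee T bt r w"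
  using E_norm_nonneg[OF in_E1D(1)[OF w] T] by (intro mult_left_mono) (auto simp: E1_norm_def)
 finally show ?thesis .
qed

lemma in_E_fast_Cauchy:
 fixes u :: "nat => real => real^'d => 'v::euclidean_space"
 assumes u: "!!n. in_E T (u n)" and q: "0 <= q" "q < 1"
  and le: "!!n. E_norm T (%ta k. u (Suc n) ta k - u n ta k) <= c * q ^ n"
 shows "in_E T (%ta k. lim (%n. u n ta k))"
  and "!!ta. ta : {0..T} ==> L1_norm (%k. u n ta k - lim (%n. u n ta k)) <= c * q ^ n / (1 - q)"
proof -
 have le': "L1_norm (%k. u (Suc n) ta k - u n ta k) <= c * q ^ n" if "ta : {0..T}" for ta n
  using L1_norm_le_E_norm[OF in_E_lincomb[OF u u], OF that, of 1 "Suc n" "-1" n] le[of n] by simp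
 show *: "L1_norm (%k. u n ta k - lim (%n. u n ta k)) <= c * q ^ n / (1 - q)" if "ta : {0..T}" for ta n
  by (rule L1_fast_Cauchy(2)[OF in_E_integrable[OF u that] q le'[OF that]])
 show "in_E T (%ta k. lim (%n. u n ta k))"
 proof (rule in_E_uniform_limit[OF u _ *])
  show "integrable lebesgue (%k. lim (%n. u n ta k))" if "ta : {0..T}" for ta
   by (rule L1_fast_Cauchy(1)[OF in_E_integrable[OF u that] q le'[OF that]])
  show "(%n. c * q ^ n / (1 - q)) \<longlonglongrightarrow> 0"
   using q by (intro tendsto_divide_zero tendsto_mult_right_zero LIMSEQ_power_zero) auto
 qed
qed

text \<open>Fields and weak gradients are Cauchy separately, the latter at a rate divided by the
  weight \<open>b\<close>. Closedness of the weak gradient ties the two limits together.\<close>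

lemma in_E1_fast_Cauchy:
 fixes M :: "('d::finite, 'c::finite) wave_model" and w :: "nat => real => real^'d => complex^'e::finite"
 assumes M: "cutoff M" and w: "!!n. in_E1 T r (w n)" and q: "0 <= q" "q < 1" and bt: "0 < bt" and T: "0 <= T"
  and le: "!!n. E1_norm ee T bt r (%ta k. w (Suc n) ta k - w n ta k) <= c * q ^ n"
 shows "EX v. in_E1 T r v & (%n. E1_norm ee T bt r (%ta k. w n ta k - v ta k)) \<longlonglongrightarrow> 0"
proof -
 define b where "b = bt powr (1 + ee)"
 have b: "b > 0" using bt by (simp add: b_def)
 define G where "G n ta = weak_gradient (modulate r (w n ta))" for n ta
 have wE: "in_E T (w n)" and GE: "in_E T (G n)" for n
  using in_E1D(1,2)[OF w[of n]] by (simp_all add: G_def[abs_def])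
 have wG: "has_weak_gradient (modulate r (w n ta)) (G n ta)" if "ta : {0..T}" for n ta
  using in_E1D(3)[OF w that] by (simp add: G_def)
 have norm_diff: "E1_norm ee T bt r (%ta k. w n ta k - v ta k) = b * E_norm T (%ta k. G n ta k - H ta k) + E_norm T (%ta k. w n ta k - v ta k)"
  if "in_E T v" "in_E T H" "!!ta. ta : {0..T} ==> has_weak_gradient (modulate r (v ta)) (H ta)" for n v H
 proof -
  have g: "has_weak_gradient (modulate r (%k. 1 *R w n ta k + (-1) *R v ta k)) (%k. 1 *R G n ta k + (-1) *R H ta k)"
   if "ta : {0..T}" for ta
   unfolding modulate_lincomb by (intro has_weak_gradient_lincomb wG \<open>ta : {0..T} ==> has_weak_gradient (modulate r (v ta)) (H ta)\<close> that)
  show ?thesis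
   using in_E1I(2)[OF M in_E_lincomb[OF wE that(1)] in_E_lincomb[OF GE that(2)] g, of ee bt] by (simp add: b_def)
 qed
 have d: "b * E_norm T (%ta k. G (Suc n) ta k - G n ta k) + E_norm T (%ta k. w (Suc n) ta k - w n ta k) <= c * q ^ n" for n
  using le[of n] norm_diff[OF wE GE wG, of "Suc n" n] by simp
 have nn: "0 <= E_norm T (%ta k. G (Suc n) ta k - G n ta k)" "0 <= E_norm T (%ta k. w (Suc n) ta k - w n ta k)" for n
  using E_norm_nonneg[OF in_E_lincomb[OF GE GE] T, of 1 "Suc n" "-1" n] E_norm_nonneg[OF in_E_lincomb[OF wE wE] T, of 1 "Suc n" "-1" n] by simp_all
 have dw: "E_norm T (%ta k. w (Suc n) ta k - w n ta k) <= c * q ^ n" for n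
  using d[of n] mult_nonneg_nonneg[OF less_imp_le[OF b] nn(1)[of n]] by linarith
 have dG: "E_norm T (%ta k. G (Suc n) ta k - G n ta k) <= (c / b) * q ^ n" for n
  using d[of n] nn(2)[of n] b by (simp add: field_simps)
 define v where "v ta k = lim (%n. w n ta k)" for ta k
 define H where "H ta k = lim (%n. G n ta k)" for ta k
 have v: "in_E T v" "!!n ta. ta : {0..T} ==> L1_norm (%k. w n ta k - v ta k) <= c * q ^ n / (1 - q)"
  using in_E_fast_Cauchy[OF wE q dw] by (auto simp: v_def[abs_def])
 have H: "in_E T H" "!!n ta. ta : {0..T} ==> L1_norm (%k. G n ta k - H ta k) <= (c / b) * q ^ n / (1 - q)"
  using in_E_fast_Cauchy[OF GE q dG] by (auto simp: H_def[abs_def])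
 have lim0: "(%n. a * q ^ n / (1 - q)) \<longlonglongrightarrow> 0" for a
  using q by (intro tendsto_divide_zero tendsto_mult_right_zero LIMSEQ_power_zero) auto
 have vH: "has_weak_gradient (modulate r (v ta)) (H ta)" if ta: "ta : {0..T}" for ta
 proof (rule has_weak_gradient_limit[where w="%n. modulate r (w n ta)" and G="%n. G n ta", OF wG[OF ta]])
  show "integrable lebesgue (modulate r (v ta))" "integrable lebesgue (H ta)"
   using in_E_integrable[OF v(1) ta] in_E_integrable[OF H(1) ta] by (auto intro: integrable_modulate)
  show "(%n. L1_norm (%k. modulate r (w n ta) k - modulate r (v ta) k)) \<longlonglongrightarrow> 0"
   unfolding modulate_diff[symmetric] L1_norm_modulate
   by (rule tendsto_sandwich[OF _ _ tendsto_const lim0[of c]]) (use v(2)[OF ta] in auto)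
  show "(%n. L1_norm (%k. G n ta k - H ta k)) \<longlonglongrightarrow> 0"
   by (rule tendsto_sandwich[OF _ _ tendsto_const lim0[of "c/b"]]) (use H(2)[OF ta] in auto)
 qed
 have vE1: "in_E1 T r v" by (rule in_E1I(1)[OF M v(1) H(1) vH])
 have "(%n. E1_norm ee T bt r (%ta k. w n ta k - v ta k)) \<longlonglongrightarrow> 0"
 proof (rule tendsto_sandwich[OF _ _ tendsto_const])
  show "(%n. b * ((c / b) * q ^ n / (1 - q)) + c * q ^ n / (1 - q)) \<longlonglongrightarrow> 0"
   by (intro tendsto_add_zero tendsto_mult_right_zero lim0)
  show "\<forall>\<^sub>F n in sequentially. E1_norm ee T bt r (%ta k. w n ta k - v ta k) <= b * ((c / b) * q ^ n / (1 - q)) + c * q ^ n / (1 - q)"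
  proof (intro always_eventually allI)
   fix n
   have "E1_norm ee T bt r (%ta k. w n ta k - v ta k) = b * E_norm T (%ta k. G n ta k - H ta k) + E_norm T (%ta k. w n ta k - v ta k)"
    by (rule norm_diff[OF v(1) H(1) vH])
   also have "... <= b * ((c / b) * q ^ n / (1 - q)) + c * q ^ n / (1 - q)"
    by (intro add_mono mult_left_mono E_norm_le v(2) H(2) T less_imp_le[OF b])
   finally show "E1_norm ee T bt r (%ta k. w n ta k - v ta k) <= b * ((c / b) * q ^ n / (1 - q)) + c * q ^ n / (1 - q)" .
  qed
  show "\<forall>\<^sub>F n in sequentially. 0 <= E1_norm ee T bt r (%ta k. w n ta k - v ta k)"
   using E1_norm_nonneg[OF in_E1_diff(1)[OF M w vE1 T] T] by simp
 qed
 then show ?thesis using vE1 by blast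
qed

section \<open>Time integrals as elements of E and E1\<close>

text \<open>After a change of variable the increment is itself a time integral, over an interval of
  length \<open>ta - sg\<close>. Time integrals are therefore Lipschitz in time, in particular in
  E.\<close>

lemma time_integral_diff:
 fixes F :: "real => real^'d => 'v::euclidean_space"
 assumes F[measurable]: "case_prod F : joint_borel"
  and bnd: "!!s. s : {0..T} ==> integrable lebesgue (F s) & L1_norm (F s) <= C"
  and st: "0 <= sg" "sg <= ta" "ta <= T"
 shows "L1_norm (%k. (LINT s:{0..ta}|lebesgue. F s k) - (LINT s:{0..sg}|lebesgue. F s k)) <= C * (ta - sg)"
proof -
 have Fs[measurable]: "F s : borel_fun" for s by measurable
 have m: "case_prod (%s. F (sg + s)) : joint_borel" by measurable
 have ae: "AE k in lebesgue. set_integrable lebesgue {0..T} (%s. F s k)"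
  by (rule time_integral_AE_integrable[OF F]) (rule bnd)
 have "AE k in lebesgue. (LINT s:{0..ta}|lebesgue. F s k) - (LINT s:{0..sg}|lebesgue. F s k) = (LINT s:{0..ta-sg}|lebesgue. F (sg + s) k)"
  using ae
 proof eventually_elim
  case (elim k)
  have fm[measurable]: "(%s. F s k) : borel_fun" by measurable
  have "integrable lebesgue (%s. indicator {0..T} s *R F s k)" using elim by (simp add: set_integrable_def)
  then have iT: "integrable lborel (%s. indicator {0..T} s *R F s k)"
   by (subst (asm) integrable_completion) measurable
  have i: "integrable lborel (%s. indicator {0..t} s *R F s k)" if "t <= T" for t
   by (rule Bochner_Integration.integrable_bound[OF iT]) (use that in \<open>auto simp: indicator_def\<close>)
  have "(LINT s:{0..ta}|lebesgue. F s k) - (LINT s:{0..sg}|lebesgue. F s k)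
    = (LINT s|lborel. indicator {0..ta} s *R F s k - indicator {0..sg} s *R F s k)"
   using i[of ta] i[of sg] st by (subst (1 2) set_integral_lebesgue_lborel) (auto intro: fm)
  also have "... = (LINT s|lborel. indicator {sg..ta} s *R F s k)"
  proof (rule integral_cong_AE)
   have "AE s in lborel. s ~= sg" by (simp add: AE_lborel_singleton)
   then show "AE s in lborel. indicator {0..ta} s *R F s k - indicator {0..sg} s *R F s k = indicator {sg..ta} s *R F s k"
    by eventually_elim (use st in \<open>auto simp: indicator_def\<close>)
  qed measurable
  also have "... = (LINT s|lborel. indicator {sg..ta} (sg + 1 * s) *R F (sg + 1 * s) k)"
   by (subst lborel_integral_real_affine[of 1 _ sg]) auto
  also have "... = (LINT s:{0..ta-sg}|lebesgue. F (sg + s) k)"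
  proof (subst set_integral_lebesgue_lborel)
   have "indicat_real {sg..ta} (sg + 1 * s) = indicator {0..ta-sg} s" for s by (auto simp: indicator_def)
   then show "(LINT s|lborel. indicator {sg..ta} (sg + 1 * s) *R F (sg + 1 * s) k) = (LINT s|lborel. indicator {0..ta-sg} s *R F (sg + s) k)"
    by simp
  qed measurable
  finally show ?case .
 qed
 moreover have "(%k. (LINT s:{0..ta}|lebesgue. F s k) - (LINT s:{0..sg}|lebesgue. F s k)) : borel_measurable lebesgue"
  using bnd st by (intro borel_measurable_diff measurable_completion) (auto intro!: time_integral_measurable[OF F, of _ C])
 ultimately have "L1_norm (%k. (LINT s:{0..ta}|lebesgue. F s k) - (LINT s:{0..sg}|lebesgue. F s k))
   = L1_norm (%k. (LINT s:{0..ta-sg}|lebesgue. F (sg + s) k))"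
  by (rule L1_norm_cong_AE)
 also have "... <= (ta - sg) * C"
  using bnd st by (intro time_integral_norm[OF m]) auto
 finally show ?thesis by (simp add: mult.commute)
qed

lemma time_integral_in_E:
 fixes F :: "real => real^'d => 'v::euclidean_space"
 assumes F: "case_prod F : joint_borel" and T: "0 <= T"
  and bnd: "!!s. s : {0..T} ==> integrable lebesgue (F s) & L1_norm (F s) <= C"
 shows "in_E T (%ta k. LINT s:{0..ta}|lebesgue. F s k)"
  and "E_norm T (%ta k. LINT s:{0..ta}|lebesgue. F s k) <= T * C"
proof -
 have C: "0 <= C" using order_trans[OF L1_norm_nonneg conjunct2[OF bnd[of 0]]] T by simp
 show "in_E T (%ta k. LINT s:{0..ta}|lebesgue. F s k)"
 proof (rule in_E_LipschitzI[where C=C])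
  show "integrable lebesgue (%k. LINT s:{0..ta}|lebesgue. F s k)" if "ta : {0..T}" for ta
   using bnd that by (intro time_integral_integrable[OF F, of _ C]) auto
  show "L1_norm (%k. (LINT s:{0..ta}|lebesgue. F s k) - (LINT s:{0..sg}|lebesgue. F s k)) <= C * \<bar>ta - sg\<bar>"
   if "ta : {0..T}" "sg : {0..T}" for ta sg
  proof (cases "sg <= ta")
   case True
   then show ?thesis using time_integral_diff[OF F bnd, of T sg ta] that by simp
  next
   case False
   then show ?thesis using time_integral_diff[OF F bnd, of T ta sg] that
    by (subst L1_norm_minus_commute) simp
  qed
 qed
 show "E_norm T (%ta k. LINT s:{0..ta}|lebesgue. F s k) <= T * C"
 proof (rule E_norm_le[OF T])
  fix ta assume ta: "ta : {0..T}"
  then have "L1_norm (%k. LINT s:{0..ta}|lebesgue. F s k) <= ta * C"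
   using bnd by (intro time_integral_norm[OF F]) auto
  also have "... <= T * C" using ta C by (intro mult_right_mono) auto
  finally show "L1_norm (%k. LINT s:{0..ta}|lebesgue. F s k) <= T * C" .
 qed
qed

lemma time_integral_has_weak_gradient:
 fixes N :: "real => real^'d => complex^'e::finite"
 assumes N: "case_prod N : joint_borel" and G: "case_prod G : joint_borel"
  and ta: "0 <= ta"
  and bN: "!!s. s : {0..ta} ==> L1_norm (N s) <= C" and bG: "!!s. s : {0..ta} ==> L1_norm (G s) <= D"
  and d: "!!s. s : {0..ta} ==> has_weak_gradient (N s) (G s)"
 shows "has_weak_gradient (%k. LINT s:{0..ta}|lebesgue. N s k) (%k. LINT s:{0..ta}|lebesgue. G s k)"
 unfolding has_weak_gradient_def
proof (intro conjI allI impI)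
 have i: "integrable lebesgue (N s)" "integrable lebesgue (G s)" if "s : {0..ta}" for s
  using d[OF that] by (auto simp: has_weak_gradient_def)
 show "integrable lebesgue (%k. LINT s:{0..ta}|lebesgue. N s k)"
  using i bN ta by (intro time_integral_integrable[OF N, of _ C]) auto
 show "integrable lebesgue (%k. LINT s:{0..ta}|lebesgue. G s k)"
  using i bG ta by (intro time_integral_integrable[OF G, of _ D]) auto
 fix fi :: "real^'d => real" and e
 assume fi: "test_function fi"
 obtain fi' B where c: "continuous_on UNIV fi'" and B: "!!x. \<bar>fi x\<bar> <= B" "!!x. \<bar>fi' x\<bar> <= B"
  and dd: "!!x t. ((%t. fi (x + t *R axis e 1)) has_vd fi' (x + t *R axis e 1)) (at t)"
  using test_function_derivative[OF fi axis_one_Basis[of e]] by (elim exE conjE) blast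
 have vd: "vector_derivative (%t. fi (k + t *R axis e 1)) (at 0) = fi' k" for k
  using dd[of k 0] by (intro vector_derivative_at) simp
 have mb[measurable]: "fi : borel_fun" "fi' : borel_fun"
  using test_function_measurable[OF fi] c by (auto intro!: borel_measurable_continuous_onI)
 note [measurable] = N G
 have ml: "fi : borel_measurable lebesgue" "fi' : borel_measurable lebesgue"
  by (auto intro: measurable_completion)
 have m1: "case_prod (%s k. fi' k *R N s k) : joint_borel" by measurable
 have m2: "case_prod (%s k. fi k *R (G s k $ e)) : joint_borel"
 proof -
  have "(%x. case_prod G x $ e) : joint_borel"
   using G by (rule borel_measurable_continuous_on[rotated]) (intro continuous_intros)
  then show ?thesis unfolding case_prod_beta' by measurable
 qed
 have b1: "integrable lebesgue (%k. fi' k *R N s k) & L1_norm (%k. fi' k *R N s k) <= B * C" if "s : {0..ta}" for s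
 proof -
  have B0: "0 <= B" using B(1)[of 0] by linarith
  have "integrable lebesgue (%k. fi' k *R N s k) & L1_norm (%k. fi' k *R N s k) <= B * L1_norm (N s)"
   using B i[OF that] ml by (intro L1_norm_mono) (auto intro!: AE_I2 mult_right_mono)
  then show ?thesis using mult_left_mono[OF bN[OF that] B0] by linarith
 qed
 have b2: "integrable lebesgue (%k. fi k *R (G s k $ e)) & L1_norm (%k. fi k *R (G s k $ e)) <= B * D" if "s : {0..ta}" for s
 proof -
  have B0: "0 <= B" using B(1)[of 0] by linarith
  have "integrable lebesgue (%k. fi k *R (G s k $ e)) & L1_norm (%k. fi k *R (G s k $ e)) <= B * L1_norm (G s)"
   using B i[OF that] ml B0 integrable_vec_nth[OF i(2)[OF that], of e] Finite_Cartesian_Product.norm_nth_le[of "G s k" e for k]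
   by (intro L1_norm_mono) (auto intro!: AE_I2 mult_mono)
  then show ?thesis using mult_left_mono[OF bG[OF that] B0] by linarith
 qed
 \<comment> \<open>Taking a component commutes with the integral where the integrand is integrable
   in time, hence for almost every wavevector.\<close>
 have aeG: "AE k in lebesgue. (LINT s:{0..ta}|lebesgue. G s k) $ e = (LINT s:{0..ta}|lebesgue. G s k $ e)"
 proof -
  have "AE k in lebesgue. set_integrable lebesgue {0..ta} (%s. G s k)"
   by (rule time_integral_AE_integrable[OF G]) (use i bG in auto)
  then show ?thesis
  proof eventually_elim
   case (elim k)
   then show ?case unfolding set_integrable_def set_lebesgue_integral_def
    using integral_bounded_linear[OF bounded_linear_vec_nth, of lebesgue "%s. indicat_real {0..ta} s *R G s k" e] by simp
  qed
 qed
 have iGe: "integrable lebesgue (%k. (LINT s:{0..ta}|lebesgue. G s k) $ e)"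
  using i bG ta by (intro integrable_vec_nth time_integral_integrable[OF G, of _ D]) auto
 have "(LINT k|lebesgue. fi' k *R (LINT s:{0..ta}|lebesgue. N s k)) = (LINT k|lebesgue. (LINT s:{0..ta}|lebesgue. fi' k *R N s k))"
 proof -
  have "fi' k *R (LINT s:{0..ta}|lebesgue. N s k) = (LINT s:{0..ta}|lebesgue. fi' k *R N s k)" for k
   unfolding set_lebesgue_integral_def by (subst integral_scaleR_right[symmetric]) (simp add: mult.commute)
  then show ?thesis by (simp only:)
 qed
 also have "... = (LINT s:{0..ta}|lebesgue. (LINT k|lebesgue. fi' k *R N s k))"
  using b1 by (intro time_integral_swap[OF m1 _ ta]) auto
 also have "... = (LINT s:{0..ta}|lebesgue. - (LINT k|lebesgue. fi k *R (G s k $ e)))"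
 proof (rule set_lebesgue_integral_cong)
  show "ALL s. s : {0..ta} --> (LINT k|lebesgue. fi' k *R N s k) = - (LINT k|lebesgue. fi k *R (G s k $ e))"
   using d fi unfolding has_weak_gradient_def vd[symmetric] by blast
 qed simp
 also have "... = - (LINT s:{0..ta}|lebesgue. (LINT k|lebesgue. fi k *R (G s k $ e)))"
  by (simp add: set_lebesgue_integral_def)
 also have "(LINT s:{0..ta}|lebesgue. (LINT k|lebesgue. fi k *R (G s k $ e))) = (LINT k|lebesgue. (LINT s:{0..ta}|lebesgue. fi k *R (G s k $ e)))"
  using b2 by (intro time_integral_swap[OF m2 _ ta, symmetric]) auto
 also have "... = (LINT k|lebesgue. fi k *R (LINT s:{0..ta}|lebesgue. G s k $ e))"
 proof -
  have "(LINT s:{0..ta}|lebesgue. fi k *R (G s k $ e)) = fi k *R (LINT s:{0..ta}|lebesgue. G s k $ e)" for k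
   unfolding set_lebesgue_integral_def by (subst integral_scaleR_right[symmetric]) (simp add: mult.commute)
  then show ?thesis by (simp only:)
 qed
 also have "... = (LINT k|lebesgue. fi k *R ((LINT s:{0..ta}|lebesgue. G s k) $ e))"
 proof (rule integral_cong_AE)
  show "AE k in lebesgue. fi k *R (LINT s:{0..ta}|lebesgue. G s k $ e) = fi k *R ((LINT s:{0..ta}|lebesgue. G s k) $ e)"
   using aeG by eventually_elim simp
  show 2: "(%k. fi k *R ((LINT s:{0..ta}|lebesgue. G s k) $ e)) : borel_measurable lebesgue"
   by (intro borel_measurable_scaleR ml borel_measurable_integrable[OF iGe])
  show "(%k. fi k *R (LINT s:{0..ta}|lebesgue. G s k $ e)) : borel_measurable lebesgue"
   by (rule borel_measurable_lebesgue_AE[OF 2]) (use aeG in eventually_elim, simp)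
 qed
 finally show "(LINT k|lebesgue. vector_derivative (%t. fi (k + t *R axis e 1)) (at 0) *R (LINT s:{0..ta}|lebesgue. N s k))
   = - (LINT k|lebesgue. fi k *R ((LINT s:{0..ta}|lebesgue. G s k) $ e))"
  unfolding vd .
qed

lemma modulate_inverse: "modulate (- r) (modulate r w) = w"
 by (simp add: fun_eq_iff modulate_def vec_eq_iff mult.assoc[symmetric] cis_mult)

text \<open>The integral formula is asked of the modulated field, because the position factor will
  have been absorbed into the integrand \<open>N\<close>. Demodulating by \<open>- r\<close> returns
  continuity in time to \<open>F\<close> itself.\<close>

lemma time_integral_in_E1:
 fixes M :: "('d::finite, 'c::finite) wave_model" and N :: "real => real^'d => complex^'e::finite"
 assumes M: "cutoff M" and T: "0 <= T"
  and N: "case_prod N : joint_borel" and G: "case_prod G : joint_borel"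
  and bN: "!!s. s : {0..T} ==> L1_norm (N s) <= C" and bG: "!!s. s : {0..T} ==> L1_norm (G s) <= D"
  and d: "!!s. s : {0..T} ==> has_weak_gradient (N s) (G s)"
  and F: "!!ta. ta : {0..T} ==> AE k in lebesgue. modulate r (F ta) k = (LINT s:{0..ta}|lebesgue. N s k)"
 shows "in_E1 T r F" and "E1_norm ee T bt r F <= T * (bt powr (1 + ee) * D + C)" and "E_norm T F <= T * C"
proof -
 have i: "integrable lebesgue (N s)" "integrable lebesgue (G s)" if "s : {0..T}" for s
  using d[OF that] by (auto simp: has_weak_gradient_def)
 have eq: "AE k in lebesgue. (LINT s:{0..ta}|lebesgue. N s k) = modulate r (F ta) k" if "ta : {0..T}" for ta
  using F[OF that] by eventually_elim simp
 have 1: "in_E T (%ta k. LINT s:{0..ta}|lebesgue. N s k)" "E_norm T (%ta k. LINT s:{0..ta}|lebesgue. N s k) <= T * C"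
  using i bN by (intro time_integral_in_E[OF N T, of C]; simp)+
 have 2: "in_E T (%ta k. LINT s:{0..ta}|lebesgue. G s k)" "E_norm T (%ta k. LINT s:{0..ta}|lebesgue. G s k) <= T * D"
  using i bG by (intro time_integral_in_E[OF G T, of D]; simp)+
 have 3: "in_E T (%ta. modulate r (F ta))" and 4: "E_norm T (%ta. modulate r (F ta)) <= T * C"
  using in_E_cong[OF 1(1) eq] 1(2) by auto
 have 5: "in_E T F" using in_E_modulate[OF 3, of "- r"] by (simp add: modulate_inverse)
 show 6: "E_norm T F <= T * C" using 4 by (simp add: E_norm_def L1_norm_modulate)
 have 7: "has_weak_gradient (modulate r (F ta)) (%k. LINT s:{0..ta}|lebesgue. G s k)" if "ta : {0..T}" for ta
 proof (rule has_weak_gradient_cong)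
  show "has_weak_gradient (%k. LINT s:{0..ta}|lebesgue. N s k) (%k. LINT s:{0..ta}|lebesgue. G s k)"
   using that bN bG d by (intro time_integral_has_weak_gradient[OF N G, of _ C D]) auto
 qed (use eq[OF that] in auto)
 show "in_E1 T r F" by (rule in_E1I(1)[OF M 5 2(1) 7])
 have "E1_norm ee T bt r F = bt powr (1 + ee) * E_norm T (%ta k. LINT s:{0..ta}|lebesgue. G s k) + E_norm T F"
  by (rule in_E1I(2)[OF M 5 2(1) 7])
 also have "... <= bt powr (1 + ee) * (T * D) + T * C"
  by (intro add_mono mult_left_mono 2 6) simp
 finally show "E1_norm ee T bt r F <= T * (bt powr (1 + ee) * D + C)" by (simp add: algebra_simps)
qed

section \<open>Convolution-type integrals over tuples of wavevectors\<close>

interpretation lborel_product: product_sigma_finite "%_::nat. lborel :: (real^'d) measure"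
 by unfold_locales

text \<open>\<open>xvec m k q\<close> lists the wavevectors \<open>k, k', \<dots>, k\<^sup>(\<^sup>m\<^sup>)\<close> as the coordinates \<open>0, \<dots>, m\<close>.\<close>

definition xvec :: "nat => real^'d => (nat => real^'d) => nat => real^'d"
where "xvec m k q i = (if i = 0 then k else if i < m then q i
 else if i = m then k - (SUM j:{1..<m}. q j) else 0)"

definition Pm :: "nat => (nat => real^'d) measure"
where "Pm m = Pi\<^sub>M {1..<m} (%_. lborel)"

lemma Pm_sigma_finite: "sigma_finite_measure (Pm m :: (nat => real^'d) measure)"
 unfolding Pm_def by (rule lborel_product.sigma_finite) simp

lemma pair_sigma_finite_Pm: "pair_sigma_finite (lborel :: (real^'d) measure) (Pm m)"
 unfolding pair_sigma_finite_def by (intro conjI Pm_sigma_finite sigma_finite_lborel)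

lemma Pm_component: "i : {1..<m} ==> (%q. q i) : Pm m \<rightarrow>\<^sub>M borel"
 using measurable_component_singleton[of i "{1..<m}" "%_. lborel :: (real^'d) measure"]
 unfolding Pm_def by simp

lemma measurable_xvec:
 assumes k: "k : N \<rightarrow>\<^sub>M borel" and q: "q : N \<rightarrow>\<^sub>M Pm m"
 shows "(%p. xvec m (k p) (q p)) : N \<rightarrow>\<^sub>M borel"
proof (rule measurable_coordinatewise_then_product)
 fix i
 note c = measurable_compose[OF q Pm_component]
 show "(%p. xvec m (k p) (q p) i) : N \<rightarrow>\<^sub>M borel"
  unfolding xvec_def using k c by (cases "i = 0"; cases "i < m"; cases "i = m") auto
qed

lemma borel_measurable_coordinate [measurable]: "(%x::nat => real^'d. x j) : borel_fun"
 by (intro borel_measurable_continuous_onI continuous_on_product_coordinates)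

lemma nn_integral_lborel_translate:
 fixes f :: "real^'d => ennreal"
 assumes [measurable]: "f : borel_fun"
 shows "(\<integral>\<^sup>+x. f (x - c) \<partial>lborel) = (\<integral>\<^sup>+x. f x \<partial>lborel)"
proof -
 have "(\<integral>\<^sup>+x. f x \<partial>lborel) = (\<integral>\<^sup>+x. f x \<partial>(distr lborel borel ((+) (- c))))"
  by (simp add: lborel_distr_plus)
 also have "... = (\<integral>\<^sup>+x. f (- c + x) \<partial>lborel)" by (rule nn_integral_distr) auto
 finally show ?thesis by simp
qed

text \<open>For fixed integration variables the last wavevector is a translate of \<open>k\<close>;
  integrating over \<open>k\<close> first decouples it from the others.\<close>

lemma nn_integral_xvec_prod:
 fixes f :: "nat => real^'d => ennreal"
 assumes m: "1 <= m" and f[measurable]: "!!j. f j : borel_fun"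
 shows "(\<integral>\<^sup>+p. (PROD j:{1..m}. f j (xvec m (fst p) (snd p) j)) \<partial>(lborel \<Otimes>\<^sub>M Pm m)) = (PROD j:{1..m}. \<integral>\<^sup>+x. f j x \<partial>lborel)"
proof -
 interpret P: pair_sigma_finite "lborel :: (real^'d) measure" "Pm m" by (rule pair_sigma_finite_Pm)
 have I: "{1..m} = insert m {1..<m}" using m by auto
 have x: "(PROD j:{1..m}. f j (xvec m k q j)) = (PROD j:{1..<m}. f j (q j)) * f m (k - (SUM j:{1..<m}. q j))" for k q
 proof -
  have "(PROD j:{1..<m}. f j (xvec m k q j)) = (PROD j:{1..<m}. f j (q j))"
   by (intro prod.cong) (auto simp: xvec_def)
  moreover have "xvec m k q m = k - (SUM j:{1..<m}. q j)" using m by (simp add: xvec_def)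
  ultimately show ?thesis unfolding I by (simp add: mult.commute)
 qed
 have meas: "(%p. PROD j:{1..m}. f j (xvec m (fst p) (snd p) j)) : borel_measurable (lborel \<Otimes>\<^sub>M Pm m)"
  by (intro borel_measurable_prod_ennreal measurable_compose[OF _ f]
    measurable_compose[OF measurable_xvec borel_measurable_coordinate]) auto
 have "(\<integral>\<^sup>+p. (PROD j:{1..m}. f j (xvec m (fst p) (snd p) j)) \<partial>(lborel \<Otimes>\<^sub>M Pm m))
   = (\<integral>\<^sup>+q. (\<integral>\<^sup>+k. (PROD j:{1..<m}. f j (q j)) * f m (k - (SUM j:{1..<m}. q j)) \<partial>lborel) \<partial>(Pm m))"
  using P.nn_integral_snd[OF meas] by (simp only: x fst_conv snd_conv)
 also have "... = (\<integral>\<^sup>+q. (PROD j:{1..<m}. f j (q j)) * (\<integral>\<^sup>+k. f m k \<partial>lborel) \<partial>(Pm m))"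
  by (intro nn_integral_cong) (simp add: nn_integral_cmult nn_integral_lborel_translate)
 also have "... = (\<integral>\<^sup>+q. (PROD j:{1..<m}. f j (q j)) \<partial>(Pm m)) * (\<integral>\<^sup>+k. f m k \<partial>lborel)"
  by (intro nn_integral_multc borel_measurable_prod_ennreal measurable_compose[OF Pm_component f]) auto
 also have "(\<integral>\<^sup>+q. (PROD j:{1..<m}. f j (q j)) \<partial>(Pm m)) = (PROD j:{1..<m}. \<integral>\<^sup>+x. f j x \<partial>lborel)"
  unfolding Pm_def by (rule lborel_product.product_nn_integral_prod) auto
 finally show ?thesis unfolding I by (simp add: mult.commute)
qed

lemma Pm_translate:
 assumes j: "j : {1..<m}"
 shows "distr (Pm m) (Pm m) (%q. q(j := q j + c)) = (Pm m :: (nat => real^'d) measure)"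
  and "(%q. q(j := q j + c)) : Pm m \<rightarrow>\<^sub>M (Pm m :: (nat => real^'d) measure)"
proof -
 show T: "(%q. q(j := q j + c)) : Pm m \<rightarrow>\<^sub>M (Pm m :: (nat => real^'d) measure)"
  unfolding Pm_def
 proof (rule measurable_PiM_single')
  fix i assume i: "i : {1..<m}"
  show "(%q. (q(j := q j + c)) i) : (Pi\<^sub>M {1..<m} (%_. lborel)) \<rightarrow>\<^sub>M lborel"
   using Pm_component[OF i] Pm_component[OF j] unfolding Pm_def by (cases "i = j") auto
 next
  show "(%q i. (q(j := q j + c)) i) : (space (Pi\<^sub>M {1..<m} (%_. lborel))) \<rightarrow> (\<Pi>\<^sub>E i\<in>{1..<m}. space lborel)"
   using j by (auto simp: space_PiM PiE_iff extensional_def)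
 qed
 show "distr (Pm m) (Pm m) (%q. q(j := q j + c)) = (Pm m :: (nat => real^'d) measure)"
  unfolding Pm_def[symmetric]
 proof (rule lborel_product.PiM_eqI[of "{1..<m}", folded Pm_def])
  fix A :: "nat => (real^'d) set"
  assume A: "!!i. i : {1..<m} ==> A i : sets lborel"
  define B where "B = A(j := (%x. x + c) -` A j)"
  have Aj: "A j : sets borel" using A[OF j] by simp
  have mc: "(%x::real^'d. x + c) : borel \<rightarrow>\<^sub>M borel" by measurable
  have Bj: "(%x. x + c) -` A j : sets borel" using measurable_sets[OF mc Aj] by simp
  have B: "B i : sets lborel" if "i : {1..<m}" for i
   using A[OF that] Bj by (simp add: B_def)
  have eB: "emeasure lborel (B i) = emeasure lborel (A i)" if "i : {1..<m}" for i
  proof (cases "i = j")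
   case True
   have "emeasure lborel (A j) = emeasure (distr lborel borel ((+) c)) (A j)" by (simp add: lborel_distr_plus)
   also have "... = emeasure lborel ((+) c -` A j)" using Aj by (subst emeasure_distr) auto
   also have "(+) c -` A j = (%x. x + c) -` A j" by (auto simp: add.commute)
   finally show ?thesis using True by (simp add: B_def)
  qed (simp add: B_def)
  have pre: "(%q. q(j := q j + c)) -` (\<Pi>\<^sub>E i\<in>{1..<m}. A i) \<inter> space (Pm m) = (\<Pi>\<^sub>E i\<in>{1..<m}. B i)"
  proof (intro set_eqI iffI)
   fix q :: "nat => real^'d"
   assume q: "q : (%q. q(j := q j + c)) -` (\<Pi>\<^sub>E i\<in>{1..<m}. A i) \<inter> space (Pm m)"
   have ext: "q : extensional {1..<m}" using q by (simp add: Pm_def space_PiM PiE_iff)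
   have mem: "(q(j := q j + c)) i : A i" if "i : {1..<m}" for i
    using q that by (auto simp: PiE_iff)
   have "q i : B i" if "i : {1..<m}" for i
    using mem[OF that] by (cases "i = j") (auto simp: B_def)
   then show "q : (\<Pi>\<^sub>E i\<in>{1..<m}. B i)" using ext by (simp add: PiE_iff)
  next
   fix q :: "nat => real^'d"
   assume q: "q : (\<Pi>\<^sub>E i\<in>{1..<m}. B i)"
   have "(q(j := q j + c)) i : A i" if "i : {1..<m}" for i
    using q that PiE_mem[OF q that] by (cases "i = j") (auto simp: B_def)
   moreover have "q(j := q j + c) : extensional {1..<m}"
    using q j by (auto simp: PiE_iff extensional_def)
   ultimately show "q : (%q. q(j := q j + c)) -` (\<Pi>\<^sub>E i\<in>{1..<m}. A i) \<inter> space (Pm m)"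
    using q by (simp add: Pm_def space_PiM PiE_iff)
  qed
  have "emeasure (distr (Pm m) (Pm m) (%q. q(j := q j + c))) (\<Pi>\<^sub>E i\<in>{1..<m}. A i) = emeasure (Pm m) (\<Pi>\<^sub>E i\<in>{1..<m}. B i)"
   unfolding pre[symmetric] using A by (intro emeasure_distr T) (auto simp: Pm_def intro!: sets_PiM_I_finite)
  also have "... = (PROD i:{1..<m}. emeasure lborel (B i))"
   unfolding Pm_def using B by (intro lborel_product.emeasure_PiM) auto
  also have "... = (PROD i:{1..<m}. emeasure lborel (A i))" using eB by (intro prod.cong) auto
  finally show "emeasure (distr (Pm m) (Pm m) (%q. q(j := q j + c))) (\<Pi>\<^sub>E i\<in>{1..<m}. A i) = (PROD i:{1..<m}. emeasure lborel (A i))" .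
 qed auto
qed

text \<open>Kernels are functions of a full tuple of wavevectors, but they are integrated only over
  the tuples whose first entry is the sum of the others, parametrised by \<open>k\<close> and
  \<open>q\<close>.\<close>

definition xint :: "nat => ((nat => real^'d) => 'v::euclidean_space) => bool"
where "xint m Ph \<longleftrightarrow> Ph : borel_fun &
 integrable (lborel \<Otimes>\<^sub>M Pm m) (%p. Ph (xvec m (fst p) (snd p)))"

definition xnorm :: "nat => ((nat => real^'d) => 'v::euclidean_space) => real"
where "xnorm m Ph = (LINT p|(lborel \<Otimes>\<^sub>M Pm m). norm (Ph (xvec m (fst p) (snd p))))"

definition Iop :: "nat => ((nat => real^'d) => 'v::euclidean_space) => real^'d => 'v"
where "Iop m Ph k = (LINT q|Pm m. Ph (xvec m k q))"

lemma Iop_joint_measurable: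
 fixes Ph :: "real => (nat => real^'d) => 'v::euclidean_space"
 assumes Ph: "case_prod Ph : joint_borel"
 shows "case_prod (%s. Iop m (Ph s)) : joint_borel"
proof -
 interpret S: sigma_finite_measure "Pm m :: (nat => real^'d) measure" by (rule Pm_sigma_finite)
 have x: "(%z. xvec m (snd (fst z)) (snd z)) : (borel \<Otimes>\<^sub>M borel) \<Otimes>\<^sub>M Pm m \<rightarrow>\<^sub>M (borel :: (nat => real^'d) measure)"
  by (rule measurable_xvec) measurable
 have "(%z. (fst (fst z), xvec m (snd (fst z)) (snd z))) : (borel \<Otimes>\<^sub>M borel) \<Otimes>\<^sub>M Pm m \<rightarrow>\<^sub>M (borel :: real measure) \<Otimes>\<^sub>M (borel :: (nat => real^'d) measure)"
  by (rule measurable_Pair[OF _ x]) measurable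
 from measurable_compose[OF this Ph]
 have "(%(p, q). Ph (fst p) (xvec m (snd p) q)) : borel_measurable ((borel \<Otimes>\<^sub>M borel) \<Otimes>\<^sub>M Pm m)"
  by (simp add: case_prod_beta')
 from S.borel_measurable_lebesgue_integral[OF this] show ?thesis
  by (simp add: Iop_def case_prod_beta')
qed

lemma xvec_pair_measurable: "(%p. xvec m (fst p) (snd p)) : lborel \<Otimes>\<^sub>M Pm m \<rightarrow>\<^sub>M borel"
 by (rule measurable_xvec) auto

lemma Iop_measurable:
 fixes Ph :: "(nat => real^'d) => 'v::euclidean_space"
 assumes "Ph : borel_fun"
 shows "Iop m Ph : borel_fun"
proof -
 interpret S: sigma_finite_measure "Pm m :: (nat => real^'d) measure" by (rule Pm_sigma_finite)
 have "(%(k, q). Ph (xvec m k q)) : borel_measurable (borel \<Otimes>\<^sub>M Pm m)"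
  unfolding case_prod_beta' by (intro measurable_compose[OF measurable_xvec assms]) auto
 from S.borel_measurable_lebesgue_integral[OF this] show ?thesis by (simp add: Iop_def[abs_def])
qed

lemma xint_AE:
 assumes "xint m Ph"
 shows "AE k in lebesgue. integrable (Pm m) (%q. Ph (xvec m k q))"
proof -
 interpret P: pair_sigma_finite "lborel :: (real^'d) measure" "Pm m" by (rule pair_sigma_finite_Pm)
 show ?thesis using P.AE_integrable_fst'[of "%p. Ph (xvec m (fst p) (snd p))"] assms
  by (simp add: xint_def AE_completion_iff)
qed

lemma Iop_norm:
 fixes Ph :: "(nat => real^'d) => 'v::euclidean_space"
 assumes Ph: "xint m Ph"
 shows "integrable lebesgue (Iop m Ph)" and "L1_norm (Iop m Ph) <= xnorm m Ph"
proof -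
 interpret P: pair_sigma_finite "lborel :: (real^'d) measure" "Pm m" by (rule pair_sigma_finite_Pm)
 have m: "Iop m Ph : borel_fun" using Ph by (auto simp: xint_def intro: Iop_measurable)
 have i: "integrable (lborel \<Otimes>\<^sub>M Pm m) (%p. Ph (xvec m (fst p) (snd p)))" using Ph by (simp add: xint_def)
 have i1: "integrable lborel (Iop m Ph)" using P.integrable_fst'[OF i] by (simp add: Iop_def[abs_def])
 then show "integrable lebesgue (Iop m Ph)" using m by (subst integrable_completion) auto
 have "L1_norm (Iop m Ph) = (LINT k|lborel. norm (Iop m Ph k))"
  unfolding L1_norm_def using m by (intro integral_completion) auto
 also have "... <= (LINT k|lborel. LINT q|Pm m. norm (Ph (xvec m k q)))"
  unfolding Iop_def using i1 P.integrable_fst'[OF integrable_norm[OF i]]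
  by (intro integral_mono integral_norm_bound) (auto simp: Iop_def[abs_def])
 also have "... = xnorm m Ph"
  using P.integral_fst'[OF integrable_norm[OF i]] by (simp add: xnorm_def)
 finally show "L1_norm (Iop m Ph) <= xnorm m Ph" .
qed

lemma xint_add: "xint m Ph ==> xint m Ps ==> xint m (%x. Ph x + Ps x)"
 by (auto simp: xint_def)

lemma xint_diff: "xint m Ph ==> xint m Ps ==> xint m (%x. Ph x - Ps x)"
 by (auto simp: xint_def)

lemma xint_scaleR: "xint m Ph ==> xint m (%x. c *R Ph x)"
 by (auto simp: xint_def)

lemma xint_sum: "(!!i. i : A ==> xint m (Ph i)) ==> xint m (%x. SUM i:A. Ph i x)"
 unfolding xint_def by (intro conjI borel_measurable_sum Bochner_Integration.integrable_sum) auto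

lemma xnorm_add:
 assumes "xint m Ph" "xint m Ps"
 shows "xnorm m (%x. Ph x + Ps x) <= xnorm m Ph + xnorm m Ps"
proof -
 have "xnorm m (%x. Ph x + Ps x) <= (LINT p|(lborel \<Otimes>\<^sub>M Pm m). norm (Ph (xvec m (fst p) (snd p))) + norm (Ps (xvec m (fst p) (snd p))))"
  unfolding xnorm_def using assms by (intro integral_mono) (auto simp: xint_def intro: norm_triangle_ineq)
 then show ?thesis using assms by (simp add: xnorm_def xint_def)
qed

lemma Iop_diff:
 assumes "xint m Ph" "xint m Ps"
 shows "AE k in lebesgue. Iop m (%x. Ph x - Ps x) k = Iop m Ph k - Iop m Ps k"
 using xint_AE[OF assms(1)] xint_AE[OF assms(2)]
 by eventually_elim (simp add: Iop_def)

lemma Iop_scaleR: "Iop m (%x. c *R Ph x) k = c *R Iop m Ph k"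
 by (simp add: Iop_def)

lemma Iop_sum:
 assumes "finite A" "!!i. i : A ==> xint m (Ph i)"
 shows "AE k in lebesgue. Iop m (%x. SUM i:A. Ph i x) k = (SUM i:A. Iop m (Ph i) k)"
proof -
 have "AE k in lebesgue. ALL i:A. integrable (Pm m) (%q. Ph i (xvec m k q))"
  using assms by (subst AE_ball_countable) (auto intro: countable_finite xint_AE)
 then show ?thesis by eventually_elim (simp add: Iop_def)
qed

definition field_prod :: "nat => (nat => real^'d => real) => (nat => real^'d) => real"
where "field_prod m a x = (PROD i<m. a i (x (Suc i)))"

lemma field_prod_measurable:
 assumes "!!i. i < m ==> a i : borel_fun"
 shows "field_prod m a : borel_fun"
 unfolding field_prod_def[abs_def]
 by (intro borel_measurable_prod measurable_compose[OF borel_measurable_coordinate] assms) auto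

text \<open>The integral of the product of the moduli factorises into L1 norms: Young's inequality
  for L1 convolutions, with a bounded kernel.\<close>

lemma field_prod_norm:
 fixes b :: "(nat => real^'d) => 'v::euclidean_space"
 assumes m: "1 <= m" and a: "!!i. i < m ==> a i : borel_fun" "!!i. i < m ==> integrable lebesgue (a i)"
  and b: "b : borel_fun" "!!x. norm (b x) <= B"
 shows "xint m (%x. field_prod m a x *R b x)"
  and "xnorm m (%x. field_prod m a x *R b x) <= B * (PROD i<m. L1_norm (a i))"
proof -
 have B: "0 <= B" using b(2) norm_ge_zero order_trans by blast
 \<comment> \<open>Slot \<open>i\<close> of the fields belongs to wavevector \<open>Suc i\<close>,
   since coordinate 0 is the output \<open>k\<close>.\<close>
 have sh: "(PROD j:{1..m}. g j) = (PROD i<m. g (Suc i))" for g :: "nat => ennreal"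
  by (simp add: prod.atLeast1_atMost_eq)
 define a' where "a' j = (if 1 <= j & j <= m then a (j - 1) else (%_. 0))" for j
 have a': "a' j : borel_fun" for j using a(1)[of "j - 1"] by (auto simp: a'_def)
 have na: "(%x. norm (a' j x)) : borel_fun" for j using a'[of j] by measurable
 have fm: "(%x. field_prod m a x *R b x) : borel_fun"
  using field_prod_measurable[of m a, OF a(1)] b(1) by (intro borel_measurable_scaleR)
 have meas: "(%p. field_prod m a (xvec m (fst p) (snd p)) *R b (xvec m (fst p) (snd p))) : borel_measurable (lborel \<Otimes>\<^sub>M Pm m)"
  using measurable_compose[OF xvec_pair_measurable fm] .
 have "(\<integral>\<^sup>+p. ennreal (norm (field_prod m a (xvec m (fst p) (snd p)) *R b (xvec m (fst p) (snd p)))) \<partial>(lborel \<Otimes>\<^sub>M Pm m))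
   <= (\<integral>\<^sup>+p. ennreal B * (PROD j:{1..m}. ennreal (norm (a' j (xvec m (fst p) (snd p) j)))) \<partial>(lborel \<Otimes>\<^sub>M Pm m))"
 proof (rule nn_integral_mono)
  fix p :: "(real^'d) \<times> (nat => real^'d)"
  let ?x = "xvec m (fst p) (snd p)"
  have "(PROD j:{1..m}. ennreal (norm (a' j (?x j)))) = (PROD i<m. ennreal (norm (a i (?x (Suc i)))))"
   unfolding sh by (intro prod.cong) (auto simp: a'_def)
  also have "... = ennreal (norm (field_prod m a ?x))"
   by (simp add: field_prod_def prod_ennreal abs_prod)
  finally have "ennreal B * (PROD j:{1..m}. ennreal (norm (a' j (?x j)))) = ennreal (B * norm (field_prod m a ?x))"
   using B by (simp add: ennreal_mult)
  moreover have "norm (field_prod m a ?x *R b ?x) <= B * norm (field_prod m a ?x)"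
   using b(2)[of ?x] by (simp add: mult.commute[of B] mult_left_mono)
  ultimately show "ennreal (norm (field_prod m a ?x *R b ?x)) <= ennreal B * (PROD j:{1..m}. ennreal (norm (a' j (?x j))))"
   by (simp add: ennreal_leI)
 qed
 also have "... = ennreal B * (\<integral>\<^sup>+p. (PROD j:{1..m}. ennreal (norm (a' j (xvec m (fst p) (snd p) j)))) \<partial>(lborel \<Otimes>\<^sub>M Pm m))"
  by (intro nn_integral_cmult borel_measurable_prod_ennreal measurable_compose[OF _ measurable_ennreal]
    measurable_compose[OF measurable_compose[OF xvec_pair_measurable borel_measurable_coordinate] na])
 also have "... = ennreal B * (PROD j:{1..m}. \<integral>\<^sup>+x. ennreal (norm (a' j x)) \<partial>lborel)"
  using a' by (subst nn_integral_xvec_prod[OF m]) auto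
 also have "(PROD j:{1..m}. \<integral>\<^sup>+x. ennreal (norm (a' j x)) \<partial>lborel) = (PROD i<m. ennreal (L1_norm (a i)))"
  unfolding sh
 proof (intro prod.cong refl)
  fix i assume "i : {..<m}"
  then have i: "i < m" by simp
  have "(\<integral>\<^sup>+x. ennreal (norm (a i x)) \<partial>lborel) = (\<integral>\<^sup>+x. ennreal (norm (a i x)) \<partial>lebesgue)"
   by (rule nn_integral_completion[symmetric])
  also have "... = ennreal (L1_norm (a i))"
   unfolding L1_norm_def using a(2)[OF i] by (intro nn_integral_eq_integral) auto
  finally show "(\<integral>\<^sup>+x. ennreal (norm (a' (Suc i) x)) \<partial>lborel) = ennreal (L1_norm (a i))"
   using i by (simp add: a'_def)
 qed
 also have "ennreal B * (PROD i<m. ennreal (L1_norm (a i))) = ennreal (B * (PROD i<m. L1_norm (a i)))"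
  using B by (simp add: prod_ennreal ennreal_mult prod_nonneg)
 finally have le: "(\<integral>\<^sup>+p. ennreal (norm (field_prod m a (xvec m (fst p) (snd p)) *R b (xvec m (fst p) (snd p)))) \<partial>(lborel \<Otimes>\<^sub>M Pm m))
   <= ennreal (B * (PROD i<m. L1_norm (a i)))" .
 then have int: "integrable (lborel \<Otimes>\<^sub>M Pm m) (%p. field_prod m a (xvec m (fst p) (snd p)) *R b (xvec m (fst p) (snd p)))"
  using meas by (intro integrableI_bounded) (auto intro: le_less_trans)
 then show "xint m (%x. field_prod m a x *R b x)" using fm by (simp add: xint_def)
 have "ennreal (xnorm m (%x. field_prod m a x *R b x)) <= ennreal (B * (PROD i<m. L1_norm (a i)))"
  using le nn_integral_eq_integral[OF integrable_norm[OF int]] by (simp add: xnorm_def)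
 then show "xnorm m (%x. field_prod m a x *R b x) <= B * (PROD i<m. L1_norm (a i))"
  using B by (subst (asm) ennreal_le_iff) (auto intro!: mult_nonneg_nonneg prod_nonneg)
qed

section \<open>Differentiation of the integrals with one slot shifted along with the output\<close>

text \<open>Moving the output and one further wavevector by the same vector respects the constraint
  that the output is the sum of the others. This is the direction in which interactions are
  differentiated.\<close>

definition shift2 :: "nat => real^'d => real => (nat => real^'d) => nat => real^'d"
where "shift2 j e t x = (%i. if i = 0 | i = Suc j then x i + t *R e else x i)"

lemma shift2_0 [simp]: "shift2 j e 0 x = x"
 by (simp add: shift2_def fun_eq_iff)

lemma shift2_add: "shift2 j e s (shift2 j e t x) = shift2 j e (t + s) x"
 by (auto simp: shift2_def fun_eq_iff algebra_simps)

lemma measurable_shift2: "shift2 j e t : borel \<rightarrow>\<^sub>M borel"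
proof (rule measurable_coordinatewise_then_product)
 fix i
 have "(%x::nat => real^'a. x i) : borel_fun" by measurable
 then show "(%x. shift2 j e t x i) : borel_fun"
  unfolding shift2_def by (cases "i = 0 | i = Suc j") auto
qed

text \<open>Translating one integration variable preserves the measure and keeps the last wavevector
  fixed while \<open>k\<close> moves. If slot \<open>j\<close> is the last one, its wavevector
  follows \<open>k\<close> by itself.\<close>

lemma Iop_shift:
 fixes Ph :: "(nat => real^'d) => 'v::euclidean_space"
 assumes j: "j < m" and Ph: "Ph : borel_fun"
 shows "Iop m Ph (k + t *R e) = Iop m (%x. Ph (shift2 j e t x)) k"
proof (cases "Suc j < m")
 case True
 then have i: "Suc j : {1..<m}" by simp
 have x: "xvec m (k + t *R e) (q(Suc j := q (Suc j) + t *R e)) = shift2 j e t (xvec m k q)" for q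
 proof
  fix i
  have "(SUM l:{1..<m}. (q(Suc j := q (Suc j) + t *R e)) l) = (SUM l:{1..<m}. q l + (if l = Suc j then t *R e else 0))"
   by (intro sum.cong) auto
  also have "... = (SUM l:{1..<m}. q l) + t *R e" using True by (simp add: sum.distrib)
  finally have s: "(SUM l:{1..<m}. (q(Suc j := q (Suc j) + t *R e)) l) = (SUM l:{1..<m}. q l) + t *R e" .
  show "xvec m (k + t *R e) (q(Suc j := q (Suc j) + t *R e)) i = shift2 j e t (xvec m k q) i"
   unfolding xvec_def s shift2_def using True by auto
 qed
 have "(%q. Ph (xvec m (k + t *R e) q)) : borel_measurable (Pm m)"
  by (intro measurable_compose[OF measurable_xvec Ph]) auto
 from integral_distr[OF Pm_translate(2)[OF i] this, of "t *R e"]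
 show ?thesis unfolding Pm_translate(1)[OF i] x Iop_def .
next
 case False
 then have m: "Suc j = m" using j by simp
 have "xvec m (k + t *R e) q = shift2 j e t (xvec m k q)" for q
  using m by (auto simp: fun_eq_iff xvec_def shift2_def)
 then show ?thesis by (simp add: Iop_def)
qed

lemma has_vector_derivative_shift2:
 fixes b :: "(nat => real^'d) => 'v::real_normed_vector"
 assumes "!!x. ((%t. b (shift2 j e t x)) has_vd db x) (at 0)"
 shows "((%t. b (shift2 j e t x)) has_vd db (shift2 j e t x)) (at t)"
proof -
 have 1: "((%s. s - t) has_vd 1) (at t)"
  by (auto intro!: derivative_eq_intros simp: has_vector_derivative_def)
 have 2: "((%s. b (shift2 j e s (shift2 j e t x))) has_vd db (shift2 j e t x)) (at ((%s. s - t) t))"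
  using assms[of "shift2 j e t x"] by simp
 have "(%s. b (shift2 j e s (shift2 j e t x))) \<circ> (%s. s - t) = (%s. b (shift2 j e s x))"
  by (simp add: fun_eq_iff shift2_add)
 then show ?thesis using vector_diff_chain_at[OF 1 2] by simp
qed

lemma shift2_derivative_bound:
 fixes b :: "(nat => real^'d) => 'v::real_normed_vector"
 assumes "!!x. ((%t. b (shift2 j e t x)) has_vd db x) (at 0)" "!!x. norm (db x) <= B'"
 shows "norm (b (shift2 j e t x) - b x) <= B' * \<bar>t\<bar>"
 using norm_diff_le_derivative_bound[where h="%t. b (shift2 j e t x)" and B=B' and s=t and u=0,
   OF has_vector_derivative_shift2[OF assms(1)] assms(2)] by simp

lemma has_vector_derivative_at_right_limit:
 assumes "(f has_vector_derivative D) (at 0)"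
 shows "((%t. (1 / t) *R (f t - f 0)) \<longlongrightarrow> D) (at_right 0)"
proof -
 have "((%t. norm ((f t - f 0) - (t - 0) *R D) / norm (t - 0)) \<longlongrightarrow> 0) (at 0)"
  using assms unfolding has_vector_derivative_def has_derivative_iff_norm by simp
 then have "((%t. norm ((f t - f 0) - (t - 0) *R D) / norm (t - 0)) \<longlongrightarrow> 0) (at_right 0)"
  by (rule tendsto_within_subset) simp
 moreover have "\<forall>\<^sub>F t in at_right 0. norm ((f t - f 0) - (t - 0) *R D) / norm (t - 0) = norm ((1 / t) *R (f t - f 0) - D)"
  unfolding eventually_at_right_field
 proof (intro exI[of _ 1] conjI allI impI)
  fix t :: real assume t: "0 < t"
  have "(1 / t) *R (f t - f 0) - D = (1 / t) *R ((f t - f 0) - t *R D)"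
   using t by (simp add: scaleR_diff_right)
  then have "norm ((1 / t) *R (f t - f 0) - D) = norm ((1 / t) *R ((f t - f 0) - t *R D))" by (simp only:)
  then show "norm ((f t - f 0) - (t - 0) *R D) / norm (t - 0) = norm ((1 / t) *R (f t - f 0) - D)"
   using t by simp
 qed simp
 ultimately have "((%t. norm ((1 / t) *R (f t - f 0) - D)) \<longlongrightarrow> 0) (at_right 0)"
  by (rule Lim_transform_eventually)
 then show ?thesis by (rule tendsto_norm_zero_cancel[THEN LIM_zero_cancel])
qed

text \<open>Kernel derivatives will be obtained by choice at each point. As limits of quotients with
  steps \<open>1 / Suc n\<close> they are measurable nevertheless.\<close>

lemma shift2_derivative_measurable:
 fixes b :: "real => (nat => real^'d) => 'v::euclidean_space"
 assumes b: "case_prod b : joint_borel"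
  and d: "!!s x. ((%t. b s (shift2 j e t x)) has_vd db s x) (at 0)"
 shows "case_prod db : joint_borel"
proof (rule borel_measurable_LIMSEQ_metric)
 fix n
 have "(%p. (fst p, shift2 j e (1 / real (Suc n)) (snd p))) : borel \<Otimes>\<^sub>M borel \<rightarrow>\<^sub>M (borel :: real measure) \<Otimes>\<^sub>M (borel :: (nat => real^'d) measure)"
  by (intro measurable_Pair measurable_fst measurable_compose[OF measurable_snd measurable_shift2])
 from measurable_compose[OF this b] b
 show "(%p. (1 / (1 / real (Suc n))) *R (b (fst p) (shift2 j e (1 / real (Suc n)) (snd p)) - b (fst p) (snd p))) : joint_borel"
  by (intro borel_measurable_scaleR borel_measurable_diff borel_measurable_const) (simp_all add: case_prod_beta')
next
 fix p :: "real \<times> (nat => real^'d)"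
 show "(%n. (1 / (1 / real (Suc n))) *R (b (fst p) (shift2 j e (1 / real (Suc n)) (snd p)) - b (fst p) (snd p))) \<longlonglongrightarrow> case_prod db p"
  using filterlim_compose[OF has_vector_derivative_at_right_limit[OF d] inverse_Suc_at_right, of "fst p" "snd p"]
  by (simp add: case_prod_beta')
qed

lemma field_prod_upd:
 assumes "j < m"
 shows "field_prod m (a(j := h)) x = h (x (Suc j)) * (PROD i:{..<m} - {j}. a i (x (Suc i)))"
proof -
 have "field_prod m (a(j := h)) x = (PROD i:insert j ({..<m} - {j}). (a(j := h)) i (x (Suc i)))"
  unfolding field_prod_def using assms by (intro prod.cong) auto
 also have "... = h (x (Suc j)) * (PROD i:{..<m} - {j}. (a(j := h)) i (x (Suc i)))"
  by (subst prod.insert) auto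
 also have "(PROD i:{..<m} - {j}. (a(j := h)) i (x (Suc i))) = (PROD i:{..<m} - {j}. a i (x (Suc i)))"
  by (intro prod.cong) auto
 finally show ?thesis .
qed

lemma prod_L1_norm_upd:
 fixes j m :: nat
 assumes "j < m"
 shows "(PROD i<m. L1_norm ((a(j := h)) i)) = L1_norm h * (PROD i:{..<m} - {j}. L1_norm (a i))"
proof -
 have "(PROD i<m. L1_norm ((a(j := h)) i)) = (PROD i:insert j ({..<m} - {j}). L1_norm ((a(j := h)) i))"
  using assms by (intro prod.cong) auto
 also have "... = L1_norm h * (PROD i:{..<m} - {j}. L1_norm ((a(j := h)) i))"
  by (subst prod.insert) auto
 also have "(PROD i:{..<m} - {j}. L1_norm ((a(j := h)) i)) = (PROD i:{..<m} - {j}. L1_norm (a i))"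
  by (intro prod.cong) auto
 finally show ?thesis .
qed

text \<open>The product rule: moving \<open>k\<close> and the argument of the \<open>j\<close>-th field together leaves the other fields alone.\<close>

lemma has_L1_derivative_Iop:
 fixes a :: "nat => real^'d => real" and b :: "(nat => real^'d) => 'v::euclidean_space"
 assumes m: "1 <= m" and j: "j < m"
  and a: "!!i. i < m ==> a i : borel_fun" "!!i. i < m ==> integrable lebesgue (a i)"
  and g: "g : borel_fun" and dg: "has_L1_derivative (a j) e g"
  and b: "b : borel_fun" "!!x. norm (b x) <= B"
  and db: "!!x. ((%t. b (shift2 j e t x)) has_vd db x) (at 0)" "!!x. norm (db x) <= B'"
  and dbm: "db : borel_fun"
 shows "has_L1_derivative (Iop m (%x. field_prod m a x *R b x)) e
  (Iop m (%x. field_prod m a x *R db x + field_prod m (a(j := g)) x *R b x))"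
proof -
 have B': "0 <= B'" using db(2) norm_ge_zero order_trans by blast
 have B: "0 <= B" using b(2) norm_ge_zero order_trans by blast
 define P where "P = (PROD i:{..<m} - {j}. L1_norm (a i))"
 have P: "0 <= P" unfolding P_def by (intro prod_nonneg) auto
 have gi: "integrable lebesgue g" using dg by (simp add: has_L1_derivative_def)
 let ?Ph = "%x. field_prod m a x *R b x"
 let ?Ps = "%x. field_prod m a x *R db x + field_prod m (a(j := g)) x *R b x"
 have upd: "(a(j := h)) i : borel_fun" "integrable lebesgue ((a(j := h)) i)"
  if "h : borel_fun" "integrable lebesgue h" "i < m" for h i
  using a[OF that(3)] that by auto
 have xPh: "xint m ?Ph" by (rule field_prod_norm(1)[OF m a b])
 have xPs: "xint m ?Ps"
  by (intro xint_add field_prod_norm(1)[OF m a dbm db(2)] field_prod_norm(1)[OF m upd b] g gi)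
 define al where "al t y = a j (y + t *R e)" for t y
 have al: "al t : borel_fun" "integrable lebesgue (al t)" for t
 proof -
  have [measurable]: "a j : borel_fun" by (rule a(1)[OF j])
  show "al t : borel_fun" unfolding al_def[abs_def] by measurable
  show "integrable lebesgue (al t)" unfolding al_def[abs_def] by (intro integrable_translate a j)
 qed
 define D where "D t y = (1 / t) * (al t y - a j y) - g y" for t y
 have D: "D t : borel_fun" "integrable lebesgue (D t)" for t
  unfolding D_def[abs_def] using al a[OF j] g gi by auto
 have D0: "((%t. L1_norm (D t)) \<longlongrightarrow> 0) (at_right 0)"
  using dg by (simp add: has_L1_derivative_def D_def[abs_def] al_def)
 have bs: "(%x. b (shift2 j e t x)) : borel_fun" for t
  by (rule measurable_compose[OF measurable_shift2 b(1)])
 have Pht: "?Ph (shift2 j e t x) = field_prod m (a(j := al t)) x *R b (shift2 j e t x)" for t x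
 proof -
  have "field_prod m a (shift2 j e t x) = field_prod m (a(j := al t)) x"
   unfolding field_prod_def by (intro prod.cong) (auto simp: shift2_def al_def)
  then show ?thesis by simp
 qed
 have xPht: "xint m (%x. ?Ph (shift2 j e t x))" for t
  unfolding Pht by (intro field_prod_norm(1)[OF m upd bs b(2)] al)
 \<comment> \<open>The error of the difference quotient splits into three terms. \<open>?T1\<close>
   is small because the quotient of the field converges in L1, \<open>?T2\<close> is of order
   \<open>t\<close> by the Lipschitz bound on the kernel, and \<open>?T3\<close>, the error of the
   kernel quotient, tends to 0 by dominated convergence.\<close>
 let ?T1 = "%t x. field_prod m (a(j := D t)) x *R b (shift2 j e t x)"
 let ?T2 = "%t x. field_prod m (a(j := g)) x *R (b (shift2 j e t x) - b x)"
 let ?T3 = "%t x. field_prod m a x *R ((1 / t) *R (b (shift2 j e t x) - b x) - db x)"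
 note bd = shift2_derivative_bound[OF db]
 have T1: "xint m (?T1 t)" "xnorm m (?T1 t) <= B * (L1_norm (D t) * P)" for t
  using field_prod_norm[where a="a(j := D t)" and b="%x. b (shift2 j e t x)" and B=B,
    OF m upd(1)[OF D] upd(2)[OF D] bs b(2)] unfolding prod_L1_norm_upd[OF j] P_def by auto
 have T2: "xint m (?T2 t)" "xnorm m (?T2 t) <= (B' * \<bar>t\<bar>) * (L1_norm g * P)" for t
  using field_prod_norm[where a="a(j := g)" and b="%x. b (shift2 j e t x) - b x" and B="B' * \<bar>t\<bar>",
    OF m upd(1)[OF g gi] upd(2)[OF g gi] borel_measurable_diff[OF bs b(1)] bd] unfolding prod_L1_norm_upd[OF j] P_def by auto
 have d3: "norm ((1 / t) *R (b (shift2 j e t x) - b x) - db x) <= 2 * B'" if "t > 0" for t x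
 proof -
  have "norm ((1 / t) *R (b (shift2 j e t x) - b x)) <= B'"
  proof -
   have "norm ((1 / t) *R (b (shift2 j e t x) - b x)) = (1 / t) * norm (b (shift2 j e t x) - b x)"
    using that by simp
   also have "... <= (1 / t) * (B' * \<bar>t\<bar>)" using bd[of t x] that by (intro mult_left_mono) auto
   also have "... = B'" using that by simp
   finally show ?thesis .
  qed
  then show ?thesis using db(2)[of x] norm_triangle_ineq4[of "(1 / t) *R (b (shift2 j e t x) - b x)" "db x"] by simp
 qed
 have m3: "(%x. (1 / t) *R (b (shift2 j e t x) - b x) - db x) : borel_fun" for t
  using bs b(1) dbm by measurable
 have T3: "xint m (?T3 t)" if "t > 0" for t
  by (rule field_prod_norm(1)[OF m a m3 d3[OF that]])
 have sum: "(1 / t) *R (?Ph (shift2 j e t x) - ?Ph x) - ?Ps x = ?T1 t x + (?T2 t x + ?T3 t x)" for t x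
 proof -
  define R where "R = (PROD i:{..<m} - {j}. a i (x (Suc i)))"
  have fa: "field_prod m a x = a j (x (Suc j)) * R"
   using field_prod_upd[OF j, of a "a j" x] by (simp add: R_def)
  show ?thesis
   unfolding Pht field_prod_upd[OF j] fa R_def[symmetric] D_def by (simp add: algebra_simps)
 qed
 have lim3: "((%t. xnorm m (?T3 t)) \<longlongrightarrow> 0) (at_right 0)"
 proof (rule tendsto_at_right_sequentially[of 0 1])
  fix S :: "nat => real"
  assume S: "!!n. 0 < S n" "S \<longlonglongrightarrow> 0"
  have "S n ~= 0" for n using S(1)[of n] by simp
  then have Sr: "filterlim S (at_right 0) sequentially" using S by (auto simp: filterlim_at)
  let ?X = "%p. xvec m (fst p) (snd p) :: nat => real^'d"
  have "(%n. LINT p|(lborel \<Otimes>\<^sub>M Pm m). norm (?T3 (S n) (?X p))) \<longlonglongrightarrow> (LINT p|((lborel :: (real^'d) measure) \<Otimes>\<^sub>M (Pm m :: (nat => real^'d) measure)). (0::real))"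
  proof (rule integral_dominated_convergence[where w="%p. 2 * B' * norm (field_prod m a (?X p) *R (1::real))"])
   have "xint m (%x. field_prod m a x *R (1::real))"
    by (rule field_prod_norm(1)[OF m a, where B=1]) auto
   then show "integrable (lborel \<Otimes>\<^sub>M Pm m) (%p. 2 * B' * norm (field_prod m a (?X p) *R (1::real)))"
    by (simp add: xint_def)
   show "(%p. norm (?T3 (S n) (?X p))) : borel_measurable (lborel \<Otimes>\<^sub>M Pm m)" for n
    using measurable_compose[OF borel_measurable_integrable[OF conjunct2[OF T3[OF S(1)[of n], unfolded xint_def]]] borel_measurable_norm] .
   show "AE p in lborel \<Otimes>\<^sub>M Pm m. (%n. norm (?T3 (S n) (?X p))) \<longlonglongrightarrow> 0"
   proof (rule AE_I2)
    fix p :: "(real^'d) \<times> (nat => real^'d)"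
    have "(%n. (1 / S n) *R (b (shift2 j e (S n) (?X p)) - b (?X p))) \<longlonglongrightarrow> db (?X p)"
     using filterlim_compose[OF has_vector_derivative_at_right_limit[OF db(1)] Sr, of "?X p"] by simp
    then have "(%n. ?T3 (S n) (?X p)) \<longlonglongrightarrow> field_prod m a (?X p) *R (db (?X p) - db (?X p))"
     by (intro tendsto_intros)
    then show "(%n. norm (?T3 (S n) (?X p))) \<longlonglongrightarrow> 0" by (auto dest: tendsto_norm)
   qed
   show "AE p in lborel \<Otimes>\<^sub>M Pm m. norm (norm (?T3 (S n) (?X p))) <= 2 * B' * norm (field_prod m a (?X p) *R (1::real))" for n
   proof (rule AE_I2)
    fix p :: "(real^'d) \<times> (nat => real^'d)"
    show "norm (norm (?T3 (S n) (?X p))) <= 2 * B' * norm (field_prod m a (?X p) *R (1::real))"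
     using mult_left_mono[OF d3[OF S(1)[of n], of "?X p"] abs_ge_zero[of "field_prod m a (?X p)"]] by (simp add: mult.commute)
   qed
  qed simp
  then show "(%n. xnorm m (?T3 (S n))) \<longlonglongrightarrow> 0" by (simp add: xnorm_def)
 qed simp
 have "((%t. L1_norm (%k. (1 / t) *R (Iop m ?Ph (k + t *R e) - Iop m ?Ph k) - Iop m ?Ps k)) \<longlongrightarrow> 0) (at_right 0)"
 proof (rule tendsto_sandwich[OF _ _ tendsto_const])
  have "((%t. B * (L1_norm (D t) * P) + ((B' * \<bar>t\<bar>) * (L1_norm g * P) + xnorm m (?T3 t))) \<longlongrightarrow> B * (0 * P) + ((B' * \<bar>0\<bar>) * (L1_norm g * P) + 0)) (at_right 0)"
   by (intro tendsto_intros D0 lim3)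
  then show "((%t. B * (L1_norm (D t) * P) + ((B' * \<bar>t\<bar>) * (L1_norm g * P) + xnorm m (?T3 t))) \<longlongrightarrow> 0) (at_right 0)" by simp
  have "L1_norm (%k. (1 / t) *R (Iop m ?Ph (k + t *R e) - Iop m ?Ph k) - Iop m ?Ps k)
    <= B * (L1_norm (D t) * P) + ((B' * \<bar>t\<bar>) * (L1_norm g * P) + xnorm m (?T3 t))" if t: "t > 0" for t
  proof -
   have x1: "xint m (%x. ?Ph (shift2 j e t x) - ?Ph x)" by (intro xint_diff xPht xPh)
   have "AE k in lebesgue. Iop m (%x. (1 / t) *R (?Ph (shift2 j e t x) - ?Ph x) - ?Ps x) k
     = (1 / t) *R (Iop m ?Ph (k + t *R e) - Iop m ?Ph k) - Iop m ?Ps k"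
    using Iop_diff[OF xPht xPh, of t] Iop_diff[OF xint_scaleR[OF x1] xPs, of "1/t"]
   proof eventually_elim
    case (elim k)
    have s: "Iop m ?Ph (k + t *R e) = Iop m (%x. ?Ph (shift2 j e t x)) k"
     by (rule Iop_shift[OF j]) (use xPh in \<open>simp add: xint_def\<close>)
    show ?case unfolding elim(2) Iop_scaleR elim(1) s ..
   qed
   then have "L1_norm (%k. (1 / t) *R (Iop m ?Ph (k + t *R e) - Iop m ?Ph k) - Iop m ?Ps k)
     = L1_norm (Iop m (%x. (1 / t) *R (?Ph (shift2 j e t x) - ?Ph x) - ?Ps x))"
    by (intro L1_norm_cong_AE[symmetric] borel_measurable_integrable Iop_norm(1) xint_diff xint_scaleR x1 xPs)
   also have "... <= xnorm m (%x. ?T1 t x + (?T2 t x + ?T3 t x))"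
    unfolding sum by (intro Iop_norm(2) xint_add T1 T2 T3 t)
   also have "... <= xnorm m (?T1 t) + xnorm m (%x. ?T2 t x + ?T3 t x)"
    by (intro xnorm_add xint_add T1 T2 T3 t)
   also have "xnorm m (%x. ?T2 t x + ?T3 t x) <= xnorm m (?T2 t) + xnorm m (?T3 t)"
    by (intro xnorm_add T2 T3 t)
   finally show ?thesis using T1(2)[of t] T2(2)[of t] by linarith
  qed
  then show "\<forall>\<^sub>F t in at_right 0. L1_norm (%k. (1 / t) *R (Iop m ?Ph (k + t *R e) - Iop m ?Ph k) - Iop m ?Ps k)
    <= B * (L1_norm (D t) * P) + ((B' * \<bar>t\<bar>) * (L1_norm g * P) + xnorm m (?T3 t))"
   unfolding eventually_at_right_field by (intro exI[of _ 1]) simp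
 qed auto
 then show ?thesis using Iop_norm(1)[OF xPh] Iop_norm(1)[OF xPs] by (simp add: has_L1_derivative_def)
qed

lemma has_L1_derivative_cong:
 fixes w g :: "real^'d => 'v::euclidean_space"
 assumes w: "has_L1_derivative w e g" and "AE k in lebesgue. w k = w' k" "AE k in lebesgue. g k = g' k"
 shows "has_L1_derivative w' e g'"
proof -
 have i: "integrable lebesgue w" "integrable lebesgue g" "integrable lebesgue w'" "integrable lebesgue g'"
  using assms integrable_lebesgue_AE by (auto simp: has_L1_derivative_def)
 have "L1_norm (%k. (1 / t) *R (w (k + t *R e) - w k) - g k) = L1_norm (%k. (1 / t) *R (w' (k + t *R e) - w' k) - g' k)" for t
 proof (rule L1_norm_cong_AE)
  show "AE k in lebesgue. (1 / t) *R (w (k + t *R e) - w k) - g k = (1 / t) *R (w' (k + t *R e) - w' k) - g' k"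
   using assms(2,3) AE_translate[OF assms(2), of "t *R e"] by eventually_elim simp
  have "integrable lebesgue (%k. (1 / t) *R (w (k + t *R e) - w k) - g k)"
   using i by (simp add: integrable_translate)
  then show "(%k. (1 / t) *R (w (k + t *R e) - w k) - g k) : borel_measurable lebesgue" by simp
 qed
 then show ?thesis using w i by (simp add: has_L1_derivative_def)
qed

lemma has_L1_derivative_sum:
 fixes w g :: "'i => real^'d => 'v::euclidean_space"
 assumes "finite A" "!!i. i : A ==> has_L1_derivative (w i) e (g i)"
 shows "has_L1_derivative (%k. SUM i:A. w i k) e (%k. SUM i:A. g i k)"
proof -
 have i: "integrable lebesgue (w i)" "integrable lebesgue (g i)" if "i : A" for i
  using assms(2)[OF that] by (auto simp: has_L1_derivative_def)
 have "((%t. L1_norm (%k. (1 / t) *R ((SUM i:A. w i (k + t *R e)) - (SUM i:A. w i k)) - (SUM i:A. g i k))) \<longlongrightarrow> 0) (at_right 0)"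
 proof (rule tendsto_sandwich[OF _ _ tendsto_const])
  show "((%t. SUM i:A. L1_norm (%k. (1 / t) *R (w i (k + t *R e) - w i k) - g i k)) \<longlongrightarrow> 0) (at_right 0)"
   using assms(2) by (intro tendsto_null_sum) (auto simp: has_L1_derivative_def)
  have "L1_norm (%k. (1 / t) *R ((SUM i:A. w i (k + t *R e)) - (SUM i:A. w i k)) - (SUM i:A. g i k))
    <= (SUM i:A. L1_norm (%k. (1 / t) *R (w i (k + t *R e) - w i k) - g i k))" for t
  proof -
   have "(%k. (1 / t) *R ((SUM i:A. w i (k + t *R e)) - (SUM i:A. w i k)) - (SUM i:A. g i k))
     = (%k. SUM i:A. (1 / t) *R (w i (k + t *R e) - w i k) - g i k)"
    by (simp add: sum_subtractf scaleR_sum_right scaleR_diff_right)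
   then show ?thesis
    using i by (simp only:) (intro L1_norm_sum_le assms(1) Bochner_Integration.integrable_diff integrable_scaleR_right integrable_translate; simp)
  qed
  then show "\<forall>\<^sub>F t in at_right 0. L1_norm (%k. (1 / t) *R ((SUM i:A. w i (k + t *R e)) - (SUM i:A. w i k)) - (SUM i:A. g i k))
    <= (SUM i:A. L1_norm (%k. (1 / t) *R (w i (k + t *R e) - w i k) - g i k))"
   by simp
 qed auto
 then show ?thesis using i by (auto simp: has_L1_derivative_def)
qed

lemma L1_norm_inner_le:
 fixes w :: "real^'d => 'v::euclidean_space"
 assumes "integrable lebesgue w" "norm al = 1"
 shows "L1_norm (%k. w k \<bullet> al) <= L1_norm w"
 using assms L1_norm_mono[of "%k. w k \<bullet> al" w 1] Cauchy_Schwarz_ineq2[of "w k" al for k] by auto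

lemma has_L1_derivative_inner:
 fixes w g :: "real^'d => 'v::euclidean_space"
 assumes w: "has_L1_derivative w e g" and al: "norm al = 1"
 shows "has_L1_derivative (%k. w k \<bullet> al) e (%k. g k \<bullet> al)"
proof -
 have i: "integrable lebesgue w" "integrable lebesgue g" using w by (auto simp: has_L1_derivative_def)
 have "((%t. L1_norm (%k. (1 / t) *R (w (k + t *R e) \<bullet> al - w k \<bullet> al) - g k \<bullet> al)) \<longlongrightarrow> 0) (at_right 0)"
 proof (rule tendsto_sandwich[OF _ _ tendsto_const])
  show "((%t. L1_norm (%k. (1 / t) *R (w (k + t *R e) - w k) - g k)) \<longlongrightarrow> 0) (at_right 0)"
   using w by (simp add: has_L1_derivative_def)
  have "L1_norm (%k. (1 / t) *R (w (k + t *R e) \<bullet> al - w k \<bullet> al) - g k \<bullet> al) <= L1_norm (%k. (1 / t) *R (w (k + t *R e) - w k) - g k)" for t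
  proof -
   have "integrable lebesgue (%k. (1 / t) *R (w (k + t *R e) - w k) - g k)" using i by (simp add: integrable_translate)
   from L1_norm_inner_le[OF this al] show ?thesis by (simp add: inner_diff_left)
  qed
  then show "\<forall>\<^sub>F t in at_right 0. L1_norm (%k. (1 / t) *R (w (k + t *R e) \<bullet> al - w k \<bullet> al) - g k \<bullet> al) <= L1_norm (%k. (1 / t) *R (w (k + t *R e) - w k) - g k)"
   by simp
 qed auto
 then show ?thesis using i by (auto simp: has_L1_derivative_def)
qed

lemma nn_integral_lborel_reflect:
 fixes f :: "real^'d => ennreal"
 assumes [measurable]: "f : borel_fun"
 shows "(\<integral>\<^sup>+x. f (c - x) \<partial>lborel) = (\<integral>\<^sup>+x. f x \<partial>lborel)"
proof -
 have "lborel = density (distr lborel borel (%x::real^'d. c + (-1) *R x)) (%_. ennreal (\<bar>-1\<bar> ^ DIM(real^'d)))"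
  by (rule lborel_affine) simp
 then have "lborel = distr lborel borel (%x::real^'d. c - x)" by (simp add: density_1)
 then have "(\<integral>\<^sup>+x. f x \<partial>lborel) = (\<integral>\<^sup>+x. f x \<partial>(distr lborel borel (%x::real^'d. c - x)))" by (rule arg_cong)
 also have "... = (\<integral>\<^sup>+x. f (c - x) \<partial>lborel)" by (rule nn_integral_distr) auto
 finally show ?thesis by simp
qed

text \<open>With at least one integration variable, every wavevector other than the output has an
  absolutely continuous distribution at each fixed \<open>k\<close>. Changing fields on null sets
  thus leaves the inner integral unchanged for all \<open>k\<close>, without an exceptional
  set.\<close>

lemma AE_xvec_notin_null:
 fixes N :: "(real^'d) set"
 assumes m: "2 <= m" and i: "i < m" and N: "N : null_sets lborel"
 shows "AE q in Pm m. xvec m k q (Suc i) ~: N"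
proof -
 have Nb: "N : sets borel" using N by auto
 have ind: "(indicator N :: _ => ennreal) : borel_fun" using Nb by measurable
 have xm: "(%q. xvec m k q (Suc i)) : Pm m \<rightarrow>\<^sub>M borel"
  by (rule measurable_compose[OF measurable_xvec borel_measurable_coordinate]) auto
 have n0: "(\<integral>\<^sup>+x. indicator N x \<partial>(lborel :: (real^'d) measure)) = 0"
  using N by (simp add: nn_integral_indicator null_sets_def)
 have "(\<integral>\<^sup>+q. indicator N (xvec m k q (Suc i)) \<partial>(Pm m)) = 0"
 proof (cases "Suc i < m")
  case True
  have "(\<integral>\<^sup>+q. indicator N (xvec m k q (Suc i)) \<partial>(Pm m)) = (\<integral>\<^sup>+q. (PROD l:{1..<m}. (if l = Suc i then indicator N else (%_. 1)) (q l)) \<partial>(Pm m))"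
  proof (rule nn_integral_cong)
   fix q :: "nat => real^'d"
   have "(PROD l:{1..<m}. (if l = Suc i then indicator N else (%_. 1)) (q l)) = (PROD l:{1..<m}. if l = Suc i then indicator N (q l) else 1 :: ennreal)"
    by (intro prod.cong) auto
   also have "... = indicator N (q (Suc i))" using True by simp
   finally show "indicator N (xvec m k q (Suc i)) = (PROD l:{1..<m}. (if l = Suc i then indicator N else (%_. 1)) (q l) :: ennreal)"
    using True by (simp add: xvec_def)
  qed
  also have "... = (PROD l:{1..<m}. \<integral>\<^sup>+x. (if l = Suc i then indicator N else (%_. 1)) x \<partial>(lborel :: (real^'d) measure))"
   unfolding Pm_def by (rule lborel_product.product_nn_integral_prod) (use ind in auto)
  also have "... = 0"
   using True n0 by (intro prod_zero) (auto intro!: bexI[of _ "Suc i"])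
  finally show ?thesis .
 next
  case False
  then have im: "Suc i = m" using i by simp
  \<comment> \<open>With the other variables fixed, the last wavevector is a reflection of the first
    integration variable.\<close>
  have I: "{1..<m} = insert 1 {2..<m}" using m by auto
  have xm': "(%q. indicator N (xvec m k q (Suc i)) :: ennreal) : borel_measurable (Pi\<^sub>M (insert 1 {2..<m}) (%_. lborel))"
   using measurable_compose[OF xm ind] unfolding Pm_def I .
  have "(\<integral>\<^sup>+q. indicator N (xvec m k q (Suc i)) \<partial>(Pm m))
    = (\<integral>\<^sup>+q. (\<integral>\<^sup>+y. indicator N (xvec m k (q(1 := y)) (Suc i)) \<partial>lborel) \<partial>(Pi\<^sub>M {2..<m} (%_. lborel)))"
   unfolding Pm_def I by (rule lborel_product.product_nn_integral_insert[OF _ _ xm']) auto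
  also have "... = (\<integral>\<^sup>+q. 0 \<partial>(Pi\<^sub>M {2..<m} (%_. lborel :: (real^'d) measure)))"
  proof (rule nn_integral_cong)
   fix q :: "nat => real^'d"
   have "xvec m k (q(1 := y)) (Suc i) = (k - (SUM l:{2..<m}. q l)) - y" for y
   proof -
    have "(SUM l:{1..<m}. (q(1 := y)) l) = y + (SUM l:{2..<m}. (q(1 := y)) l)"
     unfolding I by (subst sum.insert) auto
    also have "(SUM l:{2..<m}. (q(1 := y)) l) = (SUM l:{2..<m}. q l)" by (intro sum.cong) auto
    finally show ?thesis using im m by (simp add: xvec_def algebra_simps)
   qed
   then show "(\<integral>\<^sup>+y. indicator N (xvec m k (q(1 := y)) (Suc i)) \<partial>(lborel :: (real^'d) measure)) = 0"
    using nn_integral_lborel_reflect[OF ind] n0 by simp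
  qed
  finally show ?thesis by simp
 qed
 then have "AE q in Pm m. indicator N (xvec m k q (Suc i)) = (0 :: ennreal)"
  using measurable_compose[OF xm ind] by (subst (asm) nn_integral_0_iff_AE) auto
 then show ?thesis by eventually_elim (auto simp: indicator_def split: if_splits)
qed

lemma AE_xvec_eq:
 fixes u v :: "nat => real^'d => 'v"
 assumes m: "2 <= m" and eq: "!!i. i < m ==> AE k in lebesgue. u i k = v i k"
 shows "AE q in Pm m. ALL i<m. u i (xvec m k q (Suc i)) = v i (xvec m k q (Suc i))"
proof -
 have "AE q in Pm m. ALL i:{..<m}. u i (xvec m k q (Suc i)) = v i (xvec m k q (Suc i))"
 proof (subst AE_ball_countable)
  show "ALL i:{..<m}. AE q in Pm m. u i (xvec m k q (Suc i)) = v i (xvec m k q (Suc i))"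
  proof
   fix i assume i: "i : {..<m}"
   have "AE k in lborel. u i k = v i k" using eq[of i] i by (simp add: AE_completion_iff)
   then obtain N where N: "N : null_sets lborel" "{k. u i k ~= v i k} \<subseteq> N"
    unfolding eventually_ae_filter by auto
   show "AE q in Pm m. u i (xvec m k q (Suc i)) = v i (xvec m k q (Suc i))"
   proof -
    have "i < m" using i by simp
    from AE_xvec_notin_null[OF m this N(1), of k] show ?thesis
     by eventually_elim (use N(2) in blast)
   qed
  qed
 qed auto
 then show ?thesis by eventually_elim auto
qed

text \<open>Real multi-indices: a multilinear form on \<open>(complex^'c)\<^sup>m\<close> is determined by its values on them.\<close>

definition multi_basis :: "nat => (nat => complex^'c) set"
where "multi_basis m = (\<Pi>\<^sub>E i\<in>{..<m}. Basis)"

lemma finite_multi_basis: "finite (multi_basis m)"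
 unfolding multi_basis_def by (intro finite_PiE) auto

lemma multi_basis_norm: "al : multi_basis m ==> i < m ==> norm (al i) = 1"
 using PiE_mem[of al "{..<m}" "%_. Basis" i] unfolding multi_basis_def by (simp add: norm_Basis)

text \<open>A multilinear kernel is represented by its values \<open>b al\<close> on real basis
  tuples; vector-valued fields then enter through the scalar factors of
  \<open>field_prod\<close>.\<close>

definition Kop :: "nat => ((nat => complex^'c) => (nat => real^'d) => 'v::euclidean_space) =>
 (nat => real^'d => complex^'c) => real^'d => 'v"
where "Kop m b u = Iop m (%x. SUM al:multi_basis m. field_prod m (%i y. u i y \<bullet> al i) x *R b al x)"

text \<open>The product rule for \<open>Kop\<close> under \<open>shift2\<close>: \<open>db\<close>
  is the derivative of the kernel, and \<open>g\<close> that of the field in slot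
  \<open>j\<close>.\<close>

definition dKop :: "nat => nat => ((nat => complex^'c) => (nat => real^'d) => 'v::euclidean_space) =>
 ((nat => complex^'c) => (nat => real^'d) => 'v) => (nat => real^'d => complex^'c) => (real^'d => complex^'c) => real^'d => 'v"
where "dKop m j b db u g = Iop m (%x. SUM al:multi_basis m. field_prod m (%i y. u i y \<bullet> al i) x *R db al x
  + field_prod m ((%i y. u i y \<bullet> al i)(j := %y. g y \<bullet> al j)) x *R b al x)"

context
 fixes m j :: nat and u :: "nat => real^'d => complex^'c::finite" and g :: "real^'d => complex^'c" and e :: "real^'d"
  and b db :: "(nat => complex^'c) => (nat => real^'d) => 'v::euclidean_space" and B B' :: real and nu :: "nat => real" and ga :: real
 assumes m: "1 <= m" and j: "j < m"
  and u: "!!i. i < m ==> u i : borel_fun" "!!i. i < m ==> integrable lebesgue (u i)" "!!i. i < m ==> L1_norm (u i) <= nu i"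
  and g: "g : borel_fun" "has_L1_derivative (u j) e g" "L1_norm g <= ga"
  and b: "!!al. al : multi_basis m ==> b al : borel_fun" "!!al x. al : multi_basis m ==> norm (b al x) <= B"
  and db: "!!al x. al : multi_basis m ==> ((%t. b al (shift2 j e t x)) has_vd db al x) (at 0)"
   "!!al x. al : multi_basis m ==> norm (db al x) <= B'" "!!al. al : multi_basis m ==> db al : borel_fun"
begin

lemma component_facts:
 assumes al: "al : multi_basis m" and i: "i < m"
 shows "(%y. u i y \<bullet> al i) : borel_fun" "integrable lebesgue (%y. u i y \<bullet> al i)"
  "L1_norm (%y. u i y \<bullet> al i) <= nu i"
 using u[OF i] L1_norm_inner_le[OF u(2)[OF i] multi_basis_norm[OF al i]] by auto

lemma gradient_component_facts:
 assumes al: "al : multi_basis m"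
 shows "(%y. g y \<bullet> al j) : borel_fun" "integrable lebesgue (%y. g y \<bullet> al j)"
  "L1_norm (%y. g y \<bullet> al j) <= ga" "has_L1_derivative (%y. u j y \<bullet> al j) e (%y. g y \<bullet> al j)"
proof -
 have gi: "integrable lebesgue g" using g(2) by (simp add: has_L1_derivative_def)
 show "(%y. g y \<bullet> al j) : borel_fun" "integrable lebesgue (%y. g y \<bullet> al j)"
  "L1_norm (%y. g y \<bullet> al j) <= ga" "has_L1_derivative (%y. u j y \<bullet> al j) e (%y. g y \<bullet> al j)"
  using g gi L1_norm_inner_le[OF gi multi_basis_norm[OF al j]] has_L1_derivative_inner[OF g(2) multi_basis_norm[OF al j]]
  by auto
qed

lemma Kop_terms:
 assumes al: "al : multi_basis m"
 shows "xint m (%x. field_prod m (%i y. u i y \<bullet> al i) x *R b al x)"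
  and "L1_norm (Iop m (%x. field_prod m (%i y. u i y \<bullet> al i) x *R b al x)) <= B * (PROD i<m. nu i)"
  and "xint m (%x. field_prod m (%i y. u i y \<bullet> al i) x *R db al x + field_prod m ((%i y. u i y \<bullet> al i)(j := %y. g y \<bullet> al j)) x *R b al x)"
  and "L1_norm (Iop m (%x. field_prod m (%i y. u i y \<bullet> al i) x *R db al x + field_prod m ((%i y. u i y \<bullet> al i)(j := %y. g y \<bullet> al j)) x *R b al x))
   <= B' * (PROD i<m. nu i) + B * (ga * (PROD i:{..<m} - {j}. nu i))"
proof -
 have B: "0 <= B" using b(2)[OF al] norm_ge_zero order_trans by blast
 have B': "0 <= B'" using db(2)[OF al] norm_ge_zero order_trans by blast
 note c = component_facts[OF al] and gc = gradient_component_facts[OF al]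
 have P1: "(PROD i<m. L1_norm (%y. u i y \<bullet> al i)) <= (PROD i<m. nu i)" using c(3) by (intro prod_mono) auto
 have nu0: "0 <= nu i" if "i < m" for i using order_trans[OF L1_norm_nonneg u(3)[OF that]] .
 have P2: "(PROD i:{..<m} - {j}. L1_norm (%y. u i y \<bullet> al i)) <= (PROD i:{..<m} - {j}. nu i)" using c(3) by (intro prod_mono) auto
 note 1 = field_prod_norm[where a="%i y. u i y \<bullet> al i", OF m c(1,2) b(1)[OF al] b(2)[OF al]]
 note 2 = field_prod_norm[where a="%i y. u i y \<bullet> al i", OF m c(1,2) db(3)[OF al] db(2)[OF al]]
 have upd: "((%i y. u i y \<bullet> al i)(j := %y. g y \<bullet> al j)) i : borel_fun"
   "integrable lebesgue (((%i y. u i y \<bullet> al i)(j := %y. g y \<bullet> al j)) i)" if "i < m" for i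
  using c[OF that] gc by auto
 note 3 = field_prod_norm[where a="(%i y. u i y \<bullet> al i)(j := %y. g y \<bullet> al j)", OF m upd b(1)[OF al] b(2)[OF al]]
 show "xint m (%x. field_prod m (%i y. u i y \<bullet> al i) x *R b al x)" by (rule 1(1))
 show "L1_norm (Iop m (%x. field_prod m (%i y. u i y \<bullet> al i) x *R b al x)) <= B * (PROD i<m. nu i)"
  using Iop_norm(2)[OF 1(1)] 1(2) mult_left_mono[OF P1 B] by linarith
 show x: "xint m (%x. field_prod m (%i y. u i y \<bullet> al i) x *R db al x + field_prod m ((%i y. u i y \<bullet> al i)(j := %y. g y \<bullet> al j)) x *R b al x)"
  by (rule xint_add[OF 2(1) 3(1)])
 have "B * (L1_norm (%y. g y \<bullet> al j) * (PROD i:{..<m} - {j}. L1_norm (%y. u i y \<bullet> al i))) <= B * (ga * (PROD i:{..<m} - {j}. nu i))"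
  using gc(3) order_trans[OF L1_norm_nonneg gc(3)] P2 by (intro mult_left_mono[OF _ B] mult_mono prod_nonneg) auto
 then show "L1_norm (Iop m (%x. field_prod m (%i y. u i y \<bullet> al i) x *R db al x + field_prod m ((%i y. u i y \<bullet> al i)(j := %y. g y \<bullet> al j)) x *R b al x))
   <= B' * (PROD i<m. nu i) + B * (ga * (PROD i:{..<m} - {j}. nu i))"
  using Iop_norm(2)[OF x] xnorm_add[OF 2(1) 3(1)] 2(2) 3(2) mult_left_mono[OF P1 B']
  unfolding prod_L1_norm_upd[OF j] by linarith
qed

lemma Kop_eq: "AE k in lebesgue. Kop m b u k = (SUM al:multi_basis m. Iop m (%x. field_prod m (%i y. u i y \<bullet> al i) x *R b al x) k)"
 unfolding Kop_def by (rule Iop_sum[OF finite_multi_basis Kop_terms(1)])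

lemma dKop_eq: "AE k in lebesgue. dKop m j b db u g k = (SUM al:multi_basis m. Iop m (%x. field_prod m (%i y. u i y \<bullet> al i) x *R db al x
  + field_prod m ((%i y. u i y \<bullet> al i)(j := %y. g y \<bullet> al j)) x *R b al x) k)"
 unfolding dKop_def by (rule Iop_sum[OF finite_multi_basis Kop_terms(3)])

lemma Kop_integrable: "integrable lebesgue (Kop m b u)"
 unfolding Kop_def by (intro Iop_norm(1) xint_sum Kop_terms(1))

lemma dKop_integrable: "integrable lebesgue (dKop m j b db u g)"
 unfolding dKop_def by (intro Iop_norm(1) xint_sum Kop_terms(3))

lemma Kop_L1_norm: "L1_norm (Kop m b u) <= real (card (multi_basis m :: (nat => complex^'c) set)) * (B * (PROD i<m. nu i))"
proof -
 have "L1_norm (Kop m b u) = L1_norm (%k. SUM al:multi_basis m. Iop m (%x. field_prod m (%i y. u i y \<bullet> al i) x *R b al x) k)"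
  by (intro L1_norm_cong_AE Kop_eq borel_measurable_integrable Kop_integrable)
 also have "... <= (SUM al:multi_basis m. L1_norm (Iop m (%x. field_prod m (%i y. u i y \<bullet> al i) x *R b al x)))"
  by (intro L1_norm_sum_le finite_multi_basis Iop_norm(1) Kop_terms(1))
 also have "... <= (SUM al:(multi_basis m :: (nat => complex^'c) set). B * (PROD i<m. nu i))"
  by (intro sum_mono Kop_terms(2))
 finally show ?thesis by simp
qed

lemma dKop_L1_norm: "L1_norm (dKop m j b db u g) <= real (card (multi_basis m :: (nat => complex^'c) set)) * (B' * (PROD i<m. nu i) + B * (ga * (PROD i:{..<m} - {j}. nu i)))"
proof -
 have "L1_norm (dKop m j b db u g) = L1_norm (%k. SUM al:multi_basis m. Iop m (%x. field_prod m (%i y. u i y \<bullet> al i) x *R db al x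
  + field_prod m ((%i y. u i y \<bullet> al i)(j := %y. g y \<bullet> al j)) x *R b al x) k)"
  by (intro L1_norm_cong_AE dKop_eq borel_measurable_integrable dKop_integrable)
 also have "... <= (SUM al:multi_basis m. L1_norm (Iop m (%x. field_prod m (%i y. u i y \<bullet> al i) x *R db al x
  + field_prod m ((%i y. u i y \<bullet> al i)(j := %y. g y \<bullet> al j)) x *R b al x)))"
  by (intro L1_norm_sum_le finite_multi_basis Iop_norm(1) Kop_terms(3))
 also have "... <= (SUM al:(multi_basis m :: (nat => complex^'c) set). B' * (PROD i<m. nu i) + B * (ga * (PROD i:{..<m} - {j}. nu i)))"
  by (intro sum_mono Kop_terms(4))
 finally show ?thesis by simp
qed

lemma Kop_has_L1_derivative: "has_L1_derivative (Kop m b u) e (dKop m j b db u g)"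
proof (rule has_L1_derivative_cong)
 show "has_L1_derivative (%k. SUM al:multi_basis m. Iop m (%x. field_prod m (%i y. u i y \<bullet> al i) x *R b al x) k) e
  (%k. SUM al:multi_basis m. Iop m (%x. field_prod m (%i y. u i y \<bullet> al i) x *R db al x
  + field_prod m ((%i y. u i y \<bullet> al i)(j := %y. g y \<bullet> al j)) x *R b al x) k)"
 proof (rule has_L1_derivative_sum[OF finite_multi_basis])
  fix al :: "nat => complex^'c" assume al: "al : multi_basis m"
  show "has_L1_derivative (Iop m (%x. field_prod m (%i y. u i y \<bullet> al i) x *R b al x)) e
   (Iop m (%x. field_prod m (%i y. u i y \<bullet> al i) x *R db al x
    + field_prod m ((%i y. u i y \<bullet> al i)(j := %y. g y \<bullet> al j)) x *R b al x))"
   by (rule has_L1_derivative_Iop[where a="%i y. u i y \<bullet> al i", OF m j component_facts(1,2)[OF al]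
     gradient_component_facts(1,4)[OF al] b(1)[OF al] b(2)[OF al] db(1)[OF al] db(2)[OF al] db(3)[OF al]])
 qed
qed (use Kop_eq dKop_eq in \<open>auto elim: eventually_mono\<close>)

end

section \<open>Interaction operators with differentiable kernels map into E1\<close>

lemma borel_measurable_vec_lambda:
 fixes f :: "'d::finite => 'a => 'v::euclidean_space"
 assumes "!!l. f l : borel_measurable M"
 shows "(%x. \<chi> l. f l x) : borel_measurable M"
proof -
 have lin: "linear (axis l :: 'v => 'v^'d)" for l
  by (rule linearI) (auto simp: vec_eq_iff axis_def)
 have "(%x. \<chi> l. f l x) = (%x. SUM l:UNIV. axis l (f l x))"
  by (auto simp: fun_eq_iff vec_eq_iff axis_def if_distrib sum.delta cong: if_cong)
 moreover have "(%x. axis l (f l x) :: 'v^'d) : borel_measurable M" for l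
  by (rule borel_measurable_continuous_on[OF linear_continuous_on assms])
   (use lin in \<open>simp add: linear_conv_bounded_linear\<close>)
 ultimately show ?thesis by simp
qed

lemma L1_norm_vec_lambda:
 fixes f :: "'d::finite => real^'n => 'v::euclidean_space"
 assumes "!!l. integrable lebesgue (f l)"
 shows "integrable lebesgue (%x. \<chi> l. f l x)" and "L1_norm (%x. \<chi> l. f l x) <= (SUM l:UNIV. L1_norm (f l))"
proof -
 have n: "norm (\<chi> l. f l x) <= (SUM l:UNIV. norm (f l x))" for x
  unfolding norm_vec_def by (rule order_trans[OF L2_set_le_sum]) auto
 have s: "integrable lebesgue (%x. SUM l:UNIV. norm (f l x))" using assms by auto
 show i: "integrable lebesgue (%x. \<chi> l. f l x)"
 proof (rule Bochner_Integration.integrable_bound[OF s])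
  show "AE x in lebesgue. norm (\<chi> l. f l x) <= norm (SUM l:UNIV. norm (f l x))"
   using n by (intro AE_I2 order_trans[OF n]) simp
 qed (use assms in \<open>auto intro!: borel_measurable_vec_lambda\<close>)
 have "L1_norm (%x. \<chi> l. f l x) <= (LINT x|lebesgue. (SUM l:UNIV. norm (f l x)))"
  unfolding L1_norm_def using i s n by (intro integral_mono) auto
 then show "L1_norm (%x. \<chi> l. f l x) <= (SUM l:UNIV. L1_norm (f l))"
  using assms by (simp add: L1_norm_def)
qed

lemma field_prod_joint_measurable:
 fixes a :: "nat => real => real^'d => real"
 assumes "!!i. i < m ==> case_prod (a i) : joint_borel"
 shows "case_prod (%s. field_prod m (%i. a i s)) : joint_borel"
proof -
 have "(%p. a i (fst p) (snd p (Suc i))) : joint_borel" if "i < m" for i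
 proof -
  have "(%p::real \<times> (nat => real^'d). (fst p, snd p (Suc i))) : borel \<Otimes>\<^sub>M borel \<rightarrow>\<^sub>M borel \<Otimes>\<^sub>M borel"
   by (intro measurable_Pair measurable_fst measurable_compose[OF measurable_snd borel_measurable_coordinate])
  from measurable_compose[OF this assms[OF that]] show ?thesis by (simp add: case_prod_beta')
 qed
 then show ?thesis unfolding field_prod_def case_prod_beta' by (intro borel_measurable_prod) auto
qed

lemma modulate_joint_measurable:
 fixes U :: "real => real^'d => complex^'c::finite"
 assumes [measurable]: "case_prod U : joint_borel"
 shows "case_prod (%s. modulate r (U s)) : joint_borel"
 unfolding modulate_def case_prod_beta' by measurable

text \<open>After the weight, the kernel derivative contributes \<open>B'\<close> and the gradient
  of the field \<open>j\<close> contributes \<open>B\<close>; the plain L1 norm adds another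
  \<open>B\<close>, hence \<open>2 * B\<close>. All fields are modulated by the one position
  \<open>r\<close>, and differentiability there is asked of \<open>U j\<close> only.\<close>

lemma Kop_time_integral_in_E1:
 fixes M :: "('d::finite, 'x::finite) wave_model" and U :: "nat => real => real^'d => complex^'c::finite"
  and b :: "(nat => complex^'c) => real => (nat => real^'d) => complex^'c"
 assumes M: "cutoff M" and T: "0 <= T" and m: "1 <= m" and j: "j < m"
  and U: "!!i. i < m ==> case_prod (U i) : joint_borel"
  and UE: "!!i. i < m ==> in_E T (U i)" and Uj: "in_E1 T r (U j)"
  and b: "!!al. al : multi_basis m ==> case_prod (b al) : joint_borel"
  and bB: "!!al s x. al : multi_basis m ==> s : {0..T} ==> norm (b al s x) <= B"
  and db: "!!al l s x. al : multi_basis m ==> ((%t. b al s (shift2 j (axis l 1) t x)) has_vd db al l s x) (at 0)"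
  and dB: "!!al l s x. al : multi_basis m ==> s : {0..T} ==> norm (db al l s x) <= B'"
  and F: "!!ta. ta : {0..T} ==> AE k in lebesgue. modulate r (F ta) k = (LINT s:{0..ta}|lebesgue. Kop m (%al. b al s) (%i. modulate r (U i s)) k)"
  and nu: "!!i. i < m ==> E_norm T (U i) <= nu i" and nuj: "E1_norm ee T bt r (U j) <= nu j"
  and B: "0 <= B" "0 <= B'"
 shows "in_E1 T r F"
  and "E1_norm ee T bt r F <= T * (real CARD('d) * real (card (multi_basis m :: (nat => complex^'c) set)) * (bt powr (1 + ee) * B' + 2 * B) * (PROD i<m. nu i))"
proof -
 obtain G where G: "case_prod G : joint_borel"
  "!!s. s : {0..T} ==> AE k in lebesgue. weak_gradient (modulate r (U j s)) k = G s k"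
  using in_E_joint_representative[OF in_E1D(2)[OF Uj]] by (elim exE conjE) blast
 have GE: "in_E T G" and GN: "E_norm T G = E_norm T (%ta. weak_gradient (modulate r (U j ta)))"
  by (rule in_E_cong[OF in_E1D(2)[OF Uj] G(2)]; simp)+
 define ga where "ga = E_norm T G"
 have hG: "has_weak_gradient (modulate r (U j s)) (G s)" if "s : {0..T}" for s
  by (rule has_weak_gradient_cong[OF in_E1D(3)[OF Uj that] _ G(2)[OF that]]) simp
 let ?u = "%s i. modulate r (U i s)"
 let ?g = "%s l k. G s k $ l"
 let ?c = "real (card (multi_basis m :: (nat => complex^'c) set))"
 have um: "case_prod (%s. ?u s i) : joint_borel" if "i < m" for i
  by (rule modulate_joint_measurable[OF U[OF that]])
 have u1: "?u s i : borel_fun" if "i < m" for s i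
  using measurable_Pair2[OF um[OF that], of s] by simp
 have u2: "integrable lebesgue (?u s i)" if "s : {0..T}" "i < m" for s i
  by (intro integrable_modulate in_E_integrable[OF UE[OF that(2)] that(1)])
 have u3: "L1_norm (?u s i) <= nu i" if "s : {0..T}" "i < m" for s i
  using L1_norm_le_E_norm[OF UE[OF that(2)] that(1)] nu[OF that(2)] by (simp add: L1_norm_modulate)
 have gm: "case_prod (%s. ?g s l) : joint_borel" for l
 proof -
  have "(%x. case_prod G x $ l) : joint_borel"
   using G(1) by (rule borel_measurable_continuous_on[rotated]) (intro continuous_intros)
  then show ?thesis by (simp add: case_prod_beta')
 qed
 have g1: "?g s l : borel_fun" for s l
  using measurable_Pair2[OF gm[of l], of s] by simp
 have g2: "has_L1_derivative (?u s j) (axis l 1) (?g s l)" if "s : {0..T}" for s l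
  using hG[OF that] unfolding has_weak_gradient_iff[OF M] by blast
 have g3: "L1_norm (?g s l) <= ga" if "s : {0..T}" for s l
 proof -
  have i: "integrable lebesgue (G s)" by (rule in_E_integrable[OF GE that])
  have "L1_norm (?g s l) <= 1 * L1_norm (G s)"
   using i integrable_vec_nth[OF i, of l] Finite_Cartesian_Product.norm_nth_le[of "G s k" l for k]
   by (intro conjunct2[OF L1_norm_mono]) auto
  then show ?thesis using L1_norm_le_E_norm[OF GE that] by (simp add: ga_def)
 qed
 have b1: "b al s : borel_fun" if "al : multi_basis m" for al s
  using measurable_Pair2[OF b[OF that], of s] by simp
 have dbm: "case_prod (db al l) : joint_borel" if "al : multi_basis m" for al l
  by (rule shift2_derivative_measurable[OF b[OF that] db[OF that]])
 have db1: "db al l s : borel_fun" if "al : multi_basis m" for al l s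
  using measurable_Pair2[OF dbm[OF that], of s] by simp
 define N where "N s = Kop m (%al. b al s) (?u s)" for s
 define H where "H s k = (\<chi> l. dKop m j (%al. b al s) (%al. db al l s) (?u s) (?g s l) k)" for s k
 have fm: "case_prod (%s. field_prod m (%i y. ?u s i y \<bullet> al i)) : joint_borel" for al
 proof (rule field_prod_joint_measurable[where a="%i s y. ?u s i y \<bullet> al i"])
  fix i assume "i < m"
  from um[OF this] have "(%p. case_prod (%s. ?u s i) p \<bullet> al i) : joint_borel"
   by (intro borel_measurable_inner borel_measurable_const)
  then show "case_prod (%s y. ?u s i y \<bullet> al i) : joint_borel" by (simp add: case_prod_beta')
 qed
 have fgm: "case_prod (%s. field_prod m ((%i y. ?u s i y \<bullet> al i)(j := %y. ?g s l y \<bullet> al j))) : joint_borel" for al l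
 proof -
  have "case_prod (%s. field_prod m (%i. (if i = j then (%s y. ?g s l y \<bullet> al j) else (%s y. ?u s i y \<bullet> al i)) s)) : joint_borel"
  proof (rule field_prod_joint_measurable)
   fix i assume i: "i < m"
   have "(%p. case_prod (%s. ?u s i) p \<bullet> al i) : joint_borel"
    "(%p. case_prod (%s. ?g s l) p \<bullet> al j) : joint_borel"
    by (intro borel_measurable_inner borel_measurable_const um[OF i] gm)+
   then show "case_prod (if i = j then (%s y. ?g s l y \<bullet> al j) else (%s y. ?u s i y \<bullet> al i)) : joint_borel"
    by (simp add: case_prod_beta')
  qed
  moreover have "(%i. (if i = j then (%s y. ?g s l y \<bullet> al j) else (%s y. ?u s i y \<bullet> al i)) s) = (%i y. ?u s i y \<bullet> al i)(j := %y. ?g s l y \<bullet> al j)" for s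
   by (auto simp: fun_eq_iff)
  ultimately show ?thesis by (simp only:)
 qed
 have Nm: "case_prod N : joint_borel"
  unfolding N_def Kop_def
 proof (rule Iop_joint_measurable)
  show "case_prod (%s x. SUM al:multi_basis m. field_prod m (%i y. ?u s i y \<bullet> al i) x *R b al s x) : joint_borel"
   using fm b unfolding case_prod_beta' by (intro borel_measurable_sum borel_measurable_scaleR) auto
 qed
 have Hm: "case_prod H : joint_borel"
 proof -
  have "case_prod (%s. dKop m j (%al. b al s) (%al. db al l s) (?u s) (?g s l)) : joint_borel" for l
   unfolding dKop_def
  proof (rule Iop_joint_measurable)
   show "case_prod (%s x. SUM al:multi_basis m. field_prod m (%i y. ?u s i y \<bullet> al i) x *R db al l s x
     + field_prod m ((%i y. ?u s i y \<bullet> al i)(j := %y. ?g s l y \<bullet> al j)) x *R b al s x) : joint_borel"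
    using fm fgm b dbm unfolding case_prod_beta' by (intro borel_measurable_sum borel_measurable_add borel_measurable_scaleR) auto
  qed
  then show ?thesis unfolding H_def case_prod_beta' by (intro borel_measurable_vec_lambda)
 qed
 define C where "C = ?c * (B * (PROD i<m. nu i))"
 define D0 where "D0 = ?c * (B' * (PROD i<m. nu i) + B * (ga * (PROD i:{..<m} - {j}. nu i)))"
 \<comment> \<open>This bound involves no derivative; \<open>undefined\<close> is an arbitrary
   coordinate direction that instantiates the derivative hypotheses.\<close>
 have NC: "L1_norm (N s) <= C" if s: "s : {0..T}" for s
  unfolding N_def C_def
  by (rule Kop_L1_norm[where m=m and j=j and u="?u s" and b="%al. b al s" and nu=nu and ga=ga and B=B and B'=B' and db="%al. db al undefined s" and g="?g s undefined" and e="axis undefined 1", OF m j u1 u2[OF s] u3[OF s] g1 g2[OF s] g3[OF s] b1 bB[OF _ s] db dB[OF _ s] db1])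
 have dint: "integrable lebesgue (dKop m j (%al. b al s) (%al. db al l s) (?u s) (?g s l))" if s: "s : {0..T}" for s l
  by (rule dKop_integrable[where m=m and j=j and u="?u s" and b="%al. b al s" and nu=nu and ga=ga and B=B and B'=B' and db="%al. db al l s" and g="?g s l" and e="axis l 1", OF m j u1 u2[OF s] u3[OF s] g1 g2[OF s] g3[OF s] b1 bB[OF _ s] db dB[OF _ s] db1])
 have dnorm: "L1_norm (dKop m j (%al. b al s) (%al. db al l s) (?u s) (?g s l)) <= D0" if s: "s : {0..T}" for s l
  unfolding D0_def
  by (rule dKop_L1_norm[where m=m and j=j and u="?u s" and b="%al. b al s" and nu=nu and ga=ga and B=B and B'=B' and db="%al. db al l s" and g="?g s l" and e="axis l 1", OF m j u1 u2[OF s] u3[OF s] g1 g2[OF s] g3[OF s] b1 bB[OF _ s] db dB[OF _ s] db1])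
 have dder: "has_L1_derivative (N s) (axis l 1) (dKop m j (%al. b al s) (%al. db al l s) (?u s) (?g s l))" if s: "s : {0..T}" for s l
  unfolding N_def
  by (rule Kop_has_L1_derivative[where m=m and j=j and u="?u s" and b="%al. b al s" and nu=nu and ga=ga and B=B and B'=B' and db="%al. db al l s" and g="?g s l" and e="axis l 1", OF m j u1 u2[OF s] u3[OF s] g1 g2[OF s] g3[OF s] b1 bB[OF _ s] db dB[OF _ s] db1])
 have Hi: "integrable lebesgue (H s)" if s: "s : {0..T}" for s
  unfolding H_def[abs_def] by (rule L1_norm_vec_lambda(1)[OF dint[OF s]])
 have HD: "L1_norm (H s) <= real CARD('d) * D0" if s: "s : {0..T}" for s
 proof -
  have "L1_norm (H s) <= (SUM l:UNIV. L1_norm (dKop m j (%al. b al s) (%al. db al l s) (?u s) (?g s l)))"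
   unfolding H_def[abs_def] by (rule L1_norm_vec_lambda(2)[OF dint[OF s]])
  also have "... <= (SUM l:(UNIV :: 'd set). D0)" by (intro sum_mono dnorm s)
  finally show ?thesis by simp
 qed
 have NH: "has_weak_gradient (N s) (H s)" if s: "s : {0..T}" for s
  unfolding has_weak_gradient_iff[OF M]
  using dder[OF s] Hi[OF s] by (auto simp: H_def has_L1_derivative_def)
 have F': "AE k in lebesgue. modulate r (F ta) k = (LINT s:{0..ta}|lebesgue. N s k)" if "ta : {0..T}" for ta
  using F[OF that] by (simp add: N_def)
 note TI = time_integral_in_E1[OF M T Nm Hm NC HD NH F']
 show "in_E1 T r F" by (rule TI(1))
 have nu0: "0 <= nu i" if "i < m" for i using order_trans[OF E_norm_nonneg[OF UE[OF that] T] nu[OF that]] .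
 have prj: "(PROD i<m. nu i) = nu j * (PROD i:{..<m} - {j}. nu i)" using j by (subst prod.remove[of _ j]) auto
 have P0: "0 <= (PROD i<m. nu i)" "0 <= (PROD i:{..<m} - {j}. nu i)" using nu0 by (auto intro!: prod_nonneg)
 \<comment> \<open>The weight turns the gradient of the field \<open>j\<close> into a quantity below
   \<open>nu j\<close>, which restores the full product of the \<open>nu i\<close>.\<close>
 have bg: "bt powr (1 + ee) * ga <= nu j"
  using nuj E_norm_nonneg[OF UE[OF j] T] by (simp add: E1_norm_def ga_def GN)
 have card1: "1 <= real CARD('d)" by (simp add: Suc_leI)
 let ?P = "PROD i<m. nu i"
 have "bt powr (1 + ee) * D0 <= ?c * (bt powr (1 + ee) * B' * ?P + B * ?P)"
 proof -
  have "bt powr (1 + ee) * D0 = ?c * (bt powr (1 + ee) * B' * ?P + B * ((bt powr (1 + ee) * ga) * (PROD i:{..<m} - {j}. nu i)))"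
   by (simp add: D0_def algebra_simps)
  also have "... <= ?c * (bt powr (1 + ee) * B' * ?P + B * (nu j * (PROD i:{..<m} - {j}. nu i)))"
   using bg P0 B by (intro mult_left_mono add_left_mono mult_right_mono) auto
  finally show ?thesis unfolding prj .
 qed
 then have "real CARD('d) * (bt powr (1 + ee) * D0) <= real CARD('d) * (?c * (bt powr (1 + ee) * B' * ?P + B * ?P))"
  by (intro mult_left_mono) auto
 moreover have "C <= real CARD('d) * (?c * (B * ?P))"
  unfolding C_def using card1 B P0 mult_right_mono[OF card1, of "?c * (B * ?P)"] by simp
 ultimately have "bt powr (1 + ee) * (real CARD('d) * D0) + C <= real CARD('d) * ?c * (bt powr (1 + ee) * B' + 2 * B) * ?P"
  by (simp add: algebra_simps)
 then have "T * (bt powr (1 + ee) * (real CARD('d) * D0) + C) <= T * (real CARD('d) * ?c * (bt powr (1 + ee) * B' + 2 * B) * ?P)"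
  by (intro mult_left_mono T)
 then show "E1_norm ee T bt r F <= T * (real CARD('d) * ?c * (bt powr (1 + ee) * B' + 2 * B) * ?P)"
  using TI(2)[of ee bt] by linarith
qed

section \<open>Spectral projections of the linear part\<close>

lemma bounded_bilinear_matrix_mult: "bounded_bilinear ((**) :: complex^'c^'c => complex^'c^'c => complex^'c^'c)"
proof -
 have "bilinear ((**) :: complex^'c^'c => complex^'c^'c => complex^'c^'c)"
  unfolding bilinear_def
  by (auto intro!: linearI simp: vec_eq_iff matrix_matrix_mult_def algebra_simps sum.distrib scaleR_sum_right)
 then show ?thesis by (simp add: bilinear_conv_bounded_bilinear)
qed

interpretation matrix_mult: bounded_bilinear "(**) :: complex^'c^'c => complex^'c^'c => complex^'c^'c"
 by (rule bounded_bilinear_matrix_mult)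

lemma bounded_linear_trace: "bounded_linear (trace :: complex^'c^'c => complex)"
 unfolding linear_conv_bounded_linear[symmetric]
 by (rule linearI) (auto simp: trace_def sum.distrib scaleR_sum_right)

text \<open>For a unit vector this is the orthogonal projection onto its line. It does not depend on
  the phase of \<open>g\<close>, so it can be smooth although eigenvectors are chosen arbitrarily at
  each wavevector.\<close>

definition outer :: "complex^'c => complex^'c^'c"
where "outer g = (\<chi> i j. g $ i * cnj (g $ j))"

lemma outer_mult_vec: "outer g *v u = cinner g u *s g"
 by (simp add: vec_eq_iff outer_def matrix_vector_mult_def cinner_def sum_distrib_left sum_distrib_right mult.commute mult.left_commute)

lemma band_proj_outer: "band_proj M n ze k u = outer (evec M n ze k) *v u"
 by (simp add: band_proj_def outer_mult_vec)

lemma outer_mult_outer: "outer g ** outer h = (\<chi> i j. cinner g h * (g $ i * cnj (h $ j)))" for g h :: "complex^'c"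
 by (simp add: vec_eq_iff outer_def matrix_matrix_mult_def cinner_def sum_distrib_left sum_distrib_right mult_ac)

lemma matrix_mult_outer:
 assumes "A *v g = complex_of_real l *s g"
 shows "A ** outer g = l *R outer g"
proof -
 have "(SUM j:UNIV. A $ i $ j * g $ j) = complex_of_real l * g $ i" for i
  using arg_cong[OF assms, of "%v. v $ i"] by (simp add: matrix_vector_mult_def)
 then have "(SUM j:UNIV. A $ i $ j * (g $ j * c)) = complex_of_real l * g $ i * c" for i c
  by (metis (no_types, lifting) mult.assoc sum.cong sum_distrib_right)
 then show ?thesis
  by (simp add: vec_eq_iff outer_def matrix_matrix_mult_def scaleR_conv_of_real[where 'a=complex] mult.assoc)
qed

lemma cinner_self: "cinner g g = complex_of_real ((norm g)\<^sup>2)"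
proof -
 have "cnj z * z = complex_of_real ((cmod z)\<^sup>2)" for z by (simp only: complex_norm_square mult.commute)
 then have "cinner g g = complex_of_real (SUM i:UNIV. (cmod (g $ i))\<^sup>2)" by (simp only: cinner_def of_real_sum)
 also have "(SUM i:UNIV. (cmod (g $ i))\<^sup>2) = (norm g)\<^sup>2" by (simp add: norm_vec_def L2_set_def sum_nonneg)
 finally show ?thesis .
qed

lemma norm_outer: "norm (outer g) = (norm g)\<^sup>2"
proof -
 have "outer g $ i = (g $ i) *s (\<chi> j. cnj (g $ j))" for i
  by (simp add: vec_eq_iff outer_def)
 then have "norm (outer g $ i) = norm (g $ i) * norm (\<chi> j. cnj (g $ j))" for i
  by (simp add: norm_smult)
 moreover have "norm (\<chi> j. cnj (g $ j)) = norm g" by (simp add: norm_vec_def)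
 ultimately have "norm (outer g) = L2_set (%i. norm g * norm (g $ i)) UNIV"
  by (simp add: norm_vec_def[of "outer g"] mult.commute)
 also have "... = norm g * norm g" by (simp add: L2_set_right_distrib[symmetric] norm_vec_def)
 finally show ?thesis by (simp add: power2_eq_square)
qed

lemma trace_outer: "trace (outer g) = cinner g g"
 by (simp add: trace_def outer_def cinner_def mult.commute)

text \<open>The square matrix with columns \<open>g p\<close> has its conjugate transpose as a left
  inverse, hence also as a right inverse, which is the completeness relation.\<close>

lemma orthonormal_resolution:
 fixes g :: "nat => complex^'c::finite"
 assumes "!!p q. p < CARD('c) ==> q < CARD('c) ==> cinner (g p) (g q) = (if p = q then 1 else 0)"
 shows "(SUM p<CARD('c). outer (g p)) = mat 1"
proof -
 obtain h where h: "bij_betw h (UNIV :: 'c set) {..<CARD('c)}"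
  using ex_bij_betw_finite_nat[of "UNIV :: 'c set"] by (auto simp: atLeast0LessThan)
 have hl: "h a < CARD('c)" for a using h by (auto simp: bij_betw_def)
 have hi: "h a = h b \<longleftrightarrow> a = b" for a b using h by (auto simp: bij_betw_def inj_on_def)
 define V where "V = (\<chi> i a. g (h a) $ i)"
 define W where "W = (\<chi> a i. cnj (g (h a) $ i))"
 have "W ** V = mat 1"
  using assms hl hi by (auto simp: vec_eq_iff W_def V_def matrix_matrix_mult_def mat_def cinner_def)
 then have VW: "V ** W = mat 1" by (simp add: matrix_left_right_inverse)
 have "(SUM p<CARD('c). outer (g p)) = (SUM a:UNIV. outer (g (h a)))"
  by (rule sum.reindex_bij_betw[OF h, symmetric])
 also have "... = V ** W"
  by (simp add: vec_eq_iff sum_component V_def W_def outer_def matrix_matrix_mult_def)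
 finally show ?thesis using VW by simp
qed

text \<open>All \<open>2 J\<close> bands in increasing order of frequency.\<close>

definition band_index :: "nat => nat => nat \<times> int"
where "band_index J p = (if p < J then (J - p, -1) else (p - J + 1, 1))"

definition lam :: "('d::finite, 'c::finite) wave_model => nat => real^'d => real"
where "lam M p k = freq M (fst (band_index (nbands M) p)) (snd (band_index (nbands M) p)) k"

definition prj :: "('d::finite, 'c::finite) wave_model => nat => real^'d => complex^'c^'c"
where "prj M p k = outer (evec M (fst (band_index (nbands M) p)) (snd (band_index (nbands M) p)) k)"

lemma band_index_surj:
 assumes "n : {1..J}" "ze : signs"
 shows "EX p<2 * J. band_index J p = (n, ze)"
proof (cases "ze = 1")
 case True
 then show ?thesis using assms by (intro exI[of _ "J + n - 1"]) (auto simp: band_index_def)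
next
 case False
 then show ?thesis using assms by (intro exI[of _ "J - n"]) (auto simp: band_index_def signs_def)
qed

lemma band_index_inj: "p < 2 * J ==> q < 2 * J ==> band_index J p = band_index J q \<longleftrightarrow> p = q"
 by (auto simp: band_index_def)

lemma band_index_range: "p < 2 * J ==> fst (band_index J p) : {1..J} & snd (band_index J p) : signs"
 by (auto simp: band_index_def signs_def)

lemma linear_partD:
 fixes M :: "('d::finite, 'c::finite) wave_model"
 assumes "linear_part M"
 shows "CARD('c) = 2 * nbands M"
  and "!!k n ze. n : {1..nbands M} ==> ze : signs ==> Lop M k *v evec M n ze k = complex_of_real (freq M n ze k) *s evec M n ze k"
  and "!!k n ze n' ze'. n : {1..nbands M} ==> ze : signs ==> n' : {1..nbands M} ==> ze' : signs ==>
   cinner (evec M n ze k) (evec M n' ze' k) = (if n = n' & ze = ze' then 1 else 0)"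
  and "!!k n. 1 <= n ==> n < nbands M ==> freq M n 1 k <= freq M (n + 1) 1 k"
  and "!!k n. 1 <= n ==> n < nbands M ==> freq M (n + 1) (-1) k <= freq M n (-1) k"
  and "!!k. freq M 1 1 k >= 0" "!!k. 0 >= freq M 1 (-1) k"
  and "!!k n ze. n : {1..nbands M} ==> ze : signs ==> freq M n (-ze) (-k) = - freq M n ze k"
  and "closed (sigma_bc M)" "sigma_bc M : null_sets lebesgue"
  and "smooth_along coord_lines (- sigma_bc M) (Lop M)"
 using assms unfolding linear_part_def by blast+

lemma evec_cinner:
 fixes M :: "('d::finite, 'c::finite) wave_model"
 assumes L: "linear_part M" and p: "p < CARD('c)" and q: "q < CARD('c)"
 shows "cinner (evec M (fst (band_index (nbands M) p)) (snd (band_index (nbands M) p)) k)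
  (evec M (fst (band_index (nbands M) q)) (snd (band_index (nbands M) q)) k) = (if p = q then 1 else 0)"
proof -
 have r: "fst (band_index (nbands M) p) : {1..nbands M}" "snd (band_index (nbands M) p) : signs"
  "fst (band_index (nbands M) q) : {1..nbands M}" "snd (band_index (nbands M) q) : signs"
  using band_index_range[of p "nbands M"] band_index_range[of q "nbands M"] p q linear_partD(1)[OF L] by auto
 show ?thesis
  unfolding linear_partD(3)[OF L r] using band_index_inj[of p "nbands M" q] p q linear_partD(1)[OF L]
  by (auto simp: prod_eq_iff)
qed

lemma prj_facts:
 fixes M :: "('d::finite, 'c::finite) wave_model"
 assumes L: "linear_part M"
 shows prj_mult: "p < CARD('c) ==> q < CARD('c) ==> prj M p k ** prj M q k = (if p = q then prj M p k else 0)"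
  and prj_eigen: "p < CARD('c) ==> Lop M k ** prj M p k = lam M p k *R prj M p k"
  and prj_sum: "(SUM p<CARD('c). prj M p k) = mat 1"
  and prj_norm: "p < CARD('c) ==> norm (prj M p k) = 1"
  and prj_trace: "p < CARD('c) ==> trace (prj M p k) = 1"
proof -
 note ev = evec_cinner[OF L]
 show "prj M p k ** prj M q k = (if p = q then prj M p k else 0)" if "p < CARD('c)" "q < CARD('c)"
  unfolding prj_def outer_mult_outer ev[OF that] by (auto simp: vec_eq_iff outer_def)
 show "Lop M k ** prj M p k = lam M p k *R prj M p k" if p: "p < CARD('c)"
 proof -
  have r: "fst (band_index (nbands M) p) : {1..nbands M}" "snd (band_index (nbands M) p) : signs"
   using band_index_range[of p "nbands M"] p linear_partD(1)[OF L] by auto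
  show ?thesis unfolding prj_def lam_def by (rule matrix_mult_outer[OF linear_partD(2)[OF L r]])
 qed
 show "(SUM p<CARD('c). prj M p k) = mat 1"
  unfolding prj_def by (rule orthonormal_resolution) (rule ev)
 show "norm (prj M p k) = 1" if "p < CARD('c)"
 proof -
  have "complex_of_real ((norm (evec M (fst (band_index (nbands M) p)) (snd (band_index (nbands M) p)) k))\<^sup>2) = 1"
   using ev[OF that that, of k] by (simp add: cinner_self)
  then show ?thesis unfolding prj_def norm_outer by (metis of_real_eq_1_iff)
 qed
 show "trace (prj M p k) = 1" if "p < CARD('c)"
  unfolding prj_def trace_outer using ev[OF that that] by simp
qed

text \<open>Neighbours in the joint ordering are two negative bands, the two first bands, or two
  positive bands. Off \<open>sigma_bc\<close>, equality is excluded in the outer cases by the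
  absence of crossings, and in the middle one because the first frequencies do not vanish.\<close>

lemma lam_strict:
 fixes M :: "('d::finite, 'c::finite) wave_model"
 assumes L: "linear_part M" and p: "Suc p < CARD('c)"
 shows "lam M p k <= lam M (Suc p) k" and "k ~: sigma_bc M ==> lam M p k < lam M (Suc p) k"
proof -
 let ?J = "nbands M"
 have c: "CARD('c) = 2 * ?J" by (rule linear_partD(1)[OF L])
 consider "Suc p < ?J" | "Suc p = ?J" | "?J <= p" by linarith
 then have "lam M p k <= lam M (Suc p) k & (k ~: sigma_bc M --> lam M p k ~= lam M (Suc p) k)"
 proof cases
  case 1
  have e: "lam M p k = freq M ((?J - Suc p) + 1) (-1) k" "lam M (Suc p) k = freq M (?J - Suc p) (-1) k"
   using 1 by (simp_all add: lam_def band_index_def Suc_diff_Suc)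
  have r: "1 <= ?J - Suc p" "?J - Suc p < ?J" using 1 by auto
  show ?thesis unfolding e using linear_partD(5)[OF L r, of k] r by (auto simp: sigma_bc_def signs_def)
 next
  case 2
  have "?J - p = 1" using 2 by simp
  then have e: "lam M p k = freq M 1 (-1) k" "lam M (Suc p) k = freq M 1 1 k"
   using 2 by (auto simp: lam_def band_index_def)
  show ?thesis unfolding e using linear_partD(6,7)[OF L, of k] by (auto simp: sigma_bc_def signs_def)
 next
  case 3
  have e: "lam M p k = freq M (p - ?J + 1) 1 k" "lam M (Suc p) k = freq M ((p - ?J + 1) + 1) 1 k"
   using 3 by (simp_all add: lam_def band_index_def Suc_diff_le)
  have r: "1 <= p - ?J + 1" "p - ?J + 1 < ?J" using 3 p c by auto
  show ?thesis unfolding e using linear_partD(4)[OF L r, of k] r by (auto simp: sigma_bc_def signs_def)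
 qed
 then show "lam M p k <= lam M (Suc p) k" "k ~: sigma_bc M ==> lam M p k < lam M (Suc p) k" by auto
qed

lemma lam_strict_mono:
 fixes M :: "('d::finite, 'c::finite) wave_model"
 assumes L: "linear_part M"
 shows "p <= q ==> q < CARD('c) ==> lam M p k <= lam M q k"
  and "k ~: sigma_bc M ==> p < q ==> q < CARD('c) ==> lam M p k < lam M q k"
proof -
 show "lam M p k <= lam M q k" if "p <= q" "q < CARD('c)"
  using that by (induction q rule: dec_induct) (auto intro: order_trans[OF _ lam_strict(1)[OF L]])
 show "lam M p k < lam M q k" if "k ~: sigma_bc M" "p < q" "q < CARD('c)"
 proof -
  have "Suc p <= q" using that by simp
  then show ?thesis using that(3)
  proof (induction q rule: dec_induct)
   case base then show ?case using lam_strict(2)[OF L _ that(1)] by simp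
  next
   case (step n) then show ?case using lam_strict(2)[OF L _ that(1), of n] by (auto intro: less_trans)
  qed
 qed
qed

text \<open>Counting from the left end gives \<open>q <= f q\<close>, counting from the right end
  the reverse. It will show that a matching of ordered eigenvalues permutes nothing.\<close>

lemma strict_mono_self_map_id:
 fixes f :: "nat => nat"
 assumes "!!p. p < n ==> f p < n" and "!!p q. p < q ==> q < n ==> f p < f q" and "p < n"
 shows "f p = p"
proof -
 have up: "q <= f q" if "q < n" for q
  using that
 proof (induction q)
  case (Suc q) then show ?case using assms(2)[of q "Suc q"] by simp
 qed simp
 have down: "f p + d <= f (p + d)" if "p + d < n" for d
  using that
 proof (induction d)
  case (Suc d) then show ?case using assms(2)[of "p + d" "Suc (p + d)"] by simp
 qed simp
 have "f p + (n - 1 - p) <= f (n - 1)" using down[of "n - 1 - p"] assms(3) by simp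
 moreover have "f (n - 1) < n" using assms(1)[of "n - 1"] assms(3) by simp
 ultimately show ?thesis using up[OF assms(3)] assms(3) by linarith
qed

lemma matrix_mult_sum_left: "(SUM i:S. f i) ** B = (SUM i:S. f i ** B)" for B :: "complex^'c^'c" and f :: "'i => complex^'c^'c"
 by (rule matrix_mult.sum_left)

lemma matrix_mult_sum_right: "B ** (SUM i:S. f i) = (SUM i:S. B ** f i)" for B :: "complex^'c^'c" and f :: "'i => complex^'c^'c"
 by (rule matrix_mult.sum_right)

section \<open>Continuity of eigenvalues and projections\<close>

context
 fixes M :: "('d::finite, 'c::finite) wave_model"
 assumes L: "linear_part M"
begin

lemma Lop_resolution: "Lop M k = (SUM q<CARD('c). lam M q k *R prj M q k)"
proof -
 have "Lop M k = Lop M k ** (SUM q<CARD('c). prj M q k)" by (simp add: prj_sum[OF L])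
 also have "... = (SUM q<CARD('c). lam M q k *R prj M q k)"
  unfolding matrix_mult_sum_right by (intro sum.cong) (auto simp: prj_eigen[OF L])
 finally show ?thesis .
qed

lemma prj_eigen_left:
 assumes p: "p < CARD('c)"
 shows "prj M p k ** Lop M k = lam M p k *R prj M p k"
proof -
 have "prj M p k ** Lop M k = (SUM q<CARD('c). lam M q k *R (prj M p k ** prj M q k))"
  unfolding Lop_resolution matrix_mult_sum_right by (simp add: matrix_mult.scaleR_right)
 also have "... = (SUM q<CARD('c). if q = p then lam M p k *R prj M p k else 0)"
  using p by (intro sum.cong) (auto simp: prj_mult[OF L])
 also have "... = lam M p k *R prj M p k" using p by simp
 finally show ?thesis .
qed

text \<open>The left projection turns \<open>Lop M k'\<close> into its eigenvalue, and the right one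
  does so with \<open>Lop M k\<close>. The continuity and derivative formulas for eigenvalues and
  projections all rest on this identity.\<close>

lemma prj_perturbation:
 assumes p: "p < CARD('c)" and q: "q < CARD('c)"
 shows "prj M p k' ** (Lop M k' - Lop M k) ** prj M q k = (lam M p k' - lam M q k) *R (prj M p k' ** prj M q k)"
proof -
 have "prj M p k' ** (Lop M k' - Lop M k) ** prj M q k
   = (prj M p k' ** Lop M k') ** prj M q k - prj M p k' ** (Lop M k ** prj M q k)"
  by (simp add: matrix_mult.diff_left matrix_mult.diff_right matrix_mul_assoc)
 also have "... = (lam M p k' - lam M q k) *R (prj M p k' ** prj M q k)"
  unfolding prj_eigen_left[OF p] prj_eigen[OF L q]
  by (simp add: matrix_mult.scaleR_left matrix_mult.scaleR_right scaleR_diff_left)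
 finally show ?thesis .
qed

lemma prj_mult_prj_bound:
 "EX K>0. ALL p q k k'. p < CARD('c) --> q < CARD('c) --> \<bar>lam M p k' - lam M q k\<bar> * norm (prj M p k' ** prj M q k) <= K * norm (Lop M k' - Lop M k)"
proof -
 obtain K where K: "0 < K" "!!(a :: complex^'c^'c) (b :: complex^'c^'c). norm (a ** b) <= norm a * norm b * K"
  using matrix_mult.pos_bounded by blast
 have "\<bar>lam M p k' - lam M q k\<bar> * norm (prj M p k' ** prj M q k) <= K * K * norm (Lop M k' - Lop M k)"
  if p: "p < CARD('c)" and q: "q < CARD('c)" for p q k k'
 proof -
  have "\<bar>lam M p k' - lam M q k\<bar> * norm (prj M p k' ** prj M q k) = norm (prj M p k' ** (Lop M k' - Lop M k) ** prj M q k)"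
   unfolding prj_perturbation[OF p q] by simp
  also have "... <= norm (prj M p k' ** (Lop M k' - Lop M k)) * norm (prj M q k) * K" by (rule K(2))
  also have "... <= (norm (prj M p k') * norm (Lop M k' - Lop M k) * K) * norm (prj M q k) * K"
   using K(1) by (intro mult_right_mono K(2)) auto
  finally show ?thesis using prj_norm[OF L p] prj_norm[OF L q] by (simp add: mult_ac)
 qed
 then show ?thesis using K(1) by (intro exI[of _ "K * K"]) simp
qed

text \<open>If all eigenvalues at \<open>k'\<close> were farther away, every block
  \<open>prj M p k' ** prj M q k\<close> would have norm below \<open>1 / CARD('c)\<close>. But
  these blocks add up to \<open>prj M q k\<close>, which has norm 1.\<close>

lemma eigenvalue_near:
 "EX C>0. ALL q k k'. q < CARD('c) --> (EX p<CARD('c). \<bar>lam M p k' - lam M q k\<bar> <= C * norm (Lop M k' - Lop M k))"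
proof -
 obtain K where K: "0 < K"
  "!!p q k k'. p < CARD('c) ==> q < CARD('c) ==> \<bar>lam M p k' - lam M q k\<bar> * norm (prj M p k' ** prj M q k) <= K * norm (Lop M k' - Lop M k)"
  using prj_mult_prj_bound by blast
 have Dp: "0 < real CARD('c)" by simp
 have "EX p<CARD('c). \<bar>lam M p k' - lam M q k\<bar> <= (real CARD('c) * K) * norm (Lop M k' - Lop M k)" if q: "q < CARD('c)" for q k k'
 proof (rule ccontr)
  assume "~ ?thesis"
  then have gt: "\<bar>lam M p k' - lam M q k\<bar> > (real CARD('c) * K) * norm (Lop M k' - Lop M k)" if "p < CARD('c)" for p
   using that by (simp add: not_le)
  let ?e = "norm (Lop M k' - Lop M k)"
  have "norm (prj M p k' ** prj M q k) < 1 / real CARD('c)" if p: "p < CARD('c)" for p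
  proof -
   have pos: "0 < \<bar>lam M p k' - lam M q k\<bar>"
   proof -
    have "0 <= real CARD('c) * K * ?e" using K(1) by (intro mult_nonneg_nonneg) auto
    then show ?thesis using gt[OF p] by linarith
   qed
   have "real CARD('c) * (K * ?e) < \<bar>lam M p k' - lam M q k\<bar>" using gt[OF p] by (simp add: mult.assoc)
   then have "K * ?e < \<bar>lam M p k' - lam M q k\<bar> * (1 / real CARD('c))" using Dp by (simp add: field_simps)
   then have "\<bar>lam M p k' - lam M q k\<bar> * norm (prj M p k' ** prj M q k) < \<bar>lam M p k' - lam M q k\<bar> * (1 / real CARD('c))"
    using K(2)[OF p q, of k' k] by linarith
   then show ?thesis using mult_less_cancel_left_pos[OF pos] by blast
  qed
  then have "(SUM p<CARD('c). norm (prj M p k' ** prj M q k)) < (SUM p<CARD('c). 1 / real CARD('c))"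
   by (intro sum_strict_mono) (auto simp: lessThan_empty_iff)
  moreover have "prj M q k = (SUM p<CARD('c). prj M p k' ** prj M q k)"
   unfolding matrix_mult_sum_left[symmetric] prj_sum[OF L] by simp
  then have "norm (prj M q k) <= (SUM p<CARD('c). norm (prj M p k' ** prj M q k))"
   by (metis norm_sum)
  ultimately show False using prj_norm[OF L q, of k] Dp by simp
 qed
 then show ?thesis using K(1) Dp by (intro exI[of _ "real CARD('c) * K"]) simp
qed

lemma open_complement_sigma: "open (- sigma_bc M)"
 using linear_partD(9)[OF L] by (simp add: open_Compl)

lemma gap:
 assumes k: "k ~: sigma_bc M"
 shows "EX G>0. ALL p q. p < CARD('c) --> q < CARD('c) --> p ~= q --> G <= \<bar>lam M p k - lam M q k\<bar>"
proof -
 define S where "S = insert 1 ((%(p, q). \<bar>lam M p k - lam M q k\<bar>) ` {(p, q). p < CARD('c) & q < CARD('c) & p ~= q})"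
 have fin: "finite {(p, q). p < CARD('c) & q < CARD('c) & p ~= q}"
  by (rule finite_subset[of _ "{..<CARD('c)} \<times> {..<CARD('c)}"]) auto
 have fS: "finite S" "S ~= {}" using fin by (auto simp: S_def)
 have pos: "0 < s" if "s : S" for s
 proof -
  have "lam M p k ~= lam M q k" if "p < CARD('c)" "q < CARD('c)" "p ~= q" for p q
   using lam_strict_mono(2)[OF L k, of p q] lam_strict_mono(2)[OF L k, of q p] that by (cases "p < q") auto
  then show ?thesis using \<open>s : S\<close> by (auto simp: S_def)
 qed
 have "0 < Min S" using fS pos by simp
 moreover have "Min S <= \<bar>lam M p k - lam M q k\<bar>" if "p < CARD('c)" "q < CARD('c)" "p ~= q" for p q
  using that fS by (intro Min_le) (auto simp: S_def)
 ultimately show ?thesis by blast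
qed

text \<open>Near a point off the band crossings the eigenvalues cannot be permuted, since they are ordered.\<close>

lemma lam_continuous:
 assumes k: "k ~: sigma_bc M" and p: "p < CARD('c)"
 shows "isCont (lam M p) k"
proof -
 obtain C where C: "0 < C"
  "!!q k k'. q < CARD('c) ==> EX p<CARD('c). \<bar>lam M p k' - lam M q k\<bar> <= C * norm (Lop M k' - Lop M k)"
  using eigenvalue_near by blast
 obtain G where G: "0 < G" "!!p q. p < CARD('c) ==> q < CARD('c) ==> p ~= q ==> G <= \<bar>lam M p k - lam M q k\<bar>"
  using gap[OF k] by blast
 have cont: "isCont (Lop M) k" using k by (auto simp: sigma_bc_def)
 have lim: "((%k'. C * norm (Lop M k' - Lop M k)) \<longlongrightarrow> 0) (at k)"
 proof -
  have "((%k'. Lop M k' - Lop M k) \<longlongrightarrow> 0) (at k)" using cont by (simp add: isCont_def LIM_zero_iff)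
  then show ?thesis by (intro tendsto_mult_right_zero tendsto_norm_zero)
 qed
 have "\<forall>\<^sub>F k' in at k. C * norm (Lop M k' - Lop M k) < G / 2"
  by (rule order_tendstoD(2)[OF lim]) (use G in simp)
 then have "\<forall>\<^sub>F k' in at k. \<bar>lam M p k' - lam M p k\<bar> <= C * norm (Lop M k' - Lop M k)"
 proof eventually_elim
  case (elim k')
  \<comment> \<open>Match each eigenvalue at \<open>k\<close> with a close one at \<open>k'\<close>.
    As long as the error is below half the gap, the matching is strictly increasing and hence the
    identity.\<close>
  have "ALL q:{..<CARD('c)}. EX p. p < CARD('c) & \<bar>lam M p k' - lam M q k\<bar> <= C * norm (Lop M k' - Lop M k)" using C(2) by simp
  from bchoice[OF this] obtain f where f: "!!q. q < CARD('c) ==> f q < CARD('c)"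
   "!!q. q < CARD('c) ==> \<bar>lam M (f q) k' - lam M q k\<bar> <= C * norm (Lop M k' - Lop M k)" by auto
  have mono: "f q < f q'" if "q < q'" "q' < CARD('c)" for q q'
  proof -
   have "lam M q' k - lam M q k >= G"
    using G(2)[of q' q] lam_strict_mono(2)[OF L k that] that by simp
   then have "lam M (f q) k' < lam M (f q') k'"
    using f(2)[of q] f(2)[of q'] that elim by (simp add: abs_le_iff)
   then show ?thesis using lam_strict_mono(1)[OF L, of "f q'" "f q" k'] f(1)[of q] that by (meson leD leI less_trans)
  qed
  have "f p = p" by (rule strict_mono_self_map_id[OF f(1) mono p])
  then show ?case using f(2)[OF p] by simp
 qed
 then have "((%k'. \<bar>lam M p k' - lam M p k\<bar>) \<longlongrightarrow> 0) (at k)"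
  by (intro tendsto_sandwich[OF _ _ tendsto_const lim]) auto
 then show ?thesis unfolding isCont_def by (rule tendsto_rabs_zero_cancel[THEN LIM_zero_cancel])
qed

text \<open>The resolution of the identity at \<open>k\<close> is inserted on the right of one term
  and that at \<open>k'\<close> on the left of the other. The diagonal blocks cancel; the remaining
  ones are controlled by the change of \<open>Lop\<close> divided by a spectral gap.\<close>

lemma prj_diff:
 assumes p: "p < CARD('c)"
 shows "prj M p k' - prj M p k = (SUM q:{..<CARD('c)} - {p}. prj M p k' ** prj M q k - prj M q k' ** prj M p k)"
proof -
 have "prj M p k' - prj M p k = prj M p k' ** (SUM q<CARD('c). prj M q k) - (SUM q<CARD('c). prj M q k') ** prj M p k"
  by (simp add: prj_sum[OF L])
 also have "... = (SUM q<CARD('c). prj M p k' ** prj M q k - prj M q k' ** prj M p k)"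
  unfolding matrix_mult_sum_left matrix_mult_sum_right by (simp add: sum_subtractf)
 also have "... = (SUM q:{..<CARD('c)} - {p}. prj M p k' ** prj M q k - prj M q k' ** prj M p k)"
  using p by (subst sum.remove[of _ p]) auto
 finally show ?thesis .
qed

lemma lam_diff_nonzero_eventually:
 assumes k: "k ~: sigma_bc M" and p: "p < CARD('c)" and q: "q < CARD('c)" and "p ~= q"
 shows "\<forall>\<^sub>F k' in at k. lam M p k' - lam M q k ~= 0"
proof -
 have ne: "lam M p k - lam M q k ~= 0"
  using lam_strict_mono(2)[OF L k, of p q] lam_strict_mono(2)[OF L k, of q p] assms by (cases "p < q") auto
 have "((%k'. lam M p k' - lam M q k) \<longlongrightarrow> lam M p k - lam M q k) (at k)"
  using lam_continuous[OF k p] by (intro tendsto_intros) (simp add: isCont_def)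
 then show ?thesis using ne by (rule tendsto_imp_eventually_ne)
qed

lemma prj_mult_tendsto_0:
 assumes k: "k ~: sigma_bc M" and p: "p < CARD('c)" and q: "q < CARD('c)" and "p ~= q"
 shows "((%k'. prj M p k' ** prj M q k) \<longlongrightarrow> 0) (at k)"
proof -
 obtain K where K: "0 < K"
  "!!p q k k'. p < CARD('c) ==> q < CARD('c) ==> \<bar>lam M p k' - lam M q k\<bar> * norm (prj M p k' ** prj M q k) <= K * norm (Lop M k' - Lop M k)"
  using prj_mult_prj_bound by blast
 have ne: "lam M p k - lam M q k ~= 0"
  using lam_strict_mono(2)[OF L k, of p q] lam_strict_mono(2)[OF L k, of q p] assms by (cases "p < q") auto
 have cont: "((%k'. Lop M k' - Lop M k) \<longlongrightarrow> 0) (at k)"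
  using k by (auto simp: sigma_bc_def isCont_def LIM_zero_iff)
 have lc: "((%k'. \<bar>lam M p k' - lam M q k\<bar>) \<longlongrightarrow> \<bar>lam M p k - lam M q k\<bar>) (at k)"
  using lam_continuous[OF k p] by (intro tendsto_intros) (simp add: isCont_def)
 have lim: "((%k'. K * norm (Lop M k' - Lop M k) / \<bar>lam M p k' - lam M q k\<bar>) \<longlongrightarrow> K * norm (0 :: complex^'c^'c) / \<bar>lam M p k - lam M q k\<bar>) (at k)"
  using ne by (intro tendsto_intros cont lc) auto
 show ?thesis
 proof (rule tendsto_norm_zero_cancel, rule tendsto_sandwich[OF _ _ tendsto_const])
  show "\<forall>\<^sub>F k' in at k. norm (prj M p k' ** prj M q k) <= K * norm (Lop M k' - Lop M k) / \<bar>lam M p k' - lam M q k\<bar>"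
   using lam_diff_nonzero_eventually[OF assms]
  proof eventually_elim
   case (elim k')
   then show ?case using K(2)[OF p q, of k' k] by (simp add: pos_le_divide_eq mult.commute)
  qed
  show "((%k'. K * norm (Lop M k' - Lop M k) / \<bar>lam M p k' - lam M q k\<bar>) \<longlongrightarrow> 0) (at k)" using lim by simp
 qed auto
qed

lemma prj_mult_tendsto_0':
 assumes k: "k ~: sigma_bc M" and p: "p < CARD('c)" and q: "q < CARD('c)" and "p ~= q"
 shows "((%k'. prj M q k' ** prj M p k) \<longlongrightarrow> 0) (at k)"
 using prj_mult_tendsto_0[OF k q p] assms by simp

lemma prj_continuous:
 assumes k: "k ~: sigma_bc M" and p: "p < CARD('c)"
 shows "isCont (prj M p) k"
proof -
 have "((%k'. prj M p k' - prj M p k) \<longlongrightarrow> 0) (at k)"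
  unfolding prj_diff[OF p]
 proof (rule tendsto_null_sum)
  fix q assume q: "q : {..<CARD('c)} - {p}"
  then have "((%k'. prj M p k' ** prj M q k - prj M q k' ** prj M p k) \<longlongrightarrow> 0 - 0) (at k)"
   by (intro tendsto_diff prj_mult_tendsto_0[OF k p] prj_mult_tendsto_0'[OF k p]) auto
  then show "((%k'. prj M p k' ** prj M q k - prj M q k' ** prj M p k) \<longlongrightarrow> 0) (at k)" by simp
 qed
 then show ?thesis unfolding isCont_def by (rule LIM_zero_cancel)
qed

end

section \<open>Differentiability of frequencies and projections off the band crossings\<close>

lemma has_vector_derivative_iff_quotient:
 "(f has_vector_derivative D) (at 0) \<longleftrightarrow> ((%t. (1 / t) *R (f t - f 0)) \<longlongrightarrow> D) (at 0)"
proof -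
 have eq: "\<forall>\<^sub>F t in at 0. norm ((f t - f 0) - (t - 0) *R D) / norm (t - 0) = norm ((1 / t) *R (f t - f 0) - D)"
  unfolding eventually_at_filter
 proof (intro always_eventually allI impI)
  fix t :: real assume t: "t ~= 0"
  have "(1 / t) *R (f t - f 0) - D = (1 / t) *R ((f t - f 0) - t *R D)"
   using t by (simp add: scaleR_diff_right)
  then have "norm ((1 / t) *R (f t - f 0) - D) = norm ((1 / t) *R ((f t - f 0) - t *R D))" by (simp only:)
  then show "norm ((f t - f 0) - (t - 0) *R D) / norm (t - 0) = norm ((1 / t) *R (f t - f 0) - D)"
   using t by simp
 qed
 have "(f has_vector_derivative D) (at 0) \<longleftrightarrow> ((%t. norm ((f t - f 0) - (t - 0) *R D) / norm (t - 0)) \<longlongrightarrow> 0) (at 0)"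
  unfolding has_vector_derivative_def has_derivative_iff_norm by (auto intro: bounded_linear_scaleR_left)
 also have "... \<longleftrightarrow> ((%t. norm ((1 / t) *R (f t - f 0) - D)) \<longlongrightarrow> 0) (at 0)"
  by (rule tendsto_cong[OF eq])
 also have "... \<longleftrightarrow> ((%t. (1 / t) *R (f t - f 0)) \<longlongrightarrow> D) (at 0)"
  by (simp add: tendsto_norm_zero_iff LIM_zero_iff)
 finally show ?thesis .
qed

lemma Ck1_D:
 fixes f :: "real^'d => 'v::real_normed_vector"
 assumes "Ck_along coord_lines (Suc n) U f"
 shows "continuous_on U f"
  and "b : Basis ==> EX g. (ALL x:U. ((%t. f (x + t *R b)) has_vd g x) (at 0)) & Ck_along coord_lines n U g"
proof -
 show "continuous_on U f" using assms by simp
 assume b: "b : Basis"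
 have "ALL p:coord_lines. EX g. (ALL x:U. ((%t. f (p x t)) has_vd g x) (at 0)) & Ck_along coord_lines n U g"
  using assms by simp
 moreover have "(%x t. x + t *R b) : coord_lines" using b by (auto simp: coord_lines_def)
 ultimately show "EX g. (ALL x:U. ((%t. f (x + t *R b)) has_vd g x) (at 0)) & Ck_along coord_lines n U g"
  by (rule bspec)
qed

lemma Ck1_I:
 fixes f :: "real^'d => 'v::real_normed_vector"
 assumes "continuous_on U f"
  and "!!b. b : Basis ==> EX g. (ALL x:U. ((%t. f (x + t *R b)) has_vd g x) (at 0)) & continuous_on U g"
 shows "Ck_along coord_lines (Suc 0) U f"
 using assms by (simp add: coord_lines_def) blast

lemma Ck1_bilinear:
 fixes f :: "real^'d => 'v::real_normed_vector" and g :: "real^'d => 'w::real_normed_vector"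
 assumes "bounded_bilinear pr" and f: "Ck_along coord_lines (Suc 0) U f" and g: "Ck_along coord_lines (Suc 0) U g"
 shows "Ck_along coord_lines (Suc 0) U (%x. pr (f x) (g x))"
proof (rule Ck1_I)
 interpret bounded_bilinear pr by fact
 note c = Ck1_D(1)[OF f] Ck1_D(1)[OF g]
 show "continuous_on U (%x. pr (f x) (g x))" by (intro continuous_on c)
 fix b :: "real^'d" assume b: "b : Basis"
 obtain f' where f': "!!x. x : U ==> ((%t. f (x + t *R b)) has_vd f' x) (at 0)" "continuous_on U f'"
  using Ck1_D(2)[OF f b] by auto
 obtain g' where g': "!!x. x : U ==> ((%t. g (x + t *R b)) has_vd g' x) (at 0)" "continuous_on U g'"
  using Ck1_D(2)[OF g b] by auto
 have "((%t. pr (f (x + t *R b)) (g (x + t *R b))) has_vd pr (f x) (g' x) + pr (f' x) (g x)) (at 0)" if "x : U" for x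
  using has_vector_derivative[OF f'(1)[OF that] g'(1)[OF that]] by simp
 moreover have "continuous_on U (%x. pr (f x) (g' x) + pr (f' x) (g x))"
  by (intro continuous_intros continuous_on c f' g')
 ultimately show "EX h. (ALL x:U. ((%t. pr (f (x + t *R b)) (g (x + t *R b))) has_vd h x) (at 0)) & continuous_on U h"
  by (intro exI[of _ "%x. pr (f x) (g' x) + pr (f' x) (g x)"]) simp
qed

lemma Ck1_linear:
 fixes f :: "real^'d => 'v::real_normed_vector"
 assumes "bounded_linear h" and f: "Ck_along coord_lines (Suc 0) U f"
 shows "Ck_along coord_lines (Suc 0) U (%x. h (f x))"
proof (rule Ck1_I)
 interpret bounded_linear h by fact
 show "continuous_on U (%x. h (f x))" by (intro continuous_on Ck1_D(1)[OF f])
 fix b :: "real^'d" assume b: "b : Basis"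
 obtain f' where f': "!!x. x : U ==> ((%t. f (x + t *R b)) has_vd f' x) (at 0)" "continuous_on U f'"
  using Ck1_D(2)[OF f b] by auto
 have "((%t. h (f (x + t *R b))) has_vd h (f' x)) (at 0)" if "x : U" for x
  by (rule has_vector_derivative[OF f'(1)[OF that]])
 moreover have "continuous_on U (%x. h (f' x))" by (intro continuous_on f')
 ultimately show "EX g. (ALL x:U. ((%t. h (f (x + t *R b))) has_vd g x) (at 0)) & continuous_on U g"
  by (intro exI[of _ "%x. h (f' x)"]) simp
qed

text \<open>Moving from \<open>x\<close> to \<open>y\<close> one coordinate at a time.\<close>

lemma coordinate_path_bound:
 fixes f :: "'a::euclidean_space => 'v::real_normed_vector"
 assumes d: "!!b x. b : Basis ==> x : ball z de ==> ((%t. f (x + t *R b)) has_vd g b x) (at 0)"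
  and B: "!!b x. b : Basis ==> x : ball z de ==> norm (g b x) <= B"
  and x: "norm (x - z) < de / real DIM('a)" and y: "norm (y - z) < de / real DIM('a)"
 shows "norm (f y - f x) <= real DIM('a) * B * norm (y - x)"
proof -
 define w where "w S = x + (SUM b:S. ((y - x) \<bullet> b) *R b)" for S
 \<comment> \<open>Relative to \<open>z\<close>, each coordinate of a point on the path is a convex
   combination of the corresponding coordinates of the end points, hence below
   \<open>de / DIM('a)\<close>. The sum of all coordinates then stays below
   \<open>de\<close>.\<close>
 have near: "w S + s *R (((y - x) \<bullet> b) *R b) : ball z de" if S: "S \<subseteq> Basis" "b : Basis" "b ~: S" and s: "0 <= s" "s <= 1" for S b s
 proof -
  let ?v = "w S + s *R (((y - x) \<bullet> b) *R b) - z"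
  have "\<bar>?v \<bullet> c\<bar> < de / real DIM('a)" if c: "c : Basis" for c
  proof -
   have fS: "finite S" by (rule finite_subset[OF S(1) finite_Basis])
   have "w S \<bullet> c = x \<bullet> c + (if c : S then (y - x) \<bullet> c else 0)"
    unfolding w_def inner_add_left inner_sum_left using c S fS
    by (simp add: inner_Basis if_distrib sum.delta subset_eq cong: if_cong sum.cong)
   then have "?v \<bullet> c = (x - z) \<bullet> c + (if c : S then 1 else if c = b then s else 0) * ((y - x) \<bullet> c)"
    using c S by (auto simp: inner_diff_left inner_add_left inner_Basis)
   moreover define r where "r = (if c : S then 1 else if c = b then s else 0)"
   ultimately have r: "0 <= r" "r <= 1" "?v \<bullet> c = (x - z) \<bullet> c + r * ((y - x) \<bullet> c)"
    using s by simp_all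
   have "?v \<bullet> c = (1 - r) * ((x - z) \<bullet> c) + r * ((y - z) \<bullet> c)"
    unfolding r(3) by (simp add: inner_diff_left algebra_simps)
   also have "\<bar>...\<bar> <= (1 - r) * \<bar>(x - z) \<bullet> c\<bar> + r * \<bar>(y - z) \<bullet> c\<bar>"
    using r(1,2) abs_triangle_ineq[of "(1 - r) * ((x - z) \<bullet> c)" "r * ((y - z) \<bullet> c)"] by (simp add: abs_mult)
   also have "... <= (1 - r) * norm (x - z) + r * norm (y - z)"
    using r(1,2) by (intro add_mono mult_left_mono Basis_le_norm c) auto
   also have "... < de / real DIM('a)"
    using x y r(1,2) by (intro convex_bound_lt) auto
   finally show ?thesis .
  qed
  then have "(SUM c:Basis. \<bar>?v \<bullet> c\<bar>) < (SUM c:(Basis :: 'a set). de / real DIM('a))"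
   by (intro sum_strict_mono) auto
  then have "norm ?v < de" using norm_le_l1[of ?v] by simp
  then show ?thesis by (simp add: dist_norm norm_minus_commute)
 qed
 have B0: "0 <= B"
 proof -
  have "norm (z - z) < de" using x norm_ge_zero[of "x - z"] by (smt (verit) DIM_positive divide_le_0_iff norm_zero diff_self of_nat_0_less_iff)
  then have "z : ball z de" by simp
  then show ?thesis using B[OF SOME_Basis] norm_ge_zero order_trans by blast
 qed
 have "norm (f (w S) - f x) <= real (card S) * (B * norm (y - x))" if "finite S" "S \<subseteq> Basis" for S
  using that
 proof (induction S rule: finite_induct)
  case empty then show ?case by (simp add: w_def)
 next
  case (insert b S)
  let ?a = "(y - x) \<bullet> b"
  have b: "b : Basis" "S \<subseteq> Basis" using insert by auto
  have wi: "w (insert b S) = w S + ?a *R b" using insert by (simp add: w_def)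
  have "norm (f (w S + (1 * ?a) *R b) - f (w S + (0 * ?a) *R b)) <= (B * \<bar>?a\<bar>) * norm (1 - 0 :: real)"
  proof (rule differentiable_bound[of "{0..1}" "%s. f (w S + (s * ?a) *R b)" "%s r. r *R (?a *R g b (w S + (s * ?a) *R b))" "B * \<bar>?a\<bar>" 1 0])
   fix s :: real assume s: "s : {0..1}"
   have inb: "w S + (s * ?a) *R b : ball z de" using near[OF b(2,1) insert(2), of s] s by simp
   have 1: "((%r. (r - s) * ?a) has_vd ?a) (at s)"
    by (auto intro!: derivative_eq_intros simp: has_vector_derivative_def)
   have 2: "((%t. f ((w S + (s * ?a) *R b) + t *R b)) has_vd g b (w S + (s * ?a) *R b)) (at ((%r. (r - s) * ?a) s))"
    using d[OF b(1) inb] by simp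
   have "(%t. f ((w S + (s * ?a) *R b) + t *R b)) \<circ> (%r. (r - s) * ?a) = (%s. f (w S + (s * ?a) *R b))"
    by (auto simp: fun_eq_iff algebra_simps)
   then have "((%s. f (w S + (s * ?a) *R b)) has_vd ?a *R g b (w S + (s * ?a) *R b)) (at s)"
    using vector_diff_chain_at[OF 1 2] by simp
   then show "((%s. f (w S + (s * ?a) *R b)) has_derivative (%r. r *R (?a *R g b (w S + (s * ?a) *R b)))) (at s within {0..1})"
    unfolding has_vector_derivative_def by (rule has_derivative_at_withinI)
   show "onorm (%r. r *R (?a *R g b (w S + (s * ?a) *R b))) <= B * \<bar>?a\<bar>"
   proof (rule onorm_bound)
    show "norm (r *R (?a *R g b (w S + (s * ?a) *R b))) <= B * \<bar>?a\<bar> * norm r" for r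
     using mult_left_mono[OF B[OF b(1) inb], of "\<bar>r\<bar> * \<bar>?a\<bar>"] by (simp add: mult_ac abs_mult)
   qed (use B0 in simp)
  qed auto
  also have "... <= B * norm (y - x)" using B0 Basis_le_norm[OF b(1), of "y - x"] by (simp add: mult_left_mono)
  finally have "norm (f (w (insert b S)) - f (w S)) <= B * norm (y - x)" by (simp add: wi)
  moreover have "norm (f (w (insert b S)) - f x) <= norm (f (w (insert b S)) - f (w S)) + norm (f (w S) - f x)"
   using norm_triangle_ineq[of "f (w (insert b S)) - f (w S)" "f (w S) - f x"] by simp
  ultimately show ?case using insert.IH[OF b(2)] insert(1,2) by (simp add: algebra_simps)
 qed
 from this[of Basis] have "norm (f (w Basis) - f x) <= real DIM('a) * (B * norm (y - x))" by simp
 moreover have "w Basis = y" by (simp add: w_def euclidean_representation)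
 ultimately show ?thesis by (simp add: mult.assoc)
qed

text \<open>Continuous partial derivatives are locally bounded, and coordinate paths turn this into
  local Lipschitz bounds. Compactness of the ball makes them uniform.\<close>

lemma Ck1_lipschitz_cball:
 fixes f :: "real^'d => 'v::real_normed_vector"
 assumes U: "open U" and f: "Ck_along coord_lines (Suc 0) U f" and K: "cball c r \<subseteq> U"
 shows "EX L>=0. ALL x:cball c r. ALL y:cball c r. norm (f x - f y) <= L * norm (x - y)"
proof -
 have "ALL b:Basis. EX g. (ALL x:U. ((%t. f (x + t *R b)) has_vd g x) (at 0)) & continuous_on U g"
  using Ck1_D(2)[OF f] by simp
 from bchoice[OF this] obtain g where g: "!!b x. b : Basis ==> x : U ==> ((%t. f (x + t *R b)) has_vd g b x) (at 0)"
  "!!b. b : Basis ==> continuous_on U (g b)" by blast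
 have "local_lipschitz {0::real} (cball c r) (%_. f)"
  unfolding local_lipschitz_def
 proof (intro ballI)
  fix z :: "real^'d" and t :: real assume z: "z : cball c r" "t : {0}"
  have zU: "z : U" using z K by auto
  have "\<forall>\<^sub>F x in nhds z. ALL b:Basis. norm (g b x) < norm (g b z) + 1"
  proof (subst eventually_ball_finite_distrib)
   show "ALL b:Basis. \<forall>\<^sub>F x in nhds z. norm (g b x) < norm (g b z) + 1"
   proof
    fix b :: "real^'d" assume "b : Basis"
    then have "isCont (g b) z" using g(2) zU U by (simp add: continuous_on_eq_continuous_at)
    then have "((%x. norm (g b x)) \<longlongrightarrow> norm (g b z)) (nhds z)"
     by (intro tendsto_norm) (simp add: isCont_def tendsto_at_iff_tendsto_nhds)
    then show "\<forall>\<^sub>F x in nhds z. norm (g b x) < norm (g b z) + 1" by (rule order_tendstoD(2)) simp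
   qed
  qed simp
  moreover have "\<forall>\<^sub>F x in nhds z. x : U" using U zU by (rule eventually_nhds_in_open)
  ultimately have "\<forall>\<^sub>F x in nhds z. x : U & (ALL b:Basis. norm (g b x) < norm (g b z) + 1)"
   by eventually_elim auto
  then obtain de where de: "0 < de" "!!x. dist x z < de ==> x : U & (ALL b:Basis. norm (g b x) < norm (g b z) + 1)"
   unfolding eventually_nhds_metric by blast
  define B where "B = (SUM b:(Basis :: (real^'d) set). norm (g b z) + 1)"
  have gB: "norm (g b x) <= B" if "b : Basis" "x : ball z de" for b x
  proof -
   have "norm (g b x) < norm (g b z) + 1" using de(2)[of x] that by (simp add: dist_commute)
   also have "... <= B" unfolding B_def using that(1) by (intro member_le_sum) auto
   finally show ?thesis by simp
  qed
  define u where "u = de / (2 * real DIM(real^'d))"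
  have u: "0 < u" "u < de / real DIM(real^'d)" using de(1) by (simp_all add: u_def field_simps)
  have lip: "(real DIM(real^'d) * B)-lipschitz_on (cball z u \<inter> cball c r) f"
  proof (rule lipschitz_onI)
   fix x y assume xy: "x : cball z u \<inter> cball c r" "y : cball z u \<inter> cball c r"
   have "norm (f x - f y) <= real DIM(real^'d) * B * norm (x - y)"
   proof (rule coordinate_path_bound[of z de f g])
    show "((%t. f (x + t *R b)) has_vd g b x) (at 0)" if "b : Basis" "x : ball z de" for b x
     using g(1)[OF that(1), of x] de(2)[of x] that(2) by (simp add: dist_commute)
    show "norm (y - z) < de / real DIM(real^'d)" "norm (x - z) < de / real DIM(real^'d)"
     using xy u(2) by (auto simp: dist_norm norm_minus_commute)
   qed (use gB in auto)
   then show "dist (f x) (f y) <= real DIM(real^'d) * B * dist x y" by (simp add: dist_norm)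
  qed (simp add: B_def sum_nonneg)
  show "EX u>0. EX L. ALL t:cball t u \<inter> {0}. L-lipschitz_on (cball z u \<inter> cball c r) f"
   using u(1) lip by blast
 qed
 then obtain L where "!!t. t : {0::real} ==> L-lipschitz_on (cball c r) ((%_. f) t)"
  by (rule local_lipschitz_compact_implies_lipschitz) auto
 then have L: "L-lipschitz_on (cball c r) f" by simp
 show ?thesis
  using lipschitz_onD[OF L] lipschitz_on_nonneg[OF L] by (intro exI[of _ L]) (auto simp: dist_norm)
qed

lemma Lop_derivative:
 fixes M :: "('d::finite, 'c::finite) wave_model"
 assumes L: "linear_part M" and e: "e : Basis"
 shows "EX dA. (ALL x:- sigma_bc M. ((%t. Lop M (x + t *R e)) has_vd dA x) (at 0)) &
  Ck_along coord_lines (Suc 0) (- sigma_bc M) dA"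
proof -
 have "Ck_along coord_lines (Suc (Suc 0)) (- sigma_bc M) (Lop M)"
  using linear_partD(11)[OF L] by (simp only: smooth_along_def)
 from Ck1_D(2)[OF this e] show ?thesis .
qed

lemma filterlim_line:
 assumes "e : Basis"
 shows "filterlim (%t. x + t *R e) (at (x :: real^'d)) (at 0)"
 unfolding filterlim_at
proof
 have "((%t. x + t *R e) \<longlongrightarrow> x + 0 *R e) (at 0)" by (intro tendsto_intros)
 then show "((%t. x + t *R e) \<longlongrightarrow> x) (at 0)" by simp
 have "e ~= 0" using assms nonzero_Basis by blast
 then show "\<forall>\<^sub>F t in at 0. x + t *R e : UNIV & x + t *R e ~= x"
  by (auto simp: eventually_at_filter)
qed

context
 fixes M :: "('d::finite, 'c::finite) wave_model" and e :: "real^'d" and dA :: "real^'d => complex^'c^'c"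
 assumes L: "linear_part M" and e: "e : Basis"
  and dA: "!!x. x ~: sigma_bc M ==> ((%t. Lop M (x + t *R e)) has_vd dA x) (at 0)"
begin

lemma Lop_quotient:
 assumes "x ~: sigma_bc M"
 shows "((%t. (1 / t) *R (Lop M (x + t *R e) - Lop M x)) \<longlongrightarrow> dA x) (at 0)"
 using dA[OF assms] unfolding has_vector_derivative_iff_quotient by simp

lemma lam_along_line:
 assumes x: "x ~: sigma_bc M" and p: "p < CARD('c)"
 shows "((%t. lam M p (x + t *R e)) \<longlongrightarrow> lam M p x) (at 0)" "((%t. prj M p (x + t *R e)) \<longlongrightarrow> prj M p x) (at 0)"
 using filterlim_compose[OF _ filterlim_line[OF e, of x], of "lam M p" "nhds (lam M p x)"]
  filterlim_compose[OF _ filterlim_line[OF e, of x], of "prj M p" "nhds (prj M p x)"]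
  lam_continuous[OF L x p] prj_continuous[OF L x p] by (simp_all add: isCont_def)

text \<open>The Hellmann-Feynman formula.\<close>

lemma lam_has_derivative:
 assumes x: "x ~: sigma_bc M" and p: "p < CARD('c)"
 shows "((%t. lam M p (x + t *R e)) has_vd Re (trace (prj M p x ** dA x ** prj M p x))) (at 0)"
proof -
 interpret trace: bounded_linear "trace :: complex^'c^'c => complex" by (rule bounded_linear_trace)
 let ?P' = "%t. prj M p (x + t *R e)" and ?P = "prj M p x"
 let ?Q = "%t. (1 / t) *R (Lop M (x + t *R e) - Lop M x)"
 have l1: "((%t. trace (?P' t ** ?Q t ** ?P)) \<longlongrightarrow> trace (?P ** dA x ** ?P)) (at 0)"
  by (intro trace.tendsto matrix_mult.tendsto lam_along_line x p Lop_quotient tendsto_const)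
 have "((%t. trace (?P' t ** ?P)) \<longlongrightarrow> trace (?P ** ?P)) (at 0)"
  by (intro trace.tendsto matrix_mult.tendsto lam_along_line x p tendsto_const)
 then have l2: "((%t. trace (?P' t ** ?P)) \<longlongrightarrow> 1) (at 0)"
  using prj_mult[OF L p p] prj_trace[OF L p] by simp
 \<comment> \<open>By the perturbation identity this quotient of traces is exactly the difference
   quotient of the eigenvalue, once the denominator, which tends to 1, is not 0.\<close>
 have l3: "((%t. Re (trace (?P' t ** ?Q t ** ?P) / trace (?P' t ** ?P))) \<longlongrightarrow> Re (trace (?P ** dA x ** ?P) / 1)) (at 0)"
  by (intro tendsto_intros l1 l2) simp
 have ev: "\<forall>\<^sub>F t in at 0. Re (trace (?P' t ** ?Q t ** ?P) / trace (?P' t ** ?P)) = (1 / t) *R (lam M p (x + t *R e) - lam M p (x + 0 *R e))"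
  using tendsto_imp_eventually_ne[OF l2 one_neq_zero]
 proof eventually_elim
  case (elim t)
  have "?P' t ** ?Q t ** ?P = (1 / t) *R (?P' t ** (Lop M (x + t *R e) - Lop M x) ** ?P)"
   by (simp only: matrix_mult.scaleR_right matrix_mult.scaleR_left)
  also have "... = ((1 / t) * (lam M p (x + t *R e) - lam M p x)) *R (?P' t ** ?P)"
   unfolding prj_perturbation[OF L p p] by simp
  finally have "trace (?P' t ** ?Q t ** ?P) = ((1 / t) * (lam M p (x + t *R e) - lam M p x)) *R trace (?P' t ** ?P)"
   by (simp only: trace.scaleR)
  then have "trace (?P' t ** ?Q t ** ?P) / trace (?P' t ** ?P) = complex_of_real ((1 / t) * (lam M p (x + t *R e) - lam M p x))"
   using elim by (simp add: scaleR_conv_of_real)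
  then show ?case by (simp only: Re_complex_of_real) simp
 qed
 show ?thesis unfolding has_vector_derivative_iff_quotient
  using Lim_transform_eventually[OF l3 ev] by simp
qed

text \<open>The first-order perturbation formula: off-diagonal blocks of \<open>dA\<close> divided
  by differences of eigenvalues.\<close>

definition dprj :: "nat => real^'d => complex^'c^'c"
where "dprj p x = (SUM q:{..<CARD('c)} - {p}. (1 / (lam M p x - lam M q x)) *R (prj M p x ** dA x ** prj M q x)
  - (1 / (lam M q x - lam M p x)) *R (prj M q x ** dA x ** prj M p x))"

lemma lam_distinct:
 assumes x: "x ~: sigma_bc M" and p: "p < CARD('c)" and q: "q < CARD('c)" and "p ~= q"
 shows "lam M p x ~= lam M q x"
 using lam_strict_mono(2)[OF L x, of p q] lam_strict_mono(2)[OF L x, of q p] assms by (cases "p < q") auto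

lemma prj_mult_quotient:
 assumes x: "x ~: sigma_bc M" and p: "p < CARD('c)" and q: "q < CARD('c)" and "p ~= q"
 shows "((%t. (1 / t) *R (prj M p (x + t *R e) ** prj M q x)) \<longlongrightarrow> (1 / (lam M p x - lam M q x)) *R (prj M p x ** dA x ** prj M q x)) (at 0)"
proof -
 let ?Q = "%t. (1 / t) *R (Lop M (x + t *R e) - Lop M x)"
 have ne: "lam M p x - lam M q x ~= 0" using lam_distinct[OF assms] by simp
 have l0: "((%t. lam M p (x + t *R e) - lam M q x) \<longlongrightarrow> lam M p x - lam M q x) (at 0)"
  by (intro tendsto_intros lam_along_line x p)
 have l1: "((%t. (1 / (lam M p (x + t *R e) - lam M q x)) *R (prj M p (x + t *R e) ** ?Q t ** prj M q x))
   \<longlongrightarrow> (1 / (lam M p x - lam M q x)) *R (prj M p x ** dA x ** prj M q x)) (at 0)"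
  by (intro tendsto_scaleR tendsto_divide tendsto_const l0 ne matrix_mult.tendsto lam_along_line x p Lop_quotient)
 have ev: "\<forall>\<^sub>F t in at 0. (1 / (lam M p (x + t *R e) - lam M q x)) *R (prj M p (x + t *R e) ** ?Q t ** prj M q x)
   = (1 / t) *R (prj M p (x + t *R e) ** prj M q x)"
  using tendsto_imp_eventually_ne[OF l0 ne]
 proof eventually_elim
  case (elim t)
  have "prj M p (x + t *R e) ** ?Q t ** prj M q x = (1 / t) *R (prj M p (x + t *R e) ** (Lop M (x + t *R e) - Lop M x) ** prj M q x)"
   by (simp only: matrix_mult.scaleR_right matrix_mult.scaleR_left)
  also have "... = (1 / t) *R ((lam M p (x + t *R e) - lam M q x) *R (prj M p (x + t *R e) ** prj M q x))"
   unfolding prj_perturbation[OF L p q] ..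
  finally show ?case using elim by simp
 qed
 show ?thesis by (rule Lim_transform_eventually[OF l1 ev])
qed

lemma prj_mult_quotient':
 assumes x: "x ~: sigma_bc M" and p: "p < CARD('c)" and q: "q < CARD('c)" and "p ~= q"
 shows "((%t. (1 / t) *R (prj M q (x + t *R e) ** prj M p x)) \<longlongrightarrow> (1 / (lam M q x - lam M p x)) *R (prj M q x ** dA x ** prj M p x)) (at 0)"
 using prj_mult_quotient[OF x q p] assms by simp

lemma prj_has_derivative:
 assumes x: "x ~: sigma_bc M" and p: "p < CARD('c)"
 shows "((%t. prj M p (x + t *R e)) has_vd dprj p x) (at 0)"
proof -
 have eq: "(1 / t) *R (prj M p (x + t *R e) - prj M p (x + 0 *R e)) =
   (SUM q:{..<CARD('c)} - {p}. (1 / t) *R (prj M p (x + t *R e) ** prj M q x) - (1 / t) *R (prj M q (x + t *R e) ** prj M p x))" for t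
  using prj_diff[OF L p, of "x + t *R e" x] by (simp add: scaleR_sum_right scaleR_diff_right)
 show ?thesis
  unfolding has_vector_derivative_iff_quotient eq dprj_def
  by (intro tendsto_sum tendsto_diff prj_mult_quotient prj_mult_quotient' x p) auto
qed

lemma continuous_on_lam_prj:
 assumes p: "p < CARD('c)"
 shows "continuous_on (- sigma_bc M) (lam M p)" "continuous_on (- sigma_bc M) (prj M p)"
 using lam_continuous[OF L _ p] prj_continuous[OF L _ p]
 by (auto intro!: continuous_at_imp_continuous_on)

lemma continuous_on_dprj:
 assumes p: "p < CARD('c)" and c: "continuous_on (- sigma_bc M) dA"
 shows "continuous_on (- sigma_bc M) (dprj p)"
 unfolding dprj_def[abs_def]
proof (intro continuous_on_sum continuous_on_diff continuous_on_scaleR continuous_on_divide continuous_on_const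
  matrix_mult.continuous_on continuous_on_lam_prj c p)
 show "ALL x:- sigma_bc M. lam M p x - lam M q x ~= 0" "ALL x:- sigma_bc M. lam M q x - lam M p x ~= 0"
  if "q : {..<CARD('c)} - {p}" for q
 proof -
  have "lam M p x - lam M q x ~= 0 & lam M q x - lam M p x ~= 0" if "x : - sigma_bc M" for x
   using lam_distinct[of x p q] p \<open>q : {..<CARD('c)} - {p}\<close> that by simp
  then show "ALL x:- sigma_bc M. lam M p x - lam M q x ~= 0" "ALL x:- sigma_bc M. lam M q x - lam M p x ~= 0" by blast+
 qed
qed auto

end

lemma prj_Ck1:
 fixes M :: "('d::finite, 'c::finite) wave_model"
 assumes L: "linear_part M" and p: "p < CARD('c)"
 shows "Ck_along coord_lines (Suc 0) (- sigma_bc M) (prj M p)"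
proof (rule Ck1_I)
 show "continuous_on (- sigma_bc M) (prj M p)"
  using prj_continuous[OF L _ p] by (auto intro!: continuous_at_imp_continuous_on)
 fix b :: "real^'d" assume b: "b : Basis"
 obtain dA where dA: "!!x. x : - sigma_bc M ==> ((%t. Lop M (x + t *R b)) has_vd dA x) (at 0)"
  "Ck_along coord_lines (Suc 0) (- sigma_bc M) dA"
  using Lop_derivative[OF L b] by blast
 have dA': "((%t. Lop M (x + t *R b)) has_vd dA x) (at 0)" if "x ~: sigma_bc M" for x
  using dA(1) that by simp
 show "EX g. (ALL x:- sigma_bc M. ((%t. prj M p (x + t *R b)) has_vd g x) (at 0)) & continuous_on (- sigma_bc M) g"
  using prj_has_derivative[OF L b dA' _ p] continuous_on_dprj[OF L b dA' p Ck1_D(1)[OF dA(2)]]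
  by (intro exI[of _ "dprj M dA p"]) auto
qed

text \<open>The Hellmann-Feynman formula contains the projection but not its derivative, so one
  derivative of the projection yields two of the eigenvalue. The second one is needed for the
  Lipschitz bound on the gradient of the frequency.\<close>

lemma lam_Ck2:
 fixes M :: "('d::finite, 'c::finite) wave_model"
 assumes L: "linear_part M" and p: "p < CARD('c)" and b: "b : Basis"
 shows "EX g. (ALL x:- sigma_bc M. ((%t. lam M p (x + t *R b)) has_vd g x) (at 0)) &
  Ck_along coord_lines (Suc 0) (- sigma_bc M) g"
proof -
 obtain dA where dA: "!!x. x : - sigma_bc M ==> ((%t. Lop M (x + t *R b)) has_vd dA x) (at 0)"
  "Ck_along coord_lines (Suc 0) (- sigma_bc M) dA"
  using Lop_derivative[OF L b] by blast
 have dA': "((%t. Lop M (x + t *R b)) has_vd dA x) (at 0)" if "x ~: sigma_bc M" for x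
  using dA(1) that by simp
 have "Ck_along coord_lines (Suc 0) (- sigma_bc M) (%x. Re (trace (prj M p x ** dA x ** prj M p x)))"
  by (intro Ck1_linear[OF bounded_linear_Re] Ck1_linear[OF bounded_linear_trace] Ck1_bilinear[OF bounded_bilinear_matrix_mult] prj_Ck1 L p dA(2))
 then show ?thesis using lam_has_derivative[OF L b dA' _ p]
  by (intro exI[of _ "%x. Re (trace (prj M p x ** dA x ** prj M p x))"]) auto
qed

lemma freq_proj_regular:
 fixes M :: "('d::finite, 'c::finite) wave_model"
 assumes L: "linear_part M" and n: "n : {1..nbands M}" "ze : signs"
 shows freq_continuous: "continuous_on (- sigma_bc M) (freq M n ze)"
  and freq_Ck2: "b : Basis ==> EX g. (ALL x:- sigma_bc M. ((%t. freq M n ze (x + t *R b)) has_vd g x) (at 0)) &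
   Ck_along coord_lines (Suc 0) (- sigma_bc M) g"
  and proj_Ck1: "Ck_along coord_lines (Suc 0) (- sigma_bc M) (%k. outer (evec M n ze k))"
proof -
 obtain p where p: "p < CARD('c)" "band_index (nbands M) p = (n, ze)"
  using band_index_surj[OF n] linear_partD(1)[OF L] by auto
 have e: "freq M n ze = lam M p" "(%k. outer (evec M n ze k)) = prj M p"
  using p(2) by (auto simp: fun_eq_iff lam_def prj_def)
 show "continuous_on (- sigma_bc M) (freq M n ze)"
  unfolding e using lam_continuous[OF L _ p(1)] by (auto intro!: continuous_at_imp_continuous_on)
 show "b : Basis ==> EX g. (ALL x:- sigma_bc M. ((%t. freq M n ze (x + t *R b)) has_vd g x) (at 0)) &
   Ck_along coord_lines (Suc 0) (- sigma_bc M) g"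
  unfolding e by (rule lam_Ck2[OF L p(1)])
 show "Ck_along coord_lines (Suc 0) (- sigma_bc M) (%k. outer (evec M n ze k))"
  unfolding e by (rule prj_Ck1[OF L p(1)])
qed

section \<open>Multilinear expansion and explicit derivative bounds\<close>

text \<open>The slots are expanded in the basis one after another. \<open>dep\<close> makes entries
  beyond slot \<open>m\<close> immaterial, so the expansion can be indexed by extensional
  tuples.\<close>

lemma multilinear_expansion:
 fixes f :: "(nat => 'v::euclidean_space) => 'w::real_vector"
 assumes lin: "!!v i. i < m ==> linear (%u. f (v(i := u)))"
  and dep: "!!v w. (!!i. i < m ==> v i = w i) ==> f v = f w"
 shows "f v = (SUM bt:(\<Pi>\<^sub>E i\<in>{..<m}. Basis). (PROD i<m. v i \<bullet> bt i) *R f bt)"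
proof -
 have "f v = (SUM bt:(\<Pi>\<^sub>E i\<in>{..<n}. Basis). (PROD i<n. v i \<bullet> bt i) *R f (%i. if i < n then bt i else v i))" if "n <= m" for n
  using that
 proof (induction n)
  case 0 then show ?case by simp
 next
  case (Suc n)
  have n: "n < m" using Suc.prems by simp
  let ?P = "%n. (\<Pi>\<^sub>E i\<in>{..<n}. Basis :: 'v set)"
  let ?w = "%bt n i. if i < n then bt i else v i"
  have slot: "f (?w bt n) = (SUM b:Basis. (v n \<bullet> b) *R f ((?w bt n)(n := b)))" for bt
  proof -
   have "f (?w bt n) = f ((?w bt n)(n := (SUM b:Basis. (v n \<bullet> b) *R b)))"
    by (intro arg_cong[of _ _ f]) (auto simp: fun_eq_iff euclidean_representation)
   also have "... = (SUM b:Basis. (v n \<bullet> b) *R f ((?w bt n)(n := b)))"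
    unfolding linear_sum[OF lin[OF n, of "?w bt n"]]
    by (intro sum.cong refl linear_cmul[OF lin[OF n, of "?w bt n"]])
   finally show ?thesis .
  qed
  have ins: "?P (Suc n) = (%(b, bt). bt(n := b)) ` (Basis \<times> ?P n)"
   unfolding lessThan_Suc by (rule PiE_insert_eq)
  have inj: "inj_on (%(b, bt). bt(n := b)) ((Basis :: 'v set) \<times> ?P n)"
   by (rule inj_combinator) simp
  have "f v = (SUM bt:?P n. SUM b:Basis. (PROD i<n. v i \<bullet> bt i) *R ((v n \<bullet> b) *R f ((?w bt n)(n := b))))"
   using Suc.IH n slot by (simp add: scaleR_sum_right)
  also have "... = (SUM (b, bt):Basis \<times> ?P n. (PROD i<n. v i \<bullet> bt i) *R ((v n \<bullet> b) *R f ((?w bt n)(n := b))))"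
   by (subst sum.swap) (simp add: sum.cartesian_product)
  also have "... = (SUM bt:?P (Suc n). (PROD i<Suc n. v i \<bullet> bt i) *R f (?w bt (Suc n)))"
   unfolding ins sum.reindex[OF inj]
  proof (rule sum.cong, simp)
   fix x :: "'v \<times> (nat => 'v)"
   obtain b bt where x: "x = (b, bt)" by (cases x)
   have "(?w bt n)(n := b) = ?w (bt(n := b)) (Suc n)" by (auto simp: fun_eq_iff)
   moreover have "(PROD i<Suc n. v i \<bullet> (bt(n := b)) i) = (PROD i<n. v i \<bullet> bt i) * (v n \<bullet> b)"
    by simp
   ultimately show "(case x of (b, bt) => (PROD i<n. v i \<bullet> bt i) *R ((v n \<bullet> b) *R f ((?w bt n)(n := b))))
    = ((%bt. (PROD i<Suc n. v i \<bullet> bt i) *R f (?w bt (Suc n))) \<circ> (%(b, bt). bt(n := b))) x"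
    unfolding x prod.case o_apply by (simp only: scaleR_scaleR)
  qed
  finally show ?case .
 qed
 from this[of m] have "f v = (SUM bt:(\<Pi>\<^sub>E i\<in>{..<m}. Basis). (PROD i<m. v i \<bullet> bt i) *R f (%i. if i < m then bt i else v i))" by simp
 also have "... = (SUM bt:(\<Pi>\<^sub>E i\<in>{..<m}. Basis). (PROD i<m. v i \<bullet> bt i) *R f bt)"
  by (intro sum.cong refl arg_cong2[of _ _ _ _ scaleR] dep) auto
 finally show ?thesis .
qed

text \<open>The constants are carried explicitly because uniformity in \<beta> and \<rho> is what
  matters. Derivatives are asked for along \<open>shift2\<close> only, as existence with a
  bound.\<close>

definition nice :: "nat => (nat => real^'d) set => ((nat => real^'d) => 'v::real_normed_vector) => real => real => bool"
where "nice j Z f A B \<longleftrightarrow> 0 <= A & 0 <= B & (ALL x:Z. norm (f x) <= A &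
 (ALL e:Basis. EX D. ((%t. f (shift2 j e t x)) has_vd D) (at 0) & norm D <= B))"

lemma niceI:
 assumes "0 <= A" "0 <= B" "!!x. x : Z ==> norm (f x) <= A"
  and "!!x e. x : Z ==> e : Basis ==> EX D. ((%t. f (shift2 j e t x)) has_vd D) (at 0) & norm D <= B"
 shows "nice j Z f A B"
 using assms by (simp add: nice_def)

lemma niceD:
 assumes "nice j Z f A B"
 shows "0 <= A" "0 <= B" "x : Z ==> norm (f x) <= A"
  "x : Z ==> e : Basis ==> EX D. ((%t. f (shift2 j e t x)) has_vd D) (at 0) & norm D <= B"
 using assms by (auto simp: nice_def)

lemma nice_bilinear:
 fixes f :: "(nat => real^'d) => 'v::real_normed_vector" and g :: "(nat => real^'d) => 'w::real_normed_vector"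
 assumes pr: "bounded_bilinear pr" and K: "!!a b. norm (pr a b) <= norm a * norm b * K" "0 <= K"
  and f: "nice j Z f A B" and g: "nice j Z g A' B'"
 shows "nice j Z (%x. pr (f x) (g x)) (A * A' * K) ((A * B' + B * A') * K)"
proof (rule niceI)
 note f0 = niceD(1,2)[OF f] and g0 = niceD(1,2)[OF g]
 show "0 <= A * A' * K" "0 <= (A * B' + B * A') * K" using f0 g0 K(2) by auto
 have bd: "norm (pr a b) <= a' * b' * K" if "norm a <= a'" "norm b <= b'" for a b a' b'
 proof -
  have "norm a * norm b <= a' * b'" using that norm_ge_zero[of a] by (intro mult_mono order_trans[OF norm_ge_zero]) auto
  then show ?thesis using K(1)[of a b] mult_right_mono[OF _ K(2)] order_trans by blast
 qed
 fix x assume x: "x : Z"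
 show "norm (pr (f x) (g x)) <= A * A' * K" by (rule bd[OF niceD(3)[OF f x] niceD(3)[OF g x]])
 fix e :: "real^'d" assume e: "e : Basis"
 obtain D where D: "((%t. f (shift2 j e t x)) has_vd D) (at 0)" "norm D <= B" using niceD(4)[OF f x e] by auto
 obtain D' where D': "((%t. g (shift2 j e t x)) has_vd D') (at 0)" "norm D' <= B'" using niceD(4)[OF g x e] by auto
 have "((%t. pr (f (shift2 j e t x)) (g (shift2 j e t x))) has_vd pr (f x) D' + pr D (g x)) (at 0)"
  using bounded_bilinear.has_vector_derivative[OF pr D(1) D'(1)] by simp
 moreover have "norm (pr (f x) D' + pr D (g x)) <= A * B' * K + B * A' * K"
  using norm_triangle_ineq[of "pr (f x) D'" "pr D (g x)"] bd[OF niceD(3)[OF f x] D'(2)] bd[OF D(2) niceD(3)[OF g x]] by linarith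
 ultimately show "EX D. ((%t. pr (f (shift2 j e t x)) (g (shift2 j e t x))) has_vd D) (at 0) & norm D <= (A * B' + B * A') * K"
  by (intro exI[of _ "pr (f x) D' + pr D (g x)"]) (simp add: algebra_simps)
qed

lemma nice_scaleR:
 fixes f :: "(nat => real^'d) => real" and g :: "(nat => real^'d) => 'w::real_normed_vector"
 assumes f: "nice j Z f A B" and g: "nice j Z g A' B'"
 shows "nice j Z (%x. f x *R g x) (A * A') (A * B' + B * A')"
 using nice_bilinear[OF bounded_bilinear_scaleR _ _ f g, of 1] by simp

lemma nice_const:
 assumes "norm c <= A"
 shows "nice j Z (%x. c) A 0"
 using assms by (intro niceI) (auto intro!: order_trans[OF norm_ge_zero assms] exI[of _ 0])

lemma nice_sum:
 fixes f :: "'i => (nat => real^'d) => 'v::real_normed_vector"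
 assumes "finite I" "!!i. i : I ==> nice j Z (f i) (A i) (B i)"
 shows "nice j Z (%x. SUM i:I. f i x) (SUM i:I. A i) (SUM i:I. B i)"
proof (rule niceI)
 show "0 <= (SUM i:I. A i)" "0 <= (SUM i:I. B i)" using assms(2) by (auto intro!: sum_nonneg simp: nice_def)
 fix x assume x: "x : Z"
 show "norm (SUM i:I. f i x) <= (SUM i:I. A i)"
  using assms(2) x by (intro order_trans[OF norm_sum] sum_mono) (auto simp: nice_def)
 fix e :: "real^'d" assume e: "e : Basis"
 have "ALL i:I. EX D. ((%t. f i (shift2 j e t x)) has_vd D) (at 0) & norm D <= B i"
  using niceD(4)[OF assms(2) x e] by blast
 from bchoice[OF this] obtain D where D: "!!i. i : I ==> ((%t. f i (shift2 j e t x)) has_vd D i) (at 0)" "!!i. i : I ==> norm (D i) <= B i"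
  by blast
 have "((%t. SUM i:I. f i (shift2 j e t x)) has_vd (SUM i:I. D i)) (at 0)"
  by (intro has_vector_derivative_sum D)
 moreover have "norm (SUM i:I. D i) <= (SUM i:I. B i)"
  using D(2) by (intro order_trans[OF norm_sum] sum_mono)
 ultimately show "EX D. ((%t. SUM i:I. f i (shift2 j e t x)) has_vd D) (at 0) & norm D <= (SUM i:I. B i)" by blast
qed

lemma nice_prod:
 fixes f :: "nat => (nat => real^'d) => real"
 assumes "!!i. i < n ==> nice j Z (f i) A B" "1 <= A" "0 <= B"
 shows "nice j Z (%x. PROD i<n. f i x) (A ^ n) (real n * A ^ n * B)"
 using assms(1)
proof (induction n)
 case 0 then show ?case using nice_const[of "1::real" 1] by simp
next
 case (Suc n)
 have "nice j Z (%x. f n x *R (PROD i<n. f i x)) (A * A ^ n) (A * (real n * A ^ n * B) + B * A ^ n)"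
  using Suc by (intro nice_scaleR) auto
 then have "nice j Z (%x. PROD i<Suc n. f i x) (A ^ Suc n) (A * (real n * A ^ n * B) + B * A ^ n)"
  by (simp add: mult.commute)
 moreover have "A * (real n * A ^ n * B) + B * A ^ n <= real (Suc n) * A ^ Suc n * B"
 proof -
  have "B * A ^ n <= A ^ Suc n * B" using assms(2,3) by (simp add: mult_right_mono mult.commute[of B])
  then show ?thesis by (simp add: algebra_simps)
 qed
 ultimately show ?case unfolding nice_def by (meson order_trans)
qed

lemma nice_coord:
 fixes F :: "real^'d => 'v::real_normed_vector"
 assumes A: "0 <= A" "0 <= B" and F: "!!x. x : Z ==> norm (F (x i)) <= A"
  and d: "!!x b. x : Z ==> b : Basis ==> EX D. ((%t. F (x i + t *R b)) has_vd D) (at 0) & norm D <= B"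
 shows "nice j Z (%x. F (x i)) A B"
proof (rule niceI[OF A F])
 fix x :: "nat => real^'d" and e :: "real^'d" assume x: "x : Z" and e: "e : Basis"
 show "EX D. ((%t. F (shift2 j e t x i)) has_vd D) (at 0) & norm D <= B"
 proof (cases "i = 0 | i = Suc j")
  case True then show ?thesis using d[OF x e] by (simp add: shift2_def)
 next
  case False then show ?thesis using A by (intro exI[of _ 0]) (simp add: shift2_def)
 qed
qed

lemma nice_Ck1_coord:
 fixes F :: "real^'d => 'v::real_normed_vector"
 assumes F: "Ck_along coord_lines (Suc 0) U F" and K: "cball c r \<subseteq> U" and Z: "!!x. x : Z ==> x i : cball c r"
 shows "EX A B. nice j Z (%x. F (x i)) A B"
proof -
 have "ALL b:Basis. EX g. (ALL x:U. ((%t. F (x + t *R b)) has_vd g x) (at 0)) & continuous_on U g"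
  using Ck1_D(2)[OF F] by simp
 from bchoice[OF this] obtain g where g: "!!b x. b : Basis ==> x : U ==> ((%t. F (x + t *R b)) has_vd g b x) (at 0)"
  "!!b. b : Basis ==> continuous_on U (g b)" by blast
 have bd: "EX B>=0. ALL x:cball c r. norm (h x) <= B" if "continuous_on U h" for h :: "real^'d => 'v"
 proof -
  have "bounded (h ` cball c r)"
   by (intro compact_imp_bounded compact_continuous_image continuous_on_subset[OF that K] compact_cball)
  then obtain B where B: "ALL y:h ` cball c r. norm y <= B" unfolding bounded_iff by blast
  have "norm (h x) <= max 0 B" if "x : cball c r" for x using B that by (intro max.coboundedI2) blast
  then show ?thesis by (intro exI[of _ "max 0 B"]) simp
 qed
 obtain A where A: "0 <= A" "!!x. x : cball c r ==> norm (F x) <= A" using bd[OF Ck1_D(1)[OF F]] by blast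
 have "ALL b:Basis. EX B>=0. ALL x:cball c r. norm (g b x) <= B" using bd[OF g(2)] by blast
 from bchoice[OF this] obtain B where B: "!!b. b : Basis ==> 0 <= B b" "!!b x. b : Basis ==> x : cball c r ==> norm (g b x) <= B b"
  by blast
 have "nice j Z (%x. F (x i)) A (SUM b:Basis. B b)"
 proof (rule nice_coord)
  show "0 <= (SUM b:Basis. B b)" using B(1) by (intro sum_nonneg)
  fix x b assume x: "x : Z" and b: "b : (Basis :: (real^'d) set)"
  have "norm (g b (x i)) <= B b" using B(2)[OF b Z[OF x]] .
  also have "... <= (SUM b:Basis. B b)" using b B(1) by (intro member_le_sum) auto
  finally show "EX D. ((%t. F (x i + t *R b)) has_vd D) (at 0) & norm D <= (SUM b:Basis. B b)"
   using g(1)[OF b, of "x i"] Z[OF x] K by blast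
 qed (use A Z in auto)
 then show ?thesis by blast
qed

text \<open>The increment is split through the point (0, t). The mean value inequality and the
  continuity of \<open>g\<close> control the first piece; the second is governed by the derivative
  \<open>D\<close>.\<close>

lemma diagonal_derivative:
 fixes f :: "real => real => 'v::real_normed_vector"
 assumes de: "0 < de" and f: "!!s t. \<bar>s\<bar> < de ==> \<bar>t\<bar> < de ==> ((%s. f s t) has_vd g s t) (at s)"
  and g: "((%p. g (fst p) (snd p)) \<longlongrightarrow> g 0 0) (nhds (0, 0))"
  and D: "((%t. f 0 t) has_vd D) (at 0)"
 shows "((%t. f t t) has_vd g 0 0 + D) (at 0)"
proof -
 have "((%t. (1 / t) *R (f t t - f 0 t)) \<longlongrightarrow> g 0 0) (at 0)"
 proof (rule tendstoI)
  fix et :: real assume et: "0 < et"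
  then have "\<forall>\<^sub>F p in nhds (0, 0). dist (g (fst p) (snd p)) (g 0 0) < et / 2" using tendstoD[OF g, of "et/2"] by simp
  then obtain d where d: "0 < d" "!!p. dist p (0, 0) < d ==> dist (g (fst p) (snd p)) (g 0 0) < et / 2"
   unfolding eventually_nhds_metric by blast
  have gd: "norm (g s t - g 0 0) <= et / 2" if "\<bar>s\<bar> < d / 2" "\<bar>t\<bar> < d / 2" for s t
  proof -
   have "dist (s, t) (0, 0) <= \<bar>s\<bar> + \<bar>t\<bar>" unfolding dist_Pair_Pair using sqrt_sum_squares_le_sum_abs[of s t] by (simp add: dist_real_def)
   then have "dist (s, t) (0, 0) < d" using that by simp
   from d(2)[OF this] show ?thesis by (simp add: dist_norm)
  qed
  define d' where "d' = min de (d / 2)"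
  have "dist ((1 / t) *R (f t t - f 0 t)) (g 0 0) < et" if t: "t ~= 0" "\<bar>t\<bar> < d'" for t
  proof -
   have td: "\<bar>t\<bar> < de" "\<bar>t\<bar> < d / 2" using t by (auto simp: d'_def)
   have "norm ((f t t - t *R g 0 0) - (f 0 t - 0 *R g 0 0)) <= et / 2 * norm (t - 0)"
   proof (rule differentiable_bound[of "closed_segment 0 t" "%s. f s t - s *R g 0 0" "%s r. r *R (g s t - g 0 0)"])
    fix s assume "s : closed_segment 0 t"
    then have "\<bar>s\<bar> <= \<bar>t\<bar>" by (auto simp: closed_segment_eq_real_ivl split: if_splits)
    then have sd: "\<bar>s\<bar> < de" "\<bar>s\<bar> < d / 2" using td by auto
    have "((%s. f s t - s *R g 0 0) has_vd g s t - g 0 0) (at s)"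
     by (auto intro!: derivative_eq_intros f[OF sd(1) td(1)])
    then show "((%s. f s t - s *R g 0 0) has_derivative (%r. r *R (g s t - g 0 0))) (at s within closed_segment 0 t)"
     unfolding has_vector_derivative_def by (rule has_derivative_at_withinI)
    show "onorm (%r. r *R (g s t - g 0 0)) <= et / 2"
     using et mult_left_mono[OF gd[OF sd(2) td(2)], of "\<bar>r\<bar>" for r] by (intro onorm_bound) (auto simp: mult.commute)
   qed auto
   then have "norm (f t t - f 0 t - t *R g 0 0) <= et / 2 * \<bar>t\<bar>" by (simp add: algebra_simps)
   moreover have "(1 / t) *R (f t t - f 0 t) - g 0 0 = (1 / t) *R (f t t - f 0 t - t *R g 0 0)"
    using t(1) by (simp add: scaleR_diff_right)
   ultimately have "norm ((1 / t) *R (f t t - f 0 t) - g 0 0) <= et / 2"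
    using t(1) by (simp add: divide_le_eq)
   then show ?thesis using et by (simp add: dist_norm)
  qed
  then show "\<forall>\<^sub>F t in at 0. dist ((1 / t) *R (f t t - f 0 t)) (g 0 0) < et"
   unfolding eventually_at using de d(1) by (intro exI[of _ d']) (auto simp: d'_def dist_real_def)
 qed
 then have "((%t. (1 / t) *R (f t t - f 0 t) + (1 / t) *R (f 0 t - f 0 0)) \<longlongrightarrow> g 0 0 + D) (at 0)"
  using D unfolding has_vector_derivative_iff_quotient by (intro tendsto_add)
 then show ?thesis unfolding has_vector_derivative_iff_quotient by (simp add: scaleR_add_right[symmetric])
qed

lemma shift2_update:
 "shift2 j e t x = (x(0 := x 0 + t *R e))(Suc j := x (Suc j) + t *R e)"
 by (auto simp: shift2_def fun_eq_iff)

lemma open_coordinates: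
 assumes "open U"
 shows "open {x :: nat => 'a::topological_space. ALL i<=m. x i : U}"
proof -
 have "{x :: nat => 'a. ALL i<=m. x i : U} = (INT i<=m. (%x. x i) -` U)" by auto
 also have "open ..."
  by (intro open_INT finite_atMost ballI open_vimage[OF assms] continuous_on_product_coordinates)
 finally show ?thesis .
qed

text \<open>Coordinates beyond \<open>m\<close> are frozen at 0, so that Tychonoff's theorem applies
  to the full product.\<close>

lemma compact_truncated_balls:
 fixes c :: "nat => real^'d"
 shows "compact {x. ALL i. x i : (if i <= m then cball (c i) r else {0})}"
proof -
 have "compactin (product_topology (%_. euclidean) UNIV) (\<Pi>\<^sub>E i\<in>UNIV. if i <= m then cball (c i) r else {0})"
  unfolding compactin_PiE by auto
 then show ?thesis by (simp add: euclidean_product_topology PiE_UNIV_domain Pi_def)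
qed

text \<open>Smoothness of \<open>chi\<close> is given along single coordinates, whereas
  \<open>shift2\<close> moves two of them at once. The diagonal derivative supplies the sum of the
  two partial derivatives.\<close>

lemma Ck1_multi_shift2:
 fixes f :: "(nat => real^'d) => 'v::real_normed_vector"
 assumes f: "Ck_along (multi_coord_lines m) (Suc 0) V f" and V: "open V" and j: "j < m" and e: "e : Basis"
 shows "EX g. continuous_on V g & (ALL x:V. ((%t. f (shift2 j e t x)) has_vd g x) (at 0))"
proof -
 have part: "EX g. (ALL x:V. ((%t. f (x(i := x i + t *R e))) has_vd g x) (at 0)) & continuous_on V g"
  if "i <= m" for i
 proof -
  have "(%x t. x(i := x i + t *R e)) : multi_coord_lines m"
   unfolding multi_coord_lines_def using that e by blast
  then show ?thesis using f by fastforce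
 qed
 obtain g0 where g0: "ALL x:V. ((%t. f (x(0 := x 0 + t *R e))) has_vd g0 x) (at 0)" "continuous_on V g0"
  using part[of 0] by blast
 obtain g1 where g1: "ALL x:V. ((%t. f (x(Suc j := x (Suc j) + t *R e))) has_vd g1 x) (at 0)" "continuous_on V g1"
  using part[of "Suc j"] j by (metis Suc_leI)
 have "((%t. f (shift2 j e t x)) has_vd g0 x + g1 x) (at 0)" if x: "x : V" for x
 proof -
  define X where "X s t = (x(0 := x 0 + s *R e))(Suc j := x (Suc j) + t *R e)" for s t
  have X0: "X 0 0 = x" by (simp add: X_def)
  have Xc: "continuous_on UNIV (%p :: real \<times> real. X (fst p) (snd p))"
  proof (rule continuous_on_coordinatewise_then_product)
   fix i show "continuous_on UNIV (%p :: real \<times> real. X (fst p) (snd p) i)"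
    by (cases "i = Suc j"; cases "i = 0") (auto simp: X_def intro!: continuous_intros)
  qed
  define W where "W = (%p :: real \<times> real. X (fst p) (snd p)) -` V"
  have W: "open W" "(0, 0) : W" unfolding W_def using open_vimage[OF V Xc] x X0 by auto
  then obtain d where d: "0 < d" "ball (0, 0) d \<subseteq> W" using openE by blast
  have XV: "X s t : V" if "\<bar>s\<bar> < d / 2" "\<bar>t\<bar> < d / 2" for s t
  proof -
   have "dist (s, t) (0, 0) <= \<bar>s\<bar> + \<bar>t\<bar>" unfolding dist_Pair_Pair using sqrt_sum_squares_le_sum_abs[of s t] by (simp add: dist_real_def)
   then have "(s, t) : ball (0, 0) d" using that by (simp add: dist_commute)
   then show ?thesis using d(2) by (auto simp: W_def)
  qed
  have "((%t. f (X t t)) has_vd g0 (X 0 0) + g1 x) (at 0)"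
  proof (rule diagonal_derivative[where de = "d / 2" and f = "%s t. f (X s t)" and g = "%s t. g0 (X s t)"])
   fix s t assume st: "\<bar>s\<bar> < d / 2" "\<bar>t\<bar> < d / 2"
   have "((%u. f ((X s t)(0 := X s t 0 + u *R e))) has_vd g0 (X s t)) (at (s - s))"
    using g0(1) XV[OF st] by simp
   moreover have "(%u. f ((X s t)(0 := X s t 0 + u *R e))) = (%u. f (X (s + u) t))"
    by (intro ext arg_cong[of _ _ f]) (auto simp: X_def fun_eq_iff scaleR_add_left)
   ultimately have "((%u. f (X (s + u) t)) has_vd g0 (X s t)) (at (s - s))" by simp
   moreover have "((%u. u - s) has_vd 1) (at s)"
    by (auto intro!: derivative_eq_intros simp: has_vector_derivative_def)
   ultimately have "((%u. f (X (s + u) t)) \<circ> (%u. u - s) has_vd 1 *R g0 (X s t)) (at s)"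
    by (intro vector_diff_chain_at) auto
   then show "((%s. f (X s t)) has_vd g0 (X s t)) (at s)" by (simp add: o_def)
  next
   have "continuous_on W (%p. g0 (X (fst p) (snd p)))"
    by (rule continuous_on_compose2[OF g0(2) continuous_on_subset[OF Xc subset_UNIV]]) (auto simp: W_def)
   then have "isCont (%p. g0 (X (fst p) (snd p))) (0, 0)"
    using continuous_on_eq_continuous_at[OF W(1)] W(2) by blast
   then have "((%p. g0 (X (fst p) (snd p))) \<longlongrightarrow> g0 (X (fst (0 :: real, 0 :: real)) (snd (0 :: real, 0 :: real)))) (at (0, 0))"
    unfolding isCont_def .
   then show "((%p. g0 (X (fst p) (snd p))) \<longlongrightarrow> g0 (X 0 0)) (nhds (0, 0))"
    by (subst (asm) tendsto_at_iff_tendsto_nhds) simp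
   show "((%t. f (X 0 t)) has_vd g1 x) (at 0)"
    using g1(1) x by (simp add: X_def)
  qed (use d in auto)
  then show ?thesis unfolding X0 by (simp add: X_def shift2_update)
 qed
 then show ?thesis using continuous_on_add[OF g0(2) g1(2)] by blast
qed

lemma nice_multi:
 fixes f :: "(nat => real^'d) => 'v::real_normed_vector"
 assumes f: "Ck_along (multi_coord_lines m) (Suc 0) V f" and V: "open V" and j: "j < m"
  and dep: "!!x y. (!!i. i <= m ==> x i = y i) ==> f x = f y"
  and Z: "{x. ALL i<=m. x i : cball (c i) r} \<subseteq> V"
 shows "EX A B. nice j {x. ALL i<=m. x i : cball (c i) r} f A B"
proof -
 let ?K = "{x. ALL i. x i : (if i <= m then cball (c i) r else {0})}"
 \<comment> \<open>Truncation does not change \<open>f\<close> and commutes with the shift, so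
   bounds on the compact set of truncated points are enough.\<close>
 define tr :: "(nat => real^'d) => nat => real^'d" where "tr x i = (if i <= m then x i else 0)" for x i
 have ftr: "f x = f (tr x)" for x by (rule dep) (simp add: tr_def)
 have trK: "tr x : ?K" if "ALL i<=m. x i : cball (c i) r" for x
  using that by (simp add: tr_def)
 have trs: "tr (shift2 j e t x) = shift2 j e t (tr x)" for e t x
  using j by (auto simp: tr_def shift2_def fun_eq_iff)
 have KV: "?K \<subseteq> V"
 proof
  fix x assume x: "x : ?K"
  then have "x i : cball (c i) r" if "i <= m" for i
   using that by (metis (mono_tags, lifting) mem_Collect_eq)
  then show "x : V" using Z by blast
 qed
 have bd: "EX B>=0. ALL x:?K. norm (h x) <= B" if "continuous_on V h" for h :: "(nat => real^'d) => 'v"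
 proof -
  have "bounded (h ` ?K)"
   by (intro compact_imp_bounded compact_continuous_image continuous_on_subset[OF that KV] compact_truncated_balls)
  then obtain B where B: "ALL y:h ` ?K. norm y <= B" unfolding bounded_iff by blast
  have "norm (h x) <= max 0 B" if "x : ?K" for x using B that by (intro max.coboundedI2) blast
  then show ?thesis by (intro exI[of _ "max 0 B"]) simp
 qed
 have "ALL e:Basis. EX g. continuous_on V g & (ALL x:V. ((%t. f (shift2 j e t x)) has_vd g x) (at 0))"
  using Ck1_multi_shift2[OF f V j] by blast
 from bchoice[OF this] obtain g where g: "!!e. e : Basis ==> continuous_on V (g e)"
  "!!e x. e : Basis ==> x : V ==> ((%t. f (shift2 j e t x)) has_vd g e x) (at 0)" by blast
 have "continuous_on V f" using f by simp
 from bd[OF this] obtain A where A: "0 <= A" "!!x. x : ?K ==> norm (f x) <= A" by blast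
 have "ALL e:Basis. EX B>=0. ALL x:?K. norm (g e x) <= B" using bd[OF g(1)] by blast
 from bchoice[OF this] obtain B where B: "!!e. e : Basis ==> 0 <= B e" "!!e x. e : Basis ==> x : ?K ==> norm (g e x) <= B e"
  by blast
 have "nice j {x. ALL i<=m. x i : cball (c i) r} f A (SUM e:Basis. B e)"
 proof (rule niceI)
  show "0 <= (SUM e:Basis. B e)" using B(1) by (intro sum_nonneg)
  fix x assume "x : {x. ALL i<=m. x i : cball (c i) r}"
  then have x: "tr x : ?K" using trK by simp
  show "norm (f x) <= A" using A(2)[OF x] by (simp add: ftr[of x])
  fix e :: "real^'d" assume e: "e : Basis"
  have "((%t. f (shift2 j e t (tr x))) has_vd g e (tr x)) (at 0)"
   using g(2)[OF e] x KV by blast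
  then have "((%t. f (shift2 j e t x)) has_vd g e (tr x)) (at 0)"
   by (subst ftr) (simp add: trs)
  moreover have "norm (g e (tr x)) <= (SUM e:Basis. B e)"
   using B(2)[OF e x] member_le_sum[of e Basis B] e B(1) by (meson finite_Basis order_trans DiffD1)
  ultimately show "EX D. ((%t. f (shift2 j e t x)) has_vd D) (at 0) & norm D <= (SUM e:Basis. B e)" by blast
 qed (use A in auto)
 then show ?thesis by blast
qed

text \<open>Where the cutoff \<open>l\<close> is not zero, the phase \<open>p\<close> varies slowly under the shift.\<close>

lemma localized_oscillation_derivative:
 fixes l p :: "(nat => real^'d) => real" and h :: "(nat => real^'d) => complex^'c"
 assumes l: "nice j UNIV l A B" and h: "nice j Z h A' B'"
  and out: "!!x. x ~: Z ==> l x = 0" "!!x. x ~: Z ==> \<forall>\<^sub>F t in at 0. l (shift2 j e t x) = 0"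
  and p: "!!x. x : Z ==> EX D. ((%t. p (shift2 j e t x)) has_vd D) (at 0) & (l x ~= 0 --> \<bar>D\<bar> <= La)"
  and e: "e : Basis" and La: "0 <= La"
 shows "norm (l x *R (cis (p x * sg) *s h x)) <= A * A'"
  and "EX D. ((%t. l (shift2 j e t x) *R (cis (p (shift2 j e t x) * sg) *s h (shift2 j e t x))) has_vd D) (at 0) &
   norm D <= B * A' + A * (La * \<bar>sg\<bar> * A' + B')"
proof -
 note nn = niceD(1,2)[OF l] niceD(1,2)[OF h]
 have sm: "norm (cis q *s y) = norm y" for q and y :: "complex^'c" by (simp add: norm_smult)
 show "norm (l x *R (cis (p x * sg) *s h x)) <= A * A'"
 proof (cases "x : Z")
  case True
  have "\<bar>l x\<bar> <= A" using niceD(3)[OF l UNIV_I] by (simp only: real_norm_def)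
  then show ?thesis using niceD(3)[OF h True] nn by (simp add: sm mult_mono)
 qed (simp add: out nn)
 show "EX D. ((%t. l (shift2 j e t x) *R (cis (p (shift2 j e t x) * sg) *s h (shift2 j e t x))) has_vd D) (at 0) &
   norm D <= B * A' + A * (La * \<bar>sg\<bar> * A' + B')"
 proof (cases "x : Z")
  case False
  have "\<forall>\<^sub>F t in at 0. l (shift2 j e t x) *R (cis (p (shift2 j e t x) * sg) *s h (shift2 j e t x)) = 0"
   using out(2)[OF False] by eventually_elim simp
  then have "((%t. l (shift2 j e t x) *R (cis (p (shift2 j e t x) * sg) *s h (shift2 j e t x))) has_vd 0) (at 0)"
   unfolding has_vector_derivative_iff_quotient
   by (intro tendsto_eventually) (use out(1)[OF False] in \<open>auto elim: eventually_mono\<close>)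
  then show ?thesis using nn La by (intro exI[of _ 0]) auto
 next
  case True
  obtain Dl where Dl: "((%t. l (shift2 j e t x)) has_vd Dl) (at 0)" "norm Dl <= B" using niceD(4)[OF l UNIV_I e] by auto
  obtain Dh where Dh: "((%t. h (shift2 j e t x)) has_vd Dh) (at 0)" "norm Dh <= B'" using niceD(4)[OF h True e] by auto
  obtain Dp where Dp: "((%t. p (shift2 j e t x)) has_vd Dp) (at 0)" "l x ~= 0 --> \<bar>Dp\<bar> <= La" using p[OF True] by auto
  let ?c = "%q. cis (q * sg)"
  have c: "((%t. ?c (p (shift2 j e t x))) has_vd (Dp * sg) *R (\<i> * ?c (p x))) (at 0)"
  proof -
   have "((%t. p (shift2 j e t x) * sg) has_vd Dp * sg) (at 0)"
    using Dp(1) unfolding has_real_derivative_iff_has_vector_derivative[symmetric] by (rule DERIV_cmult_right)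
   moreover have "(cis has_vector_derivative \<i> * cis q) (at q)" for q
   proof -
    have "((%z. exp (\<i> * z)) has_field_derivative \<i> * cis q) (at (complex_of_real q))"
     by (auto intro!: derivative_eq_intros simp: cis_conv_exp)
    from has_vector_derivative_real_field[OF this] show ?thesis by (simp add: cis_conv_exp[abs_def])
   qed
   ultimately have "(cis \<circ> (%t. p (shift2 j e t x) * sg) has_vd (Dp * sg) *R (\<i> * ?c (p (shift2 j e 0 x)))) (at 0)"
    by (intro vector_diff_chain_at) auto
   then show ?thesis by (simp add: o_def)
  qed
  let ?D1 = "?c (p x) *s Dh + ((Dp * sg) *R (\<i> * ?c (p x))) *s h x"
  have d1: "((%t. ?c (p (shift2 j e t x)) *s h (shift2 j e t x)) has_vd ?D1) (at 0)"
   using bounded_bilinear.has_vector_derivative[OF bounded_bilinear_smult c Dh(1)] by simp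
  have d2: "((%t. l (shift2 j e t x) *R (?c (p (shift2 j e t x)) *s h (shift2 j e t x))) has_vd l x *R ?D1 + Dl *R (?c (p x) *s h x)) (at 0)"
   using bounded_bilinear.has_vector_derivative[OF bounded_bilinear_scaleR Dl(1) d1] by simp
  have "norm (Dl *R (?c (p x) *s h x)) <= B * A'"
   using Dl(2) niceD(3)[OF h True] nn by (simp add: sm mult_mono)
  moreover have "norm (l x *R ?D1) <= A * (La * \<bar>sg\<bar> * A' + B')"
  proof (cases "l x = 0")
   case False
   have "norm (((Dp * sg) *R (\<i> * ?c (p x))) *s h x) = \<bar>Dp\<bar> * \<bar>sg\<bar> * norm (h x)"
    by (simp add: norm_smult norm_mult abs_mult)
   also have "... <= La * \<bar>sg\<bar> * A'" using Dp(2) False niceD(3)[OF h True] La by (intro mult_mono) auto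
   finally have "norm ?D1 <= La * \<bar>sg\<bar> * A' + B'"
    using norm_triangle_ineq[of "?c (p x) *s Dh" "((Dp * sg) *R (\<i> * ?c (p x))) *s h x"] Dh(2) sm[of "p x * sg" Dh] by linarith
   moreover have "\<bar>l x\<bar> <= A" using niceD(3)[OF l UNIV_I] by (simp only: real_norm_def)
   ultimately show ?thesis using nn by (simp only: norm_scaleR) (intro mult_mono, auto)
  qed (use nn La in auto)
  ultimately have "norm (l x *R ?D1 + Dl *R (?c (p x) *s h x)) <= B * A' + A * (La * \<bar>sg\<bar> * A' + B')"
   using norm_triangle_ineq[of "l x *R ?D1" "Dl *R (?c (p x) *s h x)"] by linarith
  then show ?thesis using d2 by blast
 qed
qed

section \<open>Combinatorics of resonant index vectors\<close>

lemma delta_Cons: "delta ((ze, l') # lv) l = (if l' = l then ze else 0) + delta lv l"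
 by (simp add: delta_def)

lemma kappa_eq_delta:
 "snd ` set lv \<subseteq> {1..nparts S} ==> kappa S lv = (SUM l:{1..nparts S}. real_of_int (delta lv l) *R ctr S l)"
proof (induction lv)
 case Nil then show ?case by (simp add: kappa_def delta_def)
next
 case (Cons a lv)
 obtain ze l' where a: "a = (ze, l')" by (cases a)
 have l': "l' : {1..nparts S}" using Cons.prems by (simp add: a)
 have "(SUM l:{1..nparts S}. real_of_int (delta (a # lv) l) *R ctr S l)
  = (SUM l:{1..nparts S}. (if l' = l then real_of_int ze *R ctr S l else 0) + real_of_int (delta lv l) *R ctr S l)"
  by (intro sum.cong refl) (simp add: a delta_Cons scaleR_add_left)
 also have "... = real_of_int ze *R ctr S l' + kappa S lv"
  using l' Cons by (simp add: sum.distrib sum.delta)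
 finally show ?case by (simp add: kappa_def a)
qed

text \<open>Every sign is odd, so the sum of all signs has the parity of the number of
  entries.\<close>

lemma odd_length_iff_odd_delta:
 "set lv \<subseteq> signs \<times> {1..N} ==> odd (length lv) \<longleftrightarrow> odd (SUM l:{1..N}. delta lv l)"
proof (induction lv)
 case Nil then show ?case by (simp add: delta_def)
next
 case (Cons a lv)
 obtain ze l' where a: "a = (ze, l')" by (cases a)
 have l': "l' : {1..N}" "odd ze" using Cons.prems by (auto simp: a signs_def)
 have "(SUM l:{1..N}. delta (a # lv) l) = ze + (SUM l:{1..N}. delta lv l)"
  using l'(1) by (simp add: a delta_Cons sum.distrib sum.delta)
 then show ?case using Cons l'(2) by simp
qed

text \<open>If \<open>(tt, l)\<close> does not occur, every entry with index \<open>l\<close> has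
  the sign \<open>- tt\<close>.\<close>

lemma delta_sign:
 "fst ` set lv \<subseteq> signs ==> tt : signs ==> (tt, l) ~: set lv ==> tt * delta lv l <= 0"
proof (induction lv)
 case Nil then show ?case by (simp add: delta_def)
next
 case (Cons a lv)
 obtain ze l' where a: "a = (ze, l')" by (cases a)
 have "tt * (if l' = l then ze else 0) <= 0" using Cons.prems by (auto simp: a signs_def)
 moreover have "tt * delta lv l <= 0" using Cons by (auto simp: a)
 ultimately show ?case by (simp add: a delta_Cons distrib_left)
qed

text \<open>The slot found here will carry the derivative; odd length keeps all centres off the band crossings.\<close>

lemma resonant_vectors_slot:
 fixes M :: "('d::finite, 'c::finite) wave_model"
 assumes ok: "nk_spectrum_ok M S" and inv: "universally_resonance_invariant M S" and m: "m : degs M"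
  and l: "l : {1..nparts S}" and tt: "tt : signs" and lv: "lv : resonant_vectors M S m l tt"
 shows "EX j<m. lv ! j = (tt, l)" and "odd m"
proof -
 have iv: "length lv = m" "set lv \<subseteq> signs \<times> {1..nparts S}" "lv : index_vectors S m"
  using lv by (auto simp: resonant_vectors_def index_vectors_def)
 have res: "resonant M S tt (band S l) lv" "real_of_int tt *R kappa S lv = ctr S l"
  using lv by (auto simp: resonant_vectors_def)
 have "band S l : {1..nbands M}" using ok l by (simp add: nk_spectrum_ok_def)
 then have "universal S tt (band S l) lv"
  using inv m tt iv(3) res(1) unfolding universally_resonance_invariant_def by blast
 then obtain I0 where I0: "I0 : {1..nparts S}" "!!l'. l' : {1..nparts S} ==> l' ~= I0 ==> delta lv l' = 0"
  "band S l = band S I0" "tt = delta lv I0"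
  unfolding universal_def by blast
 \<comment> \<open>Universality leaves one nonzero \<open>delta\<close>; this is used once for the
   centre and once for the parity.\<close>
 have single: "(SUM l:{1..nparts S}. f l (delta lv l)) = f I0 tt" if "!!l. f l 0 = 0" for f :: "nat => int => 'x::comm_monoid_add"
  using I0(1,2,4) that by (subst sum.remove[OF _ I0(1)]) auto
 have "kappa S lv = real_of_int tt *R ctr S I0"
 proof (subst kappa_eq_delta)
  show "snd ` set lv \<subseteq> {1..nparts S}" using iv(2) by fastforce
 qed (rule single[of "%l d. real_of_int d *R ctr S l"], simp)
 \<comment> \<open>The sign \<open>tt\<close> is its own inverse. Equal band and equal centre then
   identify \<open>l\<close> with \<open>I0\<close>, as the pairs are distinct.\<close>
 then have "ctr S l = ctr S I0" using res(2) tt by (auto simp: signs_def)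
 moreover have "inj_on (%l. (band S l, ctr S l)) {1..nparts S}" using ok by (simp add: nk_spectrum_ok_def)
 ultimately have "l = I0" using I0(1,3) l by (auto dest: inj_onD)
 then have "tt * delta lv l > 0" using I0(4) tt by (auto simp: signs_def)
 then have "(tt, l) : set lv" using delta_sign[of lv tt l] iv(2) tt by fastforce
 then show "EX j<m. lv ! j = (tt, l)" using iv(1) by (auto simp: in_set_conv_nth)
 have "odd (SUM l:{1..nparts S}. delta lv l)" using single[of "%_ d. d"] tt by (auto simp: signs_def)
 then show "odd m" using odd_length_iff_odd_delta[OF iv(2)] iv(1) by simp
qed

text \<open>Among single centres, \<open>nk_spectrum_ok\<close> keeps only the unsigned ones off the
  band crossings, but it also keeps all values of \<open>kappa\<close> off them. Padding the entry
  \<open>(tt, l)\<close> with cancelling pairs up to the odd length \<open>m\<close> exhibits the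
  centre with either sign as such a value.\<close>

lemma odd_degree_centers:
 fixes M :: "('d::finite, 'c::finite) wave_model"
 assumes ok: "nk_spectrum_ok M S" and m: "m : degs M" "odd m" and l: "l : {1..nparts S}" and tt: "tt : signs"
  and bt0: "small_beta M S bt0"
 shows "cball (real_of_int tt *R ctr S l) (2 * bt0 powr (1 - eps M)) \<subseteq> - sigma_bc M"
proof -
 obtain p where p: "m = 2 * p + 1" using m(2) by (elim oddE)
 \<comment> \<open>Pairs of opposite sign at one centre contribute nothing to
   \<open>kappa\<close>.\<close>
 define alt where "alt q = concat (replicate q [(1::int, l), (- 1, l)])" for q
 have alt: "length (alt q) = 2 * q" "set (alt q) \<subseteq> signs \<times> {1..nparts S}" "kappa S (alt q) = 0" for q
  using l by (induction q) (auto simp: alt_def signs_def kappa_def)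
 have "(tt, l) # alt p : index_vectors S m" using alt[of p] l tt p by (simp add: index_vectors_def)
 then have "kappa S ((tt, l) # alt p) ~: sigma_bc M" using ok m(1) unfolding nk_spectrum_ok_def by blast
 moreover have "kappa S ((tt, l) # alt p) = real_of_int tt *R ctr S l" using alt(3)[of p] by (simp add: kappa_def)
 ultimately have "cball (real_of_int tt *R ctr S l) (2 * bt0 powr (1 - eps M)) \<inter> sigma_bc M = {}"
  using bt0 l tt unfolding small_beta_def by simp
 then show ?thesis by blast
qed

section \<open>Localizers, and linearity of the nonlinearity in its slots\<close>

lemma cutoffD:
 assumes "cutoff M"
 shows "0 < eps M" "eps M < 1" "0 <= cut M et" "norm et <= 1 / 2 ==> cut M et = 1" "1 <= norm et ==> cut M et = 0"
 using assms by (auto simp: cutoff_def)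

text \<open>The wider scale \<open>c = 1/2\<close> determines the radius, which then serves both
  kinds of localizers.\<close>

lemma localizer_support:
 assumes M: "cutoff M" and bt: "0 < bt" and c: "1 / 2 <= c" and nz: "localizer M c bt k0 k ~= 0"
 shows "norm (k - k0) < 2 * bt powr (1 - eps M)"
proof (rule ccontr)
 assume "~ norm (k - k0) < 2 * bt powr (1 - eps M)"
 then have "1 <= (1 / 2 * bt powr (- (1 - eps M))) * norm (k - k0)"
  using bt mult_left_mono[of "2 * bt powr (1 - eps M)" "norm (k - k0)" "1 / 2 * bt powr (- (1 - eps M))"]
  by (simp add: powr_add[symmetric])
 also have "... <= (c * bt powr (- (1 - eps M))) * norm (k - k0)"
  using c by (intro mult_right_mono) auto
 also have "... = norm ((c * bt powr (- (1 - eps M))) *R (k - k0))" using c by (simp add: abs_mult)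
 finally show False using nz cutoffD(5)[OF M] by (simp add: localizer_def)
qed

text \<open>The chain rule costs the dilation factor \<beta>^(-(1-\<epsilon>)), uniformly in the
  centre. \<open>A\<close> is at least 1 because powers of it will bound products of
  localizers.\<close>

lemma localizer_bounds:
 fixes M :: "('d::finite, 'c::finite) wave_model"
 assumes M: "cutoff M"
 shows "EX A>=1. EX B>=0. ALL bt c k0. 0 < bt --> \<bar>c\<bar> <= 1 -->
  (ALL k. \<bar>localizer M c bt k0 k\<bar> <= A & (ALL e:Basis. EX D. ((%t. localizer M c bt k0 (k + t *R e)) has_vd D) (at 0)
   & \<bar>D\<bar> <= B * bt powr (- (1 - eps M))))"
proof -
 have ex: "ALL b:Basis. EX fi' B. (ALL x. \<bar>cut M x\<bar> <= B & \<bar>fi' x\<bar> <= B) &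
  (ALL x t. ((%t. cut M (x + t *R b)) has_vd fi' (x + t *R b)) (at t))"
  using test_function_derivative[OF test_function_cut[OF M]] by blast
 from bchoice[OF this] obtain fi' where "ALL b:Basis. EX B. (ALL x. \<bar>cut M x\<bar> <= B & \<bar>fi' b x\<bar> <= B) &
  (ALL x t. ((%t. cut M (x + t *R b)) has_vd fi' b (x + t *R b)) (at t))" by blast
 from bchoice[OF this] obtain B where B: "!!b x. b : Basis ==> \<bar>cut M x\<bar> <= B b" "!!b x. b : Basis ==> \<bar>fi' b x\<bar> <= B b"
  "!!b x t. b : Basis ==> ((%t. cut M (x + t *R b)) has_vd fi' b (x + t *R b)) (at t)" by blast
 have B0: "0 <= B b" if "b : Basis" for b using order_trans[OF abs_ge_zero B(1)[OF that]] .
 define C where "C = 1 + (SUM b:Basis. B b)"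
 have C1: "1 <= C" unfolding C_def using B0 by (simp add: sum_nonneg)
 have BC: "B b <= C" if "b : Basis" for b
  using member_le_sum[of b Basis B] that B0 unfolding C_def by fastforce
 show ?thesis
 proof (rule exI[of _ C], rule conjI[OF C1], rule exI[of _ C], intro conjI allI impI ballI)
  show "0 <= C" using C1 by simp
  fix bt c :: real and k0 k :: "real^'d" assume bt: "0 < bt" and c: "\<bar>c\<bar> <= 1"
  obtain b0 :: "real^'d" where "b0 : Basis" using nonempty_Basis by blast
  then show "\<bar>localizer M c bt k0 k\<bar> <= C" unfolding localizer_def using B(1) BC order_trans by blast
  fix e :: "real^'d" assume e: "e : Basis"
  let ?q = "c * bt powr (- (1 - eps M))"
  have "((%t. cut M (?q *R (k - k0) + t *R e)) has_vd fi' e (?q *R (k - k0) + (?q * 0) *R e)) (at (?q * 0))"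
   by (rule B(3)[OF e])
  moreover have "((%t. ?q * t) has_vd ?q) (at 0)"
   by (auto intro!: derivative_eq_intros simp: has_vector_derivative_def)
  ultimately have "((%t. cut M (?q *R (k - k0) + t *R e)) \<circ> (%t. ?q * t) has_vd ?q *R fi' e (?q *R (k - k0) + (?q * 0) *R e)) (at 0)"
   by (intro vector_diff_chain_at)
  moreover have "?q *R (k - k0) + (?q * t) *R e = ?q *R (k + t *R e - k0)" for t
   by (simp add: algebra_simps)
  ultimately have "((%t. localizer M c bt k0 (k + t *R e)) has_vd ?q * fi' e (?q *R (k - k0))) (at 0)"
   by (simp add: localizer_def o_def)
  moreover have "\<bar>?q * fi' e (?q *R (k - k0))\<bar> <= C * bt powr (- (1 - eps M))"
  proof -
   have "\<bar>?q\<bar> <= bt powr (- (1 - eps M))" using c by (simp add: abs_mult mult_left_le_one_le)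
   then show ?thesis using order_trans[OF B(2)[OF e] BC[OF e]] by (subst abs_mult, subst mult.commute) (intro mult_mono, auto intro: order_trans[OF B0[OF e] BC[OF e]])
  qed
  ultimately show "EX D. ((%t. localizer M c bt k0 (k + t *R e)) has_vd D) (at 0) & \<bar>D\<bar> <= C * bt powr (- (1 - eps M))" by blast
 qed
qed

lemma localizer_borel: "cutoff M ==> localizer M c bt k0 : borel_fun"
 unfolding localizer_def[abs_def]
 by (rule measurable_compose[OF _ test_function_measurable[OF test_function_cut]]) auto

lemma complex_linear_imp_linear:
 fixes f :: "complex^'a => complex^'b"
 assumes "Vector_Spaces.linear (*s) (*s) f"
 shows "linear f"
proof -
 interpret Vector_Spaces.linear "(*s)" "(*s)" f by (rule assms)
 have s: "c *R x = complex_of_real c *s x" for c and x :: "complex^'x"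
  by (simp add: vec_eq_iff scaleR_conv_of_real[symmetric])
 show ?thesis by (intro linearI) (simp_all add: add s scale)
qed

lemma nonlinear_partD:
 fixes M :: "('d::finite, 'c::finite) wave_model"
 assumes "nonlinear_part M"
 shows "finite (degs M)" and "m : degs M ==> 2 <= m"
  and "m : degs M ==> length us = m ==>
   Ck_along (multi_coord_lines m) q {x. ALL i<=m. x i ~: sigma_bc M} (%x. chi M m (map x [0..<Suc m]) us)"
  and chi_linear: "m : degs M ==> length ks = Suc m ==> i < m ==> linear (%u. chi M m ks (map (v(i := u)) [0..<m]))"
proof -
 show "finite (degs M)" "m : degs M ==> 2 <= m" using assms by (auto simp: nonlinear_part_def)
 show "m : degs M ==> length us = m ==>
   Ck_along (multi_coord_lines m) q {x. ALL i<=m. x i ~: sigma_bc M} (%x. chi M m (map x [0..<Suc m]) us)"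
  using assms unfolding nonlinear_part_def smooth_along_def by blast
 assume a: "m : degs M" "length ks = Suc m" "i < m"
 have "map (v(i := u)) [0..<m] = (map v [0..<m])[i := u]" for u
  using a(3) by (intro nth_equalityI) (auto simp: nth_list_update)
 moreover have "Vector_Spaces.linear (*s) (*s) (%u. chi M m ks ((map v [0..<m])[i := u]))"
 proof -
  have "length (map v [0..<m]) = m" by simp
  then show ?thesis using assms a unfolding nonlinear_part_def by blast
 qed
 ultimately show "linear (%u. chi M m ks (map (v(i := u)) [0..<m]))"
  by (simp add: complex_linear_imp_linear)
qed

lemma chi_expansion:
 fixes M :: "('d::finite, 'c::finite) wave_model"
 assumes "nonlinear_part M" "m : degs M" "length ks = Suc m"
 shows "chi M m ks (map v [0..<m]) = (SUM bt:multi_basis m. (PROD i<m. v i \<bullet> bt i) *R chi M m ks (map bt [0..<m]))"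
 unfolding multi_basis_def
proof (rule multilinear_expansion)
 fix v :: "nat => complex^'c" and i assume "i < m"
 then show "linear (%u. chi M m ks (map (v(i := u)) [0..<m]))" using chi_linear[OF assms] by simp
qed (auto intro!: arg_cong[of _ _ "chi M m ks"])

section \<open>The localized interaction kernel\<close>

text \<open>Index 0 is the centre of the output and \<open>Suc i\<close> that of slot
  \<open>i\<close>, in step with the numbering of the wavevectors.\<close>

definition cen :: "'d::finite nk_spectrum => nat => int => (int \<times> nat) list => nat => real^'d"
where "cen S l tt lv i = (if i = 0 then real_of_int tt *R ctr S l
 else real_of_int (fst (lv ! (i - 1))) *R ctr S (snd (lv ! (i - 1))))"

text \<open>All cutoffs of a summand are collected in one factor, so that phase and amplitude need
  to be controlled only near the centres.\<close>

definition kloc :: "('d::finite, 'c::finite) wave_model => 'd nk_spectrum => real => nat => nat => int =>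
 (int \<times> nat) list => (nat => real^'d) => real"
where "kloc M S bt m l tt lv x = (PROD i<Suc m. localizer M (if i = 0 then 1 else 1/2) bt (cen S l tt lv i) (x i))"

definition slot_proj :: "('d::finite, 'c::finite) wave_model => 'd nk_spectrum => (int \<times> nat) list => nat =>
 real^'d => complex^'c => complex^'c"
where "slot_proj M S lv i k = band_proj M (band S (snd (lv ! i))) (fst (lv ! i)) k"

definition kvec :: "('d::finite, 'c::finite) wave_model => 'd nk_spectrum => nat => nat => int =>
 (int \<times> nat) list => (nat => complex^'c) => (nat => real^'d) => complex^'c"
where "kvec M S m l tt lv v x = (1 / (2 * pi) ^ ((m - 1) * CARD('d))) *R
 band_proj M (band S l) tt (x 0) (chi M m (map x [0..<Suc m]) (map (%i. slot_proj M S lv i (x (Suc i)) (v i)) [0..<m]))"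

definition kphase :: "('d::finite, 'c::finite) wave_model => 'd nk_spectrum => nat => nat => int =>
 (int \<times> nat) list => (nat => real^'d) => real"
where "kphase M S m l tt lv x = freq M (band S l) tt (x 0)
 - (SUM i<m. freq M (band S (snd (lv ! i))) (fst (lv ! i)) (x (Suc i)))"

text \<open>Fixed vectors take the place of the fields, which makes this an explicit function of the
  wavevectors; the fields re-enter by multilinearity.\<close>

definition kernel :: "('d::finite, 'c::finite) wave_model => 'd nk_spectrum => real => real => nat => nat => int =>
 (int \<times> nat) list => (nat => complex^'c) => real => (nat => real^'d) => complex^'c"
where "kernel M S bt rh m l tt lv v s x =
 kloc M S bt m l tt lv x *R (cis (kphase M S m l tt lv x * (s / rh)) *s kvec M S m l tt lv v x)"

lemma nice_ex_scaleR:
 fixes f :: "(nat => real^'d) => real" and g :: "(nat => real^'d) => 'w::real_normed_vector"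
 shows "EX A B. nice j Z f A B ==> EX A B. nice j Z g A B ==> EX A B. nice j Z (%x. f x *R g x) A B"
 using nice_scaleR by blast

lemma bounded_bilinear_matrix_vec: "bounded_bilinear ((*v) :: complex^'c^'c => complex^'c => complex^'c)"
proof -
 have "bilinear ((*v) :: complex^'c^'c => complex^'c => complex^'c)"
  unfolding bilinear_def
  by (auto intro!: linearI simp: vec_eq_iff matrix_vector_mult_def algebra_simps sum.distrib scaleR_sum_right)
 then show ?thesis by (simp add: bilinear_conv_bounded_bilinear)
qed

lemma nice_ex_matrix_vec:
 fixes f :: "(nat => real^'d) => complex^'c^'c" and g :: "(nat => real^'d) => complex^'c"
 assumes f: "EX A B. nice j Z f A B" and g: "EX A B. nice j Z g A B"
 shows "EX A B. nice j Z (%x. f x *v g x) A B"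
proof -
 have b: "bounded_bilinear ((*v) :: complex^'c^'c => complex^'c => complex^'c)"
  by (rule bounded_bilinear_matrix_vec)
 from bounded_bilinear.nonneg_bounded[OF b] obtain K where K: "0 <= K"
  "!!a c. norm ((a :: complex^'c^'c) *v c) <= norm a * norm c * K" by blast
 show ?thesis using nice_bilinear[OF b K(2,1)] f g by blast
qed

lemma nice_ex_sum:
 fixes f :: "'i => (nat => real^'d) => 'v::real_normed_vector"
 assumes "finite I" "!!i. i : I ==> EX A B. nice j Z (f i) A B"
 shows "EX A B. nice j Z (%x. SUM i:I. f i x) A B"
proof -
 have "ALL i:I. EX A B. nice j Z (f i) A B" using assms(2) by blast
 from bchoice[OF this] obtain A where "ALL i:I. EX B. nice j Z (f i) (A i) B" by blast
 from bchoice[OF this] obtain B where "!!i. i : I ==> nice j Z (f i) (A i) (B i)" by blast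
 then have "nice j Z (%x. SUM i:I. f i x) (SUM i:I. A i) (SUM i:I. B i)" by (rule nice_sum[OF assms(1)])
 then show ?thesis by blast
qed

lemma nice_ex_prod:
 fixes f :: "nat => (nat => real^'d) => real"
 assumes "!!i. i < n ==> EX A B. nice j Z (f i) A B"
 shows "EX A B. nice j Z (%x. PROD i<n. f i x) A B"
 using assms
proof (induction n)
 case 0
 have "nice j Z (%x. PROD i<0. f i x) 1 0" using nice_const[of "1::real" 1] by simp
 then show ?case by blast
next
 case (Suc n)
 have "EX A B. nice j Z (%x. f n x *R (PROD i<n. f i x)) A B"
  by (intro nice_ex_scaleR) (use Suc in auto)
 then show ?case by (simp add: mult.commute)
qed

text \<open>Only ingredients of known regularity remain: rank-one projections and values of
  \<open>chi\<close> at constant vectors. Eigenvectors no longer occur on their own.\<close>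

lemma kvec_expansion:
 fixes M :: "('d::finite, 'c::finite) wave_model" and v :: "nat => complex^'c"
 assumes N: "nonlinear_part M" "m : degs M"
 shows "kvec M S m l tt lv v x = (1 / (2 * pi) ^ ((m - 1) * CARD('d))) *R
  (outer (evec M (band S l) tt (x 0)) *v (SUM ga:multi_basis m.
   (PROD i<m. (outer (evec M (band S (snd (lv ! i))) (fst (lv ! i)) (x (Suc i))) *v v i) \<bullet> ga i) *R
    chi M m (map x [0..<Suc m]) (map ga [0..<m])))"
 unfolding kvec_def slot_proj_def band_proj_outer
 by (subst chi_expansion[OF N]) simp_all

lemma kvec_linear_expansion:
 fixes M :: "('d::finite, 'c::finite) wave_model" and v :: "nat => complex^'c"
 assumes N: "nonlinear_part M" "m : degs M"
 shows "kvec M S m l tt lv v x = (SUM al:multi_basis m. (PROD i<m. v i \<bullet> al i) *R kvec M S m l tt lv al x)"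
 unfolding multi_basis_def
proof (rule multilinear_expansion)
 fix v :: "nat => complex^'c" and i assume i: "i < m"
 let ?h = "%j. slot_proj M S lv j (x (Suc j))"
 have hl: "linear (?h i)" unfolding slot_proj_def band_proj_outer
  by (rule bounded_linear.linear[OF bounded_bilinear.bounded_linear_right[OF bounded_bilinear_matrix_vec]])
 have "linear (%w. chi M m (map x [0..<Suc m]) (map ((%j. ?h j (v j))(i := w)) [0..<m]))"
  using i by (intro chi_linear[OF N]) simp_all
 from linear_compose[OF hl this]
 have "linear (%u. chi M m (map x [0..<Suc m]) (map ((%j. ?h j (v j))(i := ?h i u)) [0..<m]))" by (simp only: o_def)
 moreover have "((%j. ?h j (v j))(i := ?h i u)) = (%j. ?h j ((v(i := u)) j))" for u by auto
 ultimately have "linear (%u. chi M m (map x [0..<Suc m]) (map (%j. ?h j ((v(i := u)) j)) [0..<m]))" by (simp only:)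
 moreover have "linear (%w. (1 / (2 * pi) ^ ((m - 1) * CARD('d))) *R band_proj M (band S l) tt (x 0) w)"
  unfolding band_proj_outer
  by (rule linear_compose_scale_right, rule bounded_linear.linear[OF bounded_bilinear.bounded_linear_right[OF bounded_bilinear_matrix_vec]])
 ultimately show "linear (%u. kvec M S m l tt lv (v(i := u)) x)"
  unfolding kvec_def by (rule linear_compose[unfolded o_def])
qed (auto simp: kvec_def intro!: arg_cong[of _ _ "chi M m _"] arg_cong[of _ _ "band_proj M _ _ _"])

lemma index_vectors_nth:
 "lv : index_vectors S m ==> i < m ==> fst (lv ! i) : signs & snd (lv ! i) : {1..nparts S}"
proof -
 assume "lv : index_vectors S m" "i < m"
 then have "lv ! i : signs \<times> {1..nparts S}" unfolding index_vectors_def using nth_mem[of i lv] by blast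
 then show ?thesis by (simp only: mem_Times_iff)
qed

section \<open>Regularity of the kernel near the centres\<close>

context
 fixes M :: "('d::finite, 'c::finite) wave_model" and S :: "'d nk_spectrum" and bt0 :: real and m l :: nat and tt :: int
  and lv :: "(int \<times> nat) list"
 assumes L: "linear_part M" and N: "nonlinear_part M" and M: "cutoff M" and ok: "nk_spectrum_ok M S"
  and inv: "universally_resonance_invariant M S" and bt0: "small_beta M S bt0"
  and m: "m : degs M" and l: "l : {1..nparts S}" and tt: "tt : signs" and lv: "lv : resonant_vectors M S m l tt"
begin

definition "offband = {x :: nat => real^'d. ALL i<=m. x i ~: sigma_bc M}"
text \<open>The radius belongs to the largest admissible \<beta>. One region thus serves all \<beta>
  up to \<open>bt0\<close>, and constants found on it are uniform in \<beta>.\<close>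

definition "near_centers = {x :: nat => real^'d. ALL i<=m. x i : cball (cen S l tt lv i) (2 * bt0 powr (1 - eps M))}"

lemma slot_ok:
 assumes "i < m"
 shows "fst (lv ! i) : signs" "snd (lv ! i) : {1..nparts S}" "band S (snd (lv ! i)) : {1..nbands M}"
proof -
 have "lv : index_vectors S m" using lv by (simp add: resonant_vectors_def)
 from index_vectors_nth[OF this assms] show *: "fst (lv ! i) : signs" "snd (lv ! i) : {1..nparts S}" by auto
 show "band S (snd (lv ! i)) : {1..nbands M}" using ok *(2) unfolding nk_spectrum_ok_def by blast
qed

lemma band_ok: "band S l : {1..nbands M}"
 using ok l unfolding nk_spectrum_ok_def by blast

lemma cen_cball:
 assumes i: "i <= m"
 shows "cball (cen S l tt lv i) (2 * bt0 powr (1 - eps M)) \<subseteq> - sigma_bc M"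
proof -
 note od = odd_degree_centers[OF ok m resonant_vectors_slot(2)[OF ok inv m l tt lv] _ _ bt0]
 show ?thesis
 proof (cases i)
  case 0 then show ?thesis using od[OF l tt] by (simp add: cen_def)
 next
  case (Suc i') then show ?thesis using od[OF slot_ok(2,1)[of i']] i by (simp add: cen_def)
 qed
qed

lemma near_offband: "near_centers \<subseteq> offband"
 unfolding near_centers_def offband_def using cen_cball by blast

lemma open_offband: "open offband"
 unfolding offband_def using open_coordinates[OF open_complement_sigma[OF L], of m] by simp

lemma nice_chi:
 assumes j: "j < m"
 shows "EX A B. nice j near_centers (%x. chi M m (map x [0..<Suc m]) (map ga [0..<m])) A B"
 unfolding near_centers_def
proof (rule nice_multi[OF _ open_offband j])
 show "Ck_along (multi_coord_lines m) (Suc 0) offband (%x. chi M m (map x [0..<Suc m]) (map ga [0..<m]))"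
  unfolding offband_def by (rule nonlinear_partD(3)[OF N m]) simp
 show "{x. ALL i<=m. x i : cball (cen S l tt lv i) (2 * bt0 powr (1 - eps M))} \<subseteq> offband"
  using near_offband unfolding near_centers_def .
qed (auto intro!: arg_cong[of _ _ "%ks. chi M m ks _"])

lemma nice_kvec:
 assumes j: "j < m"
 shows "EX A B. nice j near_centers (kvec M S m l tt lv al) A B"
proof -
 have proj: "EX A B. nice j near_centers (%x. outer (evec M n ze (x i))) A B"
  if "i <= m" "n : {1..nbands M}" "ze : signs" for n ze i
  using that(1) by (intro nice_Ck1_coord[OF proj_Ck1[OF L that(2,3)] cen_cball[OF that(1)]]) (simp add: near_centers_def)
 have const: "EX A B. nice j near_centers (%x. c) A B" for c :: "'v::real_normed_vector"
  using nice_const[of c "norm c" j near_centers] by blast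
 have entry: "EX A B. nice j near_centers (%x. (outer (evec M (band S (snd (lv ! i))) (fst (lv ! i)) (x (Suc i))) *v al i) \<bullet> ga) A B"
  if i: "i < m" for i ga
 proof -
  have "EX A B. nice j near_centers (%x. outer (evec M (band S (snd (lv ! i))) (fst (lv ! i)) (x (Suc i))) *v al i) A B"
   using i by (intro nice_ex_matrix_vec proj const slot_ok) auto
  moreover have "EX A B. nice j near_centers (%x. ga) A B" by (rule const)
  ultimately show ?thesis
   using nice_bilinear[OF bounded_bilinear_inner, of 1 j near_centers] by (fastforce simp: Cauchy_Schwarz_ineq2 norm_cauchy_schwarz)
 qed
 have prods: "EX A B. nice j near_centers (%x. PROD i<m. (outer (evec M (band S (snd (lv ! i))) (fst (lv ! i)) (x (Suc i))) *v al i) \<bullet> ga i) A B" for ga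
  by (rule nice_ex_prod) (rule entry)
 have "EX A B. nice j near_centers (%x. SUM ga:multi_basis m.
   (PROD i<m. (outer (evec M (band S (snd (lv ! i))) (fst (lv ! i)) (x (Suc i))) *v al i) \<bullet> ga i) *R
    chi M m (map x [0..<Suc m]) (map ga [0..<m])) A B"
 proof (rule nice_ex_sum[OF finite_multi_basis])
  fix ga :: "nat => complex^'c"
  show "EX A B. nice j near_centers (%x. (PROD i<m. (outer (evec M (band S (snd (lv ! i))) (fst (lv ! i)) (x (Suc i))) *v al i) \<bullet> ga i) *R
    chi M m (map x [0..<Suc m]) (map ga [0..<m])) A B"
   by (rule nice_ex_scaleR[OF prods nice_chi[OF j]])
 qed
 note s = nice_ex_matrix_vec[OF proj[OF le0 band_ok tt] this]
 show ?thesis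
  by (subst kvec_expansion[OF N m, abs_def], rule nice_ex_scaleR, rule const, rule s)
qed

lemma kloc_support:
 assumes "0 < bt" "kloc M S bt m l tt lv x ~= 0" "i <= m"
 shows "norm (x i - cen S l tt lv i) < 2 * bt powr (1 - eps M)"
proof -
 have "localizer M (if i = 0 then 1 else 1/2) bt (cen S l tt lv i) (x i) ~= 0"
 proof
  assume "localizer M (if i = 0 then 1 else 1/2) bt (cen S l tt lv i) (x i) = 0"
  then have "kloc M S bt m l tt lv x = 0"
   unfolding kloc_def using assms(3) by (intro prod_zero bexI[of _ i]) simp_all
  then show False using assms(2) by contradiction
 qed
 then show ?thesis by (rule localizer_support[OF M assms(1), rotated]) simp
qed

lemma powr_beta_mono: "0 < bt ==> bt <= bt0 ==> bt powr (1 - eps M) <= bt0 powr (1 - eps M)"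
 using cutoffD(1,2)[OF M] by (intro powr_mono2) auto

text \<open>Outside, phase and amplitude may fail to be differentiable. The complement of a closed
  ball is open, so a short shift does not lead back and the product has derivative 0 there.\<close>

lemma kloc_outside:
 assumes bt: "0 < bt" "bt <= bt0" and x: "x ~: near_centers"
 shows "kloc M S bt m l tt lv x = 0" and "\<forall>\<^sub>F t in at 0. kloc M S bt m l tt lv (shift2 j e t x) = 0"
proof -
 have out: "kloc M S bt m l tt lv y = 0" if "i <= m" "y i ~: cball (cen S l tt lv i) (2 * bt0 powr (1 - eps M))" for y i
  using kloc_support[OF bt(1), of y i] that powr_beta_mono[OF bt] by (fastforce simp: dist_norm norm_minus_commute)
 obtain i where i: "i <= m" "x i ~: cball (cen S l tt lv i) (2 * bt0 powr (1 - eps M))"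
  using x unfolding near_centers_def by blast
 show "kloc M S bt m l tt lv x = 0" by (rule out[of i x, OF i])
 have "((%t. shift2 j e t x i) \<longlongrightarrow> shift2 j e 0 x i) (at 0)"
  unfolding shift2_def by (cases "i = 0 | i = Suc j") (auto intro!: tendsto_eq_intros)
 moreover have "open (- cball (cen S l tt lv i) (2 * bt0 powr (1 - eps M)))" by (intro open_Compl closed_cball)
 ultimately have "\<forall>\<^sub>F t in at 0. shift2 j e t x i : - cball (cen S l tt lv i) (2 * bt0 powr (1 - eps M))"
  using i(2) by (intro topological_tendstoD) auto
 then show "\<forall>\<^sub>F t in at 0. kloc M S bt m l tt lv (shift2 j e t x) = 0"
  by (rule eventually_mono) (rule out[OF i(1)], simp)
qed

text \<open>Slot \<open>j\<close> has the band, the sign and the centre of the output, and no other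
  slot moves. The derivative is therefore the increment of one function \<open>g\<close> between
  \<open>x 0\<close> and \<open>x (Suc j)\<close>, to which the Lipschitz bound applies.\<close>

lemma kphase_derivative:
 assumes j: "j < m" "lv ! j = (tt, l)"
 shows "EX K>=0. ALL e:Basis. ALL bt x. 0 < bt --> bt <= bt0 --> x : near_centers -->
  (EX D. ((%t. kphase M S m l tt lv (shift2 j e t x)) has_vd D) (at 0) &
   (kloc M S bt m l tt lv x ~= 0 --> \<bar>D\<bar> <= K * bt powr (1 - eps M)))"
proof -
 let ?om = "freq M (band S l) tt" and ?C = "cball (cen S l tt lv 0) (2 * bt0 powr (1 - eps M))"
 have cj: "cen S l tt lv (Suc j) = cen S l tt lv 0" using j(2) by (simp add: cen_def)
 have "ALL e:Basis. EX g K. 0 <= K & (ALL x:?C. ((%t. ?om (x + t *R e)) has_vd g x) (at 0)) &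
  (ALL x:?C. ALL y:?C. norm (g x - g y) <= K * norm (x - y))"
 proof
  fix e :: "real^'d" assume e: "e : Basis"
  from freq_Ck2[OF L band_ok tt e] obtain g where g: "ALL x:- sigma_bc M. ((%t. ?om (x + t *R e)) has_vd g x) (at 0)"
   "Ck_along coord_lines (Suc 0) (- sigma_bc M) g" by blast
  from Ck1_lipschitz_cball[OF open_complement_sigma[OF L] g(2) cen_cball[OF le0]]
  show "EX g K. 0 <= K & (ALL x:?C. ((%t. ?om (x + t *R e)) has_vd g x) (at 0)) &
   (ALL x:?C. ALL y:?C. norm (g x - g y) <= K * norm (x - y))"
   using g(1) cen_cball[OF le0] by (meson subsetD)
 qed
 from bchoice[OF this] obtain g where "ALL e:Basis. EX K. 0 <= K & (ALL x:?C. ((%t. ?om (x + t *R e)) has_vd g e x) (at 0)) &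
  (ALL x:?C. ALL y:?C. norm (g e x - g e y) <= K * norm (x - y))" by blast
 from bchoice[OF this] obtain K where K: "!!e. e : Basis ==> 0 <= K e"
  "!!e x. e : Basis ==> x : ?C ==> ((%t. ?om (x + t *R e)) has_vd g e x) (at 0)"
  "!!e x y. e : Basis ==> x : ?C ==> y : ?C ==> norm (g e x - g e y) <= K e * norm (x - y)" by blast
 define K' where "K' = 4 * (SUM e:Basis. K e)"
 have K': "0 <= K'" "!!e. e : Basis ==> 4 * K e <= K'"
  unfolding K'_def using K(1) member_le_sum[of _ Basis K] by (auto intro!: sum_nonneg)
 show ?thesis
 proof (rule exI[of _ K'], intro conjI ballI allI impI)
  fix e :: "real^'d" and bt x assume e: "e : Basis" and bt: "0 < bt" "bt <= bt0" and x: "x : near_centers"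
  have x0: "x 0 : ?C" using x unfolding near_centers_def by blast
  have xj: "x (Suc j) : ?C" using x j(1) unfolding near_centers_def by (metis (mono_tags, lifting) Suc_leI cj mem_Collect_eq)
  \<comment> \<open>In slot \<open>j\<close> the frequency function is \<open>?om\<close> itself;
    all other field wavevectors are constant along the shift.\<close>
  have terms: "((%t. freq M (band S (snd (lv ! i))) (fst (lv ! i)) (shift2 j e t x (Suc i))) has_vd
   (if i = j then g e (x (Suc j)) else 0)) (at 0)" for i
   using K(2)[OF e xj] j(2) by (simp add: shift2_def)
  have "((%t. kphase M S m l tt lv (shift2 j e t x)) has_vd
   g e (x 0) - (SUM i<m. if i = j then g e (x (Suc j)) else 0)) (at 0)"
   unfolding kphase_def
   using K(2)[OF e x0] by (intro has_vector_derivative_diff has_vector_derivative_sum terms) (simp add: shift2_def)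
  then have d: "((%t. kphase M S m l tt lv (shift2 j e t x)) has_vd g e (x 0) - g e (x (Suc j))) (at 0)"
   using j(1) by simp
  have "\<bar>g e (x 0) - g e (x (Suc j))\<bar> <= K' * bt powr (1 - eps M)" if nz: "kloc M S bt m l tt lv x ~= 0"
  proof -
   \<comment> \<open>Both wavevectors are within \<open>2 * bt powr (1 - eps M)\<close> of their
     common centre, which is where the 4 in \<open>K'\<close> comes from.\<close>
   have "norm (x 0 - x (Suc j)) <= norm (x 0 - cen S l tt lv 0) + norm (x (Suc j) - cen S l tt lv 0)"
    by (metis norm_minus_commute norm_triangle_ineq4 diff_diff_eq2 diff_add_cancel add.commute dist_norm dist_triangle2)
   then have "norm (x 0 - x (Suc j)) <= 4 * bt powr (1 - eps M)"
    using kloc_support[OF bt(1) nz le0] kloc_support[OF bt(1) nz, of "Suc j"] j(1) cj by simp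
   then have "K e * norm (x 0 - x (Suc j)) <= K e * (4 * bt powr (1 - eps M))" by (rule mult_left_mono[OF _ K(1)[OF e]])
   also have "... <= K' * bt powr (1 - eps M)" using mult_right_mono[OF K'(2)[OF e], of "bt powr (1 - eps M)"] by (simp add: mult_ac)
   finally show ?thesis using K(3)[OF e x0 xj] by simp
  qed
  then show "EX D. ((%t. kphase M S m l tt lv (shift2 j e t x)) has_vd D) (at 0) &
   (kloc M S bt m l tt lv x ~= 0 --> \<bar>D\<bar> <= K' * bt powr (1 - eps M))" using d by blast
 qed (rule K'(1))
qed

end

context
 fixes M :: "('d::finite, 'c::finite) wave_model" and S :: "'d nk_spectrum" and bt0 :: real and m l :: nat and tt :: int
  and lv :: "(int \<times> nat) list"
 assumes L: "linear_part M" and N: "nonlinear_part M" and M: "cutoff M" and ok: "nk_spectrum_ok M S"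
  and inv: "universally_resonance_invariant M S" and bt0: "small_beta M S bt0"
  and m: "m : degs M" and l: "l : {1..nparts S}" and tt: "tt : signs" and lv: "lv : resonant_vectors M S m l tt"
begin

lemmas kernel_context = L N M ok inv bt0 m l tt lv

abbreviation (input) "near == near_centers M S bt0 m l tt lv"

lemma nice_kloc:
 "EX A>=1. EX B>=0. ALL bt>0. nice j UNIV (kloc M S bt m l tt lv) A (B * bt powr (- (1 - eps M)))"
proof -
 from localizer_bounds[OF M] obtain A B where A: "1 <= A" and B: "0 <= B"
  and AB: "ALL bt c k0. 0 < bt --> \<bar>c\<bar> <= 1 -->
  (ALL k. \<bar>localizer M c bt k0 k\<bar> <= A & (ALL e:Basis. EX D. ((%t. localizer M c bt k0 (k + t *R e)) has_vd D) (at 0)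
   & \<bar>D\<bar> <= B * bt powr (- (1 - eps M))))" by blast
 have "nice j UNIV (kloc M S bt m l tt lv) (A ^ Suc m) ((real (Suc m) * A ^ Suc m * B) * bt powr (- (1 - eps M)))" if bt: "0 < bt" for bt
 proof -
  have "nice j UNIV (%x. localizer M (if i = 0 then 1 else 1/2) bt (cen S l tt lv i) (x i)) A (B * bt powr (- (1 - eps M)))" for i
  proof -
   have c: "\<bar>if i = 0 then 1 else 1/2\<bar> <= (1 :: real)" by simp
   show ?thesis
    using A B AB[rule_format, OF bt c] by (intro nice_coord) auto
  qed
  then have "nice j UNIV (%x. PROD i<Suc m. localizer M (if i = 0 then 1 else 1/2) bt (cen S l tt lv i) (x i)) (A ^ Suc m)
   (real (Suc m) * A ^ Suc m * (B * bt powr (- (1 - eps M))))"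
   using A B by (intro nice_prod) auto
  then show ?thesis unfolding kloc_def[abs_def] by (simp only: mult.assoc)
 qed
 moreover have "1 <= A ^ Suc m" using A by (rule one_le_power)
 moreover have "0 <= real (Suc m) * A ^ Suc m * B" using A B by simp
 ultimately show ?thesis by blast
qed

text \<open>The derivative contains \<beta>^(-(1-\<epsilon>)) from the cutoffs,
  \<beta>^(1-\<epsilon>) s / \<rho> from the phase, and no power of \<beta> from the amplitude. Each
  is at most a constant times \<beta>^(-(1+\<epsilon>)), the inverse of the weight in the
  norm.\<close>

lemma kernel_bounds:
 assumes j: "j < m" "lv ! j = (tt, l)"
 shows "EX K>=0. ALL bt rh. 0 < bt --> bt <= bt0 --> 0 < rh --> bt\<^sup>2 / rh <= C1 --> (ALL al:multi_basis m. ALL x s.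
  norm (kernel M S bt rh m l tt lv al s x) <= K & (ALL e:Basis. EX D.
   ((%t. kernel M S bt rh m l tt lv al s (shift2 j e t x)) has_vd D) (at 0) &
   (s : {0..1} --> norm D <= K * bt powr (- (1 + eps M)))))"
proof -
 have b01: "0 < bt0" "bt0 <= 1" using bt0 by (auto simp: small_beta_def)
 note ep = cutoffD(1,2)[OF M]
 from nice_kloc[of j] obtain A B where A: "1 <= A" and B: "0 <= B"
  and nl: "!!bt. 0 < bt ==> nice j UNIV (kloc M S bt m l tt lv) A (B * bt powr (- (1 - eps M)))" by blast
 from kphase_derivative[OF kernel_context j] obtain P where P: "0 <= P"
  and np: "ALL e:Basis. ALL bt x. 0 < bt --> bt <= bt0 --> x : near -->
  (EX D. ((%t. kphase M S m l tt lv (shift2 j e t x)) has_vd D) (at 0) &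
   (kloc M S bt m l tt lv x ~= 0 --> \<bar>D\<bar> <= P * bt powr (1 - eps M)))" by blast
 have "ALL al:multi_basis m. EX A B. nice j near (kvec M S m l tt lv al) A B"
  using nice_kvec[OF kernel_context j(1)] by blast
 from bchoice[OF this] obtain A' where "ALL al:multi_basis m. EX B. nice j near (kvec M S m l tt lv al) (A' al) B" by blast
 from bchoice[OF this] obtain B' where nv: "!!al. al : multi_basis m ==> nice j near (kvec M S m l tt lv al) (A' al) (B' al)" by blast
 \<comment> \<open>\<open>C1\<close> is an arbitrary real number; its absolute value keeps all
   summands nonnegative.\<close>
 define K1 where "K1 al = A * A' al + (B * A' al + A * (P * \<bar>C1\<bar> * A' al + B' al))" for al
 have nonneg: "0 <= A' al" "0 <= B' al" if "al : multi_basis m" for al using niceD(1,2)[OF nv[OF that]] .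
 have K1: "0 <= K1 al" "A * A' al <= K1 al" "B * A' al + A * (P * \<bar>C1\<bar> * A' al + B' al) <= K1 al" if "al : multi_basis m" for al
  unfolding K1_def using nonneg[OF that] A B P by auto
 have K2: "K1 al <= (SUM al:multi_basis m. K1 al)" if "al : multi_basis m" for al
  using that K1(1) by (intro member_le_sum finite_multi_basis) auto
 show ?thesis
 proof (rule exI[of _ "SUM al:multi_basis m. K1 al"], intro conjI allI impI ballI)
  show "0 <= (SUM al:multi_basis m. K1 al)" by (intro sum_nonneg K1(1))
  fix bt rh :: real and al :: "nat => complex^'c" and x s
  assume bt: "0 < bt" "bt <= bt0" and rh: "0 < rh" and C1: "bt\<^sup>2 / rh <= C1" and al: "al : multi_basis m"
  have npe: "EX D. ((%t. kphase M S m l tt lv (shift2 j e t x)) has_vd D) (at 0) &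
   (kloc M S bt m l tt lv x ~= 0 --> \<bar>D\<bar> <= P * bt powr (1 - eps M))" if "x : near" "e : Basis" for x e
   using np bt that by blast
  have P': "0 <= P * bt powr (1 - eps M)" using P by simp
  obtain e0 :: "real^'d" where e0: "e0 : Basis" using nonempty_Basis by blast
  have "norm (kernel M S bt rh m l tt lv al s x) <= A * A' al"
   unfolding kernel_def
   by (rule localized_oscillation_derivative(1)[OF nl[OF bt(1)] nv[OF al] kloc_outside[OF kernel_context bt] npe[OF _ e0] e0 P'])
  then show "norm (kernel M S bt rh m l tt lv al s x) <= (SUM al:multi_basis m. K1 al)"
   using K1(2)[OF al] K2[OF al] by linarith
  fix e :: "real^'d" assume e: "e : Basis"
  have "EX D. ((%t. kernel M S bt rh m l tt lv al s (shift2 j e t x)) has_vd D) (at 0) &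
   norm D <= (B * bt powr (- (1 - eps M))) * A' al + A * ((P * bt powr (1 - eps M)) * \<bar>s / rh\<bar> * A' al + B' al)"
   unfolding kernel_def
   by (rule localized_oscillation_derivative(2)[OF nl[OF bt(1)] nv[OF al] kloc_outside[OF kernel_context bt] npe[OF _ e] e P'])
  then obtain D where
   D: "((%t. kernel M S bt rh m l tt lv al s (shift2 j e t x)) has_vd D) (at 0)"
   "norm D <= (B * bt powr (- (1 - eps M))) * A' al + A * ((P * bt powr (1 - eps M)) * \<bar>s / rh\<bar> * A' al + B' al)"
   by blast
  have "norm D <= (SUM al:multi_basis m. K1 al) * bt powr (- (1 + eps M))" if s: "s : {0..1}"
  proof -
   let ?b = "bt powr (- (1 + eps M))"
   have bt1: "bt <= 1" using bt b01 by linarith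
   have b1: "bt powr (- (1 - eps M)) <= ?b" using bt(1) bt1 ep by (intro powr_mono') auto
   have b2: "1 <= ?b" using powr_mono'[of "- (1 + eps M)" 0 bt] bt(1) bt1 ep by simp
   \<comment> \<open>Writing \<open>1 - \<epsilon>\<close> as \<open>2 - (1 + \<epsilon>)\<close>
     brings out \<beta>^2 / \<rho>, which is at most \<open>C1\<close>; times up to 1 add no further
     factor.\<close>
   have b3: "bt powr (1 - eps M) * \<bar>s / rh\<bar> <= \<bar>C1\<bar> * ?b"
   proof -
    have "bt powr (1 - eps M) = bt\<^sup>2 * ?b" using bt(1) by (simp add: powr_add[symmetric] flip: powr_numeral)
    then have "bt powr (1 - eps M) * \<bar>s / rh\<bar> = (bt\<^sup>2 / rh) * s * ?b" using s rh by (simp add: abs_divide)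
    also have "... <= \<bar>C1\<bar> * ?b"
    proof (rule mult_right_mono)
     have "(bt\<^sup>2 / rh) * s <= (bt\<^sup>2 / rh) * 1" using s rh by (intro mult_left_mono) auto
     then show "(bt\<^sup>2 / rh) * s <= \<bar>C1\<bar>" using C1 by linarith
    qed simp
    finally show ?thesis .
   qed
   note n = nonneg[OF al]
   have "(B * bt powr (- (1 - eps M))) * A' al <= (B * ?b) * A' al"
    using b1 B n by (intro mult_right_mono mult_left_mono) auto
   moreover have "P * (bt powr (1 - eps M) * \<bar>s / rh\<bar>) * A' al <= P * (\<bar>C1\<bar> * ?b) * A' al"
    using b3 P n by (intro mult_right_mono mult_left_mono) auto
   moreover have "B' al <= B' al * ?b" using b2 n mult_left_mono[of 1 ?b "B' al"] by simp
   ultimately have "norm D <= (B * ?b) * A' al + A * (P * (\<bar>C1\<bar> * ?b) * A' al + B' al * ?b)"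
    using D(2) mult_left_mono[of "P * (bt powr (1 - eps M) * \<bar>s / rh\<bar>) * A' al + B' al" "P * (\<bar>C1\<bar> * ?b) * A' al + B' al * ?b" A] A
    by (simp only: mult.assoc) linarith
   also have "... = (B * A' al + A * (P * \<bar>C1\<bar> * A' al + B' al)) * ?b" by (simp only: algebra_simps)
   also have "... <= (SUM al:multi_basis m. K1 al) * ?b"
    using K1(3)[OF al] K2[OF al] by (intro mult_right_mono) (linarith, simp)
   finally show ?thesis .
  qed
  then show "EX D. ((%t. kernel M S bt rh m l tt lv al s (shift2 j e t x)) has_vd D) (at 0) &
   (s : {0..1} --> norm D <= (SUM al:multi_basis m. K1 al) * bt powr (- (1 + eps M)))"
   using D(1) by blast
 qed
qed

text \<open>Phase and amplitude are continuous off the band crossings only. Multiplying them by the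
  indicator of that open set changes nothing, because the localizers vanish elsewhere.\<close>

lemma kernel_measurable:
 assumes bt: "0 < bt" "bt <= bt0"
 shows "case_prod (kernel M S bt rh m l tt lv al) : joint_borel"
proof -
 let ?V = "offband M m :: (nat => real^'d) set"
 have V: "?V : sets borel" using open_offband[OF kernel_context] by simp
 have coord: "continuous_on ?V (%x. g (x i))" if "i <= m" "continuous_on (- sigma_bc M) g" for i and g :: "real^'d => 'v::topological_space"
  using that by (intro continuous_on_compose2[OF that(2) continuous_on_subset[OF continuous_on_product_coordinates]])
   (auto simp: offband_def[OF kernel_context])
 have p: "continuous_on ?V (kphase M S m l tt lv)"
  unfolding kphase_def using slot_ok[OF kernel_context] tt band_ok[OF kernel_context]
  by (intro continuous_intros coord freq_continuous[OF L]) auto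
 have chi: "continuous_on ?V (%x. chi M m (map x [0..<Suc m]) (map ga [0..<m]))" for ga
  using nonlinear_partD(3)[OF N m, of "map ga [0..<m]" 0] by (simp add: offband_def[OF kernel_context])
 have proj: "continuous_on ?V (%x. outer (evec M n ze (x i)))" if "i <= m" "n : {1..nbands M}" "ze : signs" for n ze i
  by (rule coord[OF that(1) Ck1_D(1)[OF proj_Ck1[OF L that(2,3)]]])
 note mv = bounded_bilinear.continuous_on[OF bounded_bilinear_matrix_vec]
 have v: "continuous_on ?V (kvec M S m l tt lv al)"
  unfolding kvec_expansion[OF N m, abs_def]
  using slot_ok[OF kernel_context] tt band_ok[OF kernel_context]
  by (intro continuous_on_scaleR continuous_on_const mv continuous_on_sum continuous_on_prod continuous_on_inner proj chi) auto
 define p' where "p' x = indicator ?V x *R kphase M S m l tt lv x" for x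
 define v' where "v' x = indicator ?V x *R kvec M S m l tt lv al x" for x
 have [measurable]: "p' : borel_fun" "v' : borel_fun"
  unfolding p'_def[abs_def] v'_def[abs_def] by (rule borel_measurable_continuous_on_indicator[OF V p], rule borel_measurable_continuous_on_indicator[OF V v])
 have [measurable]: "kloc M S bt m l tt lv : borel_fun"
  unfolding kloc_def[abs_def]
  by (intro borel_measurable_prod measurable_compose[OF borel_measurable_coordinate localizer_borel[OF M]])
 have "case_prod (%s x. kloc M S bt m l tt lv x *R (cis (p' x * (s / rh)) *s v' x)) : joint_borel"
  by measurable
 also have "(%s x. kloc M S bt m l tt lv x *R (cis (p' x * (s / rh)) *s v' x)) = kernel M S bt rh m l tt lv al"
 proof (intro ext)
  fix s x
  show "kloc M S bt m l tt lv x *R (cis (p' x * (s / rh)) *s v' x) = kernel M S bt rh m l tt lv al s x"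
   using kloc_outside(1)[OF kernel_context bt, of x] near_offband[OF kernel_context]
   by (cases "x : ?V") (auto simp: kernel_def p'_def v'_def)
 qed
 finally show ?thesis .
qed

end

section \<open>The averaged nonlinearity as a kernel operator\<close>

text \<open>The interaction integrates arbitrary representatives over a completed measure; this
  moves the integral to a measurable integrand on the uncompleted product.\<close>

lemma integral_completion_cong_AE:
 fixes f g :: "'a => 'v::euclidean_space"
 assumes f: "f : borel_measurable N" and eq: "AE x in N. f x = g x"
 shows "(LINT x|completion N. g x) = (LINT x|N. f x)"
proof -
 have eq': "AE x in completion N. f x = g x" using AE_completion[OF eq] .
 have f': "f : borel_measurable (completion N)" by (rule measurable_completion[OF f])
 have "g : borel_measurable (completion N)"
 proof (rule borel_measurableI)
  fix S :: "'v set" assume S: "open S"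
  show "g -` S \<inter> space (completion N) : sets (completion N)"
  proof (rule completion.in_sets_AE)
   show "AE x in completion N. (x : f -` S \<inter> space (completion N)) = (x : g -` S \<inter> space (completion N))"
    using eq' by eventually_elim simp
   show "f -` S \<inter> space (completion N) : sets (completion N)"
    using S by (intro measurable_sets[OF f']) auto
  qed auto
 qed
 then have "(LINT x|completion N. g x) = (LINT x|completion N. f x)"
  using f' eq' by (intro integral_cong_AE) (auto elim: eventually_mono)
 then show ?thesis by (simp add: integral_completion[OF f])
qed

lemma bounded_linear_smult: "bounded_linear ((*s) c :: complex^'c => complex^'c)"
 by (rule bounded_bilinear.bounded_linear_right[OF bounded_bilinear_smult])

text \<open>A nonzero scalar is invertible and the zero scalar is trivial, so integrability does not
  enter.\<close>

lemma integral_smult: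
 fixes f :: "'a => complex^'c"
 shows "(LINT x|N. c *s f x) = c *s (LINT x|N. f x)"
 by (rule integral_bounded_linear'[OF bounded_linear_smult[of c] bounded_linear_smult[of "inverse c"]])
  (auto simp: vec_eq_iff)

text \<open>The summand of the averaged nonlinearity with an independent field in each slot.\<close>

definition sterm :: "('d::finite, 'c::finite) wave_model => 'd nk_spectrum => real => real => nat => nat => int =>
 (int \<times> nat) list => (nat => real => ('d, 'c) wavefield) => real => ('d, 'c) wavefield"
where "sterm M S bt rh m l tt lv u ta k = localizer M 1 bt (real_of_int tt *R ctr S l) k *R
 interaction M rh m (band S l) tt (map (%(ze, l'). (band S l', ze)) lv)
  (map (%i ta1 k1. localizer M (1/2) bt (cen S l tt lv (Suc i)) k1 *R u i ta1 k1) [0..<m]) ta k"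

lemma F_av_eq_sterm:
 "F_av M S bt rh v l tt ta k = (SUM m:degs M. SUM lv:resonant_vectors M S m l tt.
  sterm M S bt rh m l tt lv (%i. v (snd (lv ! i)) (fst (lv ! i))) ta k)"
 unfolding F_av_def
proof (intro sum.cong refl)
 fix m lv assume "lv : resonant_vectors M S m l tt"
 then have len: "length lv = m" by (simp add: resonant_vectors_def index_vectors_def)
 have "map (%(ze, l') ta1 k1. localizer M (1/2) bt (real_of_int ze *R ctr S l') k1 *R v l' ze ta1 k1) lv
  = map (%i ta1 k1. localizer M (1/2) bt (cen S l tt lv (Suc i)) k1 *R v (snd (lv ! i)) (fst (lv ! i)) ta1 k1) [0..<m]"
  by (rule nth_equalityI) (auto simp: len cen_def case_prod_beta')
 then show "localizer M 1 bt (real_of_int tt *R ctr S l) k *R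
  interaction M rh m (band S l) tt (map (%(ze, l'). (band S l', ze)) lv)
   (map (%(ze, l') ta1 k1. localizer M (1/2) bt (real_of_int ze *R ctr S l') k1 *R v l' ze ta1 k1) lv) ta k
  = sterm M S bt rh m l tt lv (%i. v (snd (lv ! i)) (fst (lv ! i))) ta k"
  by (simp add: sterm_def)
qed

lemma xvec_wavevectors: "2 <= m ==> wavevectors m k q = map (xvec m k q) [0..<Suc m]"
 by (rule nth_equalityI) (auto simp: wavevectors_def xvec_def nth_append nth_Cons' less_Suc_eq simp del: upt_Suc)

text \<open>The constraint on the wavevectors in the form that splits
  \<open>cis (r \<bullet> k)\<close> into one factor per field.\<close>

lemma xvec_sum:
 assumes "2 <= m"
 shows "(SUM i<m. xvec m k q (Suc i)) = k"
proof -
 have "(SUM i<m. xvec m k q (Suc i)) = (SUM i:{1..m}. xvec m k q i)"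
  by (rule sum.reindex_bij_witness[of _ "%i. i - 1" Suc]) auto
 also have "{1..m} = insert m {1..<m}" using assms by auto
 also have "(SUM i:insert m {1..<m}. xvec m k q i) = xvec m k q m + (SUM i:{1..<m}. xvec m k q i)" by simp
 also have "(SUM i:{1..<m}. xvec m k q i) = (SUM i:{1..<m}. q i)" by (intro sum.cong) (auto simp: xvec_def)
 finally show ?thesis using assms by (simp add: xvec_def)
qed

lemma smult_sum: "c *s (SUM i:A. f i) = (SUM i:A. c *s f i)" for f :: "'i => complex^'c"
 by (rule linear_sum[OF bounded_linear.linear[OF bounded_linear_smult]])

lemma smult_scaleR: "c *s (a *R x) = a *R (c *s x)" for x :: "complex^'c"
 by (rule linear_cmul[OF bounded_linear.linear[OF bounded_linear_smult]])

lemma scaleR_eq_smult: "a *R x = complex_of_real a *s x" for x :: "complex^'c"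
 by (simp add: vec_eq_iff scaleR_conv_of_real[symmetric])

lemma band_proj_smult: "band_proj M n ze k (c *s u) = c *s band_proj M n ze k u"
 by (simp add: band_proj_def cinner_def vec_eq_iff sum_distrib_left mult_ac)

text \<open>Modulation factors are complex, while the expansion over basis tuples is only real
  linear. They are pulled out by the complex linearity of \<open>chi\<close> in each slot.\<close>

lemma kvec_smult:
 fixes M :: "('d::finite, 'c::finite) wave_model" and w :: "nat => complex^'c"
 assumes N: "nonlinear_part M" and m: "m : degs M"
 shows "kvec M S m l tt lv (%i. c i *s w i) x = (PROD i<m. c i) *s kvec M S m l tt lv w x"
proof -
 let ?X = "map x [0..<Suc m]"
 have "chi M m ?X (map (%i. (if i < n then c i else 1) *s w i) [0..<m]) = (PROD i<n. c i) *s chi M m ?X (map w [0..<m])"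
  if "n <= m" for n and w :: "nat => complex^'c"
  using that
 proof (induction n)
  case 0 then show ?case by simp
 next
  case (Suc n)
  let ?us = "map (%i. (if i < n then c i else 1) *s w i) [0..<m]"
  interpret Vector_Spaces.linear "(*s)" "(*s)" "%u. chi M m ?X (?us[n := u])"
  proof -
   have "length ?X = Suc m" "length ?us = m" "n < m" using Suc.prems by simp_all
   then show "Vector_Spaces.linear (*s) (*s) (%u. chi M m ?X (?us[n := u]))"
    using N m unfolding nonlinear_part_def by blast
  qed
  have "map (%i. (if i < Suc n then c i else 1) *s w i) [0..<m] = ?us[n := c n *s w n]"
   by (rule nth_equalityI) (auto simp: nth_list_update less_Suc_eq)
  moreover have "?us[n := w n] = ?us" using Suc.prems by (intro nth_equalityI) (auto simp: nth_list_update)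
  ultimately show ?case using scale[of "c n" "w n"] Suc by (simp add: mult.commute)
 qed
 note all = this[OF order_refl]
 have "chi M m ?X (map (%i. c i *s v i) [0..<m]) = (PROD i<m. c i) *s chi M m ?X (map v [0..<m])" for v :: "nat => complex^'c"
 proof -
  have "map (%i. (if i < m then c i else 1) *s v i) [0..<m] = map (%i. c i *s v i) [0..<m]"
   by (rule map_cong) auto
  then show ?thesis using all[of v] by (simp only:)
 qed
 from this[of "%i. slot_proj M S lv i (x (Suc i)) (w i)"] show ?thesis
  unfolding kvec_def slot_proj_def band_proj_smult by (simp add: band_proj_smult smult_scaleR)
qed

lemma kernel_smult:
 fixes M :: "('d::finite, 'c::finite) wave_model"
 assumes N: "nonlinear_part M" and m: "m : degs M"
 shows "kernel M S bt rh m l tt lv (%i. c i *s w i) s x = (PROD i<m. c i) *s kernel M S bt rh m l tt lv w s x"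
 unfolding kernel_def kvec_smult[OF N m] smult_scaleR by (simp add: mult.commute)

lemma kernel_expansion:
 fixes M :: "('d::finite, 'c::finite) wave_model" and v :: "nat => complex^'c"
 assumes N: "nonlinear_part M" and m: "m : degs M"
 shows "kernel M S bt rh m l tt lv v s x = (SUM al:multi_basis m. (PROD i<m. v i \<bullet> al i) *R kernel M S bt rh m l tt lv al s x)"
 unfolding kernel_def kvec_linear_expansion[OF N m, of S l tt lv v x] smult_sum smult_scaleR scaleR_sum_right
 by (simp add: mult.commute)

lemma Kop_kernel:
 fixes M :: "('d::finite, 'c::finite) wave_model" and W :: "nat => ('d, 'c) wavefield"
 assumes N: "nonlinear_part M" and m: "m : degs M"
 shows "Kop m (%al. kernel M S bt rh m l tt lv al s) W k =
  (LINT q|Pm m. kernel M S bt rh m l tt lv (%i. W i (xvec m k q (Suc i))) s (xvec m k q))"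
 unfolding Kop_def Iop_def field_prod_def kernel_expansion[OF N m, symmetric] ..

text \<open>The outer localizer and those multiplying the fields are real scalars; the latter leave
  their slots by homogeneity, and all of them form \<open>kloc\<close>.\<close>

lemma interaction_integrand:
 fixes M :: "('d::finite, 'c::finite) wave_model" and u :: "nat => real => ('d, 'c) wavefield"
 assumes N: "nonlinear_part M" and m: "m : degs M" and lv: "length lv = m"
 shows "localizer M 1 bt (real_of_int tt *R ctr S l) k *R
  (let ks = wavevectors m k q in (1 / (2 * pi) ^ ((m - 1) * CARD('d))) *R
   (cis (phase M m (band S l) tt (map (%(ze, l'). (band S l', ze)) lv) ks * s / rh) *s
    band_proj M (band S l) tt k (chi M m ks
      (map (%j. band_proj M (fst (map (%(ze, l'). (band S l', ze)) lv ! j)) (snd (map (%(ze, l'). (band S l', ze)) lv ! j)) (ks ! Suc j)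
       ((map (%i ta1 k1. localizer M (1/2) bt (cen S l tt lv (Suc i)) k1 *R u i ta1 k1) [0..<m] ! j) s (ks ! Suc j))) [0..<m]))))
  = kernel M S bt rh m l tt lv (%i. u i s (xvec m k q (Suc i))) s (xvec m k q)"
proof -
 let ?x = "xvec m k q"
 have m2: "2 <= m" by (rule nonlinear_partD(2)[OF N m])
 have x0: "?x 0 = k" by (simp add: xvec_def)
 have nth: "map ?x [0..<Suc m] ! Suc j = ?x (Suc j)" if "j < m" for j
  using that by (simp del: upt_Suc)
 have nth0: "map ?x [0..<Suc m] ! 0 = k" by (simp del: upt_Suc add: x0)
 have slot: "map (%(ze, l'). (band S l', ze)) lv ! j = (band S (snd (lv ! j)), fst (lv ! j))" if "j < m" for j
  using that lv by (simp add: case_prod_beta')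
 have ph: "phase M m (band S l) tt (map (%(ze, l'). (band S l', ze)) lv) (map ?x [0..<Suc m]) = kphase M S m l tt lv ?x"
  unfolding phase_def kphase_def nth0 x0
  by (intro arg_cong2[of _ _ _ _ "(-)"] refl sum.cong) (simp add: slot nth del: upt_Suc)
 let ?L = "%i. localizer M (1/2) bt (cen S l tt lv (Suc i)) (?x (Suc i))"
 have fields: "map (%j. band_proj M (fst (map (%(ze, l'). (band S l', ze)) lv ! j)) (snd (map (%(ze, l'). (band S l', ze)) lv ! j)) (map ?x [0..<Suc m] ! Suc j)
   ((map (%i ta1 k1. localizer M (1/2) bt (cen S l tt lv (Suc i)) k1 *R u i ta1 k1) [0..<m] ! j) s (map ?x [0..<Suc m] ! Suc j))) [0..<m]
  = map (%j. slot_proj M S lv j (?x (Suc j)) (complex_of_real (?L j) *s u j s (?x (Suc j)))) [0..<m]"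
  by (rule map_cong) (auto simp: slot nth slot_proj_def scaleR_eq_smult simp del: upt_Suc)
 have kl: "kloc M S bt m l tt lv ?x = localizer M 1 bt (real_of_int tt *R ctr S l) k * (PROD i<m. ?L i)"
  unfolding kloc_def by (subst prod.lessThan_Suc_shift) (simp add: x0 cen_def)
 have "localizer M 1 bt (real_of_int tt *R ctr S l) k *R (cis (kphase M S m l tt lv ?x * (s / rh)) *s
   kvec M S m l tt lv (%i. complex_of_real (?L i) *s u i s (?x (Suc i))) ?x)
  = kernel M S bt rh m l tt lv (%i. u i s (?x (Suc i))) s ?x"
  unfolding kernel_def
  by (subst kvec_smult[OF N m]) (simp only: kl of_real_prod[symmetric] scaleR_eq_smult[symmetric] smult_scaleR scaleR_scaleR)
 then show ?thesis
  unfolding Let_def xvec_wavevectors[OF m2] ph fields kvec_def by (simp add: x0 smult_scaleR del: upt_Suc)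
qed

lemma scaleR_time_integral:
 fixes G :: "real => 'a => 'v::euclidean_space"
 shows "c *R (LINT s:{0..ta}|lebesgue. (LINT q|N. G s q)) = (LINT s:{0..ta}|lebesgue. (LINT q|N. c *R G s q))"
 by (simp only: set_lebesgue_integral_def integral_scaleR_right[symmetric] scaleR_left_commute)

lemma sterm_eq:
 fixes M :: "('d::finite, 'c::finite) wave_model" and u :: "nat => real => ('d, 'c) wavefield"
 assumes N: "nonlinear_part M" and m: "m : degs M" and lv: "length lv = m"
 shows "sterm M S bt rh m l tt lv u ta k = (LINT s:{0..ta}|lebesgue. (LINT q|completion (Pm m).
  kernel M S bt rh m l tt lv (%i. u i s (xvec m k q (Suc i))) s (xvec m k q)))"
 unfolding sterm_def interaction_def Pm_def[symmetric] scaleR_time_integral interaction_integrand[OF N m lv] ..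

text \<open>The modulation factor is the product of the factors at the individual wavevectors and is
  handed to all fields, with the same \<open>r\<close> for each. Replacing the fields by jointly
  Borel representatives is harmless at every \<open>k\<close>, as \<open>m\<close> is at least
  2.\<close>

lemma modulate_sterm:
 fixes M :: "('d::finite, 'c::finite) wave_model" and u U :: "nat => real => ('d, 'c) wavefield"
 assumes N: "nonlinear_part M" and m: "m : degs M" and lv: "length lv = m"
  and meas: "!!al. case_prod (kernel M S bt rh m l tt lv al) : joint_borel"
  and U: "!!i. i < m ==> case_prod (U i) : joint_borel"
  and eq: "!!i s. i < m ==> s : {0..ta} ==> AE k in lebesgue. u i s k = U i s k"
 shows "modulate r (sterm M S bt rh m l tt lv u ta) k =
  (LINT s:{0..ta}|lebesgue. Kop m (%al. kernel M S bt rh m l tt lv al s) (%i. modulate r (U i s)) k)"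
proof -
 have m2: "2 <= m" by (rule nonlinear_partD(2)[OF N m])
 let ?K = "%U s q. kernel M S bt rh m l tt lv (%i. U i s (xvec m k q (Suc i))) s (xvec m k q)"
 have inner: "cis (r \<bullet> k) *s (LINT q|completion (Pm m). ?K u s q) = Kop m (%al. kernel M S bt rh m l tt lv al s) (%i. modulate r (U i s)) k"
  if s: "s : {0..ta}" for s
 proof -
  have dep: "kernel M S bt rh m l tt lv v s x = kernel M S bt rh m l tt lv w s x" if "!!i. i < m ==> v i = w i" for v w x
  proof -
   have "map (%i. slot_proj M S lv i (x (Suc i)) (v i)) [0..<m] = map (%i. slot_proj M S lv i (x (Suc i)) (w i)) [0..<m]"
    using that by (intro map_cong) auto
   then show ?thesis unfolding kernel_def kvec_def by (simp only:)
  qed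
  have "AE q in Pm m. ALL i<m. u i s (xvec m k q (Suc i)) = U i s (xvec m k q (Suc i))"
   by (rule AE_xvec_eq[OF m2, where u="%i. u i s" and v="%i. U i s"]) (rule eq[OF _ s])
  then have "AE q in Pm m. ?K U s q = ?K u s q"
   by (rule eventually_mono) (intro dep, simp)
  moreover have "?K U s : borel_measurable (Pm m)"
  proof -
   have x: "(%q. xvec m k q) : Pm m \<rightarrow>\<^sub>M borel" by (rule measurable_xvec) auto
   have "(%q. U i s (xvec m k q (Suc i))) : borel_measurable (Pm m)" if "i < m" for i
    using measurable_compose[OF measurable_compose[OF x borel_measurable_coordinate] measurable_Pair2[OF U[OF that], of s]] by simp
   moreover have "(%q. kernel M S bt rh m l tt lv al s (xvec m k q)) : borel_measurable (Pm m)" for al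
    using measurable_compose[OF x measurable_Pair2[OF meas[of al], of s]] by simp
   ultimately show ?thesis
    unfolding kernel_expansion[OF N m, of S bt rh l tt lv "%i. U i s (xvec m k q (Suc i))" for q]
    by (intro borel_measurable_sum borel_measurable_scaleR borel_measurable_prod borel_measurable_inner borel_measurable_const) auto
  qed
  ultimately have "(LINT q|completion (Pm m). ?K u s q) = (LINT q|Pm m. ?K U s q)"
   by (intro integral_completion_cong_AE)
  then have "cis (r \<bullet> k) *s (LINT q|completion (Pm m). ?K u s q) = (LINT q|Pm m. cis (r \<bullet> k) *s ?K U s q)"
   by (simp only: integral_smult)
  also have "... = (LINT q|Pm m. kernel M S bt rh m l tt lv (%i. modulate r (U i s) (xvec m k q (Suc i))) s (xvec m k q))"
  proof -
   have "(PROD i<m. cis (r \<bullet> xvec m k q (Suc i))) = cis (r \<bullet> k)" for q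
    by (subst xvec_sum[OF m2, of k q, symmetric]) (simp add: inner_sum_right cis_conv_exp exp_sum sum_distrib_left)
   then show ?thesis unfolding modulate_def kernel_smult[OF N m] by (simp only:)
  qed
  also have "... = Kop m (%al. kernel M S bt rh m l tt lv al s) (%i. modulate r (U i s)) k"
   by (rule Kop_kernel[OF N m, symmetric])
  finally show ?thesis .
 qed
 have "modulate r (sterm M S bt rh m l tt lv u ta) k = (LINT s:{0..ta}|lebesgue. cis (r \<bullet> k) *s (LINT q|completion (Pm m). ?K u s q))"
  unfolding modulate_def sterm_eq[OF N m lv] set_lebesgue_integral_def by (simp only: integral_smult[symmetric] smult_scaleR)
 also have "... = (LINT s:{0..ta}|lebesgue. Kop m (%al. kernel M S bt rh m l tt lv al s) (%i. modulate r (U i s)) k)"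
  unfolding set_lebesgue_integral_def
  by (intro Bochner_Integration.integral_cong refl) (auto simp: inner indicator_def)
 finally show ?thesis .
qed

lemma Kop_basic:
 fixes u :: "nat => real^'d => complex^'c::finite" and b :: "(nat => complex^'c) => (nat => real^'d) => 'v::euclidean_space"
 assumes m: "1 <= m" and u: "!!i. i < m ==> u i : borel_fun" "!!i. i < m ==> integrable lebesgue (u i)"
  and b: "!!al. al : multi_basis m ==> b al : borel_fun" "!!al x. al : multi_basis m ==> norm (b al x) <= B"
 shows "xint m (%x. SUM al:multi_basis m. field_prod m (%i y. u i y \<bullet> al i) x *R b al x)"
  and "L1_norm (Kop m b u) <= real (card (multi_basis m :: (nat => complex^'c) set)) * (B * (PROD i<m. L1_norm (u i)))"
proof -
 have um: "(%y. u i y \<bullet> al i) : borel_fun" "integrable lebesgue (%y. u i y \<bullet> al i)" if "i < m" for al i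
  using u[OF that] by (auto intro!: borel_measurable_inner integrable_inner_left)
 have x: "xint m (%x. field_prod m (%i y. u i y \<bullet> al i) x *R b al x)"
  and xn: "xnorm m (%x. field_prod m (%i y. u i y \<bullet> al i) x *R b al x) <= B * (PROD i<m. L1_norm (%y. u i y \<bullet> al i))"
  if al: "al : multi_basis m" for al
  by (rule field_prod_norm[where a="%i y. u i y \<bullet> al i" and b="b al" and B=B, OF m um(1)[where al=al] um(2)[where al=al] b(1)[OF al] b(2)[OF al]]; assumption)+
 show "xint m (%x. SUM al:multi_basis m. field_prod m (%i y. u i y \<bullet> al i) x *R b al x)"
  by (rule xint_sum) (rule x)
 have n: "L1_norm (Iop m (%x. field_prod m (%i y. u i y \<bullet> al i) x *R b al x)) <= B * (PROD i<m. L1_norm (u i))" if al: "al : multi_basis m" for al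
 proof -
  have B: "0 <= B" using order_trans[OF norm_ge_zero b(2)[OF al]] .
  have "L1_norm (Iop m (%x. field_prod m (%i y. u i y \<bullet> al i) x *R b al x)) <= B * (PROD i<m. L1_norm (%y. u i y \<bullet> al i))"
   using Iop_norm(2)[OF x[OF al]] xn[OF al] by linarith
  also have "... <= B * (PROD i<m. L1_norm (u i))"
   using u(2) multi_basis_norm[OF al] by (intro mult_left_mono[OF _ B] prod_mono conjI L1_norm_nonneg L1_norm_inner_le) auto
  finally show ?thesis .
 qed
 have i: "integrable lebesgue (Iop m (%x. field_prod m (%i y. u i y \<bullet> al i) x *R b al x))" if "al : multi_basis m" for al
  by (rule Iop_norm(1)[OF x[OF that]])
 have "L1_norm (Kop m b u) = L1_norm (%k. SUM al:multi_basis m. Iop m (%x. field_prod m (%i y. u i y \<bullet> al i) x *R b al x) k)"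
  unfolding Kop_def
  by (rule L1_norm_cong_AE[OF Iop_sum[OF finite_multi_basis x] borel_measurable_integrable[OF Iop_norm(1)[OF xint_sum[OF x]]]])
 also have "... <= (SUM al:multi_basis m. L1_norm (Iop m (%x. field_prod m (%i y. u i y \<bullet> al i) x *R b al x)))"
  by (rule L1_norm_sum_le[OF finite_multi_basis i])
 also have "... <= (SUM al:(multi_basis m :: (nat => complex^'c) set). B * (PROD i<m. L1_norm (u i)))"
  by (intro sum_mono n)
 finally show "L1_norm (Kop m b u) <= real (card (multi_basis m :: (nat => complex^'c) set)) * (B * (PROD i<m. L1_norm (u i)))" by simp
qed

lemma Kop_joint_measurable:
 fixes u :: "nat => real => real^'d => complex^'c::finite"
 assumes u: "!!i. i < m ==> case_prod (u i) : joint_borel"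
  and b: "!!al. al : multi_basis m ==> case_prod (b al) : joint_borel"
 shows "case_prod (%s. Kop m (%al. b al s) (%i. u i s) :: real^'d => 'v::euclidean_space) : joint_borel"
 unfolding Kop_def
proof (rule Iop_joint_measurable)
 have "case_prod (%s. field_prod m (%i y. u i s y \<bullet> al i)) : joint_borel" for al
 proof (rule field_prod_joint_measurable[where a="%i s y. u i s y \<bullet> al i"])
  fix i assume "i < m"
  from u[OF this] have "(%p. case_prod (u i) p \<bullet> al i) : joint_borel"
   by (intro borel_measurable_inner borel_measurable_const)
  then show "case_prod (%s y. u i s y \<bullet> al i) : joint_borel" by (simp add: case_prod_beta')
 qed
 then show "case_prod (%s x. SUM al:multi_basis m. field_prod m (%i y. u i s y \<bullet> al i) x *R b al s x) : joint_borel"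
  using b unfolding case_prod_beta' by (intro borel_measurable_sum borel_measurable_scaleR) auto
qed

lemma Kop_diff_slot:
 fixes u :: "nat => real^'d => complex^'c::finite" and b :: "(nat => complex^'c) => (nat => real^'d) => 'v::euclidean_space"
 assumes m: "1 <= m" and i0: "i0 < m" and u: "!!i. i < m ==> u i : borel_fun" "!!i. i < m ==> integrable lebesgue (u i)"
  and v: "v : borel_fun" "integrable lebesgue v" and w: "w : borel_fun" "integrable lebesgue w"
  and b: "!!al. al : multi_basis m ==> b al : borel_fun" "!!al x. al : multi_basis m ==> norm (b al x) <= B"
 shows "AE k in lebesgue. Kop m b (u(i0 := %y. v y - w y)) k = Kop m b (u(i0 := v)) k - Kop m b (u(i0 := w)) k"
proof -
 let ?Ph = "%u x. SUM al:multi_basis m. field_prod m (%i y. u i y \<bullet> al i) x *R b al x"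
 have "xint m (?Ph (u(i0 := v)))" "xint m (?Ph (u(i0 := w)))"
  using u v w b by (auto intro!: Kop_basic(1)[OF m])
 from Iop_diff[OF this]
 have "AE k in lebesgue. Iop m (%x. ?Ph (u(i0 := v)) x - ?Ph (u(i0 := w)) x) k = Kop m b (u(i0 := v)) k - Kop m b (u(i0 := w)) k"
  unfolding Kop_def .
 moreover have "?Ph (u(i0 := v)) x - ?Ph (u(i0 := w)) x = ?Ph (u(i0 := %y. v y - w y)) x" for x
 proof -
  have upd: "(%i y. (u(i0 := f)) i y \<bullet> al i) = (%i y. u i y \<bullet> al i)(i0 := %y. f y \<bullet> al i0)" for f al by auto
  show ?thesis
   unfolding upd field_prod_upd[OF i0] sum_subtractf[symmetric]
   by (intro sum.cong refl) (simp add: inner_diff_left left_diff_distrib scaleR_left_diff_distrib)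
 qed
 ultimately show ?thesis unfolding Kop_def by simp
qed

lemma sterm_cong: "(!!i. i < m ==> u i = w i) ==> sterm M S bt rh m l tt lv u = sterm M S bt rh m l tt lv w"
 unfolding sterm_def by (intro ext arg_cong2[of _ _ _ _ scaleR] refl arg_cong[of _ _ "%us. interaction M rh m (band S l) tt _ us _ _"] map_cong) auto

lemma in_E_representatives:
 fixes u :: "nat => real => real^'d => complex^'c::finite"
 assumes "!!i. i < m ==> in_E T (u i)"
 shows "EX U. ALL i<m. case_prod (U i) : joint_borel & (ALL ta:{0..T}. AE k in lebesgue. u i ta k = U i ta k)"
proof -
 have "ALL i. EX U. i < m --> case_prod U : joint_borel & (ALL ta:{0..T}. AE k in lebesgue. u i ta k = U ta k)"
  using in_E_joint_representative[OF assms] by blast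
 from choice[OF this] show ?thesis by blast
qed

context
 fixes M :: "('d::finite, 'c::finite) wave_model" and S :: "'d nk_spectrum" and bt0 :: real and m l :: nat and tt :: int
  and lv :: "(int \<times> nat) list"
 assumes L: "linear_part M" and N: "nonlinear_part M" and M: "cutoff M" and ok: "nk_spectrum_ok M S"
  and inv: "universally_resonance_invariant M S" and bt0: "small_beta M S bt0"
  and m: "m : degs M" and l: "l : {1..nparts S}" and tt: "tt : signs" and lv: "lv : resonant_vectors M S m l tt"
begin

text \<open>Each field may have its own position \<open>p i\<close>, but only the gradient of the
  field in slot \<open>j\<close> is used. The other fields enter through their E norms, which no
  position affects.\<close>

lemma sterm_bound:
 assumes j: "j < m" "lv ! j = (tt, l)"
 shows "EX C>=0. ALL bt rh T u p nu. 0 < bt --> bt <= bt0 --> 0 < rh --> bt\<^sup>2 / rh <= C1 --> 0 <= T --> T <= 1 -->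
  (ALL i<m. in_E1 T (p i) (u i) & E1_norm (eps M) T bt (p i) (u i) <= nu i) -->
  in_E1 T (p j) (sterm M S bt rh m l tt lv u) & E1_norm (eps M) T bt (p j) (sterm M S bt rh m l tt lv u) <= T * C * (PROD i<m. nu i)"
proof -
 have m1: "1 <= m" using nonlinear_partD(2)[OF N m] by simp
 have len: "length lv = m" using lv by (simp add: resonant_vectors_def index_vectors_def)
 from kernel_bounds[OF L N M ok inv bt0 m l tt lv j] obtain K where K: "0 <= K"
  and kb: "ALL bt rh. 0 < bt --> bt <= bt0 --> 0 < rh --> bt\<^sup>2 / rh <= C1 --> (ALL al:multi_basis m. ALL x s.
  norm (kernel M S bt rh m l tt lv al s x) <= K & (ALL e:Basis. EX D.
   ((%t. kernel M S bt rh m l tt lv al s (shift2 j e t x)) has_vd D) (at 0) &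
   (s : {0..1} --> norm D <= K * bt powr (- (1 + eps M)))))" by blast
 \<comment> \<open>\<open>3 * K\<close> is one \<open>K\<close> from the weighted kernel derivative
   and \<open>2 * K\<close> from the bound on the kernel itself.\<close>
 define C where "C = real CARD('d) * real (card (multi_basis m :: (nat => complex^'c) set)) * (3 * K)"
 show ?thesis
 proof (rule exI[of _ C], rule conjI)
  show "0 <= C" using K by (simp add: C_def)
  show "ALL bt rh T u p nu. 0 < bt --> bt <= bt0 --> 0 < rh --> bt\<^sup>2 / rh <= C1 --> 0 <= T --> T <= 1 -->
   (ALL i<m. in_E1 T (p i) (u i) & E1_norm (eps M) T bt (p i) (u i) <= nu i) -->
   in_E1 T (p j) (sterm M S bt rh m l tt lv u) & E1_norm (eps M) T bt (p j) (sterm M S bt rh m l tt lv u) <= T * C * (PROD i<m. nu i)"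
  proof (intro allI impI)
   fix bt rh T :: real and u :: "nat => real => ('d, 'c) wavefield" and p :: "nat => real^'d" and nu
   assume bt: "0 < bt" "bt <= bt0" and rh: "0 < rh" "bt\<^sup>2 / rh <= C1" and T: "0 <= T" "T <= 1"
    and u: "ALL i<m. in_E1 T (p i) (u i) & E1_norm (eps M) T bt (p i) (u i) <= nu i"
   let ?k = "kernel M S bt rh m l tt lv"
   have kb': "ALL al:multi_basis m. ALL x s. norm (?k al s x) <= K & (ALL e:Basis. EX D.
    ((%t. ?k al s (shift2 j e t x)) has_vd D) (at 0) & (s : {0..1} --> norm D <= K * bt powr (- (1 + eps M))))"
    using kb bt rh by blast
   \<comment> \<open>The derivative is chosen at each point together with its bound, which is
     available for times up to 1.\<close>
   define db where "db al q s x = (SOME D. ((%t. ?k al s (shift2 j (axis q 1) t x)) has_vd D) (at 0) &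
    (s : {0..1} --> norm D <= K * bt powr (- (1 + eps M))))" for al q s x
   have db: "((%t. ?k al s (shift2 j (axis q 1) t x)) has_vd db al q s x) (at 0) &
    (s : {0..1} --> norm (db al q s x) <= K * bt powr (- (1 + eps M)))" if "al : multi_basis m" for al q s x
   proof -
    have "axis q 1 : (Basis :: (real^'d) set)" by simp
    then have "EX D. ((%t. ?k al s (shift2 j (axis q 1) t x)) has_vd D) (at 0) & (s : {0..1} --> norm D <= K * bt powr (- (1 + eps M)))"
     using kb' that by blast
    then show ?thesis unfolding db_def by (rule someI_ex)
   qed
   have uE: "in_E T (u i)" if "i < m" for i using u that in_E1D(1) by blast
   have "EX U. ALL i<m. case_prod (U i) : joint_borel & (ALL ta:{0..T}. AE k in lebesgue. u i ta k = U i ta k)"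
    by (rule in_E_representatives[OF uE])
   then obtain U where U: "!!i. i < m ==> case_prod (U i) : joint_borel"
    "!!i ta. i < m ==> ta : {0..T} ==> AE k in lebesgue. u i ta k = U i ta k" by blast
   have U1: "in_E1 T (p i) (U i)" "E1_norm (eps M) T bt (p i) (U i) <= nu i" if "i < m" for i
    using in_E1_cong(1)[where r="p i", OF M _ U(2)[OF that]] in_E1_cong(2)[where r="p i" and ee="eps M" and bt=bt, OF M _ U(2)[OF that]] u that by auto
   have F: "AE k in lebesgue. modulate (p j) (sterm M S bt rh m l tt lv u ta) k =
    (LINT s:{0..ta}|lebesgue. Kop m (%al. ?k al s) (%i. modulate (p j) (U i s)) k)" if ta: "ta : {0..T}" for ta
   proof (rule AE_I2, rule modulate_sterm[OF N m len kernel_measurable[OF L N M ok inv bt0 m l tt lv bt]])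
    fix i s assume "i < m" "s : {0..ta}"
    then show "AE k in lebesgue. u i s k = U i s k" using U(2)[of i s] ta by simp
   qed (rule U(1))
   have s1: "s : {0..T} ==> s : {0..1}" for s using T by simp
   have 1: "norm (?k al s x) <= K" if "al : multi_basis m" for al s x using kb' that by blast
   have 2: "norm (db al q s x) <= K * bt powr (- (1 + eps M))" if "al : multi_basis m" "s : {0..T}" for al q s x
    using db[OF that(1)] s1[OF that(2)] by blast
   have 3: "E_norm T (U i) <= nu i" if "i < m" for i
    using E_norm_le_E1_norm[OF U1(1)[OF that] T(1), of "eps M" bt] U1(2)[OF that] by linarith
   have 4: "0 <= K * bt powr (- (1 + eps M))" using K by simp
   have 5: "bt powr (1 + eps M) * (K * bt powr (- (1 + eps M))) + 2 * K = 3 * K"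
    using bt(1) by (simp add: mult.left_commute powr_add[symmetric])
   have UE: "in_E T (U i)" if "i < m" for i by (rule in_E1D(1)[OF U1(1)[OF that]])
   have db1: "((%t. ?k al s (shift2 j (axis q 1) t x)) has_vd db al q s x) (at 0)" if "al : multi_basis m" for al q s x
    using db[OF that] by blast
   note KT = Kop_time_integral_in_E1[where b="?k" and U=U and F="sterm M S bt rh m l tt lv u" and r="p j" and db=db and j=j and m=m and nu=nu
     and B=K and B'="K * bt powr (- (1 + eps M))" and T=T and ee="eps M" and bt=bt]
   note km = kernel_measurable[OF L N M ok inv bt0 m l tt lv bt]
   have r1: "in_E1 T (p j) (sterm M S bt rh m l tt lv u)"
    by (rule KT(1)[OF M T(1) m1 j(1) U(1) UE U1(1)[OF j(1)] km 1 db1 2 F 3 U1(2)[OF j(1)] K 4])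
   have r2: "E1_norm (eps M) T bt (p j) (sterm M S bt rh m l tt lv u) <= T * (real CARD('d) * real (card (multi_basis m :: (nat => complex^'c) set)) *
     (bt powr (1 + eps M) * (K * bt powr (- (1 + eps M))) + 2 * K) * (PROD i<m. nu i))"
    by (rule KT(2)[OF M T(1) m1 j(1) U(1) UE U1(1)[OF j(1)] km 1 db1 2 F 3 U1(2)[OF j(1)] K 4])
   show "in_E1 T (p j) (sterm M S bt rh m l tt lv u) & E1_norm (eps M) T bt (p j) (sterm M S bt rh m l tt lv u) <= T * C * (PROD i<m. nu i)"
    using r1 r2 unfolding 5 C_def by (simp only: mult.assoc)
  qed
 qed
qed

end

context
 fixes M :: "('d::finite, 'c::finite) wave_model" and S :: "'d nk_spectrum" and bt0 :: real and m l :: nat and tt :: int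
  and lv :: "(int \<times> nat) list"
 assumes L: "linear_part M" and N: "nonlinear_part M" and M: "cutoff M" and ok: "nk_spectrum_ok M S"
  and inv: "universally_resonance_invariant M S" and bt0: "small_beta M S bt0"
  and m: "m : degs M" and l: "l : {1..nparts S}" and tt: "tt : signs" and lv: "lv : resonant_vectors M S m l tt"
begin

text \<open>Additivity in a slot holds for the integrands only almost everywhere at each time. The
  defect \<open>D\<close> has L1 norm 0 at each time, hence so does its time integral.\<close>

lemma sterm_diff_slot:
 assumes j: "j < m" "lv ! j = (tt, l)" and bt: "0 < bt" "bt <= bt0" and rh: "0 < rh" and i0: "i0 < m" and T: "0 <= T"
  and u: "!!i. i < m ==> in_E T (u i)" and a: "in_E T a" and b: "in_E T b" and ta: "ta : {0..T}"
 shows "AE k in lebesgue. sterm M S bt rh m l tt lv (u(i0 := %s k. a s k - b s k)) ta k =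
  sterm M S bt rh m l tt lv (u(i0 := a)) ta k - sterm M S bt rh m l tt lv (u(i0 := b)) ta k"
proof -
 have m1: "1 <= m" using nonlinear_partD(2)[OF N m] by simp
 have len: "length lv = m" using lv by (simp add: resonant_vectors_def index_vectors_def)
 let ?k = "kernel M S bt rh m l tt lv"
 \<comment> \<open>Here the parameters are fixed, so \<open>bt\<^sup>2 / rh\<close> itself serves as
   the constant \<open>C1\<close>.\<close>
 from kernel_bounds[OF L N M ok inv bt0 m l tt lv j, of "bt\<^sup>2 / rh"] obtain K where K: "0 <= K"
  and "ALL bt' rh'. 0 < bt' --> bt' <= bt0 --> 0 < rh' --> bt'\<^sup>2 / rh' <= bt\<^sup>2 / rh --> (ALL al:multi_basis m. ALL x s.
   norm (kernel M S bt' rh' m l tt lv al s x) <= K & (ALL e:Basis. EX D.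
   ((%t. kernel M S bt' rh' m l tt lv al s (shift2 j e t x)) has_vd D) (at 0) &
   (s : {0..1} --> norm D <= K * bt' powr (- (1 + eps M)))))" by (elim exE conjE)
 note kb = this(2)[rule_format, OF bt rh order_refl, THEN conjunct1]
 note km = kernel_measurable[OF L N M ok inv bt0 m l tt lv bt]
 have k1: "?k al s : borel_fun" for al s using measurable_Pair2[OF km[of rh al], of s] by simp
 have "EX U. ALL i<m. case_prod (U i) : joint_borel & (ALL ta:{0..T}. AE k in lebesgue. u i ta k = U i ta k)"
  by (rule in_E_representatives[OF u])
 then obtain U where U: "!!i. i < m ==> case_prod (U i) : joint_borel"
  "!!i ta. i < m ==> ta : {0..T} ==> AE k in lebesgue. u i ta k = U i ta k" by blast
 from in_E_joint_representative[OF a] obtain A where A: "case_prod A : joint_borel"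
  "!!ta. ta : {0..T} ==> AE k in lebesgue. a ta k = A ta k" by blast
 from in_E_joint_representative[OF b] obtain B where B: "case_prod B : joint_borel"
  "!!ta. ta : {0..T} ==> AE k in lebesgue. b ta k = B ta k" by blast
 have AB: "case_prod (%s y. A s y - B s y) : joint_borel"
  "AE k in lebesgue. a s k - b s k = A s k - B s k" if "s : {0..T}" for s
 proof -
  show "case_prod (%s y. A s y - B s y) : joint_borel"
   using borel_measurable_diff[OF A(1) B(1)] by (simp add: case_prod_beta')
  show "AE k in lebesgue. a s k - b s k = A s k - B s k" using A(2)[OF that] B(2)[OF that] by eventually_elim simp
 qed
 have abE: "in_E T (%s k. a s k - b s k)" using in_E_lincomb[OF a b, where a=1 and b="-1"] by simp
 define N' where "N' X s = Kop m (%al. ?k al s) (%i. (U(i0 := X)) i s)" for X s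
 let ?G = "%X x. case_prod (N' X) : joint_borel &
   (EX c. ALL s:{0..T}. integrable lebesgue (N' X s) & L1_norm (N' X s) <= c) &
   (ALL k. sterm M S bt rh m l tt lv (u(i0 := x)) ta k = (LINT s:{0..ta}|lebesgue. N' X s k))"
 have good: "?G X x"
  if X: "case_prod X : joint_borel" and x: "in_E T x" "!!s. s : {0..T} ==> AE k in lebesgue. x s k = X s k" for x X
 proof -
  have m': "case_prod ((U(i0 := X)) i) : joint_borel" if "i < m" for i
   using U(1)[OF that] X by simp
  have e': "AE k in lebesgue. (u(i0 := x)) i s k = (U(i0 := X)) i s k" if "i < m" "s : {0..T}" for i s
   using U(2)[OF that] x(2)[OF that(2)] by simp
  have E': "in_E T ((U(i0 := X)) i)" if "i < m" for i
  proof (rule in_E_cong(1)[OF _ e'[OF that]])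
   show "in_E T ((u(i0 := x)) i)" using u[OF that] x(1) by simp
  qed
  have m1': "(U(i0 := X)) i s : borel_fun" if "i < m" for i s
   using measurable_Pair2[OF m'[OF that], of s] by simp
  let ?c = "real (card (multi_basis m :: (nat => complex^'c) set)) * (K * (PROD i<m. E_norm T ((U(i0 := X)) i)))"
  have "integrable lebesgue (N' X s) & L1_norm (N' X s) <= ?c" if s: "s : {0..T}" for s
  proof -
   note kb2 = Kop_basic[where u="%i. (U(i0 := X)) i s" and b="%al. ?k al s" and B=K, OF m1 m1' in_E_integrable[OF E' s] k1 kb]
   have "integrable lebesgue (N' X s)" unfolding N'_def Kop_def by (rule Iop_norm(1)[OF kb2(1)])
   moreover have "(PROD i<m. L1_norm ((U(i0 := X)) i s)) <= (PROD i<m. E_norm T ((U(i0 := X)) i))"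
    using L1_norm_le_E_norm[OF E' s] by (intro prod_mono conjI L1_norm_nonneg) auto
   then have "L1_norm (N' X s) <= ?c"
    using kb2(2) K unfolding N'_def by (meson mult_left_mono of_nat_0_le_iff order_trans)
   ultimately show ?thesis ..
  qed
  moreover have "case_prod (N' X) : joint_borel"
   unfolding N'_def by (rule Kop_joint_measurable[OF m' km])
  moreover have "sterm M S bt rh m l tt lv (u(i0 := x)) ta k = (LINT s:{0..ta}|lebesgue. N' X s k)" for k
  proof -
   \<comment> \<open>Modulation with position 0 is the identity, so the formula for modulated terms
     yields the plain one.\<close>
   have "modulate 0 (sterm M S bt rh m l tt lv (u(i0 := x)) ta) k =
    (LINT s:{0..ta}|lebesgue. Kop m (%al. ?k al s) (%i. modulate 0 ((U(i0 := X)) i s)) k)"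
   proof (rule modulate_sterm[OF N m len km m'])
    fix i s assume "i < m" "s : {0..ta}"
    then show "AE k in lebesgue. (u(i0 := x)) i s k = (U(i0 := X)) i s k" using ta by (intro e') auto
   qed
   then show ?thesis by (simp add: modulate_def N'_def)
  qed
  ultimately show ?thesis by blast
 qed
 have T0: "0 : {0..T}" using T by simp
 let ?C = "%s y. A s y - B s y"
 have gA: "?G A a" by (rule good[OF A(1) a A(2)])
 have gB: "?G B b" by (rule good[OF B(1) b B(2)])
 have gC: "?G ?C (%s k. a s k - b s k)" by (rule good[OF AB(1)[OF T0] abE AB(2)])
 define D where "D s k = N' ?C s k - (N' A s k - N' B s k)" for s k
 have ae0: "AE k in lebesgue. D s k = 0" if s: "s : {0..T}" for s
 proof -
  have iA: "integrable lebesgue (A s)" "integrable lebesgue (B s)" "!!i. i < m ==> integrable lebesgue (U i s)"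
   using in_E_integrable[OF in_E_cong(1)[OF a A(2)] s] in_E_integrable[OF in_E_cong(1)[OF b B(2)] s] in_E_integrable[OF in_E_cong(1)[OF u U(2)] s] by auto
  have mA: "A s : borel_fun" "B s : borel_fun" "!!i. i < m ==> U i s : borel_fun"
   using measurable_Pair2[OF A(1), of s] measurable_Pair2[OF B(1), of s] measurable_Pair2[OF U(1), of _ s] by auto
  have upd: "(%i. (U(i0 := X)) i s) = (%i. U i s)(i0 := X s)" for X by auto
  have "AE k in lebesgue. Kop m (%al. ?k al s) ((%i. U i s)(i0 := %y. A s y - B s y)) k
   = Kop m (%al. ?k al s) ((%i. U i s)(i0 := A s)) k - Kop m (%al. ?k al s) ((%i. U i s)(i0 := B s)) k"
   by (rule Kop_diff_slot[where u="%i. U i s" and b="%al. ?k al s" and v="A s" and w="B s" and B=K, OF m1 i0 mA(3) iA(3) mA(1) iA(1) mA(2) iA(2) k1 kb])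
  then show ?thesis unfolding D_def N'_def upd by (rule eventually_mono) simp
 qed
 have Dm: "case_prod D : joint_borel"
  using gA gB gC unfolding D_def case_prod_beta' by (intro borel_measurable_diff) auto
 have sub: "s : {0..ta} ==> s : {0..T}" for s using ta by simp
 have D0: "integrable lebesgue (D s) & L1_norm (D s) <= 0" if s: "s : {0..ta}" for s
 proof -
  have di: "integrable lebesgue (D s)" using gA gB gC sub[OF s] unfolding D_def by (intro Bochner_Integration.integrable_diff) auto
  have "L1_norm (D s) = L1_norm (%k :: real^'d. 0 :: complex^'c)"
   by (rule L1_norm_cong_AE[OF ae0[OF sub[OF s]] borel_measurable_integrable[OF di]])
  then show ?thesis using di by (simp add: L1_norm_def)
 qed
 have si: "AE k in lebesgue. set_integrable lebesgue {0..ta} (%s. N' X s k)"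
  if Xm: "case_prod (N' X) : joint_borel" and Xc: "EX c. ALL s:{0..T}. integrable lebesgue (N' X s) & L1_norm (N' X s) <= c" for X
 proof -
  obtain c where "!!s. s : {0..T} ==> integrable lebesgue (N' X s) & L1_norm (N' X s) <= c" using Xc by blast
  then show ?thesis by (intro time_integral_AE_integrable[OF Xm]) (use sub in blast)
 qed
 have ta0: "0 <= ta" using ta by simp
 have "L1_norm (%k. LINT s:{0..ta}|lebesgue. D s k) = 0"
  using time_integral_norm[OF Dm D0 ta0] L1_norm_nonneg[of "%k. LINT s:{0..ta}|lebesgue. D s k"] by simp
 then have "AE k in lebesgue. (LINT s:{0..ta}|lebesgue. D s k) = 0"
  using L1_norm_eq_0[OF time_integral_integrable[OF Dm D0 ta0]] by simp
 moreover have "AE k in lebesgue. (LINT s:{0..ta}|lebesgue. D s k) =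
  (LINT s:{0..ta}|lebesgue. N' ?C s k) - ((LINT s:{0..ta}|lebesgue. N' A s k) - (LINT s:{0..ta}|lebesgue. N' B s k))"
  using si[OF conjunct1[OF gA] conjunct1[OF conjunct2[OF gA]]] si[OF conjunct1[OF gB] conjunct1[OF conjunct2[OF gB]]]
   si[OF conjunct1[OF gC] conjunct1[OF conjunct2[OF gC]]]
 proof eventually_elim
  case (elim k)
  have "set_integrable lebesgue {0..ta} (%s. N' A s k - N' B s k)" by (rule set_integral_diff(1)[OF elim(1,2)])
  from set_integral_diff(2)[OF elim(3) this] set_integral_diff(2)[OF elim(1,2)] show ?case
   unfolding D_def by simp
 qed
 ultimately show ?thesis
 proof eventually_elim
  case (elim k)
  have "sterm M S bt rh m l tt lv (u(i0 := %s k. a s k - b s k)) ta k = (LINT s:{0..ta}|lebesgue. N' ?C s k)"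
   "sterm M S bt rh m l tt lv (u(i0 := a)) ta k = (LINT s:{0..ta}|lebesgue. N' A s k)"
   "sterm M S bt rh m l tt lv (u(i0 := b)) ta k = (LINT s:{0..ta}|lebesgue. N' B s k)"
   using gA gB gC by blast+
  then show ?case using elim by simp
 qed
qed

end

section \<open>Lipschitz estimates for the averaged nonlinearity\<close>

abbreviation (input) close_fields
where "close_fields M S Q bt T r v w de == (ALL l:{1..nparts S}. ALL tt:signs. in_E1 T (r l) (v l tt) & in_E1 T (r l) (w l tt) &
 E1_norm (eps M) T bt (r l) (v l tt) <= Q & E1_norm (eps M) T bt (r l) (w l tt) <= Q &
 E1_norm (eps M) T bt (r l) (%ta k. v l tt ta k - w l tt ta k) <= de)"

context
 fixes M :: "('d::finite, 'c::finite) wave_model" and S :: "'d nk_spectrum" and bt0 :: real and m l :: nat and tt :: int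
  and lv :: "(int \<times> nat) list"
 assumes L: "linear_part M" and N: "nonlinear_part M" and M: "cutoff M" and ok: "nk_spectrum_ok M S"
  and inv: "universally_resonance_invariant M S" and bt0: "small_beta M S bt0"
  and m: "m : degs M" and l: "l : {1..nparts S}" and tt: "tt : signs" and lv: "lv : resonant_vectors M S m l tt"
begin

text \<open>Differences are telescoped, exchanging one field at a time.\<close>

lemma sterm_lipschitz:
 assumes Q: "0 <= Q"
 shows "EX C>=0. ALL bt rh T r v w de. 0 < bt --> bt <= bt0 --> 0 < rh --> bt\<^sup>2 / rh <= C1 --> 0 <= T --> T <= 1 -->
  close_fields M S Q bt T r v w de -->
  in_E1 T (r l) (sterm M S bt rh m l tt lv (%i. v (snd (lv ! i)) (fst (lv ! i)))) &
  E1_norm (eps M) T bt (r l) (sterm M S bt rh m l tt lv (%i. v (snd (lv ! i)) (fst (lv ! i)))) <= T * C * Q &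
  E1_norm (eps M) T bt (r l) (%ta k. sterm M S bt rh m l tt lv (%i. v (snd (lv ! i)) (fst (lv ! i))) ta k
   - sterm M S bt rh m l tt lv (%i. w (snd (lv ! i)) (fst (lv ! i))) ta k) <= T * C * de"
proof -
 have m1: "1 <= m" using nonlinear_partD(2)[OF N m] by simp
 from resonant_vectors_slot(1)[OF ok inv m l tt lv] obtain j where j: "j < m" "lv ! j = (tt, l)" by (elim exE conjE)
 from sterm_bound[where ?C1.0=C1, OF L N M ok inv bt0 m l tt lv j] obtain C where C: "0 <= C"
  and sb: "ALL bt rh T u p nu. 0 < bt --> bt <= bt0 --> 0 < rh --> bt\<^sup>2 / rh <= C1 --> 0 <= T --> T <= 1 -->
  (ALL i<m. in_E1 T (p i) (u i) & E1_norm (eps M) T bt (p i) (u i) <= nu i) -->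
  in_E1 T (p j) (sterm M S bt rh m l tt lv u) & E1_norm (eps M) T bt (p j) (sterm M S bt rh m l tt lv u) <= T * C * (PROD i<m. nu i)"
  by (elim exE conjE)
 \<comment> \<open>There are \<open>m\<close> exchanges; in each, one slot contributes the distance
   \<open>de\<close> and the other \<open>m - 1\<close> slots contribute \<open>Q\<close>.\<close>
 define C' where "C' = C * (real m * Q ^ (m - 1))"
 show ?thesis
 proof (rule exI[of _ C'], rule conjI)
  show "0 <= C'" using C Q by (simp add: C'_def)
  show "ALL bt rh T r v w de. 0 < bt --> bt <= bt0 --> 0 < rh --> bt\<^sup>2 / rh <= C1 --> 0 <= T --> T <= 1 -->
  close_fields M S Q bt T r v w de -->
  in_E1 T (r l) (sterm M S bt rh m l tt lv (%i. v (snd (lv ! i)) (fst (lv ! i)))) &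
  E1_norm (eps M) T bt (r l) (sterm M S bt rh m l tt lv (%i. v (snd (lv ! i)) (fst (lv ! i)))) <= T * C' * Q &
  E1_norm (eps M) T bt (r l) (%ta k. sterm M S bt rh m l tt lv (%i. v (snd (lv ! i)) (fst (lv ! i))) ta k
   - sterm M S bt rh m l tt lv (%i. w (snd (lv ! i)) (fst (lv ! i))) ta k) <= T * C' * de"
  proof (intro allI impI)
   fix bt rh T :: real and r and v w :: "('d, 'c) wavevec" and de
   assume bt: "0 < bt" "bt <= bt0" and rh: "0 < rh" "bt\<^sup>2 / rh <= C1" and T: "0 <= T" "T <= 1"
    and vw: "close_fields M S Q bt T r v w de"
   let ?s = "sterm M S bt rh m l tt lv"
   define p where "p i = r (snd (lv ! i))" for i
   define V where "V i = v (snd (lv ! i)) (fst (lv ! i))" for i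
   define W where "W i = w (snd (lv ! i)) (fst (lv ! i))" for i
   have pj: "p j = r l" by (simp add: p_def j)
   have VW: "in_E1 T (p i) (V i)" "in_E1 T (p i) (W i)" "E1_norm (eps M) T bt (p i) (V i) <= Q" "E1_norm (eps M) T bt (p i) (W i) <= Q"
    "E1_norm (eps M) T bt (p i) (%ta k. V i ta k - W i ta k) <= de" if "i < m" for i
    using vw slot_ok(1,2)[OF L N M ok inv bt0 m l tt lv that] unfolding p_def V_def W_def by blast+
   have sb': "in_E1 T (p j) (?s u) & E1_norm (eps M) T bt (p j) (?s u) <= T * C * (PROD i<m. nu i)"
    if "!!i. i < m ==> in_E1 T (p i) (u i) & E1_norm (eps M) T bt (p i) (u i) <= nu i" for u nu
    using sb[rule_format, OF bt rh T] that by blast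
   \<comment> \<open>\<open>H 0\<close> is \<open>V\<close>, and \<open>H m\<close> agrees with
     \<open>W\<close> in all slots; consecutive hybrids differ in slot \<open>n\<close>
     only.\<close>
   define H where "H n i = (if i < n then W i else V i)" for n i
   have HE: "in_E1 T (p i) (H n i) & E1_norm (eps M) T bt (p i) (H n i) <= Q" if "i < m" for n i
    using VW[OF that] by (simp add: H_def)
   have sH: "in_E1 T (p j) (?s (H n))" for n by (rule conjunct1[OF sb'[OF HE[where n=n]]])
   have step: "in_E1 T (p j) (%ta k. ?s (H n) ta k - ?s (H (Suc n)) ta k) &
    E1_norm (eps M) T bt (p j) (%ta k. ?s (H n) ta k - ?s (H (Suc n)) ta k) <= T * C * (Q ^ (m - 1) * de)" if n: "n < m" for n
   proof -
    define D where "D s k = V n s k - W n s k" for s k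
    have ae: "AE k in lebesgue. ?s ((H n)(n := D)) ta k = ?s (H n) ta k - ?s (H (Suc n)) ta k" if ta: "ta : {0..T}" for ta
    proof -
     have "(H n)(n := V n) = H n" "(H n)(n := W n) = H (Suc n)" by (auto simp: H_def fun_eq_iff)
     moreover have "AE k in lebesgue. ?s ((H n)(n := %s k. V n s k - W n s k)) ta k = ?s ((H n)(n := V n)) ta k - ?s ((H n)(n := W n)) ta k"
      by (rule sterm_diff_slot[OF L N M ok inv bt0 m l tt lv j bt rh(1) n T(1) in_E1D(1)[OF conjunct1[OF HE]] in_E1D(1)[OF VW(1)[OF n]] in_E1D(1)[OF VW(2)[OF n]] ta])
     ultimately show ?thesis by (simp add: D_def[abs_def])
    qed
    have "in_E1 T (p j) (?s ((H n)(n := D))) & E1_norm (eps M) T bt (p j) (?s ((H n)(n := D))) <= T * C * (PROD i<m. if i = n then de else Q)"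
    proof (rule sb')
     fix i assume i: "i < m"
     show "in_E1 T (p i) (((H n)(n := D)) i) & E1_norm (eps M) T bt (p i) (((H n)(n := D)) i) <= (if i = n then de else Q)"
     proof (cases "i = n")
      case True
      then show ?thesis using VW(5)[OF i] in_E1_diff(1)[OF M VW(1,2)[OF i] T(1)] by (simp add: D_def[abs_def])
     qed (use HE[OF i] in simp)
    qed
    moreover have "(PROD i<m. if i = n then de else Q) = Q ^ (m - 1) * de"
    proof -
     have "(PROD i<m. if i = n then de else Q) = de * (PROD i:{..<m} - {n}. if i = n then de else Q)"
      using n by (subst prod.remove[of _ n]) auto
     also have "(PROD i:{..<m} - {n}. if i = n then de else Q) = (PROD i:{..<m} - {n}. Q)" by (intro prod.cong) auto
     finally show ?thesis using n by (simp add: mult.commute)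
    qed
    ultimately show ?thesis
     using in_E1_cong(1)[where r="p j", OF M _ ae] in_E1_cong(2)[where r="p j" and ee="eps M" and bt=bt, OF M _ ae] by simp
   qed
   have tel: "E1_norm (eps M) T bt (p j) (%ta k. ?s V ta k - ?s (H n) ta k) <= real n * (T * C * (Q ^ (m - 1) * de))" if "n <= m" for n
    using that
   proof (induction n)
    case 0
    have "H 0 = V" by (simp add: H_def fun_eq_iff)
    then have "E1_norm (eps M) T bt (p j) (%ta k. ?s V ta k - ?s (H 0) ta k) <= 0"
     using in_E1_lincomb(2)[where a=0 and b=0 and ee="eps M" and bt=bt, OF M sH[of 0] sH[of 0] T(1)] by simp
    then show ?case by simp
   next
    case (Suc n)
    have V: "in_E1 T (p j) (?s V)" using sH[of 0] by (simp add: H_def[abs_def])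
    have "E1_norm (eps M) T bt (p j) (%ta k. (?s V ta k - ?s (H n) ta k) + (?s (H n) ta k - ?s (H (Suc n)) ta k))
     <= E1_norm (eps M) T bt (p j) (%ta k. ?s V ta k - ?s (H n) ta k) + E1_norm (eps M) T bt (p j) (%ta k. ?s (H n) ta k - ?s (H (Suc n)) ta k)"
     using step[of n] Suc.prems by (intro in_E1_add(2)[OF M in_E1_diff(1)[OF M V sH T(1)] _ T(1)]) auto
    also have "... <= real n * (T * C * (Q ^ (m - 1) * de)) + T * C * (Q ^ (m - 1) * de)"
     using Suc step[of n] by (intro add_mono) auto
    finally show ?case by (simp add: algebra_simps)
   qed
   have "?s (H m) = ?s W" by (rule sterm_cong) (simp add: H_def)
   then have "E1_norm (eps M) T bt (p j) (%ta k. ?s V ta k - ?s W ta k) <= T * C' * de"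
    using tel[OF order_refl] by (simp add: C'_def mult_ac)
   moreover have "in_E1 T (p j) (?s V) & E1_norm (eps M) T bt (p j) (?s V) <= T * C * (PROD i<m. Q)"
    by (rule sb') (use VW in auto)
   \<comment> \<open>The size bound is brought to the same constant \<open>C'\<close>, using that
     \<open>m\<close> is at least 1.\<close>
   moreover have "T * C * (PROD i<m. Q) <= T * C' * Q"
   proof -
    have "Q ^ m = Q ^ (m - 1) * Q" using m1 by (cases m) auto
    moreover have "1 * (C * Q ^ (m - 1) * Q) <= real m * (C * Q ^ (m - 1) * Q)" using m1 C Q by (intro mult_right_mono) auto
    ultimately have "C * Q ^ m <= C' * Q" unfolding C'_def by (simp add: mult_ac)
    then show ?thesis using mult_left_mono[OF _ T(1)] by (simp add: mult.assoc)
   qed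
   ultimately show "in_E1 T (r l) (?s (%i. v (snd (lv ! i)) (fst (lv ! i)))) &
    E1_norm (eps M) T bt (r l) (?s (%i. v (snd (lv ! i)) (fst (lv ! i)))) <= T * C' * Q &
    E1_norm (eps M) T bt (r l) (%ta k. ?s (%i. v (snd (lv ! i)) (fst (lv ! i))) ta k - ?s (%i. w (snd (lv ! i)) (fst (lv ! i))) ta k) <= T * C' * de"
    unfolding pj V_def[abs_def] W_def[abs_def] by linarith
  qed
 qed
qed

end

text \<open>\<open>z\<close> provides an element of the space, from which the zero field for the
  empty sum is obtained as a linear combination.\<close>

lemma in_E1_sum:
 fixes M :: "('d::finite, 'c::finite) wave_model" and f :: "'i => real => real^'d => complex^'e::finite"
  and z :: "real => real^'d => complex^'e"
 assumes M: "cutoff M" and T: "0 <= T" and z: "in_E1 T r z" and I: "finite I"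
  and f: "!!i. i : I ==> in_E1 T r (f i)" "!!i. i : I ==> E1_norm ee T bt r (f i) <= c i"
 shows "in_E1 T r (%ta k. SUM i:I. f i ta k) & E1_norm ee T bt r (%ta k. SUM i:I. f i ta k) <= (SUM i:I. c i)"
 using I f
proof (induction I rule: finite_induct)
 case empty
 then show ?case using in_E1_lincomb(1)[where a=0 and b=0, OF M z z T] in_E1_lincomb(2)[where a=0 and b=0 and ee=ee and bt=bt, OF M z z T] by simp
next
 case (insert i I)
 have IH: "in_E1 T r (%ta k. SUM i:I. f i ta k)" "E1_norm ee T bt r (%ta k. SUM i:I. f i ta k) <= (SUM i:I. c i)"
  using insert.IH insert.prems by auto
 have i: "in_E1 T r (f i)" "E1_norm ee T bt r (f i) <= c i" using insert.prems by auto
 show ?case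
  using insert.hyps in_E1_add(1)[OF M i(1) IH(1) T] in_E1_add(2)[where ee=ee and bt=bt, OF M i(1) IH(1) T] i(2) IH(2) by simp
qed

lemma finite_resonant_vectors: "finite (resonant_vectors M S m l tt)"
proof (rule finite_subset)
 show "resonant_vectors M S m l tt \<subseteq> {xs. set xs \<subseteq> signs \<times> {1..nparts S} & length xs = m}"
  by (auto simp: resonant_vectors_def index_vectors_def)
 show "finite {xs. set xs \<subseteq> signs \<times> {1..nparts S} & length xs = m}"
  by (rule finite_lists_length_eq) (simp add: signs_def)
qed

lemma F_av_component_lipschitz:
 fixes M :: "('d::finite, 'c::finite) wave_model"
 assumes L: "linear_part M" and N: "nonlinear_part M" and M: "cutoff M" and ok: "nk_spectrum_ok M S"
  and inv: "universally_resonance_invariant M S" and bt0: "small_beta M S bt0" and Q: "0 <= Q"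
  and l: "l : {1..nparts S}" and tt: "tt : signs"
 shows "EX C>=0. ALL bt rh T r v w de. 0 < bt --> bt <= bt0 --> 0 < rh --> bt\<^sup>2 / rh <= C1 --> 0 <= T --> T <= 1 -->
  close_fields M S Q bt T r v w de -->
  in_E1 T (r l) (F_av M S bt rh v l tt) & E1_norm (eps M) T bt (r l) (F_av M S bt rh v l tt) <= T * C * Q &
  E1_norm (eps M) T bt (r l) (%ta k. F_av M S bt rh v l tt ta k - F_av M S bt rh w l tt ta k) <= T * C * de"
proof -
 define s where "s bt rh v i = sterm M S bt rh (fst i) l tt (snd i) (%j. v (snd (snd i ! j)) (fst (snd i ! j)))"
  for bt rh and v :: "('d, 'c) wavevec" and i
 define I where "I = Sigma (degs M) (%m. resonant_vectors M S m l tt)"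
 have fin: "finite I" unfolding I_def using nonlinear_partD(1)[OF N] by (intro finite_SigmaI finite_resonant_vectors)
 have F: "F_av M S bt rh v l tt = (%ta k. SUM i:I. s bt rh v i ta k)" for bt rh v
  unfolding F_av_eq_sterm[abs_def] I_def s_def
  by (intro ext) (simp add: sum.Sigma nonlinear_partD(1)[OF N] finite_resonant_vectors case_prod_beta')
 let ?P = "%C i bt rh T r v w de. in_E1 T (r l) (s bt rh v i) & E1_norm (eps M) T bt (r l) (s bt rh v i) <= T * C * Q &
   E1_norm (eps M) T bt (r l) (%ta k. s bt rh v i ta k - s bt rh w i ta k) <= T * C * de"
 let ?H = "%bt T r v w de. close_fields M S Q bt T r v w de"
 have "ALL i:I. EX C>=0. ALL bt rh T r v w de. 0 < bt --> bt <= bt0 --> 0 < rh --> bt\<^sup>2 / rh <= C1 --> 0 <= T --> T <= 1 -->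
  ?H bt T r v w de --> ?P C i bt rh T r v w de"
 proof
  fix i assume "i : I"
  then have i: "fst i : degs M" "snd i : resonant_vectors M S (fst i) l tt" by (auto simp: I_def)
  show "EX C>=0. ALL bt rh T r v w de. 0 < bt --> bt <= bt0 --> 0 < rh --> bt\<^sup>2 / rh <= C1 --> 0 <= T --> T <= 1 -->
   ?H bt T r v w de --> ?P C i bt rh T r v w de"
   unfolding s_def by (rule sterm_lipschitz[OF L N M ok inv bt0 i(1) l tt i(2) Q])
 qed
 from bchoice[OF this] obtain C where C: "ALL i:I. 0 <= C i & (ALL bt rh T r v w de. 0 < bt --> bt <= bt0 --> 0 < rh --> bt\<^sup>2 / rh <= C1 --> 0 <= T --> T <= 1 -->
  ?H bt T r v w de --> ?P (C i) i bt rh T r v w de)" by (elim exE)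
 show ?thesis
 proof (rule exI[of _ "SUM i:I. C i"], intro conjI allI impI)
  show "0 <= (SUM i:I. C i)" using C by (blast intro: sum_nonneg)
  fix bt rh T :: real and r and v w :: "('d, 'c) wavevec" and de
  assume c: "0 < bt" "bt <= bt0" "0 < rh" "bt\<^sup>2 / rh <= C1" "0 <= T" "T <= 1" and H: "?H bt T r v w de"
  \<comment> \<open>The terms for \<open>w\<close> are seen to lie in E1 by applying the estimate to
    the pair of \<open>w\<close> with itself, whose difference has norm at most
    \<open>Q + Q\<close>.\<close>
  have H': "?H bt T r w w \<bar>Q + Q\<bar>"
  proof (intro ballI conjI)
   fix l' tt' assume a: "l' : {1..nparts S}" "tt' : signs"
   have w: "in_E1 T (r l') (w l' tt')" "E1_norm (eps M) T bt (r l') (w l' tt') <= Q" using H a by blast+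
   then show "in_E1 T (r l') (w l' tt')" "in_E1 T (r l') (w l' tt')" "E1_norm (eps M) T bt (r l') (w l' tt') <= Q" "E1_norm (eps M) T bt (r l') (w l' tt') <= Q" by auto
   show "E1_norm (eps M) T bt (r l') (%ta k. w l' tt' ta k - w l' tt' ta k) <= \<bar>Q + Q\<bar>"
    using in_E1_diff(2)[where ee="eps M" and bt=bt, OF M w(1) w(1) c(5)] w(2) by linarith
  qed
  have P: "?P (C i) i bt rh T r v w de" if "i : I" for i
   by (rule conjunct2[OF C[rule_format, OF that], rule_format, OF c]) (rule H[rule_format])
  have P': "in_E1 T (r l) (s bt rh w i)" if "i : I" for i
   by (rule conjunct1[OF conjunct2[OF C[rule_format, OF that], rule_format, OF c]]) (rule H'[rule_format])
  have z: "in_E1 T (r l) (v l tt)" using H l tt by blast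
  have 1: "in_E1 T (r l) (%ta k. SUM i:I. s bt rh v i ta k) & E1_norm (eps M) T bt (r l) (%ta k. SUM i:I. s bt rh v i ta k) <= (SUM i:I. T * C i * Q)"
   by (rule in_E1_sum[OF M c(5) z fin]) (use P in blast)+
  have 2: "in_E1 T (r l) (%ta k. SUM i:I. s bt rh v i ta k - s bt rh w i ta k) & E1_norm (eps M) T bt (r l) (%ta k. SUM i:I. s bt rh v i ta k - s bt rh w i ta k) <= (SUM i:I. T * C i * de)"
  proof (rule in_E1_sum[OF M c(5) z fin, where f="%i ta k. s bt rh v i ta k - s bt rh w i ta k"])
   fix i assume i: "i : I"
   show "in_E1 T (r l) (%ta k. s bt rh v i ta k - s bt rh w i ta k)" by (rule in_E1_diff(1)[OF M conjunct1[OF P[OF i]] P'[OF i] c(5)])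
   show "E1_norm (eps M) T bt (r l) (%ta k. s bt rh v i ta k - s bt rh w i ta k) <= T * C i * de" using P[OF i] by blast
  qed
  show "in_E1 T (r l) (F_av M S bt rh v l tt)" using 1 unfolding F by blast
  show "E1_norm (eps M) T bt (r l) (F_av M S bt rh v l tt) <= T * (SUM i:I. C i) * Q"
   using 1 unfolding F by (simp add: sum_distrib_left sum_distrib_right)
  show "E1_norm (eps M) T bt (r l) (%ta k. F_av M S bt rh v l tt ta k - F_av M S bt rh w l tt ta k) <= T * (SUM i:I. C i) * de"
   using 2 unfolding F by (simp add: sum_distrib_left sum_distrib_right sum_subtractf)
 qed
qed

section \<open>The fixed point argument\<close>

abbreviation (input) vec_diff :: "('d, 'c) wavevec => ('d, 'c) wavevec => ('d, 'c::finite) wavevec"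
where "vec_diff v w == %l tt ta k. v l tt ta k - w l tt ta k"

context
 fixes M :: "('d::finite, 'c::finite) wave_model" and S :: "'d nk_spectrum" and T :: real and r :: "nat => real^'d"
 assumes M: "cutoff M" and T: "0 <= T"
begin

lemma in_E1_vecD: "in_E1_vec S T r v ==> l : {1..nparts S} ==> tt : signs ==> in_E1 T (r l) (v l tt)"
 unfolding in_E1_vec_def by blast

lemma E1_vec_add:
 assumes v: "in_E1_vec S T r v" and w: "in_E1_vec S T r w"
 shows "in_E1_vec S T r (%l tt ta k. v l tt ta k + w l tt ta k)"
  and "E1_vec_norm M S T bt r (%l tt ta k. v l tt ta k + w l tt ta k) <= E1_vec_norm M S T bt r v + E1_vec_norm M S T bt r w"
proof -
 show "in_E1_vec S T r (%l tt ta k. v l tt ta k + w l tt ta k)"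
  unfolding in_E1_vec_def by (intro ballI in_E1_add(1)[OF M _ _ T] in_E1_vecD[OF v] in_E1_vecD[OF w])
 show "E1_vec_norm M S T bt r (%l tt ta k. v l tt ta k + w l tt ta k) <= E1_vec_norm M S T bt r v + E1_vec_norm M S T bt r w"
  unfolding E1_vec_norm_def sum.distrib[symmetric]
  by (intro sum_mono in_E1_add(2)[OF M _ _ T] in_E1_vecD[OF v] in_E1_vecD[OF w])
qed

lemma E1_vec_diff:
 assumes v: "in_E1_vec S T r v" and w: "in_E1_vec S T r w"
 shows "in_E1_vec S T r (vec_diff v w)"
 unfolding in_E1_vec_def by (intro ballI in_E1_diff(1)[OF M _ _ T] in_E1_vecD[OF v] in_E1_vecD[OF w])

lemma E1_vec_cong:
 assumes v: "in_E1_vec S T r v" and eq: "!!l tt ta. l : {1..nparts S} ==> tt : signs ==> ta : {0..T} ==> AE k in lebesgue. v l tt ta k = w l tt ta k"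
 shows "E1_vec_norm M S T bt r w = E1_vec_norm M S T bt r v"
 unfolding E1_vec_norm_def by (intro sum.cong refl in_E1_cong(2)[OF M in_E1_vecD[OF v] eq])

lemma E1_vec_nonneg: "in_E1_vec S T r v ==> 0 <= E1_vec_norm M S T bt r v"
 unfolding E1_vec_norm_def by (intro sum_nonneg E1_norm_nonneg[OF in_E1_vecD T])

lemma E1_norm_le_vec:
 assumes v: "in_E1_vec S T r v" and l: "l : {1..nparts S}" and tt: "tt : signs"
 shows "E1_norm (eps M) T bt (r l) (v l tt) <= E1_vec_norm M S T bt r v"
proof -
 have nn: "0 <= E1_norm (eps M) T bt (r l) (v l tt)" if "l : {1..nparts S}" "tt : signs" for l tt
  by (rule E1_norm_nonneg[OF in_E1_vecD[OF v that] T])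
 have "E1_norm (eps M) T bt (r l) (v l tt) <= (SUM tt:signs. E1_norm (eps M) T bt (r l) (v l tt))"
  using nn l tt by (intro member_le_sum) (auto simp: signs_def)
 also have "... <= E1_vec_norm M S T bt r v"
  unfolding E1_vec_norm_def using nn l by (intro member_le_sum[of l "{1..nparts S}" "%l. SUM tt:signs. E1_norm (eps M) T bt (r l) (v l tt)"]) (auto intro!: sum_nonneg)
 finally show ?thesis .
qed

lemma E1_vec_zero:
 assumes v: "in_E1_vec S T r v" and z: "E1_vec_norm M S T bt r v <= 0"
  and l: "l : {1..nparts S}" and tt: "tt : signs" and ta: "ta : {0..T}"
 shows "AE k in lebesgue. v l tt ta k = 0"
proof -
 note i = in_E1_vecD[OF v l tt]
 have "L1_norm (v l tt ta) <= 0"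
  using L1_norm_le_E_norm[OF in_E1D(1)[OF i] ta] E_norm_le_E1_norm[OF i T, of "eps M" bt] E1_norm_le_vec[OF v l tt, of bt] z by linarith
 then show ?thesis by (rule L1_norm_eq_0[OF in_E_integrable[OF in_E1D(1)[OF i] ta]])
qed

end

lemma F_av_lipschitz:
 fixes M :: "('d::finite, 'c::finite) wave_model"
 assumes L: "linear_part M" and N: "nonlinear_part M" and M: "cutoff M" and ok: "nk_spectrum_ok M S"
  and inv: "universally_resonance_invariant M S" and bt0: "small_beta M S bt0" and Q: "0 <= Q"
 shows "EX C>=0. ALL bt rh T r v w. 0 < bt --> bt <= bt0 --> 0 < rh --> bt\<^sup>2 / rh <= C1 --> 0 <= T --> T <= 1 -->
  in_E1_vec S T r v --> in_E1_vec S T r w --> E1_vec_norm M S T bt r v <= Q --> E1_vec_norm M S T bt r w <= Q -->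
  in_E1_vec S T r (F_av M S bt rh v) & E1_vec_norm M S T bt r (F_av M S bt rh v) <= T * C * Q &
  E1_vec_norm M S T bt r (vec_diff (F_av M S bt rh v) (F_av M S bt rh w)) <= T * C * E1_vec_norm M S T bt r (vec_diff v w)"
proof -
 let ?I = "{1..nparts S} \<times> signs"
 let ?H = "%bt T r v w de. close_fields M S Q bt T r v w de"
 let ?P = "%C i bt rh T r v w de. in_E1 T (r (fst i)) (F_av M S bt rh v (fst i) (snd i)) &
  E1_norm (eps M) T bt (r (fst i)) (F_av M S bt rh v (fst i) (snd i)) <= T * C * Q &
  E1_norm (eps M) T bt (r (fst i)) (%ta k. F_av M S bt rh v (fst i) (snd i) ta k - F_av M S bt rh w (fst i) (snd i) ta k) <= T * C * de"
 have "ALL i:?I. EX C>=0. ALL bt rh T r v w de. 0 < bt --> bt <= bt0 --> 0 < rh --> bt\<^sup>2 / rh <= C1 --> 0 <= T --> T <= 1 -->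
  ?H bt T r v w de --> ?P C i bt rh T r v w de"
  by (intro ballI F_av_component_lipschitz[OF L N M ok inv bt0 Q]) auto
 from bchoice[OF this] obtain C where C: "ALL i:?I. 0 <= C i & (ALL bt rh T r v w de. 0 < bt --> bt <= bt0 --> 0 < rh --> bt\<^sup>2 / rh <= C1 --> 0 <= T --> T <= 1 -->
  ?H bt T r v w de --> ?P (C i) i bt rh T r v w de)" by (elim exE)
 show ?thesis
 proof (rule exI[of _ "SUM i:?I. C i"], intro conjI allI impI)
  show "0 <= (SUM i:?I. C i)" using C by (blast intro: sum_nonneg)
  fix bt rh T :: real and r and v w :: "('d, 'c) wavevec"
  assume c: "0 < bt" "bt <= bt0" "0 < rh" "bt\<^sup>2 / rh <= C1" "0 <= T" "T <= 1"
   and v: "in_E1_vec S T r v" "E1_vec_norm M S T bt r v <= Q" and w: "in_E1_vec S T r w" "E1_vec_norm M S T bt r w <= Q"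
  let ?de = "E1_vec_norm M S T bt r (vec_diff v w)"
  have H: "?H bt T r v w ?de"
  proof (intro ballI)
   fix l tt assume a: "l : {1..nparts S}" "tt : signs"
   show "in_E1 T (r l) (v l tt) & in_E1 T (r l) (w l tt) &
    E1_norm (eps M) T bt (r l) (v l tt) <= Q & E1_norm (eps M) T bt (r l) (w l tt) <= Q &
    E1_norm (eps M) T bt (r l) (%ta k. v l tt ta k - w l tt ta k) <= ?de"
    using in_E1_vecD[OF M c(5) v(1) a] in_E1_vecD[OF M c(5) w(1) a] E1_norm_le_vec[OF M c(5) v(1) a, of bt] E1_norm_le_vec[OF M c(5) w(1) a, of bt] v(2) w(2)
     E1_norm_le_vec[OF M c(5) E1_vec_diff[OF M c(5) v(1) w(1)] a, of bt] by simp
  qed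
  have P: "?P (C i) i bt rh T r v w ?de" if "i : ?I" for i
   by (rule conjunct2[OF C[rule_format, OF that], rule_format, OF c]) (rule H[rule_format])
  have P1: "in_E1 T (r l) (F_av M S bt rh v l tt)" "E1_norm (eps M) T bt (r l) (F_av M S bt rh v l tt) <= T * C (l, tt) * Q"
   "E1_norm (eps M) T bt (r l) (%ta k. F_av M S bt rh v l tt ta k - F_av M S bt rh w l tt ta k) <= T * C (l, tt) * ?de"
   if "l : {1..nparts S}" "tt : signs" for l tt
   using P[of "(l, tt)"] that by auto
  show "in_E1_vec S T r (F_av M S bt rh v)" unfolding in_E1_vec_def using P1(1) by blast
  have tot: "(SUM l:{1..nparts S}. SUM tt:signs. T * C (l, tt) * q) = T * (SUM i:?I. C i) * q" for q
   by (simp add: sum.cartesian_product sum_distrib_left sum_distrib_right case_prod_beta')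
  show "E1_vec_norm M S T bt r (F_av M S bt rh v) <= T * (SUM i:?I. C i) * Q"
   unfolding E1_vec_norm_def tot[symmetric] by (intro sum_mono P1(2))
  show "E1_vec_norm M S T bt r (vec_diff (F_av M S bt rh v) (F_av M S bt rh w)) <= T * (SUM i:?I. C i) * ?de"
   unfolding tot[symmetric] by (subst (1) E1_vec_norm_def) (intro sum_mono P1(3))
 qed
qed

text \<open>On the ball of radius \<open>2 * R\<close>, the data use one half of the radius and the
  nonlinearity the other. Picard iteration is carried out by hand, since distinct representatives
  may have distance 0.\<close>

lemma averaged_system_solution:
 fixes M :: "('d::finite, 'c::finite) wave_model"
 assumes L: "linear_part M" and N: "nonlinear_part M" and M: "cutoff M" and ok: "nk_spectrum_ok M S"
  and inv: "universally_resonance_invariant M S" and bt0: "small_beta M S bt0" and R: "0 <= R"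
 shows "EX tass>0. ALL bt rh T r H. 0 < bt --> bt <= bt0 --> 0 < rh --> bt\<^sup>2 / rh <= C1 --> 0 < T --> T <= tass -->
  in_E1_vec S T r H --> E1_vec_norm M S T bt r H <= R -->
  (EX V. in_E1_vec S T r V & averaged_system M S T bt rh H V & E1_vec_norm M S T bt r V <= 2 * R &
   (ALL w. in_E1_vec S T r w & averaged_system M S T bt rh H w & E1_vec_norm M S T bt r w <= 2 * R --> E_vec_eq S T w V))"
proof -
 have Q: "0 <= 2 * R" using R by simp
 from F_av_lipschitz[where ?C1.0=C1, OF L N M ok inv bt0 Q] obtain C where C: "0 <= C"
  and lip: "ALL bt rh T r v w. 0 < bt --> bt <= bt0 --> 0 < rh --> bt\<^sup>2 / rh <= C1 --> 0 <= T --> T <= 1 -->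
  in_E1_vec S T r v --> in_E1_vec S T r w --> E1_vec_norm M S T bt r v <= 2 * R --> E1_vec_norm M S T bt r w <= 2 * R -->
  in_E1_vec S T r (F_av M S bt rh v) & E1_vec_norm M S T bt r (F_av M S bt rh v) <= T * C * (2 * R) &
  E1_vec_norm M S T bt r (vec_diff (F_av M S bt rh v) (F_av M S bt rh w)) <= T * C * E1_vec_norm M S T bt r (vec_diff v w)" by (elim exE conjE)
 \<comment> \<open>\<open>T * C <= 1/2\<close> makes the nonlinearity a half-contraction that maps
   the ball of radius \<open>2 * R\<close> into that of radius \<open>R\<close>. The summand 1 in
   \<open>C + 1\<close> avoids a division by 0, and the bound 1 is the range of times in the kernel
   estimates.\<close>
 define tass where "tass = min 1 (1 / (2 * (C + 1)))"
 show ?thesis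
 proof (rule exI[of _ tass], intro conjI allI impI)
  show "0 < tass" using C by (simp add: tass_def)
  fix bt rh T :: real and r and H :: "('d, 'c) wavevec"
  assume c: "0 < bt" "bt <= bt0" "0 < rh" "bt\<^sup>2 / rh <= C1" and T': "0 < T" "T <= tass"
   and H: "in_E1_vec S T r H" "E1_vec_norm M S T bt r H <= R"
  have T: "0 <= T" "T <= 1" using T' by (auto simp: tass_def)
  let ?F = "F_av M S bt rh" and ?n = "E1_vec_norm M S T bt r" and ?E = "in_E1_vec S T r"
  have half: "T * C <= 1 / 2"
  proof -
   have "T * C <= (1 / (2 * (C + 1))) * (C + 1)" using T T'(2) C by (intro mult_mono) (auto simp: tass_def)
   also have "... = 1 / 2" using C by (simp add: field_simps)
   finally show ?thesis .
  qed
  have lip': "?E (?F v)" "?n (?F v) <= R" "?n (vec_diff (?F v) (?F w)) <= 1 / 2 * ?n (vec_diff v w)"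
   if v: "?E v" "?n v <= 2 * R" and w: "?E w" "?n w <= 2 * R" for v w
  proof -
   note l = lip[rule_format, OF c T v(1) w(1) v(2) w(2)]
   show "?E (?F v)" using l by blast
   show "?n (?F v) <= R" using l mult_right_mono[OF half Q] by simp
   have "T * C * ?n (vec_diff v w) <= 1 / 2 * ?n (vec_diff v w)"
    by (rule mult_right_mono[OF half E1_vec_nonneg[OF M T(1) E1_vec_diff[OF M T(1) v(1) w(1)]]])
   then show "?n (vec_diff (?F v) (?F w)) <= 1 / 2 * ?n (vec_diff v w)" using l by linarith
  qed
  have RQ: "R <= 2 * R" using R by simp
  let ?Ph = "%v l tt ta k. ?F v l tt ta k + H l tt ta k"
  have Ph: "?E (?Ph v)" "?n (?Ph v) <= 2 * R" if v: "?E v" "?n v <= 2 * R" for v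
  proof -
   show "?E (?Ph v)" by (rule E1_vec_add(1)[OF M T(1) lip'(1)[OF v v] H(1)])
   show "?n (?Ph v) <= 2 * R"
    using E1_vec_add(2)[OF M T(1) lip'(1)[OF v v] H(1), of bt] lip'(2)[OF v v] H(2) by linarith
  qed
  have Phd: "vec_diff (?Ph v) (?Ph w) = vec_diff (?F v) (?F w)" for v w by simp
  \<comment> \<open>The iteration starts at the data, which already lie in the ball.\<close>
  define x where "x n = (?Ph ^^ n) H" for n
  have xS: "x (Suc n) = ?Ph (x n)" for n by (simp add: x_def)
  have xE: "?E (x n) & ?n (x n) <= 2 * R" for n
  proof (induction n)
   case 0 then show ?case using H RQ by (simp add: x_def)
  next
   case (Suc n) then show ?case unfolding xS using Ph by blast
  qed
  define c0 where "c0 = ?n (vec_diff (x 1) (x 0))"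
  have d: "?n (vec_diff (x (Suc n)) (x n)) <= c0 * (1 / 2) ^ n" for n
  proof (induction n)
   case 0 then show ?case by (simp add: c0_def)
  next
   case (Suc n)
   have "?n (vec_diff (x (Suc (Suc n))) (x (Suc n))) = ?n (vec_diff (?F (x (Suc n))) (?F (x n)))"
    unfolding xS[of "Suc n"] xS[of n] by simp
   also have "... <= 1 / 2 * ?n (vec_diff (x (Suc n)) (x n))" by (rule lip'(3)) (use xE in blast)+
   finally show ?case using Suc by simp
  qed
  \<comment> \<open>Limits are taken in each component separately, as each component space has its
    own position.\<close>
  have "EX v. in_E1 T (r l) v & (%n. E1_norm (eps M) T bt (r l) (%ta k. x n l tt ta k - v ta k)) \<longlonglongrightarrow> 0"
   if a: "l : {1..nparts S}" "tt : signs" for l tt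
  proof (rule in_E1_fast_Cauchy[where q="1/2" and c=c0])
   fix n
   have e: "?E (x n)" "?E (x (Suc n))" using xE by blast+
   show "in_E1 T (r l) (x n l tt)" by (rule in_E1_vecD[OF M T(1) e(1) a])
   show "E1_norm (eps M) T bt (r l) (%ta k. x (Suc n) l tt ta k - x n l tt ta k) <= c0 * (1 / 2) ^ n"
    by (rule order_trans[OF E1_norm_le_vec[OF M T(1) E1_vec_diff[OF M T(1) e(2,1)] a] d])
  qed (use M c T in auto)
  then have "ALL i:{1..nparts S} \<times> signs. EX v. in_E1 T (r (fst i)) v & (%n. E1_norm (eps M) T bt (r (fst i)) (%ta k. x n (fst i) (snd i) ta k - v ta k)) \<longlonglongrightarrow> 0"
   by auto
  from bchoice[OF this] obtain V' where V': "ALL i:{1..nparts S} \<times> signs. in_E1 T (r (fst i)) (V' i) &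
   (%n. E1_norm (eps M) T bt (r (fst i)) (%ta k. x n (fst i) (snd i) ta k - V' i ta k)) \<longlonglongrightarrow> 0" by (elim exE)
  define V where "V l tt = V' (l, tt)" for l tt
  have VE: "?E V" unfolding in_E1_vec_def V_def using V' by fastforce
  have lim: "(%n. ?n (vec_diff (x n) V)) \<longlonglongrightarrow> 0"
  proof -
   have "(%n. E1_norm (eps M) T bt (r l) (%ta k. x n l tt ta k - V l tt ta k)) \<longlonglongrightarrow> 0" if "l : {1..nparts S}" "tt : signs" for l tt
    using bspec[OF V', of "(l, tt)"] that unfolding V_def by simp
   then have "(%n. ?n (vec_diff (x n) V)) \<longlonglongrightarrow> (SUM l:{1..nparts S}. SUM tt:signs. 0)"
    unfolding E1_vec_norm_def by (intro tendsto_sum)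
   then show ?thesis by simp
  qed
  have xVE: "?E (vec_diff (x n) V)" for n by (rule E1_vec_diff[OF M T(1) conjunct1[OF xE] VE])
  have neg: "?n (vec_diff v w) = ?n (vec_diff w v)" if "?E v" "?E w" for v w
  proof -
   have "?n (vec_diff v w) <= ?n (vec_diff w v)" if "?E v" "?E w" for v w
    unfolding E1_vec_norm_def
   proof (intro sum_mono)
    fix l tt assume a: "l : {1..nparts S}" "tt : signs"
    note i = in_E1_diff(1)[OF M in_E1_vecD[OF M T(1) that(2) a] in_E1_vecD[OF M T(1) that(1) a] T(1)]
    show "E1_norm (eps M) T bt (r l) (%ta k. v l tt ta k - w l tt ta k) <= E1_norm (eps M) T bt (r l) (%ta k. w l tt ta k - v l tt ta k)"
     using in_E1_lincomb(2)[where a="-1" and b=0 and ee="eps M" and bt=bt, OF M i i T(1)] by simp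
   qed
   from this[OF that] this[OF that(2,1)] show ?thesis by linarith
  qed
  have tri: "?n (vec_diff u w) <= ?n (vec_diff u v) + ?n (vec_diff v w)" if "?E u" "?E v" "?E w" for u v w
   using E1_vec_add(2)[OF M T(1) E1_vec_diff[OF M T(1) that(1,2)] E1_vec_diff[OF M T(1) that(2,3)], of bt] by simp
  have VQ: "?n V <= 2 * R"
  proof (rule LIMSEQ_le_const)
   show "EX N. ALL n>=N. ?n V <= 2 * R + ?n (vec_diff (x n) V)"
   proof (intro exI allI impI)
    fix n
    have "?n (%l tt ta k. x n l tt ta k + (V l tt ta k - x n l tt ta k)) <= ?n (x n) + ?n (vec_diff V (x n))"
     by (rule E1_vec_add(2)[OF M T(1) conjunct1[OF xE] E1_vec_diff[OF M T(1) VE conjunct1[OF xE]]])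
    then show "?n V <= 2 * R + ?n (vec_diff (x n) V)"
     using conjunct2[OF xE[of n]] neg[OF VE conjunct1[OF xE[of n]]] by simp
   qed
   show "(%n. 2 * R + ?n (vec_diff (x n) V)) \<longlonglongrightarrow> 2 * R" using tendsto_add[OF tendsto_const lim, of "2 * R"] by simp
  qed
  \<comment> \<open>In the ball, the system amounts to distance 0 between \<open>v\<close> and its
    image, a form that passes to limits.\<close>
  have solves: "averaged_system M S T bt rh H v \<longleftrightarrow> ?n (vec_diff v (?Ph v)) <= 0" if v: "?E v" "?n v <= 2 * R" for v
  proof
   assume "?n (vec_diff v (?Ph v)) <= 0"
   from E1_vec_zero[OF M T(1) E1_vec_diff[OF M T(1) v(1) Ph(1)[OF v]] this] show "averaged_system M S T bt rh H v"
    unfolding averaged_system_def by (auto elim!: eventually_mono)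
  next
   assume a: "averaged_system M S T bt rh H v"
   have "?n (vec_diff v (?Ph v)) = ?n (vec_diff v v)"
   proof (rule E1_vec_cong[OF M T(1) E1_vec_diff[OF M T(1) v(1) v(1)]])
    fix l tt ta assume "l : {1..nparts S}" "tt : signs" "ta : {0..T}"
    then have "AE k in lebesgue. v l tt ta k = ?F v l tt ta k + H l tt ta k" using a unfolding averaged_system_def by blast
    then show "AE k in lebesgue. v l tt ta k - v l tt ta k = v l tt ta k - (?F v l tt ta k + H l tt ta k)" by (rule eventually_mono) simp
   qed
   also have "... <= (SUM l:{1..nparts S}. SUM tt:signs. 0)"
    unfolding E1_vec_norm_def
   proof (intro sum_mono)
    fix l tt assume a: "l : {1..nparts S}" "tt : signs"
    note i = in_E1_vecD[OF M T(1) v(1) a]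
    show "E1_norm (eps M) T bt (r l) (%ta k. v l tt ta k - v l tt ta k) <= 0"
     using in_E1_lincomb(2)[where a=0 and b=0 and ee="eps M" and bt=bt, OF M i i T(1)] by simp
   qed
   finally show "?n (vec_diff v (?Ph v)) <= 0" by simp
  qed
  \<comment> \<open>\<open>V\<close> is compared with its image through \<open>x (Suc n)\<close>,
    which is the image of \<open>x n\<close>.\<close>
  have "?n (vec_diff V (?Ph V)) <= 0"
  proof (rule LIMSEQ_le_const)
   show "EX N. ALL n>=N. ?n (vec_diff V (?Ph V)) <= ?n (vec_diff (x (Suc n)) V) + 1 / 2 * ?n (vec_diff (x n) V)"
   proof (intro exI allI impI)
    fix n
    have e: "?E (x n)" "?n (x n) <= 2 * R" "?E (x (Suc n))" using xE by blast+
    have "?n (vec_diff V (?Ph V)) <= ?n (vec_diff V (x (Suc n))) + ?n (vec_diff (x (Suc n)) (?Ph V))"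
     by (rule tri[OF VE e(3) Ph(1)[OF VE VQ]])
    also have "vec_diff (x (Suc n)) (?Ph V) = vec_diff (?F (x n)) (?F V)" unfolding xS by simp
    also have "?n (vec_diff V (x (Suc n))) = ?n (vec_diff (x (Suc n)) V)" by (rule neg[OF VE e(3)])
    finally show "?n (vec_diff V (?Ph V)) <= ?n (vec_diff (x (Suc n)) V) + 1 / 2 * ?n (vec_diff (x n) V)"
     using lip'(3)[OF e(1,2) VE VQ] by linarith
   qed
   show "(%n. ?n (vec_diff (x (Suc n)) V) + 1 / 2 * ?n (vec_diff (x n) V)) \<longlonglongrightarrow> 0"
    using tendsto_add[OF LIMSEQ_Suc[OF lim] tendsto_mult[OF tendsto_const lim], of "1/2"] by simp
  qed
  then have sol: "averaged_system M S T bt rh H V" using solves[OF VE VQ] by blast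
  have uniq: "E_vec_eq S T w V" if w: "?E w" "averaged_system M S T bt rh H w" "?n w <= 2 * R" for w
  proof -
   have z: "?n (vec_diff w (?Ph w)) <= 0" "?n (vec_diff V (?Ph V)) <= 0" using solves[OF w(1,3)] solves[OF VE VQ] w(2) sol by blast+
   note Phw = Ph(1)[OF w(1,3)] and PhV = Ph(1)[OF VE VQ]
   \<comment> \<open>Both fields are fixed points up to distance 0, so their distance is at most
     half of itself.\<close>
   have "?n (vec_diff w V) <= ?n (vec_diff w (?Ph w)) + (?n (vec_diff (?Ph w) (?Ph V)) + ?n (vec_diff (?Ph V) V))"
    using tri[OF w(1) Phw VE] tri[OF Phw PhV VE] by linarith
   then have "?n (vec_diff w V) <= 1 / 2 * ?n (vec_diff w V)"
    using z neg[OF PhV VE] lip'(3)[OF w(1,3) VE VQ] unfolding Phd by linarith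
   then have "?n (vec_diff w V) <= 0" by linarith
   from E1_vec_zero[OF M T(1) E1_vec_diff[OF M T(1) w(1) VE] this] show ?thesis
    unfolding E_vec_eq_def by (auto elim!: eventually_mono)
  qed
  show "EX V. ?E V & averaged_system M S T bt rh H V & ?n V <= 2 * R &
   (ALL w. ?E w & averaged_system M S T bt rh H w & ?n w <= 2 * R --> E_vec_eq S T w V)"
   using VE sol VQ uniq by blast
 qed
qed

section \<open>Localization of solutions and the wavepacket property\<close>

text \<open>If the integral does not exist, its default value 0 is fixed by every linear map as
  well.\<close>

lemma integral_fixed_by_linear:
 fixes P :: "'v::euclidean_space => 'v"
 assumes "bounded_linear P" "!!x. P (f x) = f x"
 shows "P (LINT x|N. f x) = (LINT x|N. f x)"
proof (cases "integrable N f")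
 case True
 from integral_bounded_linear[OF assms(1) this] show ?thesis unfolding assms(2) by (rule sym)
next
 case False
 then show ?thesis using linear_0[OF bounded_linear.linear[OF assms(1)]] by (simp add: not_integrable_integral_eq)
qed

lemma bounded_linear_band_proj: "bounded_linear (band_proj M n ze k)"
 unfolding band_proj_outer[abs_def] by (rule bounded_bilinear.bounded_linear_right[OF bounded_bilinear_matrix_vec])

lemma band_proj_idem:
 assumes L: "linear_part M" and n: "n : {1..nbands M}" and ze: "ze : signs"
 shows "band_proj M n ze k (band_proj M n ze k u) = band_proj M n ze k u"
proof -
 have "cinner (evec M n ze k) (evec M n ze k) = 1" using linear_partD(3)[OF L n ze n ze] by simp
 then have e: "band_proj M n ze k (evec M n ze k) = evec M n ze k" by (simp add: band_proj_def)
 have "band_proj M n ze k (cinner (evec M n ze k) u *s evec M n ze k) = cinner (evec M n ze k) u *s evec M n ze k"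
  by (simp only: band_proj_smult e)
 then show ?thesis by (simp only: band_proj_def[where u=u])
qed

text \<open>Where the localizer at scale 1 does not vanish, the argument of the cutoff at scale 1/2
  has norm at most 1/2, and there the cutoff equals 1.\<close>

lemma localizer_half:
 assumes M: "cutoff M"
 shows "localizer M (1/2) bt k0 k * localizer M 1 bt k0 k = localizer M 1 bt k0 k"
proof (cases "localizer M 1 bt k0 k = 0")
 case False
 then have "norm ((1 * bt powr (- (1 - eps M))) *R (k - k0)) < 1"
  using cutoffD(5)[OF M] unfolding localizer_def by (meson not_le)
 then have "norm ((1 / 2 * bt powr (- (1 - eps M))) *R (k - k0)) <= 1 / 2" by simp
 from cutoffD(4)[OF M this] show ?thesis by (simp add: localizer_def)
qed simp

text \<open>Every value of the integrand already lies in the range of the output projection, which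
  is idempotent; the integrals inherit this.\<close>

lemma interaction_projected:
 fixes M :: "('a::finite, 'c::finite) wave_model"
 assumes L: "linear_part M" and n: "n : {1..nbands M}" and ze: "ze : signs"
 shows "band_proj M n ze k (interaction M rh m n ze xi us ta k) = interaction M rh m n ze xi us ta k"
proof -
 note lin = linear_cmul[OF bounded_linear.linear[OF bounded_linear_band_proj[where M=M and n=n and ze=ze and k=k]]]
 define G where "G t q = (let ks = wavevectors m k q in (1 / (2 * pi) ^ ((m - 1) * CARD('a))) *R
   (cis (phase M m n ze xi ks * t / rh) *s band_proj M n ze k
     (chi M m ks (map (%j. band_proj M (fst (xi ! j)) (snd (xi ! j)) (ks ! Suc j) ((us ! j) t (ks ! Suc j))) [0..<m]))))" for t q
 have G: "band_proj M n ze k (G t q) = G t q" for t q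
  unfolding G_def Let_def lin band_proj_smult band_proj_idem[OF L n ze] ..
 have "band_proj M n ze k (LINT q|N. G t q) = (LINT q|N. G t q)" for t N
  by (rule integral_fixed_by_linear[OF bounded_linear_band_proj G])
 then have "band_proj M n ze k (indicator A t *R (LINT q|N. G t q)) = indicator A t *R (LINT q|N. G t q)" for t N and A :: "real set"
  unfolding lin by (simp only:)
 from integral_fixed_by_linear[OF bounded_linear_band_proj this] show ?thesis
  unfolding interaction_def set_lebesgue_integral_def G_def .
qed

text \<open>Both terms on the right of the equation carry the outer localizer and the output
  projection. The localizer at scale 1 absorbs the one at scale 1/2, and the projection is
  idempotent, so every solution is localized.\<close>

lemma averaged_solution_localized:
 fixes M :: "('d::finite, 'c::finite) wave_model"
 assumes L: "linear_part M" and M: "cutoff M" and ok: "nk_spectrum_ok M S"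
  and sol: "averaged_system M S T bt rh (h_Psi M S bt f) v"
  and l: "l : {1..nparts S}" and tt: "tt : signs" and ta: "ta : {0..T}"
 shows "AE k in lebesgue. v l tt ta k =
  localizer M (1/2) bt (real_of_int tt *R ctr S l) k *R band_proj M (band S l) tt k (v l tt ta k)"
proof -
 have n: "band S l : {1..nbands M}" using ok l unfolding nk_spectrum_ok_def by blast
 note lin = bounded_linear.linear[OF bounded_linear_band_proj]
 have "AE k in lebesgue. v l tt ta k = F_av M S bt rh v l tt ta k + h_Psi M S bt f l tt ta k"
  using sol l tt ta unfolding averaged_system_def by blast
 then show ?thesis
 proof (rule eventually_mono)
  fix k assume v: "v l tt ta k = F_av M S bt rh v l tt ta k + h_Psi M S bt f l tt ta k"
  let ?l = "localizer M 1 bt (real_of_int tt *R ctr S l) k" and ?P = "band_proj M (band S l) tt k"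
  define X where "X = (SUM m:degs M. SUM lv:resonant_vectors M S m l tt.
   interaction M rh m (band S l) tt (map (%(ze, l'). (band S l', ze)) lv)
   (map (%(ze, l') ta1 k1. localizer M (1/2) bt (real_of_int ze *R ctr S l') k1 *R v l' ze ta1 k1) lv) ta k) + ?P (f k)"
  have vX: "v l tt ta k = ?l *R X" unfolding v F_av_def h_Psi_def X_def by (simp add: scaleR_sum_right scaleR_add_right)
  have "?P X = X"
   unfolding X_def by (simp only: linear_add[OF lin] linear_sum[OF lin] interaction_projected[OF L n tt] band_proj_idem[OF L n tt])
  then have "localizer M (1/2) bt (real_of_int tt *R ctr S l) k *R ?P (v l tt ta k) = ?l *R X"
   unfolding vX linear_cmul[OF lin] by (simp add: localizer_half[OF M])
  then show "v l tt ta k = localizer M (1/2) bt (real_of_int tt *R ctr S l) k *R ?P (v l tt ta k)" using vX by simp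
 qed
qed

text \<open>The scalar packet is taken to be the sum of its two parts, so the remainder vanishes.
  Size and gradient bounds are read off the E1 norm.\<close>

lemma localized_solution_wavepacket:
 fixes M :: "('d::finite, 'c::finite) wave_model"
 assumes L: "linear_part M" and M: "cutoff M" and ok: "nk_spectrum_ok M S" and bt: "0 < bt" and T: "0 <= T"
  and sol: "averaged_system M S T bt rh (h_Psi M S bt f) v" and v: "in_E1_vec S T r v" "E1_vec_norm M S T bt r v <= Q"
  and l: "l : {1..nparts S}" and ta: "ta : {0..T}"
 shows "wavepacket_at M (band S l, ctr S l) s (2 * Q) 0 bt (%k. v l (-1) ta k + v l 1 ta k) (%tt. v l tt ta)"
  and "tt : signs ==> EX G. has_weak_gradient (modulate (r l) (v l tt ta)) G"
  and "tt : signs ==> L1_norm (weak_gradient (modulate (r l) (v l tt ta))) <= Q * bt powr (- 1 - eps M)"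
proof -
 have i: "in_E1 T (r l) (v l tt)" "E1_norm (eps M) T bt (r l) (v l tt) <= Q" if "tt : signs" for tt
  using in_E1_vecD[OF M T v(1) l that] E1_norm_le_vec[OF M T v(1) l that, of bt] v(2) by auto
 have int: "integrable lebesgue (v l tt ta)" "L1_norm (v l tt ta) <= Q" if "tt : signs" for tt
  using in_E_integrable[OF in_E1D(1)[OF i(1)[OF that]] ta] L1_norm_le_E_norm[OF in_E1D(1)[OF i(1)[OF that]] ta]
   E_norm_le_E1_norm[OF i(1)[OF that] T, of "eps M" bt] i(2)[OF that] by auto
 have s: "1 : signs" "-1 : signs" by (auto simp: signs_def)
 show "wavepacket_at M (band S l, ctr S l) s (2 * Q) 0 bt (%k. v l (-1) ta k + v l 1 ta k) (%tt. v l tt ta)"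
  unfolding wavepacket_at_def
 proof (intro conjI ballI)
  show "integrable lebesgue (%k. v l (-1) ta k + v l 1 ta k)" using int(1) s by simp
  show "L1_norm (%k. v l (-1) ta k + v l 1 ta k) <= 2 * Q"
   using L1_norm_add[OF int(1)[OF s(2)] int(1)[OF s(1)]] int(2)[OF s(1)] int(2)[OF s(2)] by linarith
  show "L1_norm (%k. v l (-1) ta k + v l 1 ta k - v l (-1) ta k - v l 1 ta k) <= 0 * bt powr s" by (simp add: L1_norm_def)
  fix tt assume tt: "tt : signs"
  show "integrable lebesgue (v l tt ta)" by (rule int(1)[OF tt])
  show "AE k in lebesgue. v l tt ta k = localizer M (1/2) bt (real_of_int tt *R snd (band S l, ctr S l)) k *R
   band_proj M (fst (band S l, ctr S l)) tt k (v l tt ta k)"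
   using averaged_solution_localized[OF L M ok sol l tt ta] by simp
 qed
 assume tt: "tt : signs"
 show "EX G. has_weak_gradient (modulate (r l) (v l tt ta)) G" using in_E1D(3)[OF i(1)[OF tt] ta] by blast
 have "L1_norm (weak_gradient (modulate (r l) (v l tt ta))) <= bt powr (- 1 - eps M) * E1_norm (eps M) T bt (r l) (v l tt)"
  by (rule L1_norm_weak_gradient_le_E1_norm[OF i(1)[OF tt] ta bt])
 also have "... <= Q * bt powr (- 1 - eps M)" using mult_right_mono[OF i(2)[OF tt], of "bt powr (- 1 - eps M)"] by (simp add: mult.commute)
 finally show "L1_norm (weak_gradient (modulate (r l) (v l tt ta))) <= Q * bt powr (- 1 - eps M)" .
qed

text \<open>One time \<open>\<tau>ss\<close> and one family \<open>V\<close> serve all parameters.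
  Positions, \<rho>, T and the time \<tau> form the parameter of the wavepacket family, which
  expresses that the wavepacket constants are uniform in them.\<close>

theorem theorem6p12:
  fixes M :: "('d::finite, 'c::finite) wave_model"
    and S :: "'d nk_spectrum"
    and h :: "real \<Rightarrow> (nat \<Rightarrow> real^'d) \<Rightarrow> ('d, 'c) wavefield"
    and s R C1 \<beta>0 :: real
  assumes "linear_part M" and "nonlinear_part M" and "cutoff M"
    and "nk_spectrum_ok M S"
    and "universally_resonance_invariant M S"
    and "s > 0" and "multi_particle_wavepacket M S s h"
    and "small_beta M S \<beta>0"
    and "\<And>\<beta> r T. 0 < \<beta> \<Longrightarrow> \<beta> \<le> \<beta>0 \<Longrightarrow> 0 < T \<Longrightarrow>
           in_E1_vec S T r (h_Psi M S \<beta> (h \<beta> r)) \<and>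
           E1_vec_norm M S T \<beta> r (h_Psi M S \<beta> (h \<beta> r)) \<le> R"
  shows "\<exists>\<tau>ss>0. \<exists>V :: real \<Rightarrow> (nat \<Rightarrow> real^'d) \<Rightarrow> real \<Rightarrow> real \<Rightarrow> ('d, 'c) wavevec.
    (\<forall>\<beta> r \<rho> T. 0 < \<beta> \<and> \<beta> \<le> \<beta>0 \<and> 0 < \<rho> \<and> \<rho> \<le> 1 \<and> \<beta>\<^sup>2 / \<rho> \<le> C1 \<and> 0 < T \<and> T \<le> \<tau>ss \<longrightarrow>
       in_E1_vec S T r (V \<beta> r \<rho> T)
     \<and> averaged_system M S T \<beta> \<rho> (h_Psi M S \<beta> (h \<beta> r)) (V \<beta> r \<rho> T)
     \<and> E1_vec_norm M S T \<beta> r (V \<beta> r \<rho> T) \<le> 2 * R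
     \<and> (\<forall>w. in_E1_vec S T r w
          \<and> averaged_system M S T \<beta> \<rho> (h_Psi M S \<beta> (h \<beta> r)) w
          \<and> E1_vec_norm M S T \<beta> r w \<le> 2 * R
          \<longrightarrow> E_vec_eq S T w (V \<beta> r \<rho> T)))
    \<and> multi_particle_wavepacket_vector M S s
        (\<lambda>\<beta>. {(r, \<rho>, T, \<tau>). 0 < \<rho> \<and> \<rho> \<le> 1 \<and> \<beta>\<^sup>2 / \<rho> \<le> C1 \<and> 0 < T \<and> T \<le> \<tau>ss \<and> 0 \<le> \<tau> \<and> \<tau> \<le> T})
        (\<lambda>(r, \<rho>, T, \<tau>). r)
        (\<lambda>\<beta> (r, \<rho>, T, \<tau>) l \<theta>. V \<beta> r \<rho> T l \<theta> \<tau>)"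
proof -
  have b0: "0 < \<beta>0" using assms(8) by (simp add: small_beta_def)
  \<comment> \<open>The bound on the data for a single choice of parameters already forces
    \<open>R\<close> to be nonnegative.\<close>
  have R: "0 \<le> R"
    using E1_vec_nonneg[OF assms(3), of 1 S "\<lambda>_. 0" "h_Psi M S \<beta>0 (h \<beta>0 (\<lambda>_. 0))" \<beta>0] assms(9)[OF b0 order_refl, of 1 "\<lambda>_. 0"] by auto
  define good where "good \<beta> r \<rho> T V \<longleftrightarrow> in_E1_vec S T r V \<and> averaged_system M S T \<beta> \<rho> (h_Psi M S \<beta> (h \<beta> r)) V \<and>
    E1_vec_norm M S T \<beta> r V \<le> 2 * R \<and> (\<forall>w. in_E1_vec S T r w \<and> averaged_system M S T \<beta> \<rho> (h_Psi M S \<beta> (h \<beta> r)) w \<and>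
      E1_vec_norm M S T \<beta> r w \<le> 2 * R \<longrightarrow> E_vec_eq S T w V)" for \<beta> r \<rho> T V
  from averaged_system_solution[where ?C1.0=C1, OF assms(1-5,8) R] obtain \<tau>ss where \<tau>ss: "0 < \<tau>ss"
    and ex: "\<forall>\<beta> \<rho> T r H. 0 < \<beta> \<longrightarrow> \<beta> \<le> \<beta>0 \<longrightarrow> 0 < \<rho> \<longrightarrow> \<beta>\<^sup>2 / \<rho> \<le> C1 \<longrightarrow> 0 < T \<longrightarrow> T \<le> \<tau>ss \<longrightarrow>
    in_E1_vec S T r H \<longrightarrow> E1_vec_norm M S T \<beta> r H \<le> R \<longrightarrow>
    (\<exists>V. in_E1_vec S T r V \<and> averaged_system M S T \<beta> \<rho> H V \<and> E1_vec_norm M S T \<beta> r V \<le> 2 * R \<and>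
      (\<forall>w. in_E1_vec S T r w \<and> averaged_system M S T \<beta> \<rho> H w \<and> E1_vec_norm M S T \<beta> r w \<le> 2 * R \<longrightarrow> E_vec_eq S T w V))"
    by (elim exE conjE)
  \<comment> \<open>The solutions are chosen once as a function of all parameters, so that the
    wavepacket claim speaks of the same fields.\<close>
  define V where "V \<beta> r \<rho> T = (SOME V. good \<beta> r \<rho> T V)" for \<beta> r \<rho> T
  have V: "good \<beta> r \<rho> T (V \<beta> r \<rho> T)" if "0 < \<beta>" "\<beta> \<le> \<beta>0" "0 < \<rho>" "\<beta>\<^sup>2 / \<rho> \<le> C1" "0 < T" "T \<le> \<tau>ss" for \<beta> r \<rho> T
  proof -
    have "\<exists>V. good \<beta> r \<rho> T V"
      using ex[rule_format, OF that conjunct1[OF assms(9)[OF that(1,2,5)]] conjunct2[OF assms(9)[OF that(1,2,5)]]] unfolding good_def .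
    then show ?thesis unfolding V_def by (rule someI_ex)
  qed
  show ?thesis
  proof (rule exI[of _ \<tau>ss], rule conjI[OF \<tau>ss], rule exI[of _ V], rule conjI)
    show "\<forall>\<beta> r \<rho> T. 0 < \<beta> \<and> \<beta> \<le> \<beta>0 \<and> 0 < \<rho> \<and> \<rho> \<le> 1 \<and> \<beta>\<^sup>2 / \<rho> \<le> C1 \<and> 0 < T \<and> T \<le> \<tau>ss \<longrightarrow>
       in_E1_vec S T r (V \<beta> r \<rho> T) \<and> averaged_system M S T \<beta> \<rho> (h_Psi M S \<beta> (h \<beta> r)) (V \<beta> r \<rho> T)
     \<and> E1_vec_norm M S T \<beta> r (V \<beta> r \<rho> T) \<le> 2 * R
     \<and> (\<forall>w. in_E1_vec S T r w \<and> averaged_system M S T \<beta> \<rho> (h_Psi M S \<beta> (h \<beta> r)) w \<and> E1_vec_norm M S T \<beta> r w \<le> 2 * R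
          \<longrightarrow> E_vec_eq S T w (V \<beta> r \<rho> T))"
      using V unfolding good_def by blast
    show "multi_particle_wavepacket_vector M S s
        (\<lambda>\<beta>. {(r, \<rho>, T, \<tau>). 0 < \<rho> \<and> \<rho> \<le> 1 \<and> \<beta>\<^sup>2 / \<rho> \<le> C1 \<and> 0 < T \<and> T \<le> \<tau>ss \<and> 0 \<le> \<tau> \<and> \<tau> \<le> T})
        (\<lambda>(r, \<rho>, T, \<tau>). r) (\<lambda>\<beta> (r, \<rho>, T, \<tau>) l \<theta>. V \<beta> r \<rho> T l \<theta> \<tau>)"
      unfolding multi_particle_wavepacket_vector_def
    proof (intro ballI)
      fix l assume l: "l \<in> {1..nparts S}"
      have ev: "\<forall>\<^sub>F \<beta> in at_right 0. 0 < \<beta> \<and> \<beta> \<le> \<beta>0"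
        unfolding eventually_at_right_field using b0 by (intro exI[of _ \<beta>0]) auto
      show "\<exists>f. particle_like_wavepacket M (band S l, ctr S l) s
        (\<lambda>\<beta>. {(r, \<rho>, T, \<tau>). 0 < \<rho> \<and> \<rho> \<le> 1 \<and> \<beta>\<^sup>2 / \<rho> \<le> C1 \<and> 0 < T \<and> T \<le> \<tau>ss \<and> 0 \<le> \<tau> \<and> \<tau> \<le> T})
        (\<lambda>p. (case p of (r, \<rho>, T, \<tau>) \<Rightarrow> r) l) f (\<lambda>\<theta> \<beta> p. (case p of (r, \<rho>, T, \<tau>) \<Rightarrow> \<lambda>l \<theta>. V \<beta> r \<rho> T l \<theta> \<tau>) l \<theta>)"
        unfolding particle_like_wavepacket_def
      \<comment> \<open>The witnesses are the sum of the two parts, \<open>2 * (2 * R)\<close> for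
        its L1 norm, 0 for the remainder and \<open>2 * R\<close> for the gradients.\<close>
      proof (rule exI[of _ "\<lambda>\<beta> (r, \<rho>, T, \<tau>) k. V \<beta> r \<rho> T l (-1) \<tau> k + V \<beta> r \<rho> T l 1 \<tau> k"],
          rule exI[of _ "2 * (2 * R)"], rule exI[of _ "0 :: real"], rule exI[of _ "2 * R"], rule eventually_mono[OF ev], intro ballI, goal_cases)
        case (1 \<beta> p)
        obtain r \<rho> T \<tau> where p: "p = (r, \<rho>, T, \<tau>)" by (cases p)
        have \<beta>: "0 < \<beta>" "\<beta> \<le> \<beta>0" and c: "0 < \<rho>" "\<beta>\<^sup>2 / \<rho> \<le> C1" "0 < T" "T \<le> \<tau>ss" and "0 \<le> \<tau>" "\<tau> \<le> T"
          using 1 unfolding p by auto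
        then have \<tau>: "\<tau> \<in> {0..T}" and T: "0 \<le> T" by auto
        have g: "averaged_system M S T \<beta> \<rho> (h_Psi M S \<beta> (h \<beta> r)) (V \<beta> r \<rho> T)" "in_E1_vec S T r (V \<beta> r \<rho> T)" "E1_vec_norm M S T \<beta> r (V \<beta> r \<rho> T) \<le> 2 * R"
          using V[OF \<beta> c, of r] unfolding good_def by blast+
        note w = localized_solution_wavepacket[OF assms(1,3,4) \<beta>(1) T g l \<tau>]
        show ?case unfolding p prod.case using w by blast
      qed
    qed
  qed
qed

end
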